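(* The WSAT$^+[t]$ problem ($t > 2$) on circuits of genus $g(n) = O(\sqrt{\log{n}})$ is FPT, where $n$ is the number of variables in the circuit.
   Context: A $\Pi_t$ circuit is a Boolean circuit in normalized form of depth at most $t$: the output gate is an AND-gate, every non-variable gate has outdegree at most 1, and starting from the output gate the gates alternate between AND-gates and OR-gates (no NOT-gates; input vertices are literals). A circuit is monotone if all its input literals are positive. The weight of an assignment is the number of variables set to 1. WSAT$^+[t]$ (weighted monotone $\Pi_t$-circuit satisfiability) is the problem: given a monotone $\Pi_t$ circuit $C$ and a parameter $k$, decide whether $C$ has a satisfying assignment of weight exactly $k$. The genus of a circuit is the genus of its underlying undirected graph after the output gate is removed. *)

theory Defs
  imports Complex_Main "HOL-Library.Landau_Symbols" "HOL-Combinatorics.Orbits"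
begin

section \<open>Model of computation\<close>

text \<open>
  Jones's WHILE language over binary trees (N. D. Jones, \<^emph>\<open>Computability and Complexity from a
  Programming Perspective\<close>, 1997).  Every command and every test costs one step.  Trees can
  only be taken apart, built, and compared with the atom, so a run of \<open>T\<close> steps can be carried
  out on trees with shared subtrees that hold \<open>O(T)\<close> cells besides the input, and the model is
  polynomially equivalent to Turing machines.
\<close>

datatype data = Atom | Cell data data

fun data_size :: "data \<Rightarrow> nat" where
  "data_size Atom = 1"
| "data_size (Cell a b) = 1 + data_size a + data_size b"

fun left :: "data \<Rightarrow> data" where
  "left Atom = Atom"
| "left (Cell a b) = a"

fun right :: "data \<Rightarrow> data" where
  "right Atom = Atom"
| "right (Cell a b) = b"

datatype expr = EVar nat | EAtom | ECell expr expr | ELeft expr | ERight expr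

type_synonym store = "nat \<Rightarrow> data"

fun eval :: "expr \<Rightarrow> store \<Rightarrow> data" where
  "eval (EVar x) s = s x"
| "eval EAtom s = Atom"
| "eval (ECell e1 e2) s = Cell (eval e1 s) (eval e2 s)"
| "eval (ELeft e) s = left (eval e s)"
| "eval (ERight e) s = right (eval e s)"

datatype com = Skip | Assign nat expr | Seq com com | Cond expr com com | While expr com

inductive exec :: "com \<Rightarrow> store \<Rightarrow> nat \<Rightarrow> store \<Rightarrow> bool" where
  Skip: "exec Skip s 1 s"
| Assign: "exec (Assign x e) s 1 (s(x := eval e s))"
| Seq: "exec c1 s1 m s2 \<Longrightarrow> exec c2 s2 n s3 \<Longrightarrow> exec (Seq c1 c2) s1 (m + n) s3"
| CondTrue: "eval e s \<noteq> Atom \<Longrightarrow> exec c1 s m s' \<Longrightarrow> exec (Cond e c1 c2) s (1 + m) s'"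
| CondFalse: "eval e s = Atom \<Longrightarrow> exec c2 s m s' \<Longrightarrow> exec (Cond e c1 c2) s (1 + m) s'"
| WhileFalse: "eval e s = Atom \<Longrightarrow> exec (While e c) s 1 s"
| WhileTrue: "eval e s1 \<noteq> Atom \<Longrightarrow> exec c s1 m s2 \<Longrightarrow> exec (While e c) s2 n s3
    \<Longrightarrow> exec (While e c) s1 (1 + m + n) s3"

text \<open>Variable 0 holds the input at the start and the output at the end.\<close>

definition runs :: "com \<Rightarrow> data \<Rightarrow> nat \<Rightarrow> data \<Rightarrow> bool" where
  "runs p x T y \<longleftrightarrow> (\<exists>s. exec p ((\<lambda>_. Atom)(0 := x)) T s \<and> s 0 = y)"

fun enc_nat :: "nat \<Rightarrow> data" where
  "enc_nat 0 = Atom"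
| "enc_nat (Suc n) = Cell Atom (enc_nat n)"

fun enc_list :: "('a \<Rightarrow> data) \<Rightarrow> 'a list \<Rightarrow> data" where
  "enc_list e [] = Atom"
| "enc_list e (x # xs) = Cell (e x) (enc_list e xs)"

definition computable :: "(nat \<Rightarrow> nat) \<Rightarrow> bool" where
  "computable f \<longleftrightarrow> (\<exists>p. \<forall>n. \<exists>T. runs p (enc_nat n) T (enc_nat (f n)))"

text \<open>
  \<open>fpt enc D L\<close>: for instances \<open>(x, k) \<in> D\<close> with parameter \<open>k\<close>, membership in \<open>L\<close> is decided in
  time \<open>f(k) * |x|^c\<close>.  Instances outside \<open>D\<close> are not considered; this is how a problem is
  restricted to a class of inputs.
\<close>

definition fpt :: "('a \<Rightarrow> data) \<Rightarrow> ('a \<times> nat) set \<Rightarrow> ('a \<times> nat) set \<Rightarrow> bool" where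
  "fpt enc D L \<longleftrightarrow> (\<exists>p f c. computable f \<and>
     (\<forall>(x, k) \<in> D. \<exists>T y. runs p (Cell (enc x) (enc_nat k)) T y \<and>
        T \<le> f k * data_size (enc x) ^ c \<and> (y \<noteq> Atom \<longleftrightarrow> (x, k) \<in> L)))"


section \<open>Genus of a finite simple graph\<close>

text \<open>
  Vertex set \<open>V\<close>, edges \<open>E\<close> as two-element subsets of \<open>V\<close>.  Embeddings into orientable
  surfaces are given by rotation systems: a cyclic order of the darts leaving each vertex.  The
  dart following \<open>(u, v)\<close> on its face boundary is the successor of \<open>(v, u)\<close> at \<open>v\<close>.
\<close>

definition darts :: "'a set set \<Rightarrow> ('a \<times> 'a) set" where
  "darts E = {(u, v). {u, v} \<in> E}"

definition rotation_system :: "'a set set \<Rightarrow> ('a \<times> 'a \<Rightarrow> 'a \<times> 'a) \<Rightarrow> bool" where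
  "rotation_system E \<sigma> \<longleftrightarrow> \<sigma> permutes darts E \<and>
     (\<forall>v \<in> Domain (darts E). cyclic_on \<sigma> {d \<in> darts E. fst d = v})"

definition faces :: "'a set set \<Rightarrow> ('a \<times> 'a \<Rightarrow> 'a \<times> 'a) \<Rightarrow> ('a \<times> 'a) set set" where
  "faces E \<sigma> = orbit (\<sigma> \<circ> prod.swap) ` darts E"

definition graph_components :: "'a set \<Rightarrow> 'a set set \<Rightarrow> 'a set set" where
  "graph_components V E = V // (darts E)\<^sup>*"

text \<open>
  Euler's formula \<open>v - e + f = 2 - 2 * g\<close> summed over the components.  An isolated vertex has no
  darts but one face.  The genus of a disconnected graph is the sum over its components.
\<close>

definition has_genus :: "'a set \<Rightarrow> 'a set set \<Rightarrow> ('a \<times> 'a \<Rightarrow> 'a \<times> 'a) \<Rightarrow> nat \<Rightarrow> bool" where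
  "has_genus V E \<sigma> h \<longleftrightarrow>
     int (card V) - int (card E) + int (card (faces E \<sigma>) + card (V - Domain (darts E)))
       = 2 * int (card (graph_components V E)) - 2 * int h"

definition graph_genus :: "'a set \<Rightarrow> 'a set set \<Rightarrow> nat" where
  "graph_genus V E = (LEAST h. \<exists>\<sigma>. rotation_system E \<sigma> \<and> has_genus V E \<sigma> h)"


section \<open>Circuits\<close>

text \<open>
  The vertices are the positions in the list \<open>nodes\<close>; a gate lists its in-neighbours.
  \<open>Lit True v\<close> is the positive and \<open>Lit False v\<close> the negative literal of variable \<open>v\<close>.
\<close>

datatype node = Lit bool nat | And "nat list" | Or "nat list"

record circuit =
  num_vars :: nat
  nodes :: "node list"
  out_gate :: nat

fun preds :: "node \<Rightarrow> nat list" where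
  "preds (Lit b v) = []"
| "preds (And js) = js"
| "preds (Or js) = js"

fun is_gate :: "node \<Rightarrow> bool" where
  "is_gate (Lit b v) = False"
| "is_gate (And js) = True"
| "is_gate (Or js) = True"

fun is_and :: "node \<Rightarrow> bool" where
  "is_and (And js) = True"
| "is_and _ = False"

definition verts :: "circuit \<Rightarrow> nat set" where
  "verts C = {..<length (nodes C)}"

definition wires :: "circuit \<Rightarrow> (nat \<times> nat) set" where
  "wires C = {(j, i). i \<in> verts C \<and> j \<in> set (preds (nodes C ! i))}"

definition wf_circuit :: "circuit \<Rightarrow> bool" where
  "wf_circuit C \<longleftrightarrow>
     wires C \<subseteq> verts C \<times> verts C \<and> acyclic (wires C) \<and>
     (\<forall>x \<in> set (nodes C). distinct (preds x) \<and> (is_gate x \<longrightarrow> preds x \<noteq> [])) \<and>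
     (\<forall>i \<in> verts C. \<forall>j \<in> verts C.
        nodes C ! i = nodes C ! j \<and> \<not> is_gate (nodes C ! i) \<longrightarrow> i = j) \<and>
     {v. \<exists>b. Lit b v \<in> set (nodes C)} = {..<num_vars C} \<and>
     out_gate C \<in> verts C \<and> out_gate C \<notin> Domain (wires C)"

text \<open>\<open>holds C A i\<close>: vertex \<open>i\<close> has value 1 when \<open>A\<close> is the set of variables set to 1.\<close>

inductive holds :: "circuit \<Rightarrow> nat set \<Rightarrow> nat \<Rightarrow> bool" for C A where
  Lit: "i \<in> verts C \<Longrightarrow> nodes C ! i = Lit b v \<Longrightarrow> (v \<in> A \<longleftrightarrow> b) \<Longrightarrow> holds C A i"
| And: "i \<in> verts C \<Longrightarrow> nodes C ! i = And js \<Longrightarrow> \<forall>j \<in> set js. holds C A j \<Longrightarrow> holds C A i"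
| Or: "i \<in> verts C \<Longrightarrow> nodes C ! i = Or js \<Longrightarrow> j \<in> set js \<Longrightarrow> holds C A j \<Longrightarrow> holds C A i"

definition pi_circuit :: "nat \<Rightarrow> circuit \<Rightarrow> bool" where
  "pi_circuit t C \<longleftrightarrow> wf_circuit C \<and>
     is_and (nodes C ! out_gate C) \<and>
     (\<forall>j \<in> verts C. is_gate (nodes C ! j) \<longrightarrow> card (wires C `` {j}) \<le> 1) \<and>
     (\<forall>(j, i) \<in> wires C. (i, out_gate C) \<in> (wires C)\<^sup>* \<and> is_gate (nodes C ! j) \<longrightarrow>
        is_and (nodes C ! j) \<noteq> is_and (nodes C ! i)) \<and>
     (\<forall>j d. (j, out_gate C) \<in> wires C ^^ d \<longrightarrow> d \<le> t)"

definition monotone_circuit :: "circuit \<Rightarrow> bool" where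
  "monotone_circuit C \<longleftrightarrow> (\<forall>b v. Lit b v \<in> set (nodes C) \<longrightarrow> b)"

definition circuit_genus :: "circuit \<Rightarrow> nat" where
  "circuit_genus C = graph_genus (verts C - {out_gate C})
     {{j, i} | j i. (j, i) \<in> wires C \<and> j \<noteq> out_gate C \<and> i \<noteq> out_gate C}"

definition weighted_sat :: "circuit \<Rightarrow> nat \<Rightarrow> bool" where
  "weighted_sat C k \<longleftrightarrow> (\<exists>A \<subseteq> {..<num_vars C}. card A = k \<and> holds C A (out_gate C))"

definition wsat_mono_instances :: "nat \<Rightarrow> (circuit \<times> nat) set" where
  "wsat_mono_instances t = {(C, k). pi_circuit t C \<and> monotone_circuit C}"

definition wsat_mono :: "nat \<Rightarrow> (circuit \<times> nat) set" where
  "wsat_mono t = {(C, k) \<in> wsat_mono_instances t. weighted_sat C k}"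

text \<open>
  Unary indices are harmless: the number of variables and all indices of a well-formed circuit
  are at most its number of vertices.
\<close>

fun enc_node :: "node \<Rightarrow> data" where
  "enc_node (Lit b v) = Cell (enc_nat (if b then 0 else 1)) (enc_nat v)"
| "enc_node (And js) = Cell (enc_nat 2) (enc_list enc_nat js)"
| "enc_node (Or js) = Cell (enc_nat 3) (enc_list enc_nat js)"

definition enc_circuit :: "circuit \<Rightarrow> data" where
  "enc_circuit C =
     Cell (enc_nat (num_vars C)) (Cell (enc_nat (out_gate C)) (enc_list enc_node (nodes C)))"

end

theory Submission
  imports Defs
begin

text \<open>
  The algorithm is a bounded search tree; no tree decomposition is needed.  Genus enters only
  through the fact that a graph of genus \<open>h\<close> with a \<open>K\<^bsub>3,N\<^esub>\<close> minor has \<open>N \<le> 4 * h + 2\<close>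
  (Euler's formula: in a rotation system restricted to a sparse model of the minor, every face
  uses at least four of the \<open>3 * N\<close> cross edges).

  A set \<open>F\<close> of pending OR-gates has to be satisfied with \<open>k\<close> further variables, so some variable
  lies below a \<open>1 / k\<close> fraction of \<open>F\<close>.  If there are at most \<open>3 * k\<close> such variables, branch on
  them.  Otherwise three of them lie below many common gates, and the minor bound makes \<open>card F\<close>
  polynomial in \<open>k\<close> and \<open>h\<close>.  In that case branch on the variables below three or more gates of
  \<open>F\<close>, and on the AND-children of a gate of \<open>F\<close> that share variables with two or more other gates of
  \<open>F\<close>; the minor bound limits the number of both.  In the remaining case the chosen children
  interact in pairs only, so \<open>F\<close> splits into independent groups of at most two gates, each solved
  recursively one level deeper in the circuit.

  The search tree has size \<open>2 ^ O\<^sub>k(h * log h)\<close>.  Since \<open>(A * y) ^ (A * y) \<le> 2 ^ (A ^ 4 + 2 * y ^ 2)\<close>,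
  this is at most \<open>f k * 2 ^ O(h ^ 2)\<close>, which is \<open>f k\<close> times a polynomial in \<open>n\<close> when
  \<open>h = O(sqrt (log n))\<close>.
\<close>

section \<open>Orbits of permutations\<close>

text \<open>The model of the minor stays inside the given graph: edges are deleted, never
  contracted. On the face permutation a deletion is essentially a product with one transposition,
  which changes the number of cycles by one; \<open>delete_edge\<close> turns this into a change of
  Euler's formula by 0 or 2. A face with fewer than four cross darts would retrace every edge it
  uses and hence swallow its whole component, which has too many cross edges for that. Since gates
  have outdegree at most one, they form a forest, and the gates below incomparable gates are
  disjoint trees. These trees are the branch sets. The number three is forced: the complete
  bipartite graph with two vertices on one side is planar, so nothing bounds the children that share
  variables with only one other gate. Hence gates must be solved in pairs. The search tree is not
  polynomial in the input. Running times are therefore measured against an ambient number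
  \<open>K\<close> that bounds the input and the tree alike, so that polynomial bounds still compose
  through the nested searches.\<close>

lemma funpow_transpose_orbit:
  assumes ab: "a \<noteq> b" and bo: "b \<in> orbit f a"
    and i: "0 < i" "i \<le> funpow_dist1 f a b"
  shows "((f \<circ> transpose a b) ^^ i) b = (f ^^ i) a"
  using i
proof (induction i)
  case (Suc i)
  show ?case
  proof (cases "i = 0")
    case False
    have IH: "((f \<circ> transpose a b) ^^ i) b = (f ^^ i) a"
      by (rule Suc.IH) (use False Suc.prems in simp_all)
    have nb: "(f ^^ i) a \<noteq> b" using funpow_dist1_least[of i f a b] False Suc.prems by auto
    \<comment> \<open>A return to \<open>a\<close> on the way would let the rest of the walk reach
      \<open>b\<close> in fewer steps than its first hitting time.\<close>
    have na: "(f ^^ i) a \<noteq> a"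
    proof
      assume eq: "(f ^^ i) a = a"
      let ?n = "funpow_dist1 f a b"
      have "(f ^^ ?n) a = (f ^^ (?n - i)) ((f ^^ i) a)"
        using Suc.prems by (metis Suc_leD funpow_add le_add_diff_inverse2 comp_apply)
      then have "(f ^^ (?n - i)) a = b" using eq funpow_dist1_prop[OF bo] by simp
      moreover have "0 < ?n - i" "?n - i < ?n" using False Suc.prems by auto
      ultimately show False using funpow_dist1_least[of "?n - i" f a b] by blast
    qed
    show ?thesis unfolding funpow.simps comp_apply[of _ _ b] IH using na nb by simp
  qed simp
qed simp

lemma funpow_in_orbit_pos: "0 < i \<Longrightarrow> (f ^^ i) x \<in> orbit f x"
  by (auto simp: orbit_altdef)

lemma permutation_orbit_eq:
  assumes "permutation f" "y \<in> orbit f x"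
  shows "orbit f y = orbit f x"
  using orbit_cyclic_eq3[OF cyclic_on_orbit'[OF assms(1)] assms(2)] .

text \<open>Since \<open>g b = f a\<close> and \<open>g a = f b\<close>, the common cycle is cut in
  two: one part runs from \<open>f a\<close> to \<open>b\<close> and closes there, the other from
  \<open>f b\<close> to \<open>a\<close>.\<close>

lemma orbit_transpose_split:
  assumes f: "permutation f" and ab: "a \<noteq> b" and bo: "b \<in> orbit f a"
  defines "g \<equiv> f \<circ> transpose a b"
  shows "orbit g a \<union> orbit g b = orbit f a" "a \<notin> orbit g b"
proof -
  have g: "permutation g" unfolding g_def
    by (intro permutation_compose f permutation_swap_id)
  have ao: "a \<in> orbit f b"
    using bo permutation_self_in_orbit[OF f] permutation_orbit_eq[OF f bo] by metis
  define n where "n = funpow_dist1 f a b"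
  define m where "m = funpow_dist1 f b a"
  have n: "0 < n" "(f ^^ n) a = b" and m: "0 < m" "(f ^^ m) b = a"
    using funpow_dist1_prop[OF bo] funpow_dist1_prop[OF ao] by (simp_all add: n_def m_def)
  have gb: "(g ^^ i) b = (f ^^ i) a" if "0 < i" "i \<le> n" for i
    using funpow_transpose_orbit[OF ab bo] that by (simp add: g_def n_def)
  have ga: "(g ^^ i) a = (f ^^ i) b" if "0 < i" "i \<le> m" for i
    using funpow_transpose_orbit[OF ab[symmetric] ao] that
    by (simp add: g_def m_def transpose_commute)
  have upto: "orbit h x = {(h ^^ i) x |i. 0 < i \<and> i \<le> N}" if per: "(h ^^ N) x = x" "0 < N" for h N and x :: 'a
  proof
    show "orbit h x \<subseteq> {(h ^^ i) x |i. 0 < i \<and> i \<le> N}"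
    proof
      fix y assume "y \<in> orbit h x"
      then obtain i where i: "y = (h ^^ i) x" "i < N" using orbit_altdef_bounded[OF per] by blast
      show "y \<in> {(h ^^ i) x |i. 0 < i \<and> i \<le> N}"
      proof (cases "i = 0")
        case True then show ?thesis using i per by force
      next
        case False then show ?thesis using i by auto
      qed
    qed
    show "{(h ^^ i) x |i. 0 < i \<and> i \<le> N} \<subseteq> orbit h x"
      by (auto simp: orbit_altdef)
  qed
  have ob: "orbit g b = {(f ^^ i) a |i. 0 < i \<and> i \<le> n}"
    using upto[of n g b] gb n by auto (metis gb)
  have oa: "orbit g a = {(f ^^ i) b |i. 0 < i \<and> i \<le> m}"
    using upto[of m g a] ga m by auto (metis ga)
  have "(f ^^ (m + n)) a = a" using n m by (simp add: funpow_add)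
  then have of: "orbit f a = {(f ^^ i) a |i. 0 < i \<and> i \<le> m + n}"
    using upto[of "m + n" f a] n by auto
  have shift: "(f ^^ i) b = (f ^^ (i + n)) a" for i using n by (simp add: funpow_add)
  show "orbit g a \<union> orbit g b = orbit f a"
  proof
    show "orbit g a \<union> orbit g b \<subseteq> orbit f a"
      unfolding oa ob of shift by fastforce
    show "orbit f a \<subseteq> orbit g a \<union> orbit g b"
    proof
      fix x assume "x \<in> orbit f a"
      then obtain i where i: "x = (f ^^ i) a" "0 < i" "i \<le> m + n" unfolding of by auto
      show "x \<in> orbit g a \<union> orbit g b"
      proof (cases "i \<le> n")
        case True then show ?thesis using i ob by auto
      next
        case False
        then have "x = (f ^^ (i - n)) b" "0 < i - n" "i - n \<le> m" using i by (auto simp: shift)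
        then show ?thesis using oa by auto
      qed
    qed
  qed
  show "a \<notin> orbit g b"
  proof
    assume "a \<in> orbit g b"
    then obtain i where i: "a = (f ^^ i) a" "0 < i" "i \<le> n" unfolding ob by auto
    then have "i < n" using n ab by (cases "i = n") auto
    have "(f ^^ n) a = (f ^^ (n - i)) ((f ^^ i) a)"
      using i(3) by (metis funpow_add le_add_diff_inverse2 comp_apply)
    then have "(f ^^ (n - i)) a = b" using i n by simp
    moreover have "0 < n - i" "n - i < n" using \<open>i < n\<close> i by auto
    ultimately show False using funpow_dist1_least[of "n - i" f a b] unfolding n_def by blast
  qed
qed

text \<open>All other cycles avoid \<open>a\<close> and \<open>b\<close> and are left unchanged, so
  the count rises by exactly one.\<close>

lemma orbit_count_split:
  assumes f: "f permutes D" "finite D" and ab: "a \<noteq> b" "a \<in> D" and bo: "b \<in> orbit f a"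
  defines "g \<equiv> f \<circ> transpose a b"
  shows "card (orbit g ` D) = card (orbit f ` D) + 1"
proof -
  have pf: "permutation f" using f by (auto simp: permutation_permutes)
  have bD: "b \<in> D" using permutes_orbit_subset[OF f(1) ab(2)] bo by blast
  have pg: "permutation g" unfolding g_def
    by (intro permutation_compose pf permutation_swap_id)
  note sp = orbit_transpose_split[OF pf ab(1) bo, folded g_def]
  have out: "orbit g x = orbit f x" if "x \<notin> orbit f a" for x
  proof (rule orbit_cong[OF permutation_self_in_orbit[OF pf]])
    fix s assume s: "s \<in> orbit f x"
    then have "orbit f s = orbit f x" by (rule permutation_orbit_eq[OF pf])
    moreover have "orbit f x \<noteq> orbit f a" using that permutation_self_in_orbit[OF pf] by blast
    ultimately have "s \<noteq> a" "s \<noteq> b" using permutation_orbit_eq[OF pf bo] by auto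
    then show "g s = f s" by (simp add: g_def)
  qed
  have inn: "orbit g x = orbit g a \<or> orbit g x = orbit g b" if "x \<in> orbit f a" for x
    using that sp(1) permutation_orbit_eq[OF pg] by blast
  let ?R = "orbit f ` D - {orbit f a}"
  have "orbit g ` D = {orbit g a, orbit g b} \<union> ?R"
  proof
    show "orbit g ` D \<subseteq> {orbit g a, orbit g b} \<union> ?R"
      using inn out permutation_self_in_orbit[OF pf] by blast
    have "orbit f x \<in> orbit g ` D" if "x \<in> D" "orbit f x \<noteq> orbit f a" for x
      using that out[of x] permutation_orbit_eq[OF pf, of x a] by auto
    then show "{orbit g a, orbit g b} \<union> ?R \<subseteq> orbit g ` D" using ab bD by auto
  qed
  moreover have "orbit g a \<noteq> orbit g b" using sp(2) permutation_self_in_orbit[OF pg] by blast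
  moreover have "orbit g a \<notin> ?R" "orbit g b \<notin> ?R"
  proof -
    have "orbit f x = orbit f a" if "orbit g y = orbit f x" "y = a \<or> y = b" for x y
      using that permutation_self_in_orbit[OF pg] permutation_orbit_eq[OF pf] bo by metis
    then show "orbit g a \<notin> ?R" "orbit g b \<notin> ?R" by blast+
  qed
  ultimately have "card (orbit g ` D) = 2 + card ?R" using f(2) by simp
  also have "\<dots> = card (orbit f ` D) + 1"
    using f(2) ab card_Suc_Diff1[of "orbit f ` D" "orbit f a"] by auto
  finally show ?thesis .
qed

text \<open>From \<open>a\<close> the new map enters the cycle of \<open>b\<close> at
  \<open>f b\<close> and runs through it until it arrives at \<open>b\<close>.\<close>

lemma orbit_transpose_merge:
  assumes f: "permutation f" and bo: "b \<notin> orbit f a"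
  shows "b \<in> orbit (f \<circ> transpose a b) a"
proof -
  let ?g = "f \<circ> transpose a b"
  have bb: "b \<in> orbit f b" using f by (rule permutation_self_in_orbit)
  have ab: "a \<noteq> b" using bo permutation_self_in_orbit[OF f] by blast
  have ao: "a \<notin> orbit f b" using bo bb permutation_orbit_eq[OF f] by blast
  let ?m = "funpow_dist1 f b b"
  have "(?g ^^ i) a = (f ^^ i) b" if "0 < i" "i \<le> ?m" for i
    using that
  proof (induction i)
    case (Suc i)
    show ?case
    proof (cases "i = 0")
      case False
      then have "(f ^^ i) b \<noteq> b" using funpow_dist1_least[of i f b b] Suc.prems by auto
      moreover have "(f ^^ i) b \<noteq> a" using ao funpow_in_orbit[OF bb] by metis
      ultimately show ?thesis using Suc False by simp
    qed simp
  qed simp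
  then have "(?g ^^ ?m) a = (f ^^ ?m) b" by blast
  then have "(?g ^^ ?m) a = b" using funpow_dist1_prop[OF bb] by metis
  then show ?thesis using funpow_in_orbit_pos[of ?m ?g a] by simp
qed

text \<open>A transposition is its own inverse, so this is the split read backwards.\<close>

lemma orbit_count_merge:
  assumes f: "f permutes D" "finite D" and ab: "a \<in> D" "b \<in> D" and bo: "b \<notin> orbit f a"
  defines "g \<equiv> f \<circ> transpose a b"
  shows "card (orbit g ` D) + 1 = card (orbit f ` D)"
proof -
  have pf: "permutation f" using f by (auto simp: permutation_permutes)
  have ne: "a \<noteq> b" using bo permutation_self_in_orbit[OF pf] by blast
  have g: "g permutes D" unfolding g_def
    by (intro permutes_compose permutes_swap_id f ab)
  have "g \<circ> transpose a b = f" by (simp add: g_def fun_eq_iff)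
  then show ?thesis
    using orbit_count_split[OF g f(2) ne ab(1)] orbit_transpose_merge[OF pf bo] by (simp add: g_def)
qed

text \<open>Shortcuts a cycle past \<open>d\<close> and leaves \<open>d\<close> as a fixed point.
  Applied to a rotation system, it deletes one dart from the cyclic order at its vertex.\<close>

definition skip :: "'a \<Rightarrow> ('a \<Rightarrow> 'a) \<Rightarrow> 'a \<Rightarrow> 'a" where
  "skip d f x = (if x = d then d else if f x = d then f d else f x)"

lemma skip_eq_transpose:
  assumes "f permutes D"
  shows "skip d f = f \<circ> transpose (inv f d) d"
proof
  fix x
  have b: "bij f" using assms permutes_bij by blast
  have 1: "f (inv f d) = d" by (meson b bij_inv_eq_iff)
  have 2: "f x = d \<longleftrightarrow> x = inv f d" using b by (metis bij_inv_eq_iff)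
  show "skip d f x = (f \<circ> transpose (inv f d) d) x"
    using 1 2 by (auto simp: skip_def transpose_def)
qed

lemma skip_permutes:
  assumes f: "f permutes D" and d: "d \<in> D"
  shows "skip d f permutes (D - {d})"
proof -
  have "skip d f permutes D" unfolding skip_eq_transpose[OF f]
    by (intro permutes_compose permutes_swap_id f d) (use permutes_inv[OF f] d permutes_in_image in metis)
  then show ?thesis
    by (rule permutes_superset) (auto simp: skip_def)
qed

lemma orbit_skip:
  assumes f: "permutation f" and x: "x \<noteq> d"
  shows "orbit (skip d f) x = orbit f x - {d}"
proof
  have inj: "inj f" using permutation_bijective[OF f] bij_is_inj by blast
  have ne: "skip d f y \<noteq> d" if "y \<noteq> d" for y
    using that inj_eq[OF inj, of y d] by (auto simp: skip_def)
  have "y \<in> orbit f x - {d}" if "y \<in> orbit (skip d f) x" for y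
    using that
  proof (induction rule: orbit.induct)
    case base
    have "skip d f x \<in> {f x, f (f x)}" using x by (auto simp: skip_def)
    then show ?case using ne[OF x] orbit.base[of f x] orbit.step[OF orbit.base, of f x] by auto
  next
    case (step y)
    then have "y \<noteq> d" by simp
    have "skip d f y \<in> {f y, f (f y)}" using \<open>y \<noteq> d\<close> by (auto simp: skip_def)
    moreover have "f y \<in> orbit f x" using step by (simp add: orbit.step)
    ultimately show ?case using ne[OF \<open>y \<noteq> d\<close>] orbit.step[of "f y" f x] by auto
  qed
  then show "orbit (skip d f) x \<subseteq> orbit f x - {d}" by blast
  have "(y \<noteq> d \<longrightarrow> y \<in> orbit (skip d f) x) \<and> (y = d \<longrightarrow> f y \<in> orbit (skip d f) x)"
    if "y \<in> orbit f x" for y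
    using that
  proof (induction rule: orbit.induct)
    case base
    have "skip d f x \<in> orbit (skip d f) x" by (rule orbit.base)
    moreover have "skip d f x = (if f x = d then f d else f x)" using x by (simp add: skip_def)
    ultimately show ?case by (auto split: if_splits)
  next
    case (step y)
    show ?case
    proof (cases "y = d")
      case True
      then have *: "f d \<in> orbit (skip d f) x" using step by simp
      then show ?thesis using True by metis
    next
      case False
      then have "skip d f y \<in> orbit (skip d f) x" using step by (auto intro: orbit.step)
      moreover have "skip d f y = (if f y = d then f d else f y)" using False by (simp add: skip_def)
      ultimately show ?thesis by (auto split: if_splits)
    qed
  qed
  then show "orbit f x - {d} \<subseteq> orbit (skip d f) x" by blast
qed

text \<open>A cycle is lost only if it consists of \<open>d\<close> alone; every other cycle keeps a
  point by which it is recognised.\<close>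

lemma orbit_count_skip:
  assumes f: "f permutes D" "finite D" and d: "d \<in> D"
  shows "card (orbit (skip d f) ` (D - {d})) + (if f d = d then 1 else 0) = card (orbit f ` D)"
proof -
  have pf: "permutation f" using f by (auto simp: permutation_permutes)
  have im: "orbit (skip d f) ` (D - {d}) = (\<lambda>Q. Q - {d}) ` (orbit f ` (D - {d}))"
    using orbit_skip[OF pf] by (auto simp: image_image)
  have inj: "inj_on (\<lambda>Q. Q - {d}) (orbit f ` (D - {d}))"
  proof (rule inj_onI)
    fix A B assume A: "A \<in> orbit f ` (D - {d})" and B: "B \<in> orbit f ` (D - {d})" and eq: "A - {d} = B - {d}"
    obtain x y where xy: "A = orbit f x" "B = orbit f y" "x \<noteq> d" "y \<noteq> d" using A B by blast
    then have "x \<in> orbit f y" using eq permutation_self_in_orbit[OF pf] by blast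
    then show "A = B" using xy permutation_orbit_eq[OF pf] by blast
  qed
  have c: "card (orbit (skip d f) ` (D - {d})) = card (orbit f ` (D - {d}))"
    unfolding im by (rule card_image[OF inj])
  show ?thesis
  proof (cases "f d = d")
    case True
    have "orbit f ` D = insert (orbit f d) (orbit f ` (D - {d}))" using d by blast
    moreover have "orbit f d \<notin> orbit f ` (D - {d})"
      using True permutation_self_in_orbit[OF pf] orbit_eq_singleton_iff[of f d] by force
    ultimately show ?thesis using c f(2) True by simp
  next
    case False
    have "f d \<in> D - {d}" using False d permutes_in_image[OF f(1)] by auto
    moreover have "orbit f (f d) = orbit f d" using pf by (rule permutation_orbit_step)
    ultimately have "orbit f ` D = orbit f ` (D - {d})" by (auto simp: image_iff)
    then show ?thesis using c False by simp
  qed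
qed

section \<open>Components\<close>

lemma darts_insert: "darts (insert {u, v} E) = insert (u, v) (insert (v, u) (darts E))"
  by (auto simp: darts_def doubleton_eq_iff)

lemma sym_darts: "sym (darts E)"
  by (auto simp: darts_def sym_def insert_commute)

lemma equiv_reach: "equiv UNIV ((darts E)\<^sup>*)"
  by (intro equivI) (auto intro: refl_rtrancl sym_rtrancl sym_darts trans_rtrancl)

lemma components_insert_connected:
  assumes "(u, v) \<in> (darts E)\<^sup>*"
  shows "graph_components V (insert {u, v} E) = graph_components V E"
proof -
  have "(v, u) \<in> (darts E)\<^sup>*" using assms sym_rtrancl[OF sym_darts] by (meson symD)
  then have "(darts (insert {u, v} E))\<^sup>* = (darts E)\<^sup>*"
    using assms unfolding darts_insert
    by (intro rtrancl_subset) auto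
  then show ?thesis by (simp add: graph_components_def)
qed

text \<open>The classes of \<open>u\<close> and \<open>v\<close> fuse and all other classes survive;
  the new reachability comes from applying \<open>rtrancl_insert\<close> to the two darts of the
  edge.\<close>

lemma components_insert_disconnected:
  assumes V: "finite V" "u \<in> V" "v \<in> V" and uv: "(u, v) \<notin> (darts E)\<^sup>*"
  shows "card (graph_components V E) = card (graph_components V (insert {u, v} E)) + 1"
proof -
  let ?R = "(darts E)\<^sup>*" and ?S = "(darts (insert {u, v} E))\<^sup>*"
  have sy: "(y, x) \<in> ?R" if "(x, y) \<in> ?R" for x y using that sym_rtrancl[OF sym_darts] by (meson symD)
  have tr: "(x, z) \<in> ?R" if "(x, y) \<in> ?R" "(y, z) \<in> ?R" for x y z using that by (rule rtrancl_trans)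
  have S: "(x, y) \<in> ?S \<longleftrightarrow> (x, y) \<in> ?R \<or> (x, u) \<in> ?R \<and> (v, y) \<in> ?R \<or> (x, v) \<in> ?R \<and> (u, y) \<in> ?R" for x y
    unfolding darts_insert rtrancl_insert by (auto intro: tr sy)
  let ?U = "?R `` {u}" and ?W = "?R `` {v}"
  have UW: "?U \<noteq> ?W" using uv by blast
  have cls: "?R `` {x} = ?R `` {y} \<longleftrightarrow> (x, y) \<in> ?R" for x y
    using equiv_class_eq_iff[OF equiv_reach, of x y E] by simp
  have q1: "?S `` {x} = ?U \<union> ?W" if "(x, u) \<in> ?R \<or> (x, v) \<in> ?R" for x
  proof -
    have "(x, y) \<in> ?S \<longleftrightarrow> (u, y) \<in> ?R \<or> (v, y) \<in> ?R" for y
      unfolding S using that by (meson tr sy)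
    then show ?thesis by blast
  qed
  have q2: "?S `` {x} = ?R `` {x}" if "\<not> ((x, u) \<in> ?R \<or> (x, v) \<in> ?R)" for x
    using that S by blast
  have fin: "finite (V // ?R)" using V(1) by (simp add: quotient_def)
  have q: "?S `` {x} = (if ?R `` {x} = ?U \<or> ?R `` {x} = ?W then ?U \<union> ?W else ?R `` {x})" for x
    unfolding cls using q1 q2 by simp
  have im: "V // r = (\<lambda>x. r `` {x}) ` V" for r :: "('a \<times> 'a) set" by (auto simp: quotient_def)
  have 1: "V // ?S = insert (?U \<union> ?W) (V // ?R - {?U, ?W})"
    unfolding im q using V(2,3) by (auto simp: image_iff)
  have 2: "?U \<union> ?W \<notin> V // ?R - {?U, ?W}"
  proof
    assume "?U \<union> ?W \<in> V // ?R - {?U, ?W}"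
    then obtain x where x: "?U \<union> ?W = ?R `` {x}" by (auto simp: quotient_def)
    then have "(x, u) \<in> ?R" "(x, v) \<in> ?R" by blast+
    then show False using uv by (meson tr sy)
  qed
  have 3: "?U \<in> V // ?R" "?W \<in> V // ?R" using V by (auto intro: quotientI)
  then have "V // ?R = insert ?U (insert ?W (V // ?R - {?U, ?W}))" by blast
  then have "card (V // ?R) = card (insert ?U (insert ?W (V // ?R - {?U, ?W})))" by simp
  also have "\<dots> = card (V // ?R - {?U, ?W}) + 2" using fin UW by simp
  finally have "card (V // ?R) = card (V // ?R - {?U, ?W}) + 2" .
  then show ?thesis using 1 2 fin by (simp add: graph_components_def)
qed

section \<open>Genus and edge deletion\<close>

definition simple_graph :: "'a set \<Rightarrow> 'a set set \<Rightarrow> bool" where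
  "simple_graph V E \<longleftrightarrow> finite V \<and> (\<forall>e \<in> E. e \<subseteq> V \<and> card e = 2)"

lemma simple_graph_subset: "simple_graph V E \<Longrightarrow> E' \<subseteq> E \<Longrightarrow> simple_graph V E'"
  by (auto simp: simple_graph_def)

lemma simple_graph_finite: "simple_graph V E \<Longrightarrow> finite E"
  unfolding simple_graph_def by (meson PowI finite_Pow_iff finite_subset subsetI)

lemma simple_graph_darts:
  assumes "simple_graph V E"
  shows "darts E \<subseteq> V \<times> V" "finite (darts E)" "(u, v) \<in> darts E \<Longrightarrow> u \<noteq> v"
proof -
  show 1: "darts E \<subseteq> V \<times> V" using assms by (auto simp: simple_graph_def darts_def)
  show "finite (darts E)" using 1 assms finite_subset by (auto simp: simple_graph_def)
  show "(u, v) \<in> darts E \<Longrightarrow> u \<noteq> v" using assms by (auto simp: simple_graph_def darts_def)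
qed

text \<open>\<open>prod.swap\<close> also moves pairs that are not darts. Restricting it makes the
  face map a permutation of \<open>darts E\<close> in the sense of \<open>permutes\<close>, without
  changing the faces.\<close>

definition dart_swap :: "'a set set \<Rightarrow> 'a \<times> 'a \<Rightarrow> 'a \<times> 'a" where
  "dart_swap E x = (if x \<in> darts E then prod.swap x else x)"

lemma swap_in_darts: "prod.swap x \<in> darts E \<longleftrightarrow> x \<in> darts E"
  by (cases x) (auto simp: darts_def insert_commute)

lemma dart_swap_permutes: "dart_swap E permutes darts E"
proof (rule bij_imp_permutes)
  show "bij_betw (dart_swap E) (darts E) (darts E)"
    by (rule bij_betwI[where g = "dart_swap E"]) (auto simp: dart_swap_def swap_in_darts)
qed (simp add: dart_swap_def)

lemma rotation_permutes: "rotation_system E \<sigma> \<Longrightarrow> \<sigma> permutes darts E"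
  by (simp add: rotation_system_def)

lemma rotation_orbit:
  assumes "rotation_system E \<sigma>" "x \<in> darts E"
  shows "orbit \<sigma> x = {d \<in> darts E. fst d = fst x}"
proof -
  have "cyclic_on \<sigma> {d \<in> darts E. fst d = fst x}"
    using assms by (cases x) (auto simp: rotation_system_def)
  then show ?thesis using assms(2) by (intro orbit_cyclic_eq3) auto
qed

lemma rotation_fst:
  assumes "rotation_system E \<sigma>" "x \<in> darts E"
  shows "\<sigma> x \<in> darts E" "fst (\<sigma> x) = fst x"
  using rotation_orbit[OF assms] orbit.base[of \<sigma> x] by auto

lemma faces_dart_swap:
  assumes "rotation_system E \<sigma>"
  shows "faces E \<sigma> = orbit (\<sigma> \<circ> dart_swap E) ` darts E"
  unfolding faces_def
proof (intro image_cong refl)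
  fix x assume "x \<in> darts E"
  then show "orbit (\<sigma> \<circ> prod.swap) x = orbit (\<sigma> \<circ> dart_swap E) x"
    by (rule orbit_cong0) (auto simp: dart_swap_def swap_in_darts rotation_fst[OF assms])
qed

lemma face_perm_permutes:
  assumes "rotation_system E \<sigma>"
  shows "(\<sigma> \<circ> dart_swap E) permutes darts E"
  using permutes_compose[OF dart_swap_permutes rotation_permutes[OF assms]] .

text \<open>Twice the genus, as an integer: that it is even and nonnegative is only known after the
  induction over edge deletions.\<close>

definition euler_defect :: "'a set \<Rightarrow> 'a set set \<Rightarrow> ('a \<times> 'a \<Rightarrow> 'a \<times> 'a) \<Rightarrow> int" where
  "euler_defect V E \<sigma> = 2 * int (card (graph_components V E))
     - (int (card V) - int (card E) + int (card (faces E \<sigma>) + card (V - Domain (darts E))))"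

lemma has_genus_defect: "has_genus V E \<sigma> h \<longleftrightarrow> euler_defect V E \<sigma> = 2 * int h"
  by (auto simp: has_genus_def euler_defect_def)

text \<open>If both darts of the edge lie on one face, that face splits: the defect drops by 2, or
  stays when a component splits as well. If they lie on two faces, these merge, which compensates
  for the lost edge, and the component stays whole.\<close>

lemma delete_edge:
  fixes u v :: 'a
  assumes G: "simple_graph V (insert {u, v} E)" and new: "{u, v} \<notin> E"
    and rot: "rotation_system (insert {u, v} E) \<sigma>"
  shows "\<exists>\<sigma>'. rotation_system E \<sigma>' \<and>
    (euler_defect V E \<sigma>' = euler_defect V (insert {u, v} E) \<sigma> \<or>
     euler_defect V E \<sigma>' = euler_defect V (insert {u, v} E) \<sigma> - 2)"
proof -
  let ?E = "insert {u, v} E"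
  define D where "D = darts ?E"
  define d where "d = (u, v)"
  define d' where "d' = (v, u)"
  have uv: "u \<noteq> v" "u \<in> V" "v \<in> V" and finV: "finite V" using G by (auto simp: simple_graph_def)
  have D: "D = insert d (insert d' (darts E))" by (simp add: D_def d_def d'_def darts_insert)
  have dE: "d \<notin> darts E" "d' \<notin> darts E" using new by (auto simp: d_def d'_def darts_def insert_commute)
  have dd: "d \<noteq> d'" using uv by (auto simp: d_def d'_def)
  have D': "darts E = D - {d} - {d'}" using D dE by auto
  have finD: "finite D" using simple_graph_darts(2)[OF G] by (simp add: D_def)
  have sig: "\<sigma> permutes D" using rot by (simp add: D_def rotation_system_def)
  have psig: "permutation \<sigma>" using sig finD by (auto simp: permutation_permutes)
  have inD: "d \<in> D" "d' \<in> D" using D by auto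
  define \<sigma>' where "\<sigma>' = skip d' (skip d \<sigma>)"
  have s1: "skip d \<sigma> permutes (D - {d})" using sig inD by (intro skip_permutes)
  have ps1: "permutation (skip d \<sigma>)" using s1 finD by (auto simp: permutation_permutes)
  have s2: "\<sigma>' permutes darts E" unfolding D' \<sigma>'_def using inD dd by (intro skip_permutes[OF s1]) auto
  have rot': "rotation_system E \<sigma>'" unfolding rotation_system_def
  proof (intro conjI s2 ballI)
    fix w assume "w \<in> Domain (darts E)"
    then obtain s where s: "s \<in> darts E" "fst s = w" by fastforce
    have "orbit \<sigma>' s = orbit (skip d \<sigma>) s - {d'}" unfolding \<sigma>'_def
      using s D' by (intro orbit_skip ps1) auto
    also have "orbit (skip d \<sigma>) s = orbit \<sigma> s - {d}" using s D' by (intro orbit_skip psig) auto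
    also have "orbit \<sigma> s = {x \<in> D. fst x = w}"
      using rotation_orbit[OF rot, of s] s D' by (simp add: D_def)
    finally have "{x \<in> darts E. fst x = w} = orbit \<sigma>' s" unfolding D' by auto
    then show "cyclic_on \<sigma>' {x \<in> darts E. fst x = w}"
      using s unfolding cyclic_on_def by blast
  qed
  define \<phi> where "\<phi> = \<sigma> \<circ> dart_swap ?E"
  have phi: "\<phi> permutes D" unfolding \<phi>_def D_def using face_perm_permutes[OF rot] .
  have pphi: "permutation \<phi>" using phi finD by (auto simp: permutation_permutes)
  \<comment> \<open>\<open>\<pi>\<close> is the face permutation with the edge detached: each of its
    two darts is now followed by its \<open>\<sigma>\<close>-successor at its own tail. Skipping
    both darts then yields the faces of the smaller graph.\<close>
  define \<pi> where "\<pi> = \<phi> \<circ> transpose d d'"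
  have pi: "\<pi> permutes D" unfolding \<pi>_def by (intro permutes_compose permutes_swap_id phi inD)
  have phix: "\<phi> x = \<sigma> (prod.swap x)" if "x \<in> D" for x using that by (simp add: \<phi>_def dart_swap_def D_def)
  have pid: "\<pi> d = \<sigma> d" "\<pi> d' = \<sigma> d'"
    using phix[OF inD(1)] phix[OF inD(2)] by (simp_all add: \<pi>_def d_def d'_def)
  have fs: "fst (\<sigma> d) = u" "fst (\<sigma> d') = v"
    using rotation_fst[OF rot] inD by (simp_all add: D_def d_def d'_def)
  then have sne: "\<sigma> d \<noteq> d'" "\<sigma> d' \<noteq> d" using uv by (auto simp: d_def d'_def)
  have agree: "(\<sigma>' \<circ> dart_swap E) x = skip d' (skip d \<pi>) x" if x: "x \<in> darts E" for x
  proof -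
    have ne: "x \<noteq> d" "x \<noteq> d'" "prod.swap x \<noteq> d" "prod.swap x \<noteq> d'"
      using x dE by (cases x; auto simp: d_def d'_def)+
    have "\<pi> x = \<sigma> (prod.swap x)" using x ne phix D' by (simp add: \<pi>_def)
    then show ?thesis using ne x pid sne by (auto simp: \<sigma>'_def skip_def dart_swap_def)
  qed
  have faces': "faces E \<sigma>' = orbit (skip d' (skip d \<pi>)) ` (D - {d} - {d'})"
    unfolding faces_dart_swap[OF rot'] D'[symmetric]
  proof (intro image_cong refl)
    fix x assume "x \<in> darts E"
    moreover have "\<sigma>' \<circ> dart_swap E \<in> darts E \<rightarrow> darts E"
      using permutes_in_image[OF face_perm_permutes[OF rot']] by blast
    ultimately show "orbit (\<sigma>' \<circ> dart_swap E) x = orbit (skip d' (skip d \<pi>)) x"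
      by (rule orbit_cong0) (rule agree)
  qed
  have pi1: "skip d \<pi> permutes (D - {d})" using pi inD by (intro skip_permutes)
  have sk: "skip d \<pi> d' = \<sigma> d'" using dd pid sne by (auto simp: skip_def)
  have "card (faces E \<sigma>') + (if \<sigma> d' = d' then 1 else 0) = card (orbit (skip d \<pi>) ` (D - {d}))"
    unfolding faces' using orbit_count_skip[OF pi1, of d'] finD inD dd sk by auto
  moreover have "card (orbit (skip d \<pi>) ` (D - {d})) + (if \<sigma> d = d then 1 else 0) = card (orbit \<pi> ` D)"
    using orbit_count_skip[OF pi finD, of d] inD pid by auto
  ultimately have cf: "card (faces E \<sigma>') + (if \<sigma> d' = d' then 1 else 0) + (if \<sigma> d = d then 1 else 0)
      = card (orbit \<pi> ` D)" by simp
  have fix_iff: "\<sigma> x = x \<longleftrightarrow> fst x \<notin> Domain (darts E)" if "x = d \<or> x = d'" for x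
  proof -
    have "\<sigma> x = x \<longleftrightarrow> {y \<in> D. fst y = fst x} = {x}"
      using rotation_orbit[OF rot, of x] that inD orbit_eq_singleton_iff[of \<sigma> x] by (auto simp: D_def)
    also have "{y \<in> D. fst y = fst x} = insert x {y \<in> darts E. fst y = fst x}"
      using that uv unfolding D by (auto simp: d_def d'_def)
    also have "insert x {y \<in> darts E. fst y = fst x} = {x} \<longleftrightarrow> {y \<in> darts E. fst y = fst x} = {}"
      using that dE by blast
    also have "\<dots> \<longleftrightarrow> fst x \<notin> Domain (darts E)" by (auto simp: Domain_iff)
    finally show ?thesis .
  qed
  \<comment> \<open>A dart fixed by \<open>\<sigma>\<close> is the only one at its vertex. Skipping
    it loses a cycle of \<open>\<pi>\<close>, but its vertex becomes isolated and so contributes a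
    face of its own.\<close>
  have iso: "V - Domain (darts E) = (V - Domain D) \<union>
      ((if \<sigma> d = d then {u} else {}) \<union> (if \<sigma> d' = d' then {v} else {}))"
    using fix_iff[of d] fix_iff[of d'] uv unfolding D by (auto simp: d_def d'_def)
  have "card (V - Domain (darts E)) = card (V - Domain D) +
      ((if \<sigma> d = d then 1 else 0) + (if \<sigma> d' = d' then 1 else 0))"
  proof -
    have "card (V - Domain (darts E)) = card (V - Domain D) +
        card ((if \<sigma> d = d then {u} else {}) \<union> (if \<sigma> d' = d' then {v} else {}))"
      unfolding iso using finV inD by (intro card_Un_disjoint) (auto simp: d_def d'_def)
    also have "card ((if \<sigma> d = d then {u} else {}) \<union> (if \<sigma> d' = d' then {v} else {})) =
       (if \<sigma> d = d then 1 else 0) + (if \<sigma> d' = d' then 1 else 0)"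
      using uv by auto
    finally show ?thesis .
  qed
  then have tot: "card (faces E \<sigma>') + card (V - Domain (darts E)) = card (orbit \<pi> ` D) + card (V - Domain D)"
    using cf by simp
  have fold: "card (faces ?E \<sigma>) = card (orbit \<phi> ` D)"
    unfolding faces_dart_swap[OF rot] by (simp add: \<phi>_def D_def)
  have cE: "card ?E = card E + 1"
    using simple_graph_finite[OF G] new by simp
  show ?thesis
  proof (cases "d' \<in> orbit \<phi> d")
    case True
    then have split: "card (orbit \<pi> ` D) = card (orbit \<phi> ` D) + 1"
      unfolding \<pi>_def using orbit_count_split[OF phi finD dd inD(1)] by simp
    show ?thesis
    proof (cases "(u, v) \<in> (darts E)\<^sup>*")
      case True
      then show ?thesis using rot' tot split fold cE components_insert_connected[OF True, of V]
        by (intro exI[of _ \<sigma>']) (simp add: euler_defect_def D_def)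
    next
      case False
      then show ?thesis
        using rot' tot split fold cE components_insert_disconnected[OF finV uv(2,3) False]
        by (intro exI[of _ \<sigma>']) (simp add: euler_defect_def D_def)
    qed
  next
    case False
    then have merge: "card (orbit \<pi> ` D) + 1 = card (orbit \<phi> ` D)"
      unfolding \<pi>_def using orbit_count_merge[OF phi finD inD] by simp
    \<comment> \<open>The face of \<open>d\<close> does not contain the reverse dart, so its other
      darts form a walk from \<open>v\<close> back to \<open>u\<close> that avoids the deleted
      edge.\<close>
    have walk: "(v, fst y) \<in> (darts E)\<^sup>*" if "y \<in> orbit \<phi> d" for y
      using that
    proof (induction rule: orbit.induct)
      case base
      then show ?case using phix[OF inD(1)] fs by (simp add: d_def d'_def)
    next
      case (step y)
      have yD: "y \<in> D" using step.hyps permutes_orbit_subset[OF phi inD(1)] by blast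
      then have "fst (\<phi> y) = snd y"
        using phix rotation_fst(2)[OF rot, of "prod.swap y"] swap_in_darts[of y ?E] by (simp add: D_def)
      moreover have "(fst y, snd y) \<in> darts E" if "y \<noteq> d"
        using that yD False step.hyps D' by (cases y) auto
      ultimately show ?case
        using step.IH rtrancl_into_rtrancl[of v "fst y" "darts E" "snd y"]
        by (cases "y = d") (auto simp: d_def)
    qed
    have "(v, u) \<in> (darts E)\<^sup>*"
      using walk[OF permutation_self_in_orbit[OF pphi]] by (simp add: d_def)
    then have "(u, v) \<in> (darts E)\<^sup>*" using sym_rtrancl[OF sym_darts] by (meson symD)
    from components_insert_connected[OF this, of V] show ?thesis
      using rot' tot merge fold cE
      by (intro exI[of _ \<sigma>']) (simp add: euler_defect_def D_def)
  qed
qed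

lemma edge_doubleton:
  assumes "simple_graph V (insert e E)"
  obtains u v where "e = {u, v}"
  using assms by (auto simp: simple_graph_def card_2_iff)

lemma euler_defect_subset:
  assumes "finite F" "simple_graph V (E \<union> F)" "rotation_system (E \<union> F) \<sigma>"
  shows "\<exists>\<sigma>'. rotation_system E \<sigma>' \<and> euler_defect V E \<sigma>' \<le> euler_defect V (E \<union> F) \<sigma>"
  using assms
proof (induction F arbitrary: \<sigma> rule: finite_induct)
  case (insert e F)
  show ?case
  proof (cases "e \<in> E \<union> F")
    case True
    then have "E \<union> insert e F = E \<union> F" by blast
    then show ?thesis using insert by metis
  next
    case False
    have eq: "E \<union> insert e F = insert e (E \<union> F)" by simp
    obtain u v where e: "e = {u, v}" using edge_doubleton[of V e "E \<union> F"] insert.prems(1) by auto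
    obtain \<sigma>1 where "rotation_system (E \<union> F) \<sigma>1"
      "euler_defect V (E \<union> F) \<sigma>1 \<le> euler_defect V (E \<union> insert e F) \<sigma>"
      using delete_edge[of V u v "E \<union> F" \<sigma>] insert.prems False e by auto
    moreover have "simple_graph V (E \<union> F)" using insert.prems(1) simple_graph_subset[of V "E \<union> insert e F" "E \<union> F"] by blast
    ultimately show ?thesis using insert.IH[of \<sigma>1] by fastforce
  qed
qed auto

lemma components_empty: "card (graph_components V {}) = card V"
proof -
  have "graph_components V {} = (\<lambda>x. {x}) ` V" by (auto simp: graph_components_def quotient_def darts_def)
  then show ?thesis by (simp add: card_image)
qed

text \<open>Deletion leads down to the edgeless graph, where each vertex is a component with one
  face and the defect is 0. On the way back every edge adds 0 or 2.\<close>

lemma euler_defect_even_nonneg: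
  assumes "finite E" "simple_graph V E" "rotation_system E \<sigma>"
  shows "\<exists>h. euler_defect V E \<sigma> = 2 * int h"
  using assms
proof (induction E arbitrary: \<sigma> rule: finite_induct)
  case empty
  have "euler_defect V {} \<sigma> = 0"
    unfolding euler_defect_def components_empty by (simp add: faces_def darts_def)
  then show ?case by auto
next
  case (insert e E)
  obtain u v where e: "e = {u, v}" using edge_doubleton[of V e E] insert.prems(1) by auto
  obtain \<sigma>' where s: "rotation_system E \<sigma>'"
    "euler_defect V E \<sigma>' = euler_defect V (insert e E) \<sigma> \<or>
     euler_defect V E \<sigma>' = euler_defect V (insert e E) \<sigma> - 2"
    using delete_edge[of V u v E \<sigma>] insert e by auto
  obtain h where "euler_defect V E \<sigma>' = 2 * int h"
    using insert.IH[OF _ s(1)] insert.prems(1) simple_graph_subset[of V "insert e E" E] by blast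
  then have "euler_defect V (insert e E) \<sigma> = 2 * int h \<or> euler_defect V (insert e E) \<sigma> = 2 * int (Suc h)"
    using s(2) by auto
  then show ?case by metis
qed

section \<open>Existence of rotation systems and attainment of the genus\<close>

lemma exists_cyclic:
  assumes "finite S" "S \<noteq> {}"
  shows "\<exists>f. f permutes S \<and> cyclic_on f S"
  using assms
proof (induction S rule: finite_ne_induct)
  case (singleton x)
  have "orbit id x = {x}" by (simp add: orbit_eq_singleton_iff)
  then show ?case using permutes_id unfolding cyclic_on_def by (metis insertI1)
next
  case (insert b S)
  then obtain f where f: "f permutes S" "cyclic_on f S" by blast
  obtain a where a: "a \<in> S" "S = orbit f a" using f(2) by (auto simp: cyclic_on_def)
  \<comment> \<open>The new point is a fixed point of \<open>f\<close>; merging its trivial cycle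
    with that of \<open>a\<close> gives one cycle on all points.\<close>
  let ?g = "f \<circ> transpose a b"
  have pf: "permutation f" using f insert by (auto simp: permutation_permutes)
  have fb: "f b = b" using f(1) insert.hyps by (simp add: permutes_not_in)
  have "f permutes insert b S" using f(1) permutes_subset by blast
  then have g: "?g permutes insert b S" using a by (intro permutes_compose permutes_swap_id) auto
  then have pg: "permutation ?g" using insert by (auto simp: permutation_permutes)
  have bo: "b \<in> orbit ?g a" using orbit_transpose_merge[OF pf] a insert.hyps by blast
  have "?g \<circ> transpose a b = f" by (simp add: fun_eq_iff)
  moreover have "a \<noteq> b" using a insert.hyps by blast
  ultimately have "orbit f a \<union> orbit f b = orbit ?g a" using orbit_transpose_split(1)[OF pg _ bo] by simp
  then have "insert b S = orbit ?g a" using a fb orbit_eq_singleton_iff[of f b] by auto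
  then show ?case using g a unfolding cyclic_on_def by blast
qed

lemma exists_rotation_system:
  assumes "finite (darts E)"
  shows "\<exists>\<sigma>. rotation_system E \<sigma>"
proof -
  let ?S = "\<lambda>v. {d \<in> darts E. fst d = v}"
  have "\<forall>v \<in> Domain (darts E). \<exists>f. f permutes ?S v \<and> cyclic_on f (?S v)"
    using assms by (intro ballI exists_cyclic) auto
  from bchoice[OF this] obtain c
    where c: "\<And>v. v \<in> Domain (darts E) \<Longrightarrow> c v permutes ?S v \<and> cyclic_on (c v) (?S v)"
    by blast
  define \<sigma> where "\<sigma> x = (if x \<in> darts E then c (fst x) x else x)" for x
  have dom: "fst x \<in> Domain (darts E)" if "x \<in> darts E" for x using that by (cases x) auto
  have im: "\<sigma> x \<in> darts E \<and> fst (\<sigma> x) = fst x" if "x \<in> darts E" for x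
    using that c[OF dom[OF that]] permutes_in_image[of "c (fst x)" "?S (fst x)" x] by (auto simp: \<sigma>_def)
  have "inj_on \<sigma> (darts E)"
  proof (rule inj_onI)
    fix x y assume xy: "x \<in> darts E" "y \<in> darts E" "\<sigma> x = \<sigma> y"
    then have "fst x = fst y" using im by metis
    moreover from this have "c (fst x) x = c (fst x) y" using xy by (simp add: \<sigma>_def)
    moreover have "inj (c (fst x))" using c[OF dom[OF xy(1)]] permutes_inj by blast
    ultimately show "x = y" using injD by metis
  qed
  moreover have "\<sigma> ` darts E \<subseteq> darts E" using im by blast
  ultimately have "bij_betw \<sigma> (darts E) (darts E)"
    using assms by (simp add: bij_betw_def endo_inj_surj)
  then have "\<sigma> permutes darts E" by (rule bij_imp_permutes) (simp add: \<sigma>_def)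
  moreover have "cyclic_on \<sigma> (?S v)" if "v \<in> Domain (darts E)" for v
    using c[OF that] cyclic_cong[of "?S v" "c v" \<sigma>] by (simp add: \<sigma>_def)
  ultimately show ?thesis by (auto simp: rotation_system_def)
qed

text \<open>The \<open>LEAST\<close> in the genus says something only if some rotation system
  satisfies Euler's formula with a natural number; existence and parity supply one.\<close>

lemma graph_genus_embedding:
  assumes "simple_graph V E"
  shows "\<exists>\<sigma>. rotation_system E \<sigma> \<and> euler_defect V E \<sigma> = 2 * int (graph_genus V E)"
proof -
  obtain \<sigma> where s: "rotation_system E \<sigma>"
    using exists_rotation_system simple_graph_darts(2)[OF assms] by blast
  obtain h where "euler_defect V E \<sigma> = 2 * int h"
    using euler_defect_even_nonneg[OF simple_graph_finite[OF assms] assms s] by blast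
  then have "\<exists>h \<sigma>. rotation_system E \<sigma> \<and> has_genus V E \<sigma> h" using s has_genus_defect by blast
  then show ?thesis unfolding graph_genus_def has_genus_defect[symmetric] by (rule LeastI_ex)
qed

section \<open>Complete bipartite minors\<close>

text \<open>Every edge is a bridge. In this form each forest edge comes with a vertex set that no
  other forest edge leaves.\<close>

definition forest :: "'a set set \<Rightarrow> bool" where
  "forest T \<longleftrightarrow> (\<forall>u v. {u, v} \<in> T \<longrightarrow> (u, v) \<notin> (darts (T - {{u, v}}))\<^sup>*)"

lemma reach_mono: "E \<subseteq> F \<Longrightarrow> (darts E)\<^sup>* \<subseteq> (darts F)\<^sup>*"
  by (rule rtrancl_mono) (auto simp: darts_def)

lemma reach_sym: "(x, y) \<in> (darts E)\<^sup>* \<Longrightarrow> (y, x) \<in> (darts E)\<^sup>*"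
  using sym_rtrancl[OF sym_darts] by (meson symD)

lemma reach_insert_connected:
  assumes "(u, v) \<in> (darts E)\<^sup>*"
  shows "(darts (insert {u, v} E))\<^sup>* = (darts E)\<^sup>*"
  using assms reach_sym[OF assms] unfolding darts_insert by (intro rtrancl_subset) auto

text \<open>An edge set of least size with the same reachability contains no edge whose ends stay
  connected without it.\<close>

lemma spanning_forest:
  assumes "finite E"
  shows "\<exists>T \<subseteq> E. forest T \<and> (darts T)\<^sup>* = (darts E)\<^sup>*"
proof -
  let ?P = "\<lambda>T. T \<subseteq> E \<and> (darts T)\<^sup>* = (darts E)\<^sup>*"
  have "?P E" by simp
  then obtain T where T: "?P T" and min: "\<And>T'. ?P T' \<Longrightarrow> card T \<le> card T'"
    using ex_has_least_nat[of ?P E card] by blast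
  have "forest T" unfolding forest_def
  proof (intro allI impI notI)
    fix u v assume e: "{u, v} \<in> T" and r: "(u, v) \<in> (darts (T - {{u, v}}))\<^sup>*"
    have "insert {u, v} (T - {{u, v}}) = T" using e by blast
    then have "?P (T - {{u, v}})" using reach_insert_connected[OF r] T by auto
    then have "card T \<le> card (T - {{u, v}})" by (rule min)
    then show False using e T assms finite_subset card_Diff1_less[of T "{u, v}"] by fastforce
  qed
  then show ?thesis using T by blast
qed

lemma forest_card:
  assumes "finite T" "simple_graph V T" "forest T"
  shows "card V = card T + card (graph_components V T)"
  using assms
proof (induction T rule: finite_induct)
  case empty
  then show ?case by (simp add: components_empty)
next
  case (insert e T)
  obtain u v where e: "e = {u, v}" using edge_doubleton[of V e T] insert.prems(1) by auto
  have sg: "simple_graph V T" using insert.prems(1) simple_graph_subset by blast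
  have "forest T" unfolding forest_def
  proof (intro allI impI notI)
    fix a b assume ab: "{a, b} \<in> T" and r: "(a, b) \<in> (darts (T - {{a, b}}))\<^sup>*"
    have "(a, b) \<in> (darts (insert e T - {{a, b}}))\<^sup>*"
      using r reach_mono[of "T - {{a, b}}" "insert e T - {{a, b}}"] by blast
    then show False using ab insert.prems(2) unfolding forest_def by blast
  qed
  then have IH: "card V = card T + card (graph_components V T)" using insert.IH sg by blast
  have "insert e T - {e} = T" using insert.hyps by blast
  then have nr: "(u, v) \<notin> (darts T)\<^sup>*" using insert.prems(2) e unfolding forest_def by (metis insertI1)
  have "finite V" "u \<in> V" "v \<in> V" using insert.prems(1) e by (auto simp: simple_graph_def)
  from components_insert_disconnected[OF this nr] show ?case using IH insert.hyps e by simp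
qed

text \<open>The successor map sends the darts ending in \<open>U\<close> bijectively to the darts
  starting in \<open>U\<close>. Removing the darts inside \<open>U\<close> from both sides balances
  exits and entries.\<close>

lemma closed_walk_balance:
  assumes fin: "finite f" and bij: "bij_betw \<phi> f f" and st: "\<And>x. x \<in> f \<Longrightarrow> fst (\<phi> x) = snd x"
  shows "card {x \<in> f. fst x \<in> U \<and> snd x \<notin> U} = card {x \<in> f. fst x \<notin> U \<and> snd x \<in> U}"
proof -
  have "\<phi> ` {x \<in> f. snd x \<in> U} = {x \<in> f. fst x \<in> U}"
  proof
    show "\<phi> ` {x \<in> f. snd x \<in> U} \<subseteq> {x \<in> f. fst x \<in> U}" using st bij by (auto simp: bij_betw_def)
    show "{x \<in> f. fst x \<in> U} \<subseteq> \<phi> ` {x \<in> f. snd x \<in> U}"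
    proof
      fix x assume x: "x \<in> {x \<in> f. fst x \<in> U}"
      moreover have "f = \<phi> ` f" using bij by (simp add: bij_betw_def)
      ultimately obtain y where "y \<in> f" "x = \<phi> y" by blast
      then show "x \<in> \<phi> ` {x \<in> f. snd x \<in> U}" using x st by auto
    qed
  qed
  moreover have "inj_on \<phi> {x \<in> f. snd x \<in> U}" using bij by (auto simp: bij_betw_def inj_on_def)
  from card_image[OF this] have "card (\<phi> ` {x \<in> f. snd x \<in> U}) = card {x \<in> f. snd x \<in> U}" .
  ultimately have eq: "card {x \<in> f. fst x \<in> U} = card {x \<in> f. snd x \<in> U}" by simp
  let ?I = "{x \<in> f. fst x \<in> U \<and> snd x \<in> U}"
  have u1: "{x \<in> f. fst x \<in> U} = ?I \<union> {x \<in> f. fst x \<in> U \<and> snd x \<notin> U}" by auto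
  have 1: "card {x \<in> f. fst x \<in> U} = card ?I + card {x \<in> f. fst x \<in> U \<and> snd x \<notin> U}"
    unfolding u1 using fin by (intro card_Un_disjoint) auto
  have u2: "{x \<in> f. snd x \<in> U} = ?I \<union> {x \<in> f. fst x \<notin> U \<and> snd x \<in> U}" by auto
  have 2: "card {x \<in> f. snd x \<in> U} = card ?I + card {x \<in> f. fst x \<notin> U \<and> snd x \<in> U}"
    unfolding u2 using fin by (intro card_Un_disjoint) auto
  show ?thesis using eq 1 2 by linarith
qed

text \<open>In the last part, the face successor of the reverse dart is the rotation successor of
  the dart itself. A face closed under reversal is therefore closed under rotation.\<close>

lemma face_props:
  assumes G: "simple_graph V E" and rot: "rotation_system E \<sigma>" and f: "f \<in> faces E \<sigma>"
  defines "\<phi> \<equiv> \<sigma> \<circ> dart_swap E"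
  shows "f \<subseteq> darts E" "f \<noteq> {}" "bij_betw \<phi> f f" "\<And>x. x \<in> f \<Longrightarrow> fst (\<phi> x) = snd x"
    "\<And>x. x \<in> f \<Longrightarrow> prod.swap x \<in> f \<Longrightarrow> \<sigma> x \<in> f"
proof -
  have fin: "finite (darts E)" using simple_graph_darts[OF G] by blast
  have per: "\<phi> permutes darts E" unfolding \<phi>_def by (rule face_perm_permutes[OF rot])
  then have pp: "permutation \<phi>" using fin by (auto simp: permutation_permutes)
  obtain x0 where x0: "x0 \<in> darts E" "f = orbit \<phi> x0" using f unfolding faces_dart_swap[OF rot] \<phi>_def by blast
  show sub: "f \<subseteq> darts E" using permutes_orbit_subset[OF per x0(1)] x0 by simp
  show "f \<noteq> {}" using x0 orbit_nonempty by metis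
  have step: "\<phi> x \<in> f" if "x \<in> f" for x using that x0 by (auto intro: orbit.step)
  have inj: "inj_on \<phi> f" using per permutes_inj inj_on_subset by blast
  show "bij_betw \<phi> f f"
    using inj step finite_subset[OF sub fin] by (simp add: bij_betw_def endo_inj_surj image_subset_iff)
  have ph: "\<phi> x = \<sigma> (prod.swap x)" if "x \<in> f" for x using that sub by (auto simp: \<phi>_def dart_swap_def)
  show "fst (\<phi> x) = snd x" if "x \<in> f" for x
    using ph[OF that] rotation_fst(2)[OF rot, of "prod.swap x"] that sub swap_in_darts[of x E] by auto
  show "\<sigma> x \<in> f" if "x \<in> f" "prod.swap x \<in> f" for x
    using step[OF that(2)] ph[OF that(2)] by simp
qed

lemma faces_partition:
  assumes G: "simple_graph V E" and rot: "rotation_system E \<sigma>"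
  shows "finite (faces E \<sigma>)" "\<Union> (faces E \<sigma>) = darts E"
    "\<And>f f'. f \<in> faces E \<sigma> \<Longrightarrow> f' \<in> faces E \<sigma> \<Longrightarrow> f \<noteq> f' \<Longrightarrow> f \<inter> f' = {}"
proof -
  let ?\<phi> = "\<sigma> \<circ> dart_swap E"
  have fin: "finite (darts E)" using simple_graph_darts[OF G] by blast
  then have pp: "permutation ?\<phi>" using face_perm_permutes[OF rot] by (auto simp: permutation_permutes)
  show "finite (faces E \<sigma>)" using fin by (simp add: faces_def)
  show "\<Union> (faces E \<sigma>) = darts E"
  proof
    show "\<Union> (faces E \<sigma>) \<subseteq> darts E" using face_props(1)[OF G rot] by blast
    show "darts E \<subseteq> \<Union> (faces E \<sigma>)"
      unfolding faces_dart_swap[OF rot] using permutation_self_in_orbit[OF pp] by blast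
  qed
  show "f \<inter> f' = {}" if "f \<in> faces E \<sigma>" "f' \<in> faces E \<sigma>" "f \<noteq> f'" for f f'
    using that permutation_orbit_eq[OF pp] unfolding faces_dart_swap[OF rot] by blast
qed

text \<open>Let \<open>H\<close> be a spanning forest of the branch sets plus one cross edge per
  pair, with \<open>f\<close> faces, \<open>N = card \<A>\<close> and \<open>g\<close> the genus.
  Euler's formula gives \<open>2 * N \<le> f + 2 * g + 1\<close>. Each face takes at least four of
  the \<open>6 * N\<close> cross darts, so \<open>4 * f \<le> 6 * N\<close>. Together,
  \<open>N \<le> 4 * g + 2\<close>.\<close>

theorem K3_minor_bound:
  fixes V :: "'a set"
  assumes G: "simple_graph V E"
    and parts: "\<And>S. S \<in> \<A> \<union> \<B> \<Longrightarrow> S \<subseteq> V \<and> S \<noteq> {}"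
    and conn: "\<And>S x y. S \<in> \<A> \<union> \<B> \<Longrightarrow> x \<in> S \<Longrightarrow> y \<in> S \<Longrightarrow> (x, y) \<in> (darts E \<inter> S \<times> S)\<^sup>*"
    and disj: "\<And>S S'. S \<in> \<A> \<union> \<B> \<Longrightarrow> S' \<in> \<A> \<union> \<B> \<Longrightarrow> S \<noteq> S' \<Longrightarrow> S \<inter> S' = {}"
    and AB: "\<A> \<inter> \<B> = {}" "card \<B> = 3"
    and adj: "\<And>A B. A \<in> \<A> \<Longrightarrow> B \<in> \<B> \<Longrightarrow> \<exists>a \<in> A. \<exists>b \<in> B. {a, b} \<in> E"
  shows "card \<A> \<le> 4 * graph_genus V E + 2"
proof (cases "\<A> = {}")
  case False
  define N where "N = card \<A>"
  let ?P = "\<A> \<union> \<B>"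
  have finV: "finite V" using G by (simp add: simple_graph_def)
  have finP: "finite ?P" using parts finV by (intro finite_subset[of ?P "Pow V"]) auto
  have fins: "finite \<A>" "finite \<B>" using finP by auto
  have same: "S = S'" if "S \<in> ?P" "S' \<in> ?P" "x \<in> S" "x \<in> S'" for S S' x
    using disj[OF that(1,2)] that(3,4) by blast
  define c where "c A B = (SOME x. fst x \<in> A \<and> snd x \<in> B \<and> {fst x, snd x} \<in> E)" for A B :: "'a set"
  have c: "fst (c A B) \<in> A \<and> snd (c A B) \<in> B \<and> {fst (c A B), snd (c A B)} \<in> E"
    if in_AB: "A \<in> \<A>" "B \<in> \<B>" for A B
  proof -
    obtain a b where "a \<in> A" "b \<in> B" "{a, b} \<in> E" using adj[OF in_AB] by blast
    then have "fst (a, b) \<in> A \<and> snd (a, b) \<in> B \<and> {fst (a, b), snd (a, b)} \<in> E" by simp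
    then show ?thesis unfolding c_def by (rule someI)
  qed
  define EC where "EC = {{fst (c A B), snd (c A B)} |A B. A \<in> \<A> \<and> B \<in> \<B>}"
  \<comment> \<open>The cross darts oriented from the \<open>\<A>\<close> side to the
    \<open>\<B>\<close> side.\<close>
  define P1 where "P1 = {c A B |A B. A \<in> \<A> \<and> B \<in> \<B>}"
  have EC: "EC = (\<lambda>x. {fst x, snd x}) ` P1" unfolding EC_def P1_def by blast
  have P1im: "P1 = (\<lambda>(A, B). c A B) ` (\<A> \<times> \<B>)" unfolding P1_def by auto
  have c_inj: "A = A' \<and> B = B'" if "A \<in> \<A>" "B \<in> \<B>" "A' \<in> \<A>" "B' \<in> \<B>" "c A B = c A' B'" for A B A' B'
    using that c[OF that(1,2)] c[OF that(3,4)] same[of A A' "fst (c A B)"] same[of B B' "snd (c A B)"]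
    by simp
  have cardP1: "card P1 = 3 * N"
  proof -
    have "inj_on (\<lambda>(A, B). c A B) (\<A> \<times> \<B>)" using c_inj by (auto simp: inj_on_def)
    then show ?thesis unfolding P1im using fins AB by (simp add: card_image card_cartesian_product N_def)
  qed
  have finP1: "finite P1" unfolding P1im using fins by simp
  define SA where "SA = \<Union> \<A>"
  define SB where "SB = \<Union> \<B>"
  have P1_side: "fst x \<in> SA" "snd x \<in> SB" if "x \<in> P1" for x
    using that c unfolding P1_def SA_def SB_def by blast+
  have WAB: "x \<notin> SB" if xA: "x \<in> SA" for x
  proof
    assume "x \<in> SB"
    then obtain A B where AB': "A \<in> \<A>" "B \<in> \<B>" "x \<in> A" "x \<in> B" using xA unfolding SA_def SB_def by blast
    then have "A = B" using same by blast
    then show False using AB AB' by blast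
  qed
  have cardEC: "card EC = 3 * N"
  proof -
    have "inj_on (\<lambda>x. {fst x, snd x}) P1"
    proof (rule inj_onI)
      fix x y assume xy: "x \<in> P1" "y \<in> P1" "{fst x, snd x} = {fst y, snd y}"
      have "fst x \<noteq> snd y" using P1_side(1)[OF xy(1)] P1_side(2)[OF xy(2)] WAB by metis
      then show "x = y" using xy(3) by (auto simp: doubleton_eq_iff prod_eq_iff)
    qed
    then show ?thesis unfolding EC using cardP1 by (simp add: card_image)
  qed
  define EW where "EW = {e \<in> E. \<exists>S \<in> ?P. e \<subseteq> S}"
  have "finite EW" using simple_graph_finite[OF G] by (simp add: EW_def)
  then obtain T where T: "T \<subseteq> EW" "forest T" "(darts T)\<^sup>* = (darts EW)\<^sup>*" using spanning_forest by blast
  have Tin: "\<exists>S \<in> ?P. a \<in> S \<and> b \<in> S" if "(a, b) \<in> darts T" for a b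
  proof -
    have "{a, b} \<in> EW" using that T(1) by (auto simp: darts_def)
    then show ?thesis unfolding EW_def by blast
  qed
  define H where "H = T \<union> EC"
  have EC_E: "EC \<subseteq> E" using c by (auto simp: EC_def)
  have HE: "H \<subseteq> E" using T(1) EC_E by (auto simp: H_def EW_def)
  have GH: "simple_graph V H" and GT: "simple_graph V T"
    using simple_graph_subset[OF G] HE by (auto simp: H_def)
  have CD: "darts EC = P1 \<union> prod.swap ` P1"
  proof -
    have "(a, b) \<in> darts EC \<longleftrightarrow> (\<exists>x \<in> P1. (a, b) = x \<or> (a, b) = prod.swap x)" for a b
    proof -
      have "(a, b) \<in> darts EC \<longleftrightarrow> (\<exists>x \<in> P1. {a, b} = {fst x, snd x})"
        unfolding EC by (auto simp: darts_def)
      also have "\<dots> \<longleftrightarrow> (\<exists>x \<in> P1. (a, b) = x \<or> (a, b) = prod.swap x)"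
        by (intro bex_cong refl) (auto simp: doubleton_eq_iff prod_eq_iff)
      finally show ?thesis .
    qed
    then show ?thesis by auto
  qed
  have dH: "darts H = darts T \<union> (P1 \<union> prod.swap ` P1)" unfolding CD[symmetric] by (auto simp: H_def darts_def)
  have P1_notT: "x \<notin> darts T" if xx: "x \<in> P1 \<union> prod.swap ` P1" for x
  proof
    assume "x \<in> darts T"
    then obtain S where S: "S \<in> ?P" "fst x \<in> S" "snd x \<in> S" using Tin by (cases x) auto
    obtain A B where "A \<in> \<A>" "B \<in> \<B>" "x = c A B \<or> x = prod.swap (c A B)" using xx unfolding P1_def by blast
    moreover from this have "A = S" using S c[of A B] same[of A S "fst (c A B)"] same[of A S "snd x"] by auto
    moreover from calculation have "B = S" using S c[of A B] same[of B S "snd (c A B)"] by auto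
    ultimately show False using AB by blast
  qed
  have TEC: "T \<inter> EC = {}"
  proof -
    { fix e assume e: "e \<in> T" "e \<in> EC"
      then obtain x where "x \<in> P1" "e = {fst x, snd x}" unfolding EC by blast
      then have "x \<in> darts T" using e by (cases x) (auto simp: darts_def)
      then have False using P1_notT[of x] \<open>x \<in> P1\<close> by blast }
    then show ?thesis by blast
  qed
  have finT: "finite T" "finite EC" using simple_graph_finite[OF GH] by (auto simp: H_def)
  have cardH: "card H = card T + 3 * N" using TEC finT cardEC by (simp add: H_def card_Un_disjoint)
  obtain \<sigma>0 where s0: "rotation_system E \<sigma>0" "euler_defect V E \<sigma>0 = 2 * int (graph_genus V E)"
    using graph_genus_embedding[OF G] by blast
  have EH: "H \<union> E = E" using HE by blast
  obtain \<sigma> where s: "rotation_system H \<sigma>" "euler_defect V H \<sigma> \<le> 2 * int (graph_genus V E)"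
    using euler_defect_subset[OF simple_graph_finite[OF G], of V H \<sigma>0] s0 G EH by auto
  have W: "darts H \<subseteq> \<Union> ?P \<times> \<Union> ?P"
  proof -
    have "darts T \<subseteq> \<Union> ?P \<times> \<Union> ?P"
    proof
      fix x assume "x \<in> darts T"
      then show "x \<in> \<Union> ?P \<times> \<Union> ?P" using Tin[of "fst x" "snd x"] by (auto simp: mem_Times_iff)
    qed
    moreover have "P1 \<subseteq> \<Union> ?P \<times> \<Union> ?P"
      using P1_side by (auto simp: SA_def SB_def mem_Times_iff)
    ultimately show ?thesis unfolding dH by auto
  qed
  have reachS: "(x, y) \<in> (darts T)\<^sup>*" if "S \<in> ?P" "x \<in> S" "y \<in> S" for S x y
  proof -
    have "darts E \<inter> S \<times> S \<subseteq> darts EW" using that(1) by (auto simp: darts_def EW_def)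
    then show ?thesis using conn[OF that] rtrancl_mono T(3) by blast
  qed
  have reachH: "(x, y) \<in> (darts H)\<^sup>*" if "S \<in> ?P" "x \<in> S" "y \<in> S" for S x y
    using reachS[OF that] reach_mono[of T H] by (auto simp: H_def)
  \<comment> \<open>Each component of the forest is represented by a branch set or by a vertex
    outside all of them.\<close>
  have compT: "card (graph_components V T) \<le> N + 3 + card (V - \<Union> ?P)"
  proof -
    define rep where "rep S = (SOME x. x \<in> S)" for S :: "'a set"
    have rep: "rep S \<in> S" if "S \<in> ?P" for S using parts[OF that] by (auto simp: rep_def some_in_eq)
    have "graph_components V T \<subseteq> (\<lambda>S. (darts T)\<^sup>* `` {rep S}) ` ?P \<union> (\<lambda>x. (darts T)\<^sup>* `` {x}) ` (V - \<Union> ?P)"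
    proof
      fix K assume "K \<in> graph_components V T"
      then obtain x where x: "x \<in> V" "K = (darts T)\<^sup>* `` {x}" by (auto simp: graph_components_def quotient_def)
      show "K \<in> (\<lambda>S. (darts T)\<^sup>* `` {rep S}) ` ?P \<union> (\<lambda>x. (darts T)\<^sup>* `` {x}) ` (V - \<Union> ?P)"
      proof (cases "x \<in> \<Union> ?P")
        case True
        then obtain S where S: "S \<in> ?P" "x \<in> S" by blast
        have "(x, rep S) \<in> (darts T)\<^sup>*" using reachS[OF S(1,2) rep[OF S(1)]] .
        then have "K = (darts T)\<^sup>* `` {rep S}" using x equiv_class_eq[OF equiv_reach] by metis
        then show ?thesis using S by blast
      next
        case False then show ?thesis using x by blast
      qed
    qed
    then have "card (graph_components V T) \<le> card ((\<lambda>S. (darts T)\<^sup>* `` {rep S}) ` ?P \<union> (\<lambda>x. (darts T)\<^sup>* `` {x}) ` (V - \<Union> ?P))"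
      using finP finV by (intro card_mono) auto
    also have "\<dots> \<le> card ?P + card (V - \<Union> ?P)"
      using card_Un_le card_image_le[OF finP] card_image_le[of "V - \<Union> ?P"] finV
      by (smt (verit) add_mono_thms_linordered_semiring(1) finite_Diff le_trans)
    also have "card ?P \<le> N + 3" using card_Un_le[of \<A> \<B>] AB by (simp add: N_def)
    finally show ?thesis by simp
  qed
  have iso: "card (V - \<Union> ?P) \<le> card (V - Domain (darts H))"
    using W finV by (intro card_mono) auto
  obtain A0 where A0: "A0 \<in> \<A>" using False by blast
  \<comment> \<open>Vertices without darts are components by themselves, and one more component
    contains a cross edge.\<close>
  have compH: "card (V - Domain (darts H)) + 1 \<le> card (graph_components V H)"
  proof -
    let ?I = "V - Domain (darts H)"
    obtain B0 where B0: "B0 \<in> \<B>" using AB(2) by force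
    have x: "c A0 B0 \<in> darts H" using A0 B0 unfolding dH P1_def by blast
    define a where "a = fst (c A0 B0)"
    have a: "a \<in> V" "a \<in> Domain (darts H)" using x simple_graph_darts(1)[OF GH] by (cases "c A0 B0"; auto simp: a_def)+
    have cl: "(darts H)\<^sup>* `` {y} = {y}" if "y \<in> ?I" for y
    proof -
      have "z = y" if "(y, z) \<in> (darts H)\<^sup>*" for z
        using that \<open>y \<in> ?I\<close> by (auto elim: converse_rtranclE)
      then show ?thesis by auto
    qed
    have "insert ((darts H)\<^sup>* `` {a}) ((\<lambda>y. {y}) ` ?I) \<subseteq> graph_components V H"
      using a cl by (auto simp: graph_components_def intro: quotientI) (metis Diff_iff quotientI)
    then have "card (insert ((darts H)\<^sup>* `` {a}) ((\<lambda>y. {y}) ` ?I)) \<le> card (graph_components V H)"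
      using finV by (intro card_mono) (auto simp: graph_components_def quotient_def)
    moreover have "(darts H)\<^sup>* `` {a} \<notin> (\<lambda>y. {y}) ` ?I"
    proof
      assume "(darts H)\<^sup>* `` {a} \<in> (\<lambda>y. {y}) ` ?I"
      then obtain y where "y \<in> ?I" "(darts H)\<^sup>* `` {a} = {y}" by blast
      moreover have "a \<in> (darts H)\<^sup>* `` {a}" by simp
      ultimately have "a = y" by simp
      then show False using a \<open>y \<in> ?I\<close> by simp
    qed
    moreover have "card ((\<lambda>y. {y}) ` ?I) = card ?I" by (intro card_image) auto
    ultimately show ?thesis using finV by simp
  qed
  have face4: "4 \<le> card (f \<inter> darts EC)" if f: "f \<in> faces H \<sigma>" for f
  proof (rule ccontr)
    assume "\<not> 4 \<le> card (f \<inter> darts EC)"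
    then have lt: "card (f \<inter> darts EC) < 4" by simp
    note fp = face_props[OF GH s(1) f]
    have finf: "finite f" using fp(1) simple_graph_darts(2)[OF GH] finite_subset by blast
    have bal: "card {x \<in> f. fst x \<in> U \<and> snd x \<notin> U} = card {x \<in> f. fst x \<notin> U \<and> snd x \<in> U}" for U
      by (rule closed_walk_balance[OF finf fp(3)]) (rule fp(4))
    have fdH: "x \<in> darts T \<or> x \<in> P1 \<or> x \<in> prod.swap ` P1" if "x \<in> f" for x using that fp(1) dH by blast
    have Tpart: "fst x \<in> S \<longleftrightarrow> snd x \<in> S" if tp: "x \<in> darts T" "S \<in> ?P" for x S
    proof -
      obtain S' where S': "S' \<in> ?P" "fst x \<in> S'" "snd x \<in> S'" using Tin[of "fst x" "snd x"] tp(1) by auto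
      then show ?thesis using same[OF tp(2) S'(1)] by blast
    qed
    have TA: "fst x \<in> SA \<longleftrightarrow> snd x \<in> SA" if "x \<in> darts T" for x
      using Tpart[OF that] unfolding SA_def by blast
    have dir: "(x \<in> P1 \<longleftrightarrow> fst x \<in> SA \<and> snd x \<notin> SA) \<and> (x \<in> prod.swap ` P1 \<longleftrightarrow> fst x \<notin> SA \<and> snd x \<in> SA)"
      if "x \<in> f" for x
    proof -
      have p: "fst x \<in> SA \<and> snd x \<notin> SA" if "x \<in> P1" using P1_side[OF that] WAB by blast
      have q: "fst x \<notin> SA \<and> snd x \<in> SA" if sw: "x \<in> prod.swap ` P1"
      proof -
        obtain y where "y \<in> P1" "x = prod.swap y" using sw by blast
        then show ?thesis using P1_side[of y] WAB by auto
      qed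
      show ?thesis using fdH[OF that] TA[of x] p q by blast
    qed
    have leave: "{x \<in> f. fst x \<in> SA \<and> snd x \<notin> SA} = f \<inter> P1" using dir by blast
    have enter: "{x \<in> f. fst x \<notin> SA \<and> snd x \<in> SA} = f \<inter> prod.swap ` P1" using dir by blast
    have eqc: "card (f \<inter> P1) = card (f \<inter> prod.swap ` P1)" using bal[of SA] leave enter by simp
    have "(f \<inter> P1) \<inter> (f \<inter> prod.swap ` P1) = {}" using leave enter by blast
    then have "card (f \<inter> darts EC) = card (f \<inter> P1) + card (f \<inter> prod.swap ` P1)"
      unfolding CD Int_Un_distrib using finf by (intro card_Un_disjoint) auto
    \<comment> \<open>A face leaves the \<open>\<A>\<close> side as often as it enters it, so fewer
      than four cross darts means at most one in each direction.\<close>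
    then have le1: "card (f \<inter> P1) \<le> 1" "card (f \<inter> prod.swap ` P1) \<le> 1" using lt eqc by auto
    have uniq1: "x = y" if "x \<in> f \<inter> P1" "y \<in> f \<inter> P1" for x y
      using that le1(1) finf by (auto simp: card_le_Suc0_iff_eq)
    have uniq2: "x = y" if "x \<in> f \<inter> prod.swap ` P1" "y \<in> f \<inter> prod.swap ` P1" for x y
      using that le1(2) finf by (auto simp: card_le_Suc0_iff_eq)
    have ex_iff: "{x \<in> f. fst x \<in> U \<and> snd x \<notin> U} \<noteq> {} \<longleftrightarrow> {x \<in> f. fst x \<notin> U \<and> snd x \<in> U} \<noteq> {}" for U
    proof -
      have "finite {x \<in> f. fst x \<in> U \<and> snd x \<notin> U}" "finite {x \<in> f. fst x \<notin> U \<and> snd x \<in> U}"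
        using finf by auto
      from card_0_eq[OF this(1)] card_0_eq[OF this(2)] show ?thesis using bal[of U] by argo
    qed
    have part_of: "fst (c A' B') \<in> S \<longleftrightarrow> S = A'" "snd (c A' B') \<in> S \<longleftrightarrow> S = B'"
      if "A' \<in> \<A>" "B' \<in> \<B>" "S \<in> ?P" for A' B' S
    proof -
      have P: "A' \<in> ?P" "B' \<in> ?P" using that by auto
      show "fst (c A' B') \<in> S \<longleftrightarrow> S = A'"
        using c[OF that(1,2)] same[OF that(3) P(1), of "fst (c A' B')"] by blast
      show "snd (c A' B') \<in> S \<longleftrightarrow> S = B'"
        using c[OF that(1,2)] same[OF that(3) P(2), of "snd (c A' B')"] by blast
    qed
    have cross_leave: "\<exists>A B. A \<in> \<A> \<and> B \<in> \<B> \<and> (x = c A B \<and> S = A \<or> x = prod.swap (c A B) \<and> S = B)"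
      if xs: "x \<in> f" "S \<in> ?P" "fst x \<in> S" "snd x \<notin> S" for x S
    proof -
      have "x \<notin> darts T" using Tpart[of x S] xs by blast
      then obtain A B where "A \<in> \<A>" "B \<in> \<B>" "x = c A B \<or> x = prod.swap (c A B)"
        using fdH[OF xs(1)] unfolding P1_def by blast
      then show ?thesis using part_of[of A B S] xs by auto
    qed
    have cross_enter: "\<exists>A B. A \<in> \<A> \<and> B \<in> \<B> \<and> (x = c A B \<and> S = B \<or> x = prod.swap (c A B) \<and> S = A)"
      if xs: "x \<in> f" "S \<in> ?P" "fst x \<notin> S" "snd x \<in> S" for x S
    proof -
      have "x \<notin> darts T" using Tpart[of x S] xs by blast
      then obtain A B where "A \<in> \<A>" "B \<in> \<B>" "x = c A B \<or> x = prod.swap (c A B)"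
        using fdH[OF xs(1)] unfolding P1_def by blast
      then show ?thesis using part_of[of A B S] xs by auto
    qed
    have swapP: "prod.swap (c A B) \<in> prod.swap ` P1" if "A \<in> \<A>" "B \<in> \<B>" for A B
      using that unfolding P1_def by blast
    have AneB: "A \<noteq> B" if "A \<in> \<A>" "B \<in> \<B>" for A B using that AB by blast
    \<comment> \<open>The face must leave \<open>B\<close> again and return to \<open>A\<close>.
      Both require a reverse cross dart, only one is available, and so it joins the same
      pair.\<close>
    have close1: "prod.swap (c A B) \<in> f" if AB': "A \<in> \<A>" "B \<in> \<B>" "c A B \<in> f" for A B
    proof -
      have 1: "c A B \<in> {x \<in> f. fst x \<in> A \<and> snd x \<notin> A}" "c A B \<in> {x \<in> f. fst x \<notin> B \<and> snd x \<in> B}"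
        using AB' part_of[of A B A] part_of[of A B B] AneB[of A B] by auto
      obtain x where x: "x \<in> f" "fst x \<notin> A" "snd x \<in> A" using ex_iff[of A] 1(1) by blast
      obtain A1 B1 where x': "A1 \<in> \<A>" "B1 \<in> \<B>" "x = prod.swap (c A1 B1)" "A = A1"
        using cross_enter[OF x(1) _ x(2,3)] AB' AneB by blast
      obtain y where y: "y \<in> f" "fst y \<in> B" "snd y \<notin> B" using ex_iff[of B] 1(2) by blast
      obtain A2 B2 where y': "A2 \<in> \<A>" "B2 \<in> \<B>" "y = prod.swap (c A2 B2)" "B = B2"
        using cross_leave[OF y(1) _ y(2,3)] AB' AneB by blast
      have "x = y" using uniq2[of x y] x(1) y(1) x' y' swapP by blast
      then have "c A1 B1 = c A2 B2" using x' y' by (metis swap_swap)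
      then have "B1 = B" using c_inj[of A1 B1 A2 B2] x' y' by blast
      then show ?thesis using x(1) x' by simp
    qed
    have inP: "c A B \<in> P1" if "A \<in> \<A>" "B \<in> \<B>" for A B using that unfolding P1_def by blast
    have close2: "c A B \<in> f" if AB': "A \<in> \<A>" "B \<in> \<B>" "prod.swap (c A B) \<in> f" for A B
    proof -
      have 1: "prod.swap (c A B) \<in> {x \<in> f. fst x \<notin> A \<and> snd x \<in> A}" "prod.swap (c A B) \<in> {x \<in> f. fst x \<in> B \<and> snd x \<notin> B}"
        using AB' part_of[of A B A] part_of[of A B B] AneB[of A B] by auto
      obtain x where x: "x \<in> f" "fst x \<in> A" "snd x \<notin> A" using ex_iff[of A] 1(1) by blast
      obtain A1 B1 where x': "A1 \<in> \<A>" "B1 \<in> \<B>" "x = c A1 B1" "A = A1"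
        using cross_leave[OF x(1) _ x(2,3)] AB' AneB by blast
      obtain y where y: "y \<in> f" "fst y \<notin> B" "snd y \<in> B" using ex_iff[of B] 1(2) by blast
      obtain A2 B2 where y': "A2 \<in> \<A>" "B2 \<in> \<B>" "y = c A2 B2" "B = B2"
        using cross_enter[OF y(1) _ y(2,3)] AB' AneB by blast
      have "x = y" using uniq1[of x y] x(1) y(1) x' y' inP by blast
      then have "B1 = B" using c_inj[of A1 B1 A2 B2] x' y' by blast
      then show ?thesis using x(1) x' by simp
    qed
    have crossclosed: "prod.swap x \<in> f" if x: "x \<in> f" "x \<notin> darts T" for x
    proof -
      obtain A B where "A \<in> \<A>" "B \<in> \<B>" "x = c A B \<or> x = prod.swap (c A B)"
        using fdH[OF x(1)] x(2) unfolding P1_def by blast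
      then show ?thesis using close1 close2 x(1) by auto
    qed
    \<comment> \<open>Without this forest edge, \<open>U\<close> is left only by cross edges. The
      face uses those in both directions, so balance at \<open>U\<close> forces the reverse of the
      forest edge as well.\<close>
    have treeclosed: "prod.swap x \<in> f" if x: "x \<in> f" "x \<in> darts T" for x
    proof (rule ccontr)
      assume no: "prod.swap x \<notin> f"
      obtain a b where ab: "x = (a, b)" by fastforce
      let ?e = "{a, b}"
      define U where "U = (darts (T - {?e}))\<^sup>* `` {a}"
      have aU: "a \<in> U" by (simp add: U_def)
      have "?e \<in> T" using x ab by (simp add: darts_def)
      then have bU: "b \<notin> U" using T(2) by (simp add: forest_def U_def)
      have only: "y = (a, b) \<or> y = (b, a)" if y: "y \<in> darts T" "(fst y \<in> U) \<noteq> (snd y \<in> U)" for y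
      proof (rule ccontr)
        assume ny: "\<not> (y = (a, b) \<or> y = (b, a))"
        then have "y \<in> darts (T - {?e})" "prod.swap y \<in> darts (T - {?e})"
          using y(1) by (cases y; auto simp: darts_def doubleton_eq_iff insert_commute)+
        then have "(fst y, snd y) \<in> darts (T - {?e})" "(snd y, fst y) \<in> darts (T - {?e})"
          by (cases y; simp)+
        then show False using y(2) unfolding U_def
          by (meson Image_singleton_iff rtrancl.rtrancl_into_rtrancl)
      qed
      let ?L = "{y \<in> f. fst y \<in> U \<and> snd y \<notin> U}" and ?R = "{y \<in> f. fst y \<notin> U \<and> snd y \<in> U}"
      have "prod.swap ` ?R \<subseteq> ?L - {x}"
      proof
        fix z assume "z \<in> prod.swap ` ?R"
        then obtain y where y: "y \<in> f" "fst y \<notin> U" "snd y \<in> U" "z = prod.swap y" by blast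
        have "y \<notin> darts T"
        proof
          assume "y \<in> darts T"
          then have "y = (b, a)" using only[of y] y aU by auto
          then show False using no y ab by simp
        qed
        then have "z \<in> f" using crossclosed y by blast
        moreover have "z \<noteq> x" using y no by auto
        ultimately show "z \<in> ?L - {x}" using y by auto
      qed
      then have "card (prod.swap ` ?R) \<le> card (?L - {x})" using finf by (intro card_mono) auto
      moreover have "card (prod.swap ` ?R) = card ?R" by (intro card_image) (auto simp: inj_on_def)
      moreover have "x \<in> ?L" using x ab aU bU by simp
      then have "card (?L - {x}) < card ?L" using finf by (intro card_Diff1_less) auto
      ultimately show False using bal[of U] by linarith
    qed
    have swapclosed: "prod.swap x \<in> f" if "x \<in> f" for x using that crossclosed treeclosed by blast
    have sigclosed: "\<sigma> x \<in> f" if "x \<in> f" for x using that swapclosed fp(5) by blast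
    have atv: "y \<in> f" if "x \<in> f" "y \<in> darts H" "fst y = fst x" for x y
    proof -
      have "y \<in> orbit \<sigma> x" using rotation_orbit[OF s(1), of x] that fp(1) by auto
      then show ?thesis by (induction rule: orbit.induct) (use sigclosed that in auto)
    qed
    obtain x0 where x0: "x0 \<in> f" using fp(2) by blast
    \<comment> \<open>Being closed under reversal and rotation, the face contains every dart of its
      component.\<close>
    have all: "y \<in> f" if "(fst x0, w) \<in> (darts H)\<^sup>*" "y \<in> darts H" "fst y = w" for w y
      using that
    proof (induction arbitrary: y rule: rtrancl_induct)
      case base
      then show ?case using atv x0 by blast
    next
      case (step w1 w2)
      then have "(w1, w2) \<in> f" by simp
      then have "(w2, w1) \<in> f" using swapclosed by force
      then show ?case using atv step.prems by auto
    qed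
    have "fst x0 \<in> \<Union> ?P" using x0 fp(1) W by (cases x0) auto
    then obtain S where S: "S \<in> ?P" "fst x0 \<in> S" by blast
    have "\<exists>A \<in> \<A>. \<forall>B \<in> \<B>. (fst x0, fst (c A B)) \<in> (darts H)\<^sup>*"
    proof (cases "S \<in> \<A>")
      case True
      then show ?thesis using S reachH[OF S] c by blast
    next
      case False
      then have SB: "S \<in> \<B>" using S by blast
      have 1: "(fst x0, snd (c A0 S)) \<in> (darts H)\<^sup>*" using reachH[OF S] c[OF A0 SB] by blast
      have "c A0 S \<in> darts H" using A0 SB inP dH by blast
      then have "(fst (c A0 S), snd (c A0 S)) \<in> darts H" by simp
      then have 2: "(snd (c A0 S), fst (c A0 S)) \<in> darts H" using sym_darts by (meson symD)
      have "(fst (c A0 S), fst (c A0 B)) \<in> (darts H)\<^sup>*" if "B \<in> \<B>" for B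
        using reachH[of A0] c[OF A0 SB] c[OF A0 that] A0 by blast
      then have "(fst x0, fst (c A0 B)) \<in> (darts H)\<^sup>*" if "B \<in> \<B>" for B
        using 1 2 that by (meson rtrancl.rtrancl_into_rtrancl rtrancl_trans)
      then show ?thesis using A0 by blast
    qed
    then obtain A where A: "A \<in> \<A>" "\<And>B. B \<in> \<B> \<Longrightarrow> (fst x0, fst (c A B)) \<in> (darts H)\<^sup>*" by blast
    have cin: "c A B \<in> f \<inter> P1" if "B \<in> \<B>" for B
      using all[OF A(2)[OF that], of "c A B"] inP[OF A(1) that] dH by blast
    \<comment> \<open>Two cross edges from one \<open>A\<close> give two forward cross darts on the
      face, where at most one is possible.\<close>
    obtain B1 B2 where B12: "B1 \<in> \<B>" "B2 \<in> \<B>" "B1 \<noteq> B2"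
      using AB(2) by (metis One_nat_def card_le_Suc0_iff_eq fins(2) numeral_3_eq_3 Suc_n_not_le_n le_SucI Suc_le_mono)
    have "c A B1 = c A B2" using uniq1 cin B12 by blast
    then show False using c_inj[of A B1 A B2] A B12 by blast
  qed
  have sumf: "4 * card (faces H \<sigma>) \<le> 6 * N"
  proof -
    note fpart = faces_partition[OF GH s(1)]
    have "4 * card (faces H \<sigma>) = (\<Sum>f \<in> faces H \<sigma>. 4)" by simp
    also have "\<dots> \<le> (\<Sum>f \<in> faces H \<sigma>. card (f \<inter> darts EC))" using face4 by (intro sum_mono) auto
    also have "\<dots> = card (\<Union>f \<in> faces H \<sigma>. f \<inter> darts EC)"
      using fpart finT(2) simple_graph_darts(2)[OF simple_graph_subset[OF G EC_E]]
      by (intro card_UN_disjoint[symmetric]) blast+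
    also have "\<dots> \<le> card (darts EC)"
      using simple_graph_darts(2)[OF simple_graph_subset[OF G EC_E]] by (intro card_mono) auto
    also have "\<dots> \<le> card P1 + card (prod.swap ` P1)" unfolding CD by (rule card_Un_le)
    also have "\<dots> \<le> 6 * N" using cardP1 card_image_le[OF finP1, of prod.swap] by simp
    finally show ?thesis .
  qed
  have "card V = card T + card (graph_components V T)" using forest_card[OF finT(1) GT T(2)] .
  \<comment> \<open>Vertices without darts in \<open>H\<close> cancel: they occur twice in the
    doubled component count of \<open>H\<close>, once among its faces, and once in the bound on the
    components of \<open>T\<close>.\<close>
  then have "2 * N \<le> card (faces H \<sigma>) + 2 * graph_genus V E + 1"
    using s(2) compT iso compH cardH unfolding euler_defect_def by linarith
  then show ?thesis using sumf unfolding N_def by linarith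
qed simp

section \<open>Programs as functions\<close>

text \<open>
  Variable 0 carries the value and variable 1 a stack that every program leaves as it found it;
  variable 2 is scratch.
\<close>

definition computes_at :: "com \<Rightarrow> data \<Rightarrow> data \<Rightarrow> nat \<Rightarrow> bool" where
  "computes_at p x y T \<longleftrightarrow>
     (\<forall>s. s 0 = x \<longrightarrow> (\<exists>n s'. exec p s n s' \<and> n \<le> T \<and> s' 0 = y \<and> s' 1 = s 1))"

lemma computes_at_mono: "computes_at p x y T \<Longrightarrow> T \<le> T' \<Longrightarrow> computes_at p x y T'"
  unfolding computes_at_def by (metis le_trans)

lemma computes_at_seq:
  assumes "computes_at p x y T" "computes_at q y z U"
  shows "computes_at (Seq p q) x z (T + U)"
  unfolding computes_at_def
proof (intro allI impI)
  fix s :: store assume "s 0 = x"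
  then obtain n s1 where 1: "exec p s n s1" "n \<le> T" "s1 0 = y" "s1 1 = s 1"
    using assms(1) unfolding computes_at_def by blast
  then obtain m s2 where 2: "exec q s1 m s2" "m \<le> U" "s2 0 = z" "s2 1 = s1 1"
    using assms(2) unfolding computes_at_def by blast
  have "exec (Seq p q) s (n + m) s2" using 1 2 by (intro exec.Seq)
  then show "\<exists>n s'. exec (Seq p q) s n s' \<and> n \<le> T + U \<and> s' 0 = z \<and> s' 1 = s 1"
    using 1 2 by (metis add_mono)
qed

lemma computes_at_expr:
  assumes "\<And>s. s 0 = x \<Longrightarrow> eval e s = y"
  shows "computes_at (Assign 0 e) x y 1"
  unfolding computes_at_def
proof (intro allI impI)
  fix s :: store assume "s 0 = x"
  then show "\<exists>n s'. exec (Assign 0 e) s n s' \<and> n \<le> 1 \<and> s' 0 = y \<and> s' 1 = s 1"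
    using exec.Assign[of 0 e s] assms[of s] by (intro exI[of _ 1] exI[of _ "s(0 := eval e s)"]) simp
qed

text \<open>The input waits on the stack while \<open>p\<close> runs; then it is exchanged for the
  result of \<open>p\<close> while \<open>q\<close> runs. Six assignments surround the two
  programs.\<close>

definition pair_com :: "com \<Rightarrow> com \<Rightarrow> com" where
  "pair_com p q =
     Seq (Assign 1 (ECell (EVar 0) (EVar 1)))
    (Seq p
    (Seq (Assign 2 (ELeft (EVar 1)))
    (Seq (Assign 1 (ECell (EVar 0) (ERight (EVar 1))))
    (Seq (Assign 0 (EVar 2))
    (Seq q
    (Seq (Assign 0 (ECell (ELeft (EVar 1)) (EVar 0)))
         (Assign 1 (ERight (EVar 1)))))))))"

lemma computes_at_pair:
  assumes "computes_at p x y T" "computes_at q x z U"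
  shows "computes_at (pair_com p q) x (Cell y z) (T + U + 6)"
  unfolding computes_at_def
proof (intro allI impI)
  fix s :: store assume x: "s 0 = x"
  let ?s1 = "s(1 := Cell (s 0) (s 1))"
  obtain n t1 where 1: "exec p ?s1 n t1" "n \<le> T" "t1 0 = y" "t1 1 = ?s1 1"
    using assms(1) x unfolding computes_at_def by (metis fun_upd_apply zero_neq_one)
  let ?t2 = "t1(2 := x, 1 := Cell y (s 1), 0 := x)"
  obtain m u where 2: "exec q ?t2 m u" "m \<le> U" "u 0 = z" "u 1 = ?t2 1"
    using assms(2) unfolding computes_at_def by (metis fun_upd_same)
  let ?v = "u(0 := Cell y z, 1 := s 1)"
  have a: "exec (Assign 1 (ECell (EVar 0) (EVar 1))) s 1 ?s1"
    using exec.Assign[of 1 "ECell (EVar 0) (EVar 1)" s] by simp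
  have b: "exec (Assign 2 (ELeft (EVar 1))) t1 1 (t1(2 := x))"
    using exec.Assign[of 2 "ELeft (EVar 1)" t1] 1 x by simp
  have c: "exec (Assign 1 (ECell (EVar 0) (ERight (EVar 1)))) (t1(2 := x)) 1 (t1(2 := x, 1 := Cell y (s 1)))"
    using exec.Assign[of 1 "ECell (EVar 0) (ERight (EVar 1))" "t1(2 := x)"] 1 by simp
  have d: "exec (Assign 0 (EVar 2)) (t1(2 := x, 1 := Cell y (s 1))) 1 ?t2"
    using exec.Assign[of 0 "EVar 2" "t1(2 := x, 1 := Cell y (s 1))"] by simp
  have e: "exec (Assign 0 (ECell (ELeft (EVar 1)) (EVar 0))) u 1 (u(0 := Cell y z))"
    using exec.Assign[of 0 "ECell (ELeft (EVar 1)) (EVar 0)" u] 2 by simp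
  have f: "exec (Assign 1 (ERight (EVar 1))) (u(0 := Cell y z)) 1 ?v"
    using exec.Assign[of 1 "ERight (EVar 1)" "u(0 := Cell y z)"] 2 by simp
  have "exec (pair_com p q) s (1 + (n + (1 + (1 + (1 + (m + (1 + 1))))))) ?v"
    unfolding pair_com_def by (intro exec.Seq; fact)
  then show "\<exists>n s'. exec (pair_com p q) s n s' \<and> n \<le> T + U + 6 \<and> s' 0 = Cell y z \<and> s' 1 = s 1"
    using 1 2 by (intro exI[of _ "1 + (n + (1 + (1 + (1 + (m + (1 + 1))))))"] exI[of _ ?v]) simp
qed

text \<open>The test consumes its input, so the input is paired with the verdict and handed to the
  chosen branch afterwards.\<close>

definition if_com :: "com \<Rightarrow> com \<Rightarrow> com \<Rightarrow> com" where
  "if_com b p q = Seq (pair_com b (Assign 0 (EVar 0)))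
     (Cond (ELeft (EVar 0)) (Seq (Assign 0 (ERight (EVar 0))) p) (Seq (Assign 0 (ERight (EVar 0))) q))"

lemma computes_at_if:
  assumes b: "computes_at b x v T" and p: "v \<noteq> Atom \<Longrightarrow> computes_at p x y U" and q: "v = Atom \<Longrightarrow> computes_at q x y U"
  shows "computes_at (if_com b p q) x y (T + U + 10)"
proof -
  have 1: "computes_at (pair_com b (Assign 0 (EVar 0))) x (Cell v x) (T + 1 + 6)"
    by (intro computes_at_pair b computes_at_expr) simp
  have r: "computes_at (Assign 0 (ERight (EVar 0))) (Cell v x) x 1"
    by (rule computes_at_expr) simp
  have 2: "computes_at (Cond (ELeft (EVar 0)) (Seq (Assign 0 (ERight (EVar 0))) p) (Seq (Assign 0 (ERight (EVar 0))) q))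
     (Cell v x) y (1 + (1 + U))" (is "computes_at ?c _ _ _")
    unfolding computes_at_def
  proof (intro allI impI)
    fix s :: store assume s: "s 0 = Cell v x"
    show "\<exists>n s'. exec ?c s n s' \<and> n \<le> 1 + (1 + U) \<and> s' 0 = y \<and> s' 1 = s 1"
    proof (cases "v = Atom")
      case True
      then obtain n s' where "exec (Seq (Assign 0 (ERight (EVar 0))) q) s n s'" "n \<le> 1 + U" "s' 0 = y" "s' 1 = s 1"
        using computes_at_seq[OF r q] s unfolding computes_at_def by blast
      then show ?thesis using s True exec.CondFalse[of "ELeft (EVar 0)" s]
        by (intro exI[of _ "1 + n"] exI[of _ s']) simp
    next
      case False
      then obtain n s' where "exec (Seq (Assign 0 (ERight (EVar 0))) p) s n s'" "n \<le> 1 + U" "s' 0 = y" "s' 1 = s 1"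
        using computes_at_seq[OF r p] s unfolding computes_at_def by blast
      then show ?thesis using s False exec.CondTrue[of "ELeft (EVar 0)" s]
        by (intro exI[of _ "1 + n"] exI[of _ s']) simp
    qed
  qed
  show ?thesis unfolding if_com_def
    by (rule computes_at_mono[OF computes_at_seq[OF 1 2]]) simp
qed

lemma computes_at_while:
  assumes "\<And>i. i < N \<Longrightarrow> computes_at p (x i) (x (Suc i)) T \<and> left (x i) \<noteq> Atom" and "left (x N) = Atom"
  shows "computes_at (While (ELeft (EVar 0)) p) (x 0) (x N) (N * (T + 1) + 1)"
  using assms
proof (induction N arbitrary: x)
  case 0
  show ?case unfolding computes_at_def
  proof (intro allI impI)
    fix s :: store assume "s 0 = x 0"
    then have "exec (While (ELeft (EVar 0)) p) s 1 s" using 0 by (intro exec.WhileFalse) simp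
    then show "\<exists>n s'. exec (While (ELeft (EVar 0)) p) s n s' \<and> n \<le> 0 * (T + 1) + 1 \<and> s' 0 = x 0 \<and> s' 1 = s 1"
      using \<open>s 0 = x 0\<close> by auto
  qed
next
  case (Suc N)
  have IH: "computes_at (While (ELeft (EVar 0)) p) (x 1) (x (Suc N)) (N * (T + 1) + 1)"
    using Suc.IH[of "\<lambda>i. x (Suc i)"] Suc.prems by simp
  have st: "computes_at p (x 0) (x 1) T" "left (x 0) \<noteq> Atom" using Suc.prems(1)[of 0] by auto
  show ?case unfolding computes_at_def
  proof (intro allI impI)
    fix s :: store assume s: "s 0 = x 0"
    obtain n s1 where 1: "exec p s n s1" "n \<le> T" "s1 0 = x 1" "s1 1 = s 1"
      using st(1) s unfolding computes_at_def by blast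
    obtain m s2 where 2: "exec (While (ELeft (EVar 0)) p) s1 m s2" "m \<le> N * (T + 1) + 1" "s2 0 = x (Suc N)" "s2 1 = s1 1"
      using IH 1(3) unfolding computes_at_def by blast
    have "exec (While (ELeft (EVar 0)) p) s (1 + n + m) s2" using st s 1 2 by (intro exec.WhileTrue) auto
    then show "\<exists>n s'. exec (While (ELeft (EVar 0)) p) s n s' \<and> n \<le> Suc N * (T + 1) + 1 \<and> s' 0 = x (Suc N) \<and> s' 1 = s 1"
      using 1 2 by (intro exI[of _ "1 + n + m"] exI[of _ s2]) simp
  qed
qed

subsection \<open>Polynomial bounds\<close>

text \<open>The base is at least 2, so constants and coefficients can be absorbed into the
  exponent.\<close>

definition polyb :: "(nat \<Rightarrow> nat) \<Rightarrow> bool" where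
  "polyb T \<longleftrightarrow> (\<exists>c. \<forall>K. T K \<le> (K + 2) ^ c)"

lemma polyb_mono: "polyb T \<Longrightarrow> (\<And>K. S K \<le> T K) \<Longrightarrow> polyb S"
  unfolding polyb_def by (meson le_trans)

lemma polyb_const: "polyb (\<lambda>_. n)"
proof -
  have "n \<le> (K + 2) ^ n" for K
    using less_exp[of n] power_mono[of 2 "K + 2" n] by linarith
  then show ?thesis unfolding polyb_def by blast
qed

lemma polyb_id: "polyb (\<lambda>K. K)"
  unfolding polyb_def by (intro exI[of _ 1]) simp

lemma polyb_add:
  assumes "polyb S" "polyb T"
  shows "polyb (\<lambda>K. S K + T K)"
proof -
  obtain a b where ab: "\<And>K. S K \<le> (K + 2) ^ a" "\<And>K. T K \<le> (K + 2) ^ b"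
    using assms unfolding polyb_def by blast
  have "S K + T K \<le> (K + 2) ^ (a + b + 1)" for K
  proof -
    have "S K \<le> (K + 2) ^ (a + b)" "T K \<le> (K + 2) ^ (a + b)"
      using ab[of K] power_increasing[of a "a + b" "K + 2"] power_increasing[of b "a + b" "K + 2"] by linarith+
    then have "S K + T K \<le> 2 * (K + 2) ^ (a + b)" by simp
    also have "\<dots> \<le> (K + 2) * (K + 2) ^ (a + b)" by (intro mult_right_mono) auto
    finally show ?thesis by simp
  qed
  then show ?thesis unfolding polyb_def by blast
qed

lemma polyb_mult:
  assumes "polyb S" "polyb T"
  shows "polyb (\<lambda>K. S K * T K)"
proof -
  obtain a b where "\<And>K. S K \<le> (K + 2) ^ a" "\<And>K. T K \<le> (K + 2) ^ b"
    using assms unfolding polyb_def by blast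
  then have "S K * T K \<le> (K + 2) ^ (a + b)" for K unfolding power_add by (intro mult_mono) auto
  then show ?thesis unfolding polyb_def by blast
qed

lemma polyb_power: "polyb S \<Longrightarrow> polyb (\<lambda>K. S K ^ n)"
  by (induction n) (auto intro: polyb_const polyb_mult)

lemma polyb_comp:
  assumes "polyb S" "polyb T"
  shows "polyb (\<lambda>K. T (S K))"
proof -
  obtain c where c: "\<And>K. T K \<le> (K + 2) ^ c" using assms(2) unfolding polyb_def by blast
  show ?thesis
    by (rule polyb_mono[OF polyb_power[OF polyb_add[OF assms(1) polyb_const[of 2]], of c]]) (rule c)
qed

lemmas polyb_intros = polyb_const polyb_id polyb_add polyb_mult polyb_power

subsection \<open>Functions computed within a bound polynomial in an ambient number\<close>

text \<open>One program serves all \<open>K\<close> and never sees \<open>K\<close>. The size of the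
  result is bounded separately, because with shared subtrees a short run can build an exponentially
  large tree.\<close>

definition compK :: "(nat \<Rightarrow> 'a set) \<Rightarrow> ('a \<Rightarrow> data) \<Rightarrow> ('b \<Rightarrow> data) \<Rightarrow> ('a \<Rightarrow> 'b) \<Rightarrow> bool" where
  "compK D ea eb f \<longleftrightarrow> (\<exists>p T. polyb T \<and> (\<forall>K. \<forall>x \<in> D K.
     computes_at p (ea x) (eb (f x)) (T K) \<and> data_size (eb (f x)) \<le> T K))"

lemma compKI:
  assumes "polyb T" "polyb S"
    "\<And>K x. x \<in> D K \<Longrightarrow> computes_at p (ea x) (eb (f x)) (T K)"
    "\<And>K x. x \<in> D K \<Longrightarrow> data_size (eb (f x)) \<le> S K"
  shows "compK D ea eb f"
  unfolding compK_def
proof (intro exI conjI allI ballI)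
  show "polyb (\<lambda>K. T K + S K)" using assms(1,2) by (rule polyb_add)
  fix K x assume "x \<in> D K"
  from assms(3,4)[OF this] show "computes_at p (ea x) (eb (f x)) (T K + S K)" "data_size (eb (f x)) \<le> T K + S K"
    using computes_at_mono[of _ _ _ "T K"] by auto
qed

lemma compKE:
  assumes "compK D ea eb f"
  obtains p T where "polyb T" "\<And>K x. x \<in> D K \<Longrightarrow> computes_at p (ea x) (eb (f x)) (T K)"
    "\<And>K x. x \<in> D K \<Longrightarrow> data_size (eb (f x)) \<le> T K"
  using assms unfolding compK_def by blast

lemma compK_cong:
  assumes "compK D ea eb f" "\<And>K x. x \<in> D K \<Longrightarrow> f x = g x"
  shows "compK D ea eb g"
proof -
  obtain p T where *: "polyb T" "\<And>K x. x \<in> D K \<Longrightarrow> computes_at p (ea x) (eb (f x)) (T K)"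
    "\<And>K x. x \<in> D K \<Longrightarrow> data_size (eb (f x)) \<le> T K" by (rule compKE[OF assms(1)]) (rule that)
  show ?thesis by (rule compKI[OF *(1) *(1), of _ p]) (use * assms(2) in auto)
qed

lemma compK_comp:
  assumes f: "compK D ea eb f" and g: "compK D' eb ec g" and im: "\<And>K x. x \<in> D K \<Longrightarrow> f x \<in> D' K"
  shows "compK D ea ec (\<lambda>x. g (f x))"
proof -
  obtain p T where 1: "polyb T" "\<And>K x. x \<in> D K \<Longrightarrow> computes_at p (ea x) (eb (f x)) (T K)"
    "\<And>K x. x \<in> D K \<Longrightarrow> data_size (eb (f x)) \<le> T K" by (rule compKE[OF f]) (rule that)
  obtain q U where 2: "polyb U" "\<And>K x. x \<in> D' K \<Longrightarrow> computes_at q (eb x) (ec (g x)) (U K)"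
    "\<And>K x. x \<in> D' K \<Longrightarrow> data_size (ec (g x)) \<le> U K" by (rule compKE[OF g]) (rule that)
  show ?thesis
    by (rule compKI[OF polyb_add[OF 1(1) 2(1)] 2(1), of _ "Seq p q"])
      (use 1 2 im computes_at_seq in blast)+
qed

text \<open>Polynomial time is the case in which the ambient number bounds the size of the
  input.\<close>

definition PT :: "('a \<Rightarrow> data) \<Rightarrow> ('b \<Rightarrow> data) \<Rightarrow> ('a \<Rightarrow> 'b) \<Rightarrow> bool" where
  "PT ea eb f \<longleftrightarrow> compK (\<lambda>K. {x. data_size (ea x) \<le> K}) ea eb f"

lemma compK_PT:
  assumes f: "compK D ea eb f" and g: "PT eb ec g"
  shows "compK D ea ec (\<lambda>x. g (f x))"
proof -
  obtain p T where 1: "polyb T" "\<And>K x. x \<in> D K \<Longrightarrow> computes_at p (ea x) (eb (f x)) (T K)"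
    "\<And>K x. x \<in> D K \<Longrightarrow> data_size (eb (f x)) \<le> T K" by (rule compKE[OF f]) (rule that)
  obtain q U where 2: "polyb U" "\<And>K x. data_size (eb x) \<le> K \<Longrightarrow> computes_at q (eb x) (ec (g x)) (U K)"
    "\<And>K x. data_size (eb x) \<le> K \<Longrightarrow> data_size (ec (g x)) \<le> U K"
    by (rule compKE[OF g[unfolded PT_def]]) auto
  have U: "polyb (\<lambda>K. U (T K))" using polyb_comp 1(1) 2(1) by blast
  show ?thesis
    by (rule compKI[OF polyb_add[OF 1(1) U] U, of _ "Seq p q"])
      (use 1 2 computes_at_seq in blast)+
qed

lemma PT_comp: "PT ea eb f \<Longrightarrow> PT eb ec g \<Longrightarrow> PT ea ec (\<lambda>x. g (f x))"
  using compK_PT[of _ ea eb f ec g] unfolding PT_def by blast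

lemma compK_pair:
  assumes f: "compK D ea eb f" and g: "compK D ea ec g"
    and e: "\<And>x y. e (x, y) = Cell (eb x) (ec y)"
  shows "compK D ea e (\<lambda>x. (f x, g x))"
proof -
  obtain p T where 1: "polyb T" "\<And>K x. x \<in> D K \<Longrightarrow> computes_at p (ea x) (eb (f x)) (T K)"
    "\<And>K x. x \<in> D K \<Longrightarrow> data_size (eb (f x)) \<le> T K" by (rule compKE[OF f]) (rule that)
  obtain q U where 2: "polyb U" "\<And>K x. x \<in> D K \<Longrightarrow> computes_at q (ea x) (ec (g x)) (U K)"
    "\<And>K x. x \<in> D K \<Longrightarrow> data_size (ec (g x)) \<le> U K" by (rule compKE[OF g]) (rule that)
  have P: "polyb (\<lambda>K. T K + U K + 6)" by (intro polyb_intros 1 2)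
  show ?thesis
  proof (rule compKI[OF P P])
    fix K x assume x: "x \<in> D K"
    show "computes_at (pair_com p q) (ea x) (e (f x, g x)) (T K + U K + 6)"
      unfolding e by (intro computes_at_pair 1 2 x)
    show "data_size (e (f x, g x)) \<le> T K + U K + 6"
      unfolding e using 1(3)[OF x] 2(3)[OF x] by simp
  qed
qed

fun enc_pair :: "('a \<Rightarrow> data) \<Rightarrow> ('b \<Rightarrow> data) \<Rightarrow> 'a \<times> 'b \<Rightarrow> data" where
  "enc_pair ea eb (x, y) = Cell (ea x) (eb y)"

definition enc_bool :: "bool \<Rightarrow> data" where
  "enc_bool b = (if b then Cell Atom Atom else Atom)"

lemma PT_pair: "PT ea eb f \<Longrightarrow> PT ea ec g \<Longrightarrow> PT ea (enc_pair eb ec) (\<lambda>x. (f x, g x))"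
  unfolding PT_def by (rule compK_pair) simp_all

lemma PT_expr:
  assumes "\<And>x s. s 0 = ea x \<Longrightarrow> eval e s = eb (f x)" "\<And>x. data_size (eb (f x)) \<le> data_size (ea x) + c"
  shows "PT ea eb f"
  unfolding PT_def
proof (rule compKI)
  show "polyb (\<lambda>K. 1)" "polyb (\<lambda>K. K + c)" by (intro polyb_intros)+
  fix K x assume "x \<in> {x. data_size (ea x) \<le> K}"
  then show "data_size (eb (f x)) \<le> K + c" using assms(2)[of x] by simp
  show "computes_at (Assign 0 e) (ea x) (eb (f x)) 1" by (rule computes_at_expr[OF assms(1)])
qed

lemma PT_id: "PT ea ea (\<lambda>x. x)"
  by (rule PT_expr[of _ "EVar 0" _ _ 0]) auto

fun const_expr :: "data \<Rightarrow> expr" where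
  "const_expr Atom = EAtom"
| "const_expr (Cell a b) = ECell (const_expr a) (const_expr b)"

lemma eval_const_expr: "eval (const_expr d) s = d"
  by (induction d) auto

lemma PT_const: "PT ea eb (\<lambda>_. b)"
  by (rule PT_expr[of _ "const_expr (eb b)" _ _ "data_size (eb b)"]) (auto simp: eval_const_expr)

lemma PT_fst: "PT ea (enc_pair eb ec) f \<Longrightarrow> PT ea eb (\<lambda>x. fst (f x))"
proof (erule PT_comp)
  show "PT (enc_pair eb ec) eb fst" by (rule PT_expr[of _ "ELeft (EVar 0)" _ _ 0]) auto
qed

lemma PT_snd: "PT ea (enc_pair eb ec) f \<Longrightarrow> PT ea ec (\<lambda>x. snd (f x))"
proof (erule PT_comp)
  show "PT (enc_pair eb ec) ec snd" by (rule PT_expr[of _ "ERight (EVar 0)" _ _ 0]) auto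
qed

lemma compK_if:
  assumes b: "compK D ea enc_bool b" and f: "compK D ea eb f" and g: "compK D ea eb g"
  shows "compK D ea eb (\<lambda>x. if b x then f x else g x)"
proof -
  obtain r R where 0: "polyb R" "\<And>K x. x \<in> D K \<Longrightarrow> computes_at r (ea x) (enc_bool (b x)) (R K)"
    by (rule compKE[OF b]) auto
  obtain p T where 1: "polyb T" "\<And>K x. x \<in> D K \<Longrightarrow> computes_at p (ea x) (eb (f x)) (T K)"
    "\<And>K x. x \<in> D K \<Longrightarrow> data_size (eb (f x)) \<le> T K" by (rule compKE[OF f]) (rule that)
  obtain q U where 2: "polyb U" "\<And>K x. x \<in> D K \<Longrightarrow> computes_at q (ea x) (eb (g x)) (U K)"
    "\<And>K x. x \<in> D K \<Longrightarrow> data_size (eb (g x)) \<le> U K" by (rule compKE[OF g]) (rule that)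
  have P: "polyb (\<lambda>K. R K + (T K + U K) + 10)" by (intro polyb_intros 0 1 2)
  show ?thesis
  proof (rule compKI[OF P P])
    fix K x assume x: "x \<in> D K"
    show "computes_at (if_com r p q) (ea x) (eb (if b x then f x else g x)) (R K + (T K + U K) + 10)"
    proof (rule computes_at_if[OF 0(2)[OF x]])
      show "computes_at p (ea x) (eb (if b x then f x else g x)) (T K + U K)" if "enc_bool (b x) \<noteq> Atom"
        using that computes_at_mono[OF 1(2)[OF x]] by (auto simp: enc_bool_def split: if_splits)
      show "computes_at q (ea x) (eb (if b x then f x else g x)) (T K + U K)" if "enc_bool (b x) = Atom"
        using that computes_at_mono[OF 2(2)[OF x]] by (auto simp: enc_bool_def split: if_splits)
    qed
    show "data_size (eb (if b x then f x else g x)) \<le> R K + (T K + U K) + 10"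
      using 1(3)[OF x] 2(3)[OF x] by auto
  qed
qed

lemma PT_if: "PT ea enc_bool b \<Longrightarrow> PT ea eb f \<Longrightarrow> PT ea eb g \<Longrightarrow> PT ea eb (\<lambda>x. if b x then f x else g x)"
  unfolding PT_def by (rule compK_if)

lemma enc_list_Nil_iff: "enc_list e xs = Atom \<longleftrightarrow> xs = []"
  by (cases xs) auto

lemma data_size_enc_list: "data_size (enc_list e xs) = 1 + (\<Sum>x\<leftarrow>xs. 1 + data_size (e x))"
  by (induction xs) auto

lemma data_size_pos: "0 < data_size d"
  by (cases d) auto

lemma length_le_data_size: "length xs \<le> data_size (enc_list e xs)"
  by (induction xs) auto

lemma data_size_elem: "x \<in> set xs \<Longrightarrow> data_size (e x) \<le> data_size (enc_list e xs)"
  by (induction xs) auto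

lemma data_size_enc_list_le:
  assumes "\<And>x. x \<in> set xs \<Longrightarrow> data_size (e x) \<le> B"
  shows "data_size (enc_list e xs) \<le> 1 + length xs * (1 + B)"
  using assms
proof (induction xs)
  case (Cons x xs)
  then have "data_size (enc_list e xs) \<le> 1 + length xs * (1 + B)" "data_size (e x) \<le> B" by auto
  then show ?case by simp
qed simp

text \<open>
  The loop keeps the remaining list in the left component of the state, next to the input and the
  accumulator.
\<close>

lemma compK_foldl:
  assumes idD: "compK D ea ea (\<lambda>x. x)"
    and l: "compK D ea (enc_list eb) l" and a: "compK D ea ec a0"
    and st: "compK E (enc_pair (enc_pair ea ec) eb) ec (\<lambda>z. st (fst (fst z)) (snd (fst z)) (snd z))"
    and E: "\<And>K x ys y zs. x \<in> D K \<Longrightarrow> l x = ys @ y # zs \<Longrightarrow> ((x, foldl (st x) (a0 x) ys), y) \<in> E K"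
  shows "compK D ea ec (\<lambda>x. foldl (st x) (a0 x) (l x))"
proof -
  obtain p0 T0 where 0: "polyb T0" "\<And>K x. x \<in> D K \<Longrightarrow> computes_at p0 (ea x) (ea x) (T0 K)"
    "\<And>K x. x \<in> D K \<Longrightarrow> data_size (ea x) \<le> T0 K" by (rule compKE[OF idD]) (rule that)
  obtain p1 T1 where 1: "polyb T1" "\<And>K x. x \<in> D K \<Longrightarrow> computes_at p1 (ea x) (enc_list eb (l x)) (T1 K)"
    "\<And>K x. x \<in> D K \<Longrightarrow> data_size (enc_list eb (l x)) \<le> T1 K" by (rule compKE[OF l]) (rule that)
  obtain p2 T2 where 2: "polyb T2" "\<And>K x. x \<in> D K \<Longrightarrow> computes_at p2 (ea x) (ec (a0 x)) (T2 K)"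
    "\<And>K x. x \<in> D K \<Longrightarrow> data_size (ec (a0 x)) \<le> T2 K" by (rule compKE[OF a]) (rule that)
  obtain p3 T3 where 3: "polyb T3" "\<And>K z. z \<in> E K \<Longrightarrow>
      computes_at p3 (enc_pair (enc_pair ea ec) eb z) (ec (st (fst (fst z)) (snd (fst z)) (snd z))) (T3 K)"
    "\<And>K z. z \<in> E K \<Longrightarrow> data_size (ec (st (fst (fst z)) (snd (fst z)) (snd z))) \<le> T3 K" by (rule compKE[OF st]) (rule that)
  define body where "body = pair_com (Assign 0 (ERight (ELeft (EVar 0))))
    (pair_com (Assign 0 (ELeft (ERight (EVar 0))))
      (Seq (Assign 0 (ECell (ERight (EVar 0)) (ELeft (ELeft (EVar 0))))) p3))"
  define prog where "prog = Seq (pair_com p1 (pair_com p0 p2))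
    (Seq (While (ELeft (EVar 0)) body) (Assign 0 (ERight (ERight (EVar 0)))))"
  define S where "S x i = Cell (enc_list eb (drop i (l x))) (Cell (ea x) (ec (foldl (st x) (a0 x) (take i (l x)))))" for x i
  have step: "computes_at body (S x i) (S x (Suc i)) (T3 K + 15) \<and> left (S x i) \<noteq> Atom" and
    ssize: "data_size (ec (foldl (st x) (a0 x) (take (Suc i) (l x)))) \<le> T3 K"
    if x: "x \<in> D K" and i: "i < length (l x)" for K x i
  proof -
    let ?y = "l x ! i" and ?acc = "foldl (st x) (a0 x) (take i (l x))"
    have dr: "drop i (l x) = ?y # drop (Suc i) (l x)" using i by (simp add: Cons_nth_drop_Suc)
    have z: "((x, ?acc), ?y) \<in> E K" by (rule E[OF x, of _ _ "drop (Suc i) (l x)"]) (simp add: id_take_nth_drop[OF i, symmetric])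
    have tk: "foldl (st x) (a0 x) (take (Suc i) (l x)) = st x ?acc ?y" using i by (simp add: take_Suc_conv_app_nth)
    show "data_size (ec (foldl (st x) (a0 x) (take (Suc i) (l x)))) \<le> T3 K" using 3(3)[OF z] tk by simp
    have Si: "S x i = Cell (Cell (eb ?y) (enc_list eb (drop (Suc i) (l x)))) (Cell (ea x) (ec ?acc))"
      unfolding S_def dr by simp
    have SSi: "S x (Suc i) = Cell (enc_list eb (drop (Suc i) (l x))) (Cell (ea x) (ec (st x ?acc ?y)))"
      unfolding S_def tk by simp
    have "computes_at (Seq (Assign 0 (ECell (ERight (EVar 0)) (ELeft (ELeft (EVar 0))))) p3) (S x i) (ec (st x ?acc ?y)) (1 + T3 K)"
    proof (rule computes_at_seq)
      show "computes_at (Assign 0 (ECell (ERight (EVar 0)) (ELeft (ELeft (EVar 0))))) (S x i)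
        (enc_pair (enc_pair ea ec) eb ((x, ?acc), ?y)) 1"
        by (rule computes_at_expr) (simp add: Si)
      show "computes_at p3 (enc_pair (enc_pair ea ec) eb ((x, ?acc), ?y)) (ec (st x ?acc ?y)) (T3 K)"
        using 3(2)[OF z] by simp
    qed
    then have "computes_at body (S x i) (S x (Suc i)) (1 + (1 + (1 + T3 K) + 6) + 6)"
      unfolding body_def SSi by (intro computes_at_pair computes_at_expr) (auto simp: Si)
    then show "computes_at body (S x i) (S x (Suc i)) (T3 K + 15) \<and> left (S x i) \<noteq> Atom"
      using computes_at_mono by (auto simp: Si)
  qed
  have S0: "S x 0 = Cell (enc_list eb (l x)) (Cell (ea x) (ec (a0 x)))" for x by (simp add: S_def)
  have P: "polyb (\<lambda>K. (T1 K + (T0 K + T2 K + 6) + 6) + ((T1 K * (T3 K + 15 + 1) + 1) + 1))"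
    by (intro polyb_intros 0 1 2 3)
  show ?thesis
  proof (rule compKI[OF P polyb_add[OF 2(1) 3(1)], of _ prog])
    fix K x assume x: "x \<in> D K"
    let ?N = "length (l x)"
    have "computes_at (pair_com p1 (pair_com p0 p2)) (ea x) (S x 0) (T1 K + (T0 K + T2 K + 6) + 6)"
      unfolding S0 by (intro computes_at_pair 0 1 2 x)
    moreover have "computes_at (While (ELeft (EVar 0)) body) (S x 0) (S x ?N) (?N * (T3 K + 15 + 1) + 1)"
      by (rule computes_at_while) (use step[OF x] in \<open>auto simp: S_def\<close>)
    moreover have "computes_at (Assign 0 (ERight (ERight (EVar 0)))) (S x ?N) (ec (foldl (st x) (a0 x) (l x))) 1"
      by (rule computes_at_expr) (simp add: S_def)
    ultimately have "computes_at prog (ea x) (ec (foldl (st x) (a0 x) (l x)))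
       ((T1 K + (T0 K + T2 K + 6) + 6) + ((?N * (T3 K + 15 + 1) + 1) + 1))"
      unfolding prog_def by (intro computes_at_seq)
    moreover have "?N \<le> T1 K" using length_le_data_size[of "l x" eb] 1(3)[OF x] by linarith
    then have "?N * (T3 K + 15 + 1) \<le> T1 K * (T3 K + 15 + 1)" by (rule mult_right_mono) simp
    ultimately show "computes_at prog (ea x) (ec (foldl (st x) (a0 x) (l x)))
       ((T1 K + (T0 K + T2 K + 6) + 6) + ((T1 K * (T3 K + 15 + 1) + 1) + 1))"
      by (elim computes_at_mono) simp
    show "data_size (ec (foldl (st x) (a0 x) (l x))) \<le> T2 K + T3 K"
    proof (cases "l x = []")
      case True then show ?thesis using 2(3)[OF x] by simp
    next
      case False
      then obtain i where "?N = Suc i" using not0_implies_Suc by fastforce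
      then show ?thesis using ssize[OF x, of i] by simp
    qed
  qed
qed

lemma compK_id: "polyb T \<Longrightarrow> (\<And>K x. x \<in> D K \<Longrightarrow> data_size (ea x) \<le> T K) \<Longrightarrow> compK D ea ea (\<lambda>x. x)"
proof (rule compKI[OF polyb_const[of 1], where p = "Assign 0 (EVar 0)"])
  show "computes_at (Assign 0 (EVar 0)) (ea x) (ea x) 1" for x by (rule computes_at_expr) simp
qed

lemma compK_restrict: "compK D ea ea (\<lambda>x. x) \<Longrightarrow> PT ea eb f \<Longrightarrow> compK D ea eb f"
  using compK_PT[of D ea ea "\<lambda>x. x" eb f] by simp

lemma data_size_enc_pair: "data_size (enc_pair ea eb z) = 1 + data_size (ea (fst z)) + data_size (eb (snd z))"
  by (cases z) simp

text \<open>The last premise keeps the accumulator from growing exponentially through sharing.\<close>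

lemma PT_foldl:
  assumes l: "PT ea (enc_list eb) l" and a: "PT ea ec a0"
    and st: "PT (enc_pair (enc_pair ea ec) eb) ec (\<lambda>z. st (fst (fst z)) (snd (fst z)) (snd z))"
    and T: "polyb T" "\<And>x ys zs. l x = ys @ zs \<Longrightarrow> data_size (ec (foldl (st x) (a0 x) ys)) \<le> T (data_size (ea x))"
  shows "PT ea ec (\<lambda>x. foldl (st x) (a0 x) (l x))"
proof -
  let ?D = "\<lambda>K. {x. data_size (ea x) \<le> K}"
  obtain p1 T1 where 1: "polyb T1"
    "\<And>K x. data_size (ea x) \<le> K \<Longrightarrow> data_size (enc_list eb (l x)) \<le> T1 K"
    by (rule compKE[OF l[unfolded PT_def]]) auto
  \<comment> \<open>\<open>T\<close> is not assumed monotone, while \<open>(K + 2) ^ c\<close> is;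
    the bound at the input size is thus also a bound at every larger \<open>K\<close>.\<close>
  obtain c where c: "\<And>K. T K \<le> (K + 2) ^ c" using T(1) unfolding polyb_def by blast
  define E where "E K = {z. data_size (ea (fst (fst z))) \<le> K \<and> data_size (ec (snd (fst z))) \<le> (K + 2) ^ c \<and>
      data_size (eb (snd z)) \<le> T1 K}" for K
  have "compK E (enc_pair (enc_pair ea ec) eb) (enc_pair (enc_pair ea ec) eb) (\<lambda>x. x)"
  proof (rule compK_id)
    show "polyb (\<lambda>K. 2 + K + (K + 2) ^ c + T1 K)" by (intro polyb_intros 1)
  qed (auto simp: E_def data_size_enc_pair)
  then have stE: "compK E (enc_pair (enc_pair ea ec) eb) ec (\<lambda>z. st (fst (fst z)) (snd (fst z)) (snd z))"
    using st by (rule compK_restrict)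
  show ?thesis unfolding PT_def
  proof (rule compK_foldl[OF _ l[unfolded PT_def] a[unfolded PT_def] stE])
    show "compK ?D ea ea (\<lambda>x. x)" by (rule compK_id[OF polyb_id]) simp
    fix K x ys y zs assume x: "x \<in> ?D K" and lx: "l x = ys @ y # zs"
    have "data_size (ec (foldl (st x) (a0 x) ys)) \<le> (data_size (ea x) + 2) ^ c"
      using T(2)[OF lx] c le_trans by blast
    also have "\<dots> \<le> (K + 2) ^ c" using x by (intro power_mono) auto
    finally show "((x, foldl (st x) (a0 x) ys), y) \<in> E K"
      using x 1(2)[of x K] data_size_elem[of y "l x" eb] lx by (auto simp: E_def)
  qed
qed

subsection \<open>Lists and numbers\<close>

lemma PT_recode: "PT ea eb f \<Longrightarrow> (\<And>x. eb (f x) = eb' (f' x)) \<Longrightarrow> PT ea eb' f'"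
  unfolding PT_def compK_def by simp

text \<open>The premise \<open>dep\<close> says that the test reads variable 0 only, so its value is
  a function of the input and can be handed to \<open>if_com\<close>.\<close>

lemma PT_cases:
  assumes "\<And>x s. s 0 = ea x \<Longrightarrow> eval e0 s \<noteq> Atom \<Longrightarrow> eval e1 s = eb (f x)"
    and "\<And>x s. s 0 = ea x \<Longrightarrow> eval e0 s = Atom \<Longrightarrow> eval e2 s = eb (f x)"
    and dep: "\<And>s s'. s 0 = s' 0 \<Longrightarrow> eval e0 s = eval e0 s'"
    and size: "\<And>x. data_size (eb (f x)) \<le> data_size (ea x) + c"
  shows "PT ea eb f"
  unfolding PT_def
proof (rule compKI)
  show "polyb (\<lambda>K. 1 + 1 + 10)" "polyb (\<lambda>K. K + c)" by (intro polyb_intros)+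
  fix K x assume "x \<in> {x. data_size (ea x) \<le> K}"
  then show "data_size (eb (f x)) \<le> K + c" using size[of x] by simp
  let ?v = "eval e0 (\<lambda>_. ea x)"
  have v: "eval e0 s = ?v" if "s 0 = ea x" for s :: store using dep[of s "\<lambda>_. ea x"] that by simp
  show "computes_at (if_com (Assign 0 e0) (Assign 0 e1) (Assign 0 e2)) (ea x) (eb (f x)) (1 + 1 + 10)"
  proof (rule computes_at_if[where v = ?v])
    show "computes_at (Assign 0 e0) (ea x) ?v 1" by (rule computes_at_expr) (rule v)
    show "computes_at (Assign 0 e1) (ea x) (eb (f x)) 1" if ne: "?v \<noteq> Atom"
    proof (rule computes_at_expr)
      fix s :: store assume s: "s 0 = ea x"
      have "eval e0 s \<noteq> Atom" using ne v[of s, OF s] by metis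
      then show "eval e1 s = eb (f x)" by (rule assms(1)[where x = x and s = s, OF s])
    qed
    show "computes_at (Assign 0 e2) (ea x) (eb (f x)) 1" if eq: "?v = Atom"
    proof (rule computes_at_expr)
      fix s :: store assume s: "s 0 = ea x"
      have "eval e0 s = Atom" using eq v[of s, OF s] by metis
      then show "eval e2 s = eb (f x)" by (rule assms(2)[where x = x and s = s, OF s])
    qed
  qed
qed

lemma PT_test:
  assumes "\<And>x s. s 0 = ea x \<Longrightarrow> eval e s \<noteq> Atom \<longleftrightarrow> b x"
    and "\<And>s s'. s 0 = s' 0 \<Longrightarrow> eval e s = eval e s'"
  shows "PT ea enc_bool b"
proof (rule PT_cases[of _ e "ECell EAtom EAtom" _ _ EAtom 2])
  fix x and s :: store assume s: "s 0 = ea x"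
  show "eval (ECell EAtom EAtom) s = enc_bool (b x)" if "eval e s \<noteq> Atom"
    using that assms(1)[where x = x and s = s, OF s] by (simp add: enc_bool_def)
  show "eval EAtom s = enc_bool (b x)" if "eval e s = Atom"
    using that assms(1)[where x = x and s = s, OF s] by (simp add: enc_bool_def)
next
  show "data_size (enc_bool (b x)) \<le> data_size (ea x) + 2" for x
    using data_size_pos[of "ea x"] by (simp add: enc_bool_def)
qed (rule assms(2))

lemma PT_Not:
  assumes "PT ea enc_bool b"
  shows "PT ea enc_bool (\<lambda>x. \<not> b x)"
  by (rule PT_recode[OF PT_if[OF assms PT_const[of _ enc_bool False] PT_const[of _ enc_bool True]]]) simp

lemma PT_conj:
  assumes "PT ea enc_bool b" "PT ea enc_bool c"
  shows "PT ea enc_bool (\<lambda>x. b x \<and> c x)"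
  by (rule PT_recode[OF PT_if[OF assms PT_const[of _ enc_bool False]]]) simp

lemma PT_disj:
  assumes "PT ea enc_bool b" "PT ea enc_bool c"
  shows "PT ea enc_bool (\<lambda>x. b x \<or> c x)"
  by (rule PT_recode[OF PT_if[OF assms(1) PT_const[of _ enc_bool True] assms(2)]]) simp

lemma PT_Nil: "PT ea (enc_list eb) l \<Longrightarrow> PT ea enc_bool (\<lambda>x. l x = [])"
proof -
  assume l: "PT ea (enc_list eb) l"
  have "PT (enc_list eb) enc_bool (\<lambda>l. l \<noteq> [])"
    by (rule PT_test[of _ "EVar 0"]) (auto simp: enc_list_Nil_iff)
  from PT_Not[OF PT_comp[OF l this]] show ?thesis by simp
qed

lemma PT_hd: "PT ea (enc_list eb) l \<Longrightarrow> PT ea eb (\<lambda>x. case l x of [] \<Rightarrow> d | y # _ \<Rightarrow> y)"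
proof (erule PT_comp)
  show "PT (enc_list eb) eb (\<lambda>l. case l of [] \<Rightarrow> d | y # _ \<Rightarrow> y)"
  proof (rule PT_cases[of _ "EVar 0" "ELeft (EVar 0)" _ _ "const_expr (eb d)" "data_size (eb d)"])
    fix l :: "'b list" and s :: store assume s: "s 0 = enc_list eb l"
    show "eval (ELeft (EVar 0)) s = eb (case l of [] \<Rightarrow> d | y # _ \<Rightarrow> y)" if "eval (EVar 0) s \<noteq> Atom"
      using that s by (cases l) auto
    show "eval (const_expr (eb d)) s = eb (case l of [] \<Rightarrow> d | y # _ \<Rightarrow> y)" if "eval (EVar 0) s = Atom"
      using that s by (cases l) (auto simp: eval_const_expr)
  next
    show "data_size (eb (case l of [] \<Rightarrow> d | y # _ \<Rightarrow> y)) \<le> data_size (enc_list eb l) + data_size (eb d)" for l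
      by (cases l) auto
  qed simp
qed

lemma PT_Cons:
  assumes "PT ea eb h" "PT ea (enc_list eb) l"
  shows "PT ea (enc_list eb) (\<lambda>x. h x # l x)"
  by (rule PT_recode[OF PT_pair[OF assms]]) simp

lemma data_size_right: "data_size (right d) \<le> data_size d"
  by (cases d) auto

lemma PT_tl: "PT ea (enc_list eb) l \<Longrightarrow> PT ea (enc_list eb) (\<lambda>x. tl (l x))"
proof (erule PT_comp)
  have *: "enc_list eb (tl l) = right (enc_list eb l)" for l by (cases l) auto
  show "PT (enc_list eb) (enc_list eb) tl"
    by (rule PT_expr[of _ "ERight (EVar 0)" _ _ 0]) (simp_all add: * data_size_right)
qed

lemma data_size_append_le: "data_size (enc_list e ys) \<le> data_size (enc_list e (ys @ zs))"
  by (simp add: data_size_enc_list)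

lemma data_size_rev: "data_size (enc_list e (rev ys)) = data_size (enc_list e ys)"
  by (simp add: data_size_enc_list rev_map[symmetric] sum_list_rev)

lemma foldl_Cons: "foldl (\<lambda>acc y. y # acc) zs ys = rev ys @ zs"
  by (induction ys arbitrary: zs) auto

lemma PT_rev: "PT ea (enc_list eb) l \<Longrightarrow> PT ea (enc_list eb) (\<lambda>x. rev (l x))"
proof (erule PT_comp)
  have "PT (enc_list eb) (enc_list eb) (\<lambda>x. foldl (\<lambda>acc y. y # acc) [] x)"
  proof (rule PT_foldl[OF PT_id PT_const _ polyb_id])
    show "PT (enc_pair (enc_pair (enc_list eb) (enc_list eb)) eb) (enc_list eb) (\<lambda>z. snd z # snd (fst z))"
      by ((rule PT_Cons PT_snd PT_fst PT_id)+)
    show "data_size (enc_list eb (foldl (\<lambda>acc y. y # acc) [] ys)) \<le> data_size (enc_list eb x)" if "x = ys @ zs" for x ys zs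
      unfolding that foldl_Cons using data_size_append_le by (simp add: data_size_rev)
  qed
  then show "PT (enc_list eb) (enc_list eb) rev" unfolding foldl_Cons by simp
qed

lemma PT_append:
  assumes "PT ea (enc_list eb) f" "PT ea (enc_list eb) g"
  shows "PT ea (enc_list eb) (\<lambda>x. f x @ g x)"
proof -
  let ?e = "enc_pair (enc_list eb) (enc_list eb)"
  have "PT ?e (enc_list eb) (\<lambda>z. foldl (\<lambda>acc y. y # acc) (snd z) (rev (fst z)))"
  proof (rule PT_foldl[OF _ _ _ polyb_id])
    show "PT ?e (enc_list eb) (\<lambda>z. rev (fst z))" by ((rule PT_rev PT_fst PT_id)+)
    show "PT ?e (enc_list eb) snd" by ((rule PT_snd PT_id)+)
    show "PT (enc_pair (enc_pair ?e (enc_list eb)) eb) (enc_list eb) (\<lambda>z. snd z # snd (fst z))"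
      by ((rule PT_Cons PT_snd PT_fst PT_id)+)
    fix z :: "'b list \<times> 'b list" and ys zs assume "rev (fst z) = ys @ zs"
    then have "fst z = rev zs @ rev ys" by (metis rev_append rev_rev_ident)
    then show "data_size (enc_list eb (foldl (\<lambda>acc y. y # acc) (snd z) ys)) \<le> data_size (?e z)"
      unfolding foldl_Cons by (cases z) (simp add: data_size_enc_list rev_map[symmetric] sum_list_rev)
  qed
  then have "PT ?e (enc_list eb) (\<lambda>z. fst z @ snd z)" by (simp add: foldl_Cons)
  from PT_comp[OF PT_pair[OF assms] this] show ?thesis by simp
qed

lemma PT_concat: "PT ea (enc_list (enc_list eb)) l \<Longrightarrow> PT ea (enc_list eb) (\<lambda>x. concat (l x))"
proof (erule PT_comp)
  have f: "foldl (@) [] ys = concat ys" for ys :: "'b list list"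
    by (induction ys rule: rev_induct) auto
  have "PT (enc_list (enc_list eb)) (enc_list eb) (\<lambda>x. foldl (@) [] x)"
  proof (rule PT_foldl[OF PT_id PT_const _ polyb_id])
    show "PT (enc_pair (enc_pair (enc_list (enc_list eb)) (enc_list eb)) (enc_list eb)) (enc_list eb) (\<lambda>z. snd (fst z) @ snd z)"
      by ((rule PT_append PT_snd PT_fst PT_id)+)
    have "data_size (enc_list eb (concat ys)) \<le> data_size (enc_list (enc_list eb) ys)" for ys
      by (induction ys) (auto simp: data_size_enc_list)
    then show "data_size (enc_list eb (foldl (@) [] ys)) \<le> data_size (enc_list (enc_list eb) x)" if "x = ys @ zs" for x ys zs
      unfolding that f using data_size_append_le le_trans by blast
  qed
  then show "PT (enc_list (enc_list eb)) (enc_list eb) concat" unfolding f by simp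
qed

lemma compK_map:
  assumes idD: "compK D ea ea (\<lambda>x. x)" and l: "compK D ea (enc_list eb) l"
    and f: "compK E (enc_pair ea eb) ec (\<lambda>z. f (fst z) (snd z))"
    and E: "\<And>K x y. x \<in> D K \<Longrightarrow> y \<in> set (l x) \<Longrightarrow> (x, y) \<in> E K"
  shows "compK D ea (enc_list ec) (\<lambda>x. map (f x) (l x))"
proof -
  obtain T0 where 0: "polyb T0" "\<And>K x. x \<in> D K \<Longrightarrow> data_size (ea x) \<le> T0 K"
    by (rule compKE[OF idD]) auto
  obtain T1 where 1: "polyb T1" "\<And>K x. x \<in> D K \<Longrightarrow> data_size (enc_list eb (l x)) \<le> T1 K"
    by (rule compKE[OF l]) auto
  obtain T2 where 2: "polyb T2" "\<And>K z. z \<in> E K \<Longrightarrow> data_size (ec (f (fst z) (snd z))) \<le> T2 K"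
    by (rule compKE[OF f]) auto
  define E' where "E' K = {((x, acc), y) |x acc y. x \<in> D K \<and> y \<in> set (l x) \<and>
     data_size (enc_list ec acc) \<le> 1 + T1 K * (1 + T2 K)}" for K
  let ?e = "enc_pair (enc_pair ea (enc_list ec)) eb"
  have id': "compK E' ?e ?e (\<lambda>x. x)"
  proof (rule compK_id)
    show "polyb (\<lambda>K. 2 + T0 K + (1 + T1 K * (1 + T2 K)) + T1 K)" by (intro polyb_intros 0 1 2)
    fix K z assume "z \<in> E' K"
    then obtain x acc y where z: "z = ((x, acc), y)" "x \<in> D K" "y \<in> set (l x)"
      "data_size (enc_list ec acc) \<le> 1 + T1 K * (1 + T2 K)" unfolding E'_def by blast
    show "data_size (?e z) \<le> 2 + T0 K + (1 + T1 K * (1 + T2 K)) + T1 K"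
      using z 0(2)[OF z(2)] 1(2)[OF z(2)] data_size_elem[OF z(3), of eb] by simp
  qed
  have pr: "compK E' ?e (enc_pair ea eb) (\<lambda>z. (fst (fst z), snd z))"
    by (rule compK_restrict[OF id']) ((rule PT_pair PT_fst PT_snd PT_id)+)
  have "compK E' ?e ec (\<lambda>z. f (fst (fst (fst z), snd z)) (snd (fst (fst z), snd z)))"
  proof (rule compK_comp[OF pr f])
    show "(fst (fst z), snd z) \<in> E K" if "z \<in> E' K" for K z using that E by (auto simp: E'_def)
  qed
  then have "compK E' ?e ec (\<lambda>z. f (fst (fst z)) (snd z))" by simp
  moreover have "compK E' ?e (enc_list ec) (\<lambda>z. snd (fst z))"
    by (rule compK_restrict[OF id']) ((rule PT_fst PT_snd PT_id)+)
  ultimately have "compK E' ?e (enc_pair ec (enc_list ec)) (\<lambda>z. (f (fst (fst z)) (snd z), snd (fst z)))"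
    by (rule compK_pair) simp
  from compK_PT[OF this PT_Cons[OF PT_fst[OF PT_id] PT_snd[OF PT_id]]]
  have st: "compK E' ?e (enc_list ec) (\<lambda>z. f (fst (fst z)) (snd z) # snd (fst z))" by simp
  \<comment> \<open>A fold that conses its results reverses the list; a final \<open>rev\<close>
    restores the order.\<close>
  have fm: "foldl (\<lambda>acc y. f x y # acc) [] ys = rev (map (f x) ys)" for x ys
    by (induction ys rule: rev_induct) auto
  have Nil: "compK D ea (enc_list ec) (\<lambda>_. [])" by (rule compK_restrict[OF idD PT_const])
  have "compK D ea (enc_list ec) (\<lambda>x. foldl (\<lambda>acc y. f x y # acc) [] (l x))"
  proof (rule compK_foldl[OF idD l Nil st])
    fix K x ys y zs assume x: "x \<in> D K" and lx: "l x = ys @ y # zs"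
    have "data_size (ec (f x w)) \<le> T2 K" if "w \<in> set ys" for w
      using 2(2)[OF E[OF x, of w]] that lx by simp
    then have "data_size (enc_list ec (rev (map (f x) ys))) \<le> 1 + length ys * (1 + T2 K)"
      using data_size_enc_list_le[of "rev (map (f x) ys)" ec "T2 K"] by auto
    also have "\<dots> \<le> 1 + T1 K * (1 + T2 K)"
      using 1(2)[OF x] length_le_data_size[of "l x" eb] lx by (intro add_mono mult_right_mono) auto
    finally show "((x, foldl (\<lambda>acc y. f x y # acc) [] ys), y) \<in> E' K"
      using x lx unfolding fm E'_def by auto
  qed
  then have "compK D ea (enc_list ec) (\<lambda>x. rev (map (f x) (l x)))" unfolding fm .
  from compK_PT[OF this PT_rev[OF PT_id]] show ?thesis by simp
qed

lemma PT_map: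
  assumes l: "PT ea (enc_list eb) l" and f: "PT (enc_pair ea eb) ec (\<lambda>z. f (fst z) (snd z))"
  shows "PT ea (enc_list ec) (\<lambda>x. map (f x) (l x))"
proof -
  obtain T1 where 1: "polyb T1" "\<And>K x. data_size (ea x) \<le> K \<Longrightarrow> data_size (enc_list eb (l x)) \<le> T1 K"
    by (rule compKE[OF l[unfolded PT_def]]) auto
  define E where "E K = {z. data_size (ea (fst z)) \<le> K \<and> snd z \<in> set (l (fst z))}" for K
  have "compK E (enc_pair ea eb) (enc_pair ea eb) (\<lambda>x. x)"
  proof (rule compK_id)
    show "polyb (\<lambda>K. 1 + K + T1 K)" by (intro polyb_intros 1)
    show "data_size (enc_pair ea eb z) \<le> 1 + K + T1 K" if "z \<in> E K" for K z
      using that 1(2)[of "fst z" K] data_size_elem[of "snd z" "l (fst z)" eb]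
      by (auto simp: E_def data_size_enc_pair)
  qed
  note fE = compK_restrict[OF this f]
  show ?thesis unfolding PT_def
    by (rule compK_map[OF _ l[unfolded PT_def] fE]) (auto simp: E_def intro: compK_id[OF polyb_id])
qed

text \<open>A unary number has the same code as a list of units, so arithmetic and counting loops
  are obtained from the list operations.\<close>

lemma enc_nat_replicate: "enc_nat n = enc_list (\<lambda>_. Atom) (replicate n ())"
  by (induction n) auto

lemma PT_replicate: "PT ea enc_nat f \<Longrightarrow> PT ea (enc_list (\<lambda>_. Atom)) (\<lambda>x. replicate (f x) ())"
  by (erule PT_recode) (simp add: enc_nat_replicate)

lemma PT_length: "PT ea (enc_list eb) l \<Longrightarrow> PT ea enc_nat (\<lambda>x. length (l x))"
proof (rule PT_recode[OF PT_map[of ea eb l "\<lambda>_. Atom" "\<lambda>_ _. ()"]])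
  show "PT (enc_pair ea eb) (\<lambda>_. Atom) (\<lambda>z. ())" by (rule PT_const)
  show "enc_list (\<lambda>_. Atom) (map (\<lambda>_. ()) (l x)) = enc_nat (length (l x))" for x
    by (simp add: enc_nat_replicate map_replicate_const)
qed

lemma PT_drop:
  assumes "PT ea enc_nat n" "PT ea (enc_list eb) l"
  shows "PT ea (enc_list eb) (\<lambda>x. drop (n x) (l x))"
proof -
  let ?e = "enc_pair enc_nat (enc_list eb)"
  have f: "foldl (\<lambda>acc y. tl acc) l us = drop (length us) l" for l :: "'b list" and us :: "unit list"
    by (induction us rule: rev_induct) (auto simp: drop_Suc tl_drop)
  have "PT ?e (enc_list eb) (\<lambda>z. foldl (\<lambda>acc y. tl acc) (snd z) (replicate (fst z) ()))"
  proof (rule PT_foldl[OF _ _ _ polyb_id])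
    show "PT ?e (enc_list (\<lambda>_. Atom)) (\<lambda>z. replicate (fst z) ())" by ((rule PT_replicate PT_fst PT_id)+)
    show "PT ?e (enc_list eb) snd" by ((rule PT_snd PT_id)+)
    show "PT (enc_pair (enc_pair ?e (enc_list eb)) (\<lambda>_. Atom)) (enc_list eb) (\<lambda>z. tl (snd (fst z)))"
      by ((rule PT_tl PT_snd PT_fst PT_id)+)
    fix z :: "nat \<times> 'b list" and ys zs :: "unit list"
    have "data_size (enc_list eb (drop m l)) \<le> data_size (enc_list eb l)" for m and l :: "'b list"
      by (metis append_take_drop_id data_size_append_le data_size_rev rev_append)
    then show "data_size (enc_list eb (foldl (\<lambda>acc y. tl acc) (snd z) ys)) \<le> data_size (?e z)"
      unfolding f by (cases z) (simp add: le_SucI trans_le_add2)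
  qed
  then have "PT ?e (enc_list eb) (\<lambda>z. drop (fst z) (snd z))" by (simp add: f)
  from PT_comp[OF PT_pair[OF assms] this] show ?thesis by simp
qed

lemma PT_minus:
  assumes "PT ea enc_nat f" "PT ea enc_nat g"
  shows "PT ea enc_nat (\<lambda>x. f x - g x)"
  by (rule PT_recode[OF PT_drop[OF assms(2) PT_replicate[OF assms(1)]]]) (simp add: enc_nat_replicate)

lemma PT_le:
  assumes "PT ea enc_nat f" "PT ea enc_nat g"
  shows "PT ea enc_bool (\<lambda>x. f x \<le> g x)"
  by (rule PT_recode[OF PT_Nil[OF PT_replicate[OF PT_minus[OF assms]]]]) simp

lemma PT_eq:
  assumes "PT ea enc_nat f" "PT ea enc_nat g"
  shows "PT ea enc_bool (\<lambda>x. f x = g x)"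
  by (rule PT_recode[OF PT_conj[OF PT_le[OF assms] PT_le[OF assms(2,1)]]]) (simp add: eq_iff)

lemma PT_mult:
  assumes "PT ea enc_nat f" "PT ea enc_nat g"
  shows "PT ea enc_nat (\<lambda>x. f x * g x)"
proof -
  have "PT ea (enc_list (\<lambda>_. Atom)) (\<lambda>x. concat (map (\<lambda>_. replicate (g x) ()) (replicate (f x) ())))"
    by ((rule PT_concat PT_map PT_replicate assms(1) PT_comp[OF PT_fst[OF PT_id] assms(2)])+)
  moreover have "concat (map (\<lambda>_. replicate b ()) (replicate a ())) = replicate (a * b) ()" for a b
    by (induction a) (auto simp: replicate_add)
  ultimately have "PT ea (enc_list (\<lambda>_. Atom)) (\<lambda>x. replicate (f x * g x) ())" by simp
  then show ?thesis by (rule PT_recode) (simp add: enc_nat_replicate)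
qed

lemma enc_nat_size: "data_size (enc_nat n) = 2 * n + 1"
  by (induction n) auto

lemma PT_Suc: "PT ea enc_nat f \<Longrightarrow> PT ea enc_nat (\<lambda>x. Suc (f x))"
proof (erule PT_comp)
  show "PT enc_nat enc_nat Suc" by (rule PT_expr[of _ "ECell EAtom (EVar 0)" _ _ 2]) auto
qed

lemma PT_upt: "PT ea enc_nat n \<Longrightarrow> PT ea (enc_list enc_nat) (\<lambda>x. [0..<n x])"
proof (erule PT_comp)
  let ?st = "\<lambda>(acc :: nat \<times> nat list) (y :: unit). (Suc (fst acc), fst acc # snd acc)"
  let ?e = "enc_pair enc_nat (enc_list enc_nat)"
  have f: "foldl ?st (0, []) us = (length us, rev [0..<length us])" for us
    by (induction us rule: rev_induct) auto
  have "PT enc_nat ?e (\<lambda>n. foldl ?st (0, []) (replicate n ()))"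
  proof (rule PT_foldl)
    show "polyb (\<lambda>K. 1 + (2 * K + 1) + (1 + K * (1 + (2 * K + 1))))" by (intro polyb_intros)
    show "PT enc_nat (enc_list (\<lambda>_. Atom)) (\<lambda>n. replicate n ())" by ((rule PT_replicate PT_id)+)
    show "PT enc_nat ?e (\<lambda>_. (0, []))" by (rule PT_const)
    show "PT (enc_pair (enc_pair enc_nat ?e) (\<lambda>_. Atom)) ?e (\<lambda>z. (Suc (fst (snd (fst z))), fst (snd (fst z)) # snd (snd (fst z))))"
      by ((rule PT_pair PT_Suc PT_Cons PT_fst PT_snd PT_id)+)
    fix n :: nat and ys zs :: "unit list" assume r: "replicate n () = ys @ zs"
    let ?m = "length ys"
    have m: "?m \<le> data_size (enc_nat n)" using arg_cong[OF r, of length] by (simp add: enc_nat_size)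
    have "data_size (enc_list enc_nat (rev [0..<?m])) \<le> 1 + ?m * (1 + (2 * ?m + 1))"
      using data_size_enc_list_le[of "rev [0..<?m]" enc_nat "2 * ?m + 1"] by (auto simp: enc_nat_size)
    also have "\<dots> \<le> 1 + data_size (enc_nat n) * (1 + (2 * data_size (enc_nat n) + 1))"
      by (intro add_mono mult_mono m order_refl) auto
    finally show "data_size (?e (foldl ?st (0, []) ys)) \<le>
       1 + (2 * data_size (enc_nat n) + 1) + (1 + data_size (enc_nat n) * (1 + (2 * data_size (enc_nat n) + 1)))"
      unfolding f using m by (simp add: enc_nat_size)
  qed
  from PT_rev[OF PT_snd[OF this]] show "PT enc_nat (enc_list enc_nat) (\<lambda>n. [0..<n])" by (simp add: f)
qed

lemma PT_any: "PT ea (enc_list enc_bool) l \<Longrightarrow> PT ea enc_bool (\<lambda>x. True \<in> set (l x))"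
proof (erule PT_comp)
  have f: "foldl (\<or>) False ys \<longleftrightarrow> True \<in> set ys" for ys
    by (induction ys rule: rev_induct) auto
  have "PT (enc_list enc_bool) enc_bool (\<lambda>x. foldl (\<or>) False x)"
  proof (rule PT_foldl[OF PT_id PT_const _ polyb_const[of 3]])
    show "PT (enc_pair (enc_pair (enc_list enc_bool) enc_bool) enc_bool) enc_bool (\<lambda>z. snd (fst z) \<or> snd z)"
      by ((rule PT_disj PT_snd PT_fst PT_id)+)
  qed (simp add: enc_bool_def)
  then show "PT (enc_list enc_bool) enc_bool (\<lambda>x. True \<in> set x)" by (simp add: f)
qed

lemma PT_list_ex:
  assumes "PT ea (enc_list eb) l" "PT (enc_pair ea eb) enc_bool (\<lambda>z. P (fst z) (snd z))"
  shows "PT ea enc_bool (\<lambda>x. list_ex (P x) (l x))"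
  by (rule PT_recode[OF PT_any[OF PT_map[OF assms]]]) (auto simp: list_ex_iff image_iff)

lemma PT_list_all:
  assumes "PT ea (enc_list eb) l" "PT (enc_pair ea eb) enc_bool (\<lambda>z. P (fst z) (snd z))"
  shows "PT ea enc_bool (\<lambda>x. list_all (P x) (l x))"
  by (rule PT_recode[OF PT_Not[OF PT_list_ex[OF assms(1) PT_Not[OF assms(2)]]]]) (auto simp: list_ex_iff list_all_iff)

lemma PT_member:
  assumes "PT ea enc_nat f" "PT ea (enc_list enc_nat) l"
  shows "PT ea enc_bool (\<lambda>x. f x \<in> set (l x))"
proof -
  have "PT (enc_pair ea enc_nat) enc_nat (\<lambda>z. f (fst z))" by (rule PT_comp[OF PT_fst[OF PT_id] assms(1)])
  from PT_eq[OF PT_snd[OF PT_id] this]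
  have "PT ea enc_bool (\<lambda>x. list_ex (\<lambda>y. y = f x) (l x))" by (rule PT_list_ex[OF assms(2)])
  then show ?thesis by (rule PT_recode) (simp add: list_ex_iff)
qed

text \<open>Filtering is done in two passes: a map attaches the truth value of the predicate, and
  this fold keeps the marked entries.\<close>

lemma PT_select: "PT ea (enc_list (enc_pair enc_bool eb)) l \<Longrightarrow> PT ea (enc_list eb) (\<lambda>x. map snd (filter fst (l x)))"
proof (erule PT_comp)
  let ?st = "\<lambda>acc y. if fst y then snd y # acc else acc"
  let ?e = "enc_list (enc_pair enc_bool eb)"
  have f: "foldl ?st [] ys = rev (map snd (filter fst ys))" for ys
    by (induction ys rule: rev_induct) auto
  have "PT ?e (enc_list eb) (\<lambda>x. foldl ?st [] x)"
  proof (rule PT_foldl[OF PT_id PT_const _ polyb_id])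
    show "PT (enc_pair (enc_pair ?e (enc_list eb)) (enc_pair enc_bool eb)) (enc_list eb)
       (\<lambda>z. if fst (snd z) then snd (snd z) # snd (fst z) else snd (fst z))"
      by ((rule PT_if PT_Cons PT_snd PT_fst PT_id)+)
    have "data_size (enc_list eb (map snd (filter fst ys))) \<le> data_size (?e ys)" for ys
      by (induction ys) (auto simp: data_size_enc_pair)
    then show "data_size (enc_list eb (foldl ?st [] ys)) \<le> data_size (?e x)" if "x = ys @ zs" for x ys zs
      unfolding that f data_size_rev using data_size_append_le le_trans by blast
  qed
  from PT_rev[OF this] show "PT ?e (enc_list eb) (\<lambda>x. map snd (filter fst x))" by (simp add: f)
qed

lemma map_snd_filter_fst: "map snd (filter fst (map (\<lambda>y. (P y, g y)) l)) = map g (filter P l)"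
  by (induction l) auto

lemma PT_filter:
  assumes "PT ea (enc_list eb) l" "PT (enc_pair ea eb) enc_bool (\<lambda>z. P (fst z) (snd z))"
  shows "PT ea (enc_list eb) (\<lambda>x. filter (P x) (l x))"
proof -
  have "PT ea (enc_list (enc_pair enc_bool eb)) (\<lambda>x. map (\<lambda>y. (P x y, y)) (l x))"
    by ((rule PT_map assms(1) PT_pair assms(2) PT_snd PT_id)+)
  from PT_select[OF this] show ?thesis by (simp add: map_snd_filter_fst)
qed

subsection \<open>Tree search\<close>

text \<open>Stated by reachability, the search is a total function without any termination argument;
  termination matters only for the running time. The component of type \<open>'c\<close> is context
  that never changes.\<close>

definition search :: "('c \<times> 's \<Rightarrow> 's list) \<Rightarrow> ('c \<times> 's \<Rightarrow> bool) \<Rightarrow> 'c \<times> 's \<Rightarrow> bool" where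
  "search succ acc z \<longleftrightarrow>
     (\<exists>s'. (snd z, s') \<in> {(a, b). b \<in> set (succ (fst z, a))}\<^sup>* \<and> acc (fst z, s'))"

lemma rtrancl_unfold_converse: "r\<^sup>* = Id \<union> r O r\<^sup>*"
proof
  show "r\<^sup>* \<subseteq> Id \<union> r O r\<^sup>*" by (auto elim: converse_rtranclE)
qed (auto intro: converse_rtrancl_into_rtrancl)

lemma search_unfold: "search succ acc (c, s) \<longleftrightarrow> acc (c, s) \<or> (\<exists>s' \<in> set (succ (c, s)). search succ acc (c, s'))"
proof -
  let ?R = "{(a, b). b \<in> set (succ (c, a))}"
  have r: "(s, s') \<in> ?R\<^sup>* \<longleftrightarrow> s = s' \<or> (\<exists>u \<in> set (succ (c, s)). (u, s') \<in> ?R\<^sup>*)" for s'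
    by (subst rtrancl_unfold_converse) auto
  show ?thesis
  proof
    assume "search succ acc (c, s)"
    then obtain s' where s': "(s, s') \<in> ?R\<^sup>*" "acc (c, s')" by (auto simp: search_def)
    then show "acc (c, s) \<or> (\<exists>s' \<in> set (succ (c, s)). search succ acc (c, s'))"
      using r[of s'] by (auto simp: search_def)
  next
    assume "acc (c, s) \<or> (\<exists>s' \<in> set (succ (c, s)). search succ acc (c, s'))"
    then show "search succ acc (c, s)"
    proof
      assume "acc (c, s)"
      then show ?thesis by (auto simp: search_def)
    next
      assume "\<exists>s' \<in> set (succ (c, s)). search succ acc (c, s')"
      then obtain u s' where us: "u \<in> set (succ (c, s))" "(u, s') \<in> ?R\<^sup>*" "acc (c, s')"
        by (auto simp: search_def)
      then show ?thesis using r[of s'] by (auto simp: search_def)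
    qed
  qed
qed

text \<open>\<open>t K c s\<close> bounds the size of the tree below \<open>s\<close>. The sum of
  \<open>t\<close> over the open nodes falls with every iteration, so it bounds both the number of
  iterations and the length of the work list.\<close>

lemma compK_search:
  assumes idD: "compK D (enc_pair ec es) (enc_pair ec es) (\<lambda>x. x)"
    and succ: "compK D (enc_pair ec es) (enc_list es) succ"
    and acc: "compK D (enc_pair ec es) enc_bool acc"
    and closed: "\<And>K c s s'. (c, s) \<in> D K \<Longrightarrow> s' \<in> set (succ (c, s)) \<Longrightarrow> (c, s') \<in> D K"
    and tree: "\<And>K c s. (c, s) \<in> D K \<Longrightarrow> 1 + (\<Sum>s'\<leftarrow>succ (c, s). t K c s') \<le> (t K c s :: nat)"
    and B: "polyb B" "\<And>K c s. (c, s) \<in> D K \<Longrightarrow> t K c s \<le> B K"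
  shows "compK D (enc_pair ec es) enc_bool (search succ acc)"
proof -
  obtain T0 where 0: "polyb T0" "\<And>K x. x \<in> D K \<Longrightarrow> data_size (enc_pair ec es x) \<le> T0 K"
    by (rule compKE[OF idD]) auto
  let ?e = "enc_pair (enc_list es) (enc_pair ec enc_bool)"
  \<comment> \<open>The loop state holds the open nodes, the context and the verdict. Accepting
    empties the list of open nodes and thereby ends the loop.\<close>
  define step where "step z = (if acc (fst (snd z), hd (fst z)) then ([], (fst (snd z), True))
    else (succ (fst (snd z), hd (fst z)) @ tl (fst z), snd z))" for z :: "'b list \<times> 'a \<times> bool"
  define pot where "pot K z = (\<Sum>s\<leftarrow>fst z. t K (fst (snd z)) s)" for K and z :: "'b list \<times> 'a \<times> bool"
  define I where "I K = {z :: 'b list \<times> 'a \<times> bool. (\<forall>s \<in> set (fst z). (fst (snd z), s) \<in> D K)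
     \<and> pot K z \<le> B K \<and> data_size (ec (fst (snd z))) \<le> T0 K}" for K
  have tpos: "1 \<le> t K c s" if "(c, s) \<in> D K" for K c s using tree[OF that] by linarith
  have lenpot: "length (fst z) \<le> pot K z" if "\<forall>s \<in> set (fst z). (fst (snd z), s) \<in> D K" for K z
  proof -
    have "length W \<le> (\<Sum>s\<leftarrow>W. t K c s)" if "\<forall>s \<in> set W. (c, s) \<in> D K" for W c
      using that by (induction W) (auto dest: tpos)
    then show ?thesis using that by (simp add: pot_def)
  qed
  have pstep: "pot K (step z) < pot K z" "step z \<in> I K" if z: "z \<in> I K" "fst z \<noteq> []" for K z
  proof -
    obtain s W c r where zz: "z = (s # W, (c, r))" using z(2) by (cases z) (auto simp: neq_Nil_conv)
    have sD: "(c, s) \<in> D K" using z zz by (auto simp: I_def)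
    show *: "pot K (step z) < pot K z"
      using tree[OF sD] tpos[OF sD] by (auto simp: step_def pot_def zz)
    then have "pot K (step z) \<le> B K" using z by (auto simp: I_def)
    then show "step z \<in> I K" using z closed[OF sD] by (auto simp: I_def step_def zz)
  qed
  define J where "J K = {z \<in> I K. fst z \<noteq> []}" for K
  have idJ: "compK J ?e ?e (\<lambda>x. x)"
  proof (rule compK_id)
    show "polyb (\<lambda>K. 1 + (1 + B K * (1 + T0 K)) + (1 + T0 K + 3))" by (intro polyb_intros 0 B)
    fix K z assume "z \<in> J K"
    then have z: "z \<in> I K" by (simp add: J_def)
    have "data_size (es s) \<le> T0 K" if "s \<in> set (fst z)" for s
    proof -
      have "(fst (snd z), s) \<in> D K" using z that by (simp add: I_def)
      from 0(2)[OF this] show ?thesis by simp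
    qed
    then have "data_size (enc_list es (fst z)) \<le> 1 + length (fst z) * (1 + T0 K)" by (rule data_size_enc_list_le)
    also have "\<dots> \<le> 1 + B K * (1 + T0 K)"
      using z lenpot[of z K] by (intro add_mono mult_right_mono) (auto simp: I_def)
    finally show "data_size (?e z) \<le> 1 + (1 + B K * (1 + T0 K)) + (1 + T0 K + 3)"
      using z by (cases z) (auto simp: I_def enc_bool_def)
  qed
  have hdJ: "compK J ?e (enc_pair ec es) (\<lambda>z. (fst (snd z), hd (fst z)))"
  proof (rule compKI[OF polyb_const[of 1] 0(1)])
    fix K z assume "z \<in> J K"
    then obtain s W c r where zz: "z = (s # W, (c, r))" and cs: "(c, s) \<in> D K"
      by (cases z) (auto simp: J_def I_def neq_Nil_conv)
    show "computes_at (Assign 0 (ECell (ELeft (ERight (EVar 0))) (ELeft (ELeft (EVar 0))))) (?e z)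
       (enc_pair ec es (fst (snd z), hd (fst z))) 1"
      by (rule computes_at_expr) (simp add: zz)
    show "data_size (enc_pair ec es (fst (snd z), hd (fst z))) \<le> T0 K" using 0(2)[OF cs] by (simp add: zz)
  qed
  have inD: "(fst (snd z), hd (fst z)) \<in> D K" if "z \<in> J K" for K z
    using that by (auto simp: J_def I_def)
  have a: "compK J ?e enc_bool (\<lambda>z. acc (fst (snd z), hd (fst z)))" by (rule compK_comp[OF hdJ acc inD])
  have su: "compK J ?e (enc_list es) (\<lambda>z. succ (fst (snd z), hd (fst z)))" by (rule compK_comp[OF hdJ succ inD])
  have tlJ: "compK J ?e (enc_list es) (\<lambda>z. tl (fst z))"
    by (rule compK_restrict[OF idJ]) ((rule PT_tl PT_fst PT_id)+)
  have "compK J ?e (enc_pair (enc_list es) (enc_list es)) (\<lambda>z. (succ (fst (snd z), hd (fst z)), tl (fst z)))"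
    by (rule compK_pair[OF su tlJ]) simp
  from compK_PT[OF this PT_append[OF PT_fst[OF PT_id] PT_snd[OF PT_id]]]
  have ap: "compK J ?e (enc_list es) (\<lambda>z. succ (fst (snd z), hd (fst z)) @ tl (fst z))" by simp
  have "compK J ?e ?e (\<lambda>z. (succ (fst (snd z), hd (fst z)) @ tl (fst z), snd z))"
    by (rule compK_pair[OF ap compK_restrict[OF idJ PT_snd[OF PT_id]]]) simp
  moreover have "compK J ?e ?e (\<lambda>z. ([], (fst (snd z), True)))"
    by (rule compK_restrict[OF idJ]) ((rule PT_pair PT_const PT_fst PT_snd PT_id)+)
  ultimately have stepJ: "compK J ?e ?e step" unfolding step_def by (intro compK_if a)
  obtain p T where p: "polyb T" "\<And>K x. x \<in> J K \<Longrightarrow> computes_at p (?e x) (?e (step x)) (T K)"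
    by (rule compKE[OF stepJ]) auto
  define init where "init z = ([snd z], (fst z, False))" for z :: "'a \<times> 'b"
  have "compK D (enc_pair ec es) ?e init" unfolding init_def
    by (rule compK_restrict[OF idD]) ((rule PT_pair PT_Cons PT_const PT_fst PT_snd PT_id)+)
  then obtain q U where q: "polyb U" "\<And>K x. x \<in> D K \<Longrightarrow> computes_at q (enc_pair ec es x) (?e (init x)) (U K)"
    by (rule compKE) auto
  have P: "polyb (\<lambda>K. (U K + (B K * (T K + 1) + 1)) + 1)" by (intro polyb_intros p q B)
  show ?thesis
  proof (rule compKI[OF P polyb_const[of 3]])
    fix K z assume z: "z \<in> D K"
    show "data_size (enc_bool (search succ acc z)) \<le> 3" by (simp add: enc_bool_def)
    let ?x = "\<lambda>i. (step ^^ i) (init z)"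
    have i0: "init z \<in> I K"
      using z B(2)[of "fst z" "snd z" K] 0(2)[OF z] by (auto simp: I_def init_def pot_def data_size_enc_pair)
    have run: "?x i \<in> I K \<and> pot K (?x i) + i \<le> pot K (init z)" if "\<And>j. j < i \<Longrightarrow> fst (?x j) \<noteq> []" for i
      using that
    proof (induction i)
      case 0 then show ?case using i0 by simp
    next
      case (Suc i)
      then have "?x i \<in> I K \<and> pot K (?x i) + i \<le> pot K (init z)" "fst (?x i) \<noteq> []" by auto
      then show ?case using pstep[of "?x i" K] by auto
    qed
    have ex: "\<exists>i. fst (?x i) = []"
    proof (rule ccontr)
      assume "\<not> ?thesis"
      then show False using run[of "Suc (pot K (init z))"] by auto
    qed
    define N where "N = (LEAST i. fst (?x i) = [])"
    have N: "fst (?x N) = []" unfolding N_def using ex by (rule LeastI_ex)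
    have lt: "fst (?x j) \<noteq> []" if "j < N" for j using that not_less_Least unfolding N_def by blast
    have NB: "N \<le> B K" using run[of N] lt i0 by (auto simp: I_def)
    \<comment> \<open>Invariant: the answer is the verdict or success of the search from some open
      node.\<close>
    have val: "(snd (snd (?x i)) \<or> (\<exists>s \<in> set (fst (?x i)). search succ acc (fst z, s)) \<longleftrightarrow> search succ acc z)
      \<and> fst (snd (?x i)) = fst z" if "i \<le> N" for i
      using that
    proof (induction i)
      case 0
      then show ?case by (simp add: init_def)
    next
      case (Suc i)
      then have "i < N" by simp
      then have ne: "fst (?x i) \<noteq> []" by (rule lt)
      have IH: "(snd (snd (?x i)) \<or> (\<exists>s \<in> set (fst (?x i)). search succ acc (fst z, s)) \<longleftrightarrow> search succ acc z)
        \<and> fst (snd (?x i)) = fst z" using Suc by simp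
      obtain s W c r where zz: "?x i = (s # W, (c, r))" using ne by (cases "?x i") (auto simp: neq_Nil_conv)
      have c: "c = fst z" using IH zz by simp
      have v: "r \<or> search succ acc (c, s) \<or> (\<exists>s \<in> set W. search succ acc (c, s)) \<longleftrightarrow> search succ acc z"
        using IH zz c by auto
      have x: "?x (Suc i) = (if acc (c, s) then ([], (c, True)) else (succ (c, s) @ W, (c, r)))"
        using zz by (simp add: step_def)
      show ?case unfolding x c[symmetric] using v search_unfold[of succ acc c s] c by (cases "acc (c, s)") auto
    qed
    have res: "snd (snd (?x N)) = search succ acc z" using val[of N] N by simp
    have w: "computes_at (While (ELeft (EVar 0)) p) (?e (?x 0)) (?e (?x N)) (N * (T K + 1) + 1)"
    proof (rule computes_at_while[of N p "\<lambda>i. ?e (?x i)" "T K"])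
      fix i assume i: "i < N"
      have "?x i \<in> J K" using run[of i] lt i by (simp add: J_def)
      from p(2)[OF this] show "computes_at p (?e (?x i)) (?e (?x (Suc i))) (T K) \<and> left (?e (?x i)) \<noteq> Atom"
        using lt[OF i] by (cases "?x i") (auto simp: enc_list_Nil_iff)
    next
      show "left (?e (?x N)) = Atom" using N by (cases "?x N") simp
    qed
    have "computes_at (Assign 0 (ERight (ERight (EVar 0)))) (?e (?x N)) (enc_bool (search succ acc z)) 1"
      by (rule computes_at_expr) (cases "?x N"; use res in auto)
    from computes_at_seq[OF computes_at_seq[OF q(2)[OF z] w[simplified funpow.simps(1) id_apply]] this]
    have "computes_at (Seq (Seq q (While (ELeft (EVar 0)) p)) (Assign 0 (ERight (ERight (EVar 0)))))
      (enc_pair ec es z) (enc_bool (search succ acc z)) ((U K + (N * (T K + 1) + 1)) + 1)" .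
    then show "computes_at (Seq (Seq q (While (ELeft (EVar 0)) p)) (Assign 0 (ERight (ERight (EVar 0)))))
      (enc_pair ec es z) (enc_bool (search succ acc z)) ((U K + (B K * (T K + 1) + 1)) + 1)"
      by (rule computes_at_mono) (intro add_mono mult_right_mono NB order_refl le0)
  qed
qed

section \<open>The search algorithm\<close>

text \<open>A total variant of list access built from operations that already have programs; the
  default node covers indices outside the list.\<close>

definition node_at :: "node list \<Rightarrow> nat \<Rightarrow> node" where
  "node_at ns i = (case drop i ns of [] \<Rightarrow> Lit True 0 | n # _ \<Rightarrow> n)"

text \<open>\<open>X\<close> holds positions of literals, not variables. The first argument is fuel;
  it is fixed in advance by the depth of the circuit, and the base case is never reached on vertices
  below the output.\<close>

fun sat_below :: "nat \<Rightarrow> node list \<Rightarrow> nat list \<Rightarrow> nat \<Rightarrow> bool" where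
  "sat_below 0 ns X i = False"
| "sat_below (Suc d) ns X i =
     (if is_gate (node_at ns i)
      then if is_and (node_at ns i) then list_all (sat_below d ns X) (preds (node_at ns i))
           else list_ex (sat_below d ns X) (preds (node_at ns i))
      else i \<in> set X)"

fun touches :: "nat \<Rightarrow> node list \<Rightarrow> nat \<Rightarrow> nat \<Rightarrow> bool" where
  "touches 0 ns x i = False"
| "touches (Suc d) ns x i =
     (if is_gate (node_at ns i) then list_ex (touches d ns x) (preds (node_at ns i)) else i = x)"

text \<open>An item is a child of an OR-gate, hence a literal or an AND-gate. A literal is treated
  like an AND-gate whose only input is itself, so both kinds are handled uniformly.\<close>

definition lits :: "node list \<Rightarrow> nat \<Rightarrow> nat list" where
  "lits ns i = (if is_gate (node_at ns i) then filter (\<lambda>j. \<not> is_gate (node_at ns j)) (preds (node_at ns i)) else [i])"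

definition ors :: "node list \<Rightarrow> nat \<Rightarrow> nat list" where
  "ors ns i = filter (\<lambda>j. is_gate (node_at ns j)) (preds (node_at ns i))"

text \<open>
  A state \<open>(m, X, k, F)\<close> asks for at most \<open>k\<close> literals that, added to the literals \<open>X\<close>, satisfy
  all OR-gates in \<open>F\<close>.  The flag \<open>m\<close> is set once the gates of \<open>F\<close> are only to be split into
  independent groups of at most two.
\<close>

type_synonym state = "bool \<times> nat list \<times> nat \<times> nat list"

text \<open>Filtering \<open>[0..<length ns]\<close> yields duplicate-free lists of bounded length.
  Only literals of \<open>L\<close> outside \<open>X\<close> are charged, gates already satisfied
  are dropped, and an exceeded budget gives no state.\<close>

definition mk_state :: "nat \<Rightarrow> node list \<Rightarrow> nat list \<Rightarrow> nat \<Rightarrow> nat list \<Rightarrow> nat list \<Rightarrow> state list" where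
  "mk_state d ns X k L F =
     (if length (filter (\<lambda>x. x \<in> set L \<and> x \<notin> set X) [0..<length ns]) \<le> k
      then [(False,
             filter (\<lambda>x. x \<in> set X \<or> x \<in> set L) [0..<length ns],
             k - length (filter (\<lambda>x. x \<in> set L \<and> x \<notin> set X) [0..<length ns]),
             filter (\<lambda>i. i \<in> set F \<and>
               \<not> sat_below d ns (filter (\<lambda>x. x \<in> set X \<or> x \<in> set L) [0..<length ns]) i) [0..<length ns])]
      else [])"

definition deg :: "nat \<Rightarrow> node list \<Rightarrow> nat list \<Rightarrow> nat \<Rightarrow> nat" where
  "deg d ns F x = length (filter (touches d ns x) F)"

definition avail :: "node list \<Rightarrow> nat list \<Rightarrow> nat list" where
  "avail ns X = filter (\<lambda>x. \<not> is_gate (node_at ns x) \<and> x \<notin> set X) [0..<length ns]"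

text \<open>The literals below a \<open>1 / k\<close> fraction of \<open>F\<close>, written without
  division.\<close>

definition cand :: "nat \<Rightarrow> node list \<Rightarrow> nat list \<Rightarrow> nat \<Rightarrow> nat list \<Rightarrow> nat list" where
  "cand d ns X k F = filter (\<lambda>x. length F \<le> k * deg d ns F x) (avail ns X)"

definition special :: "nat \<Rightarrow> node list \<Rightarrow> nat list \<Rightarrow> nat list \<Rightarrow> nat list" where
  "special d ns X F = filter (\<lambda>x. 3 \<le> deg d ns F x) (avail ns X)"

text \<open>For a child \<open>c\<close> of \<open>i\<close> in \<open>F\<close> and another gate
  \<open>j\<close> in \<open>F\<close>, the degree bound means that the shared literal lies below
  \<open>i\<close> and \<open>j\<close> and below no further gate of \<open>F\<close>.\<close>

definition linked :: "nat \<Rightarrow> node list \<Rightarrow> nat list \<Rightarrow> nat list \<Rightarrow> nat \<Rightarrow> nat \<Rightarrow> bool" where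
  "linked d ns X F c j \<longleftrightarrow>
     list_ex (\<lambda>x. deg d ns F x \<le> 2 \<and> touches d ns x c \<and> touches d ns x j) (avail ns X)"

definition special_item :: "nat \<Rightarrow> node list \<Rightarrow> nat list \<Rightarrow> nat list \<Rightarrow> nat \<Rightarrow> nat \<Rightarrow> bool" where
  "special_item d ns X F i c \<longleftrightarrow> 2 \<le> length (filter (\<lambda>j. j \<noteq> i \<and> linked d ns X F c j) F)"

definition var_branches :: "nat \<Rightarrow> node list \<Rightarrow> nat list \<Rightarrow> nat \<Rightarrow> nat list \<Rightarrow> nat list \<Rightarrow> state list" where
  "var_branches d ns X k F xs = concat (map (\<lambda>x. mk_state d ns X k [x] F) xs)"

definition item_branches :: "nat \<Rightarrow> node list \<Rightarrow> nat list \<Rightarrow> nat \<Rightarrow> nat list \<Rightarrow> state list" where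
  "item_branches d ns X k F =
     concat (map (\<lambda>i. concat (map (\<lambda>c.
       if special_item d ns X F i c
       then mk_state d ns X k (lits ns c) (filter (\<lambda>j. j \<noteq> i) F @ ors ns c) else [])
       (preds (node_at ns i)))) F)"

definition branches :: "nat \<Rightarrow> node list \<Rightarrow> bool \<Rightarrow> nat list \<Rightarrow> nat \<Rightarrow> nat list \<Rightarrow> state list" where
  "branches d ns m X k F =
     (if m then []
      else if length (cand d ns X k F) \<le> 3 * k then var_branches d ns X k F (cand d ns X k F)
      else var_branches d ns X k F (special d ns X F) @ item_branches d ns X k F @ [(True, X, k, F)])"

definition group_states :: "nat \<Rightarrow> node list \<Rightarrow> nat list \<Rightarrow> nat \<Rightarrow> nat \<Rightarrow> nat \<Rightarrow> state list" where
  "group_states d ns X b i j =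
     concat (map (\<lambda>c. concat (map (\<lambda>c'.
       mk_state d ns X b (lits ns c @ lits ns c') (ors ns c @ ors ns c'))
       (preds (node_at ns j)))) (preds (node_at ns i)))"

text \<open>The choice \<open>i = j\<close> covers groups of one gate. Each entry consists of the
  sub-instances for the group under the budget share \<open>b\<close>, and of the state that remains
  once one of them is satisfiable.\<close>

definition groups :: "nat \<Rightarrow> node list \<Rightarrow> bool \<Rightarrow> nat list \<Rightarrow> nat \<Rightarrow> nat list \<Rightarrow> (state list \<times> state) list" where
  "groups d ns m X k F =
     (if m
      then concat (map (\<lambda>i. concat (map (\<lambda>j. map (\<lambda>b.
        (group_states d ns X b i j, (True, X, k - b, filter (\<lambda>l. l \<noteq> i \<and> l \<noteq> j) F)))
        [0..<Suc k]) F)) F)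
      else [])"

definition branches_at :: "nat \<Rightarrow> node list \<times> state \<Rightarrow> state list" where
  "branches_at d z = branches d (fst z) (fst (snd z)) (fst (snd (snd z))) (fst (snd (snd (snd z)))) (snd (snd (snd (snd z))))"

definition groups_at :: "nat \<Rightarrow> node list \<times> state \<Rightarrow> (state list \<times> state) list" where
  "groups_at d z = groups d (fst z) (fst (snd z)) (fst (snd (snd z))) (fst (snd (snd (snd z)))) (snd (snd (snd (snd z))))"

definition succs :: "nat \<Rightarrow> (node list \<times> state \<Rightarrow> bool) \<Rightarrow> node list \<times> state \<Rightarrow> state list" where
  "succs d orc z = branches_at d z @
     map snd (filter (\<lambda>y. list_ex (\<lambda>q. orc (fst z, q)) (fst y)) (groups_at d z))"

definition no_gates :: "node list \<times> state \<Rightarrow> bool" where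
  "no_gates z \<longleftrightarrow> snd (snd (snd (snd z))) = []"

text \<open>Each level uses the previous one as oracle for its groups, whose new gates lie deeper in
  the circuit. With \<open>e = 0\<close> no gate can be left, so an emptiness test suffices.\<close>

fun solve :: "nat \<Rightarrow> nat \<Rightarrow> node list \<times> state \<Rightarrow> bool" where
  "solve d 0 = no_gates"
| "solve d (Suc e) = search (succs d (solve d e)) no_gates"

subsection \<open>Programs for the search steps\<close>

abbreviation enc_nodes :: "node list \<Rightarrow> data" where
  "enc_nodes \<equiv> enc_list enc_node"

abbreviation enc_nats :: "nat list \<Rightarrow> data" where
  "enc_nats \<equiv> enc_list enc_nat"

abbreviation enc_state :: "state \<Rightarrow> data" where
  "enc_state \<equiv> enc_pair enc_bool (enc_pair enc_nats (enc_pair enc_nat enc_nats))"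

lemma PT_node_at:
  assumes "PT ea enc_nodes a" "PT ea enc_nat b"
  shows "PT ea enc_node (\<lambda>x. node_at (a x) (b x))"
  unfolding node_at_def by (rule PT_hd[OF PT_drop[OF assms(2,1)]])

lemma PT_is_gate: "PT ea enc_node n \<Longrightarrow> PT ea enc_bool (\<lambda>x. is_gate (n x))"
proof (erule PT_comp)
  show "PT enc_node enc_bool is_gate"
  proof (rule PT_test[of _ "ERight (ELeft (EVar 0))"])
    show "eval (ERight (ELeft (EVar 0))) s \<noteq> Atom \<longleftrightarrow> is_gate x" if "s 0 = enc_node x" for x s
      using that by (cases x) (auto simp: numeral_eq_Suc)
  qed auto
qed

lemma PT_is_and: "PT ea enc_node n \<Longrightarrow> PT ea enc_bool (\<lambda>x. is_and (n x))"
proof (erule PT_comp)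
  have "PT enc_node enc_bool (\<lambda>n. is_gate n \<and> \<not> is_and n)"
  proof (rule PT_test[of _ "ERight (ERight (ELeft (EVar 0)))"])
    show "eval (ERight (ERight (ELeft (EVar 0)))) s \<noteq> Atom \<longleftrightarrow> is_gate x \<and> \<not> is_and x" if "s 0 = enc_node x" for x s
      using that by (cases x) (auto simp: numeral_eq_Suc)
  qed auto
  from PT_conj[OF PT_is_gate[OF PT_id] PT_Not[OF this]]
  show "PT enc_node enc_bool is_and"
  proof (rule PT_recode)
    show "enc_bool (is_gate x \<and> \<not> (is_gate x \<and> \<not> is_and x)) = enc_bool (is_and x)" for x by (cases x) auto
  qed
qed

lemma PT_preds: "PT ea enc_node n \<Longrightarrow> PT ea enc_nats (\<lambda>x. preds (n x))"
proof (erule PT_comp)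
  show "PT enc_node enc_nats preds"
  proof (rule PT_cases[of _ "ERight (ELeft (EVar 0))" "ERight (EVar 0)" _ _ EAtom 0])
    show "eval (ERight (EVar 0)) s = enc_nats (preds x)" if "s 0 = enc_node x" "eval (ERight (ELeft (EVar 0))) s \<noteq> Atom" for x s
      using that by (cases x) (auto split: if_splits)
    show "eval EAtom s = enc_nats (preds x)" if "s 0 = enc_node x" "eval (ERight (ELeft (EVar 0))) s = Atom" for x s
      using that by (cases x) (auto simp: numeral_eq_Suc)
    show "data_size (enc_nats (preds x)) \<le> data_size (enc_node x) + 0" for x by (cases x) auto
  qed auto
qed

lemmas PT_rules = PT_id PT_const PT_pair PT_fst PT_snd PT_if PT_Not PT_conj PT_disj PT_Nil PT_Cons
  PT_append PT_concat PT_map PT_length PT_minus PT_le PT_eq PT_mult PT_Suc PT_upt PT_list_ex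
  PT_list_all PT_member PT_filter PT_node_at PT_is_gate PT_is_and PT_preds

lemma PT_app2:
  assumes "PT (enc_pair e1 e2) eb (\<lambda>z. h (fst z) (snd z))" "PT ea e1 a" "PT ea e2 b"
  shows "PT ea eb (\<lambda>x. h (a x) (b x))"
  using PT_comp[OF PT_pair[OF assms(2,3)] assms(1)] by simp

lemma PT_app3:
  assumes "PT (enc_pair e1 (enc_pair e2 e3)) eb (\<lambda>z. h (fst z) (fst (snd z)) (snd (snd z)))"
    "PT ea e1 a" "PT ea e2 b" "PT ea e3 c"
  shows "PT ea eb (\<lambda>x. h (a x) (b x) (c x))"
  using PT_comp[OF PT_pair[OF assms(2) PT_pair[OF assms(3,4)]] assms(1)] by simp

lemma PT_app4:
  assumes "PT (enc_pair e1 (enc_pair e2 (enc_pair e3 e4))) eb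
      (\<lambda>z. h (fst z) (fst (snd z)) (fst (snd (snd z))) (snd (snd (snd z))))"
    "PT ea e1 a" "PT ea e2 b" "PT ea e3 c" "PT ea e4 d"
  shows "PT ea eb (\<lambda>x. h (a x) (b x) (c x) (d x))"
  using PT_comp[OF PT_pair[OF assms(2) PT_pair[OF assms(3) PT_pair[OF assms(4,5)]]] assms(1)] by simp

lemma PT_app5:
  assumes "PT (enc_pair e1 (enc_pair e2 (enc_pair e3 (enc_pair e4 e5)))) eb
      (\<lambda>z. h (fst z) (fst (snd z)) (fst (snd (snd z))) (fst (snd (snd (snd z)))) (snd (snd (snd (snd z)))))"
    "PT ea e1 a" "PT ea e2 b" "PT ea e3 c" "PT ea e4 d" "PT ea e5 f"
  shows "PT ea eb (\<lambda>x. h (a x) (b x) (c x) (d x) (f x))"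
  using PT_comp[OF PT_pair[OF assms(2) PT_pair[OF assms(3) PT_pair[OF assms(4) PT_pair[OF assms(5,6)]]]] assms(1)] by simp

text \<open>The fuel is a constant, so unrolling the recursion gives one polynomial-time program for
  each \<open>d\<close>.\<close>

lemma PT_sat_below_base:
  "PT (enc_pair enc_nodes (enc_pair enc_nats enc_nat)) enc_bool (\<lambda>z. sat_below d (fst z) (fst (snd z)) (snd (snd z)))"
proof (induction d)
  case 0
  show ?case unfolding sat_below.simps by (rule PT_const)
next
  case (Suc d)
  show ?case unfolding sat_below.simps by (rule PT_rules PT_app3[OF Suc])+
qed

lemmas PT_sat_below = PT_app3[OF PT_sat_below_base]

lemma PT_touches_base:
  "PT (enc_pair enc_nodes (enc_pair enc_nat enc_nat)) enc_bool (\<lambda>z. touches d (fst z) (fst (snd z)) (snd (snd z)))"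
proof (induction d)
  case 0
  show ?case unfolding touches.simps by (rule PT_const)
next
  case (Suc d)
  show ?case unfolding touches.simps by (rule PT_rules PT_app3[OF Suc])+
qed

lemmas PT_touches = PT_app3[OF PT_touches_base]

lemma PT_lits_base: "PT (enc_pair enc_nodes enc_nat) enc_nats (\<lambda>z. lits (fst z) (snd z))"
  unfolding lits_def by (rule PT_rules)+

lemmas PT_lits = PT_app2[OF PT_lits_base]

lemma PT_ors_base: "PT (enc_pair enc_nodes enc_nat) enc_nats (\<lambda>z. ors (fst z) (snd z))"
  unfolding ors_def by (rule PT_rules)+

lemmas PT_ors = PT_app2[OF PT_ors_base]

lemma PT_mk_state_base:
  "PT (enc_pair enc_nodes (enc_pair enc_nats (enc_pair enc_nat (enc_pair enc_nats enc_nats)))) (enc_list enc_state)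
     (\<lambda>z. mk_state d (fst z) (fst (snd z)) (fst (snd (snd z))) (fst (snd (snd (snd z)))) (snd (snd (snd (snd z)))))"
  unfolding mk_state_def by (rule PT_rules PT_sat_below)+

lemmas PT_mk_state = PT_app5[OF PT_mk_state_base]

lemma PT_deg_base:
  "PT (enc_pair enc_nodes (enc_pair enc_nats enc_nat)) enc_nat (\<lambda>z. deg d (fst z) (fst (snd z)) (snd (snd z)))"
  unfolding deg_def by (rule PT_rules PT_touches)+

lemmas PT_deg = PT_app3[OF PT_deg_base]

lemma PT_avail_base: "PT (enc_pair enc_nodes enc_nats) enc_nats (\<lambda>z. avail (fst z) (snd z))"
  unfolding avail_def by (rule PT_rules)+

lemmas PT_avail = PT_app2[OF PT_avail_base]

lemma PT_cand_base:
  "PT (enc_pair enc_nodes (enc_pair enc_nats (enc_pair enc_nat enc_nats))) enc_nats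
     (\<lambda>z. cand d (fst z) (fst (snd z)) (fst (snd (snd z))) (snd (snd (snd z))))"
  unfolding cand_def by (rule PT_rules PT_deg PT_avail)+

lemmas PT_cand = PT_app4[OF PT_cand_base]

lemma PT_special_base:
  "PT (enc_pair enc_nodes (enc_pair enc_nats enc_nats)) enc_nats
     (\<lambda>z. special d (fst z) (fst (snd z)) (snd (snd z)))"
  unfolding special_def by (rule PT_rules PT_deg PT_avail)+

lemmas PT_special = PT_app3[OF PT_special_base]

lemma PT_linked_base:
  "PT (enc_pair enc_nodes (enc_pair enc_nats (enc_pair enc_nats (enc_pair enc_nat enc_nat)))) enc_bool
     (\<lambda>z. linked d (fst z) (fst (snd z)) (fst (snd (snd z))) (fst (snd (snd (snd z)))) (snd (snd (snd (snd z)))))"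
  unfolding linked_def by (rule PT_rules PT_deg PT_avail PT_touches)+

lemmas PT_linked = PT_app5[OF PT_linked_base]

lemma PT_special_item_base:
  "PT (enc_pair enc_nodes (enc_pair enc_nats (enc_pair enc_nats (enc_pair enc_nat enc_nat)))) enc_bool
     (\<lambda>z. special_item d (fst z) (fst (snd z)) (fst (snd (snd z))) (fst (snd (snd (snd z)))) (snd (snd (snd (snd z)))))"
  unfolding special_item_def by (rule PT_rules PT_linked)+

lemmas PT_special_item = PT_app5[OF PT_special_item_base]

lemma PT_var_branches_base:
  "PT (enc_pair enc_nodes (enc_pair enc_nats (enc_pair enc_nat (enc_pair enc_nats enc_nats)))) (enc_list enc_state)
     (\<lambda>z. var_branches d (fst z) (fst (snd z)) (fst (snd (snd z))) (fst (snd (snd (snd z)))) (snd (snd (snd (snd z)))))"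
  unfolding var_branches_def by (rule PT_rules PT_mk_state)+

lemmas PT_var_branches = PT_app5[OF PT_var_branches_base]

lemma PT_item_branches_base:
  "PT (enc_pair enc_nodes (enc_pair enc_nats (enc_pair enc_nat enc_nats))) (enc_list enc_state)
     (\<lambda>z. item_branches d (fst z) (fst (snd z)) (fst (snd (snd z))) (snd (snd (snd z))))"
  unfolding item_branches_def by (rule PT_rules PT_mk_state PT_special_item PT_lits PT_ors)+

lemmas PT_item_branches = PT_app4[OF PT_item_branches_base]

lemma PT_group_states_base:
  "PT (enc_pair enc_nodes (enc_pair enc_nats (enc_pair enc_nat (enc_pair enc_nat enc_nat)))) (enc_list enc_state)
     (\<lambda>z. group_states d (fst z) (fst (snd z)) (fst (snd (snd z))) (fst (snd (snd (snd z)))) (snd (snd (snd (snd z)))))"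
  unfolding group_states_def by (rule PT_rules PT_mk_state PT_lits PT_ors)+

lemmas PT_group_states = PT_app5[OF PT_group_states_base]

lemma PT_branches_at: "PT (enc_pair enc_nodes enc_state) (enc_list enc_state) (branches_at d)"
  unfolding branches_at_def branches_def
  by (rule PT_rules PT_cand PT_special PT_var_branches PT_item_branches)+

lemma PT_groups_at:
  "PT (enc_pair enc_nodes enc_state) (enc_list (enc_pair (enc_list enc_state) enc_state)) (groups_at d)"
  unfolding groups_at_def groups_def by (rule PT_rules PT_group_states)+

lemma PT_no_gates: "PT (enc_pair enc_nodes enc_state) enc_bool no_gates"
  unfolding no_gates_def by (rule PT_rules)+

text \<open>The oracle is polynomial only in the ambient number, so every query has to lie in the
  domain on which its bound holds.\<close>

lemma compK_succs:
  assumes idD: "compK D (enc_pair enc_nodes enc_state) (enc_pair enc_nodes enc_state) (\<lambda>z. z)"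
    and orc: "compK Q (enc_pair enc_nodes enc_state) enc_bool orc"
    and Q: "\<And>K z y q. z \<in> D K \<Longrightarrow> y \<in> set (groups_at d z) \<Longrightarrow> q \<in> set (fst y) \<Longrightarrow> (fst z, q) \<in> Q K"
  shows "compK D (enc_pair enc_nodes enc_state) (enc_list enc_state) (succs d orc)"
proof -
  let ?e = "enc_pair enc_nodes enc_state" and ?g = "enc_pair (enc_list enc_state) enc_state"
  have gr: "compK D ?e (enc_list ?g) (groups_at d)" by (rule compK_restrict[OF idD PT_groups_at])
  obtain T0 where T0: "polyb T0" "\<And>K z. z \<in> D K \<Longrightarrow> data_size (?e z) \<le> T0 K"
    by (rule compKE[OF idD]) auto
  obtain T1 where T1: "polyb T1" "\<And>K z. z \<in> D K \<Longrightarrow> data_size (enc_list ?g (groups_at d z)) \<le> T1 K"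
    by (rule compKE[OF gr]) auto
  define E where "E K = {(z, y). z \<in> D K \<and> y \<in> set (groups_at d z)}" for K
  have idE: "compK E (enc_pair ?e ?g) (enc_pair ?e ?g) (\<lambda>z. z)"
  proof (rule compK_id)
    show "polyb (\<lambda>K. 1 + T0 K + T1 K)" by (intro polyb_intros T0 T1)
    fix K w assume "w \<in> E K"
    then obtain z y where w: "w = (z, y)" "z \<in> D K" "y \<in> set (groups_at d z)" by (auto simp: E_def)
    show "data_size (enc_pair ?e ?g w) \<le> 1 + T0 K + T1 K"
      using T0(2)[OF w(2)] T1(2)[OF w(2)] data_size_elem[OF w(3), of ?g] unfolding w(1) data_size_enc_pair[of ?e] by simp
  qed
  have qs: "compK E (enc_pair ?e ?g) (enc_list enc_state) (\<lambda>w. fst (snd w))"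
    by (rule compK_restrict[OF idE]) ((rule PT_rules)+)
  obtain T2 where T2: "polyb T2" "\<And>K w. w \<in> E K \<Longrightarrow> data_size (enc_list enc_state (fst (snd w))) \<le> T2 K"
    by (rule compKE[OF qs]) auto
  define E2 where "E2 K = {(w, q). w \<in> E K \<and> q \<in> set (fst (snd w))}" for K
  have idE2: "compK E2 (enc_pair (enc_pair ?e ?g) enc_state) (enc_pair (enc_pair ?e ?g) enc_state) (\<lambda>z. z)"
  proof (rule compK_id)
    show "polyb (\<lambda>K. 1 + (1 + T0 K + T1 K) + T2 K)" by (intro polyb_intros T0 T1 T2)
    fix K v assume "v \<in> E2 K"
    then obtain z y q where v: "v = ((z, y), q)" "(z, y) \<in> E K" "z \<in> D K" "y \<in> set (groups_at d z)" "q \<in> set (fst y)"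
      by (auto simp: E_def E2_def)
    show "data_size (enc_pair (enc_pair ?e ?g) enc_state v) \<le> 1 + (1 + T0 K + T1 K) + T2 K"
      using T0(2)[OF v(3)] T1(2)[OF v(3)] T2(2)[OF v(2)] data_size_elem[OF v(4), of ?g] data_size_elem[OF v(5), of enc_state]
      unfolding v(1) data_size_enc_pair[of ?e] data_size_enc_pair[of "enc_pair ?e ?g"] by simp
  qed
  have pr: "compK E2 (enc_pair (enc_pair ?e ?g) enc_state) ?e (\<lambda>v. (fst (fst (fst v)), snd v))"
    by (rule compK_restrict[OF idE2]) ((rule PT_rules)+)
  have o: "compK E2 (enc_pair (enc_pair ?e ?g) enc_state) enc_bool (\<lambda>v. orc (fst (fst (fst v)), snd v))"
  proof (rule compK_comp[OF pr orc])
    show "(fst (fst (fst v)), snd v) \<in> Q K" if "v \<in> E2 K" for K v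
      using that by (auto simp: E_def E2_def intro: Q)
  qed
  have "compK E (enc_pair ?e ?g) (enc_list enc_bool) (\<lambda>w. map (\<lambda>q. orc (fst (fst w), q)) (fst (snd w)))"
    by (rule compK_map[OF idE qs, where f = "\<lambda>w q. orc (fst (fst w), q)", OF o]) (auto simp: E2_def)
  from compK_PT[OF this PT_any[OF PT_id]]
  have ex: "compK E (enc_pair ?e ?g) enc_bool (\<lambda>w. list_ex (\<lambda>q. orc (fst (fst w), q)) (fst (snd w)))"
    by (rule compK_cong) (auto simp: list_ex_iff image_iff)
  have "compK E (enc_pair ?e ?g) (enc_pair enc_bool enc_state)
      (\<lambda>w. (list_ex (\<lambda>q. orc (fst (fst w), q)) (fst (snd w)), snd (snd w)))"
    by (rule compK_pair[OF ex compK_restrict[OF idE PT_snd[OF PT_snd[OF PT_id]]]]) simp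
  then have "compK D ?e (enc_list (enc_pair enc_bool enc_state))
      (\<lambda>z. map (\<lambda>y. (list_ex (\<lambda>q. orc (fst z, q)) (fst y), snd y)) (groups_at d z))"
    by (rule compK_map[OF idD gr, where f = "\<lambda>z y. (list_ex (\<lambda>q. orc (fst z, q)) (fst y), snd y)"]) (auto simp: E_def)
  from compK_PT[OF this PT_select[OF PT_id]]
  have "compK D ?e (enc_list enc_state)
      (\<lambda>z. map snd (filter (\<lambda>y. list_ex (\<lambda>q. orc (fst z, q)) (fst y)) (groups_at d z)))"
    by (simp add: map_snd_filter_fst)
  from compK_pair[OF compK_restrict[OF idD PT_branches_at[of d]] this, of "enc_pair (enc_list enc_state) (enc_list enc_state)"]
  have "compK D ?e (enc_pair (enc_list enc_state) (enc_list enc_state)) (\<lambda>z. (branches_at d z,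
      map snd (filter (\<lambda>y. list_ex (\<lambda>q. orc (fst z, q)) (fst y)) (groups_at d z))))" by simp
  from compK_PT[OF this PT_append[OF PT_fst[OF PT_id] PT_snd[OF PT_id]]]
  show ?thesis unfolding succs_def by simp
qed

section \<open>Structure of monotone circuits\<close>

locale mono_circuit =
  fixes t :: nat and C :: circuit
  assumes pi: "pi_circuit t C" and mono: "monotone_circuit C"
begin

abbreviation "ns \<equiv> nodes C"
abbreviation "out \<equiv> out_gate C"
abbreviation "W \<equiv> wires C"

definition Lits :: "nat set" where
  "Lits = {i. i < length ns \<and> \<not> is_gate (ns ! i)}"

definition gate :: "nat \<Rightarrow> bool" where
  "gate i \<longleftrightarrow> i < length ns \<and> is_gate (ns ! i)"

text \<open>A well-formed circuit may contain gates that do not feed the output. Alternation and the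
  depth bound hold only for those that do.\<close>

definition Tops :: "nat set" where
  "Tops = {i. gate i \<and> \<not> is_and (ns ! i) \<and> (i, out) \<in> W\<^sup>*}"

lemma wf: "wf_circuit C" using pi by (simp add: pi_circuit_def)

lemma wire_iff: "(j, i) \<in> W \<longleftrightarrow> i < length ns \<and> j \<in> set (preds (ns ! i))"
  by (auto simp: wires_def verts_def)

lemma wire_verts: "(j, i) \<in> W \<Longrightarrow> j < length ns \<and> i < length ns"
  using wf by (auto simp: wf_circuit_def verts_def)

lemma wire_gate: "(j, i) \<in> W \<Longrightarrow> gate i"
  by (cases "ns ! i") (auto simp: wire_iff gate_def)

lemma acyclicW: "acyclic W" using wf by (simp add: wf_circuit_def)

lemma out_vert: "out < length ns" and out_top: "(out, i) \<notin> W"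
  using wf by (auto simp: wf_circuit_def verts_def)

lemma out_and: "is_and (ns ! out)" using pi by (simp add: pi_circuit_def)

lemma out_gate: "gate out" using out_vert out_and by (cases "ns ! out") (auto simp: gate_def)

lemma finite_Lits: "finite Lits" by (simp add: Lits_def)

lemma Lits_node: "x \<in> Lits \<Longrightarrow> \<exists>v. ns ! x = Lit True v"
  using mono unfolding monotone_circuit_def Lits_def by (cases "ns ! x") (auto, metis nth_mem)

lemma Lits_not_gate: "x \<in> Lits \<Longrightarrow> \<not> gate x" by (simp add: Lits_def gate_def)

lemma Lits_or_gate: "i < length ns \<Longrightarrow> i \<in> Lits \<or> gate i" by (auto simp: Lits_def gate_def)

section \<open>Unique upward paths and the depth of gates\<close>

lemma node_at_eq: "i < length ns \<Longrightarrow> node_at ns i = ns ! i"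
  by (simp add: node_at_def Cons_nth_drop_Suc[symmetric])

lemma gate_unique_wire:
  assumes "gate j" "(j, i) \<in> W" "(j, i') \<in> W"
  shows "i = i'"
proof -
  have "card (W `` {j}) \<le> 1" using pi assms(1) by (auto simp: pi_circuit_def verts_def gate_def)
  moreover have "finite (W `` {j})"
    by (rule finite_subset[of _ "{..<length ns}"]) (auto dest: wire_verts)
  ultimately show ?thesis using assms by (simp add: card_le_Suc0_iff_eq)
qed

lemma alternate: "(j, i) \<in> W \<Longrightarrow> (i, out) \<in> W\<^sup>* \<Longrightarrow> gate j \<Longrightarrow> is_and (ns ! j) \<noteq> is_and (ns ! i)"
  using pi by (auto simp: pi_circuit_def gate_def)

lemma depth_le: "(j, out) \<in> W ^^ n \<Longrightarrow> n \<le> t" using pi by (auto simp: pi_circuit_def)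

definition dep :: "nat \<Rightarrow> nat" where
  "dep i = (LEAST n. (i, out) \<in> W ^^ n)"

lemma dep_path: "(i, out) \<in> W\<^sup>* \<Longrightarrow> (i, out) \<in> W ^^ dep i"
  unfolding dep_def by (metis LeastI_ex rtrancl_power)

lemma dep_le: "(i, out) \<in> W\<^sup>* \<Longrightarrow> dep i \<le> t"
  using dep_path depth_le by blast

text \<open>A gate has one outgoing wire, so all its paths to the output start with that wire. For
  literals, which may have many outgoing wires, this fails.\<close>

lemma dep_step:
  assumes "gate j" "(j, i) \<in> W" "(i, out) \<in> W\<^sup>*"
  shows "dep j = Suc (dep i)"
proof -
  have "j \<noteq> out" using assms(2) out_top by auto
  have iff: "(j, out) \<in> W ^^ n \<longleftrightarrow> (\<exists>m. n = Suc m \<and> (i, out) \<in> W ^^ m)" for n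
  proof
    assume p: "(j, out) \<in> W ^^ n"
    then obtain m where m: "n = Suc m" using \<open>j \<noteq> out\<close> by (cases n) auto
    obtain y where "(j, y) \<in> W" "(y, out) \<in> W ^^ m" using p m relpow_Suc_D2 by metis
    moreover from this have "y = i" using gate_unique_wire assms by blast
    ultimately show "\<exists>m. n = Suc m \<and> (i, out) \<in> W ^^ m" using m by blast
  next
    assume "\<exists>m. n = Suc m \<and> (i, out) \<in> W ^^ m"
    then show "(j, out) \<in> W ^^ n" using assms(2) relpow_Suc_I2 by metis
  qed
  have 1: "(i, out) \<in> W ^^ dep i" using assms(3) by (rule dep_path)
  show ?thesis
  proof (rule antisym)
    show "dep j \<le> Suc (dep i)" unfolding dep_def[of j] by (rule Least_le) (use iff 1 in blast)
    have "(j, out) \<in> W ^^ dep j"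
      using dep_path[OF converse_rtrancl_into_rtrancl[OF assms(2,3)]] .
    then obtain m where "dep j = Suc m" "(i, out) \<in> W ^^ m" using iff by blast
    then show "Suc (dep i) \<le> dep j" unfolding dep_def[of i] by (simp add: Least_le)
  qed
qed

text \<open>Assignments are sets of literal positions. In a monotone circuit they correspond to sets
  of variables, and vertices of the graph and assigned objects then live in the same type.\<close>

definition sem :: "nat set \<Rightarrow> nat \<Rightarrow> bool" where
  "sem S i \<longleftrightarrow> holds C {v. \<exists>x \<in> S. x \<in> Lits \<and> ns ! x = Lit True v} i"

lemma sem_lit: "x \<in> Lits \<Longrightarrow> sem S x \<longleftrightarrow> x \<in> S"
proof -
  assume x: "x \<in> Lits"
  then obtain v where v: "ns ! x = Lit True v" using Lits_node by blast
  let ?A = "{v. \<exists>x \<in> S. x \<in> Lits \<and> ns ! x = Lit True v}"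
  have xv: "x \<in> verts C" using x by (auto simp: Lits_def verts_def)
  have uniq: "y = x" if "y \<in> Lits" "ns ! y = Lit True v" for y
    using wf that v xv x unfolding wf_circuit_def Lits_def verts_def
    by (metis (no_types, lifting) lessThan_iff mem_Collect_eq)
  have "v \<in> ?A \<longleftrightarrow> x \<in> S" using uniq x v by blast
  moreover have "holds C ?A x \<longleftrightarrow> v \<in> ?A"
  proof
    show "v \<in> ?A" if "holds C ?A x" using that v by (cases rule: holds.cases) auto
    show "holds C ?A x" if "v \<in> ?A" using that v xv by (intro holds.Lit[where b = True and v = v]) auto
  qed
  ultimately show ?thesis by (simp add: sem_def)
qed

lemma sem_and: "gate i \<Longrightarrow> is_and (ns ! i) \<Longrightarrow> sem S i \<longleftrightarrow> (\<forall>j. (j, i) \<in> W \<longrightarrow> sem S j)"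
proof -
  assume g: "gate i" "is_and (ns ! i)"
  then obtain js where js: "ns ! i = And js" by (cases "ns ! i") auto
  have "i \<in> verts C" using g by (simp add: gate_def verts_def)
  then have "sem S i \<longleftrightarrow> (\<forall>j \<in> set js. sem S j)"
    unfolding sem_def using js by (auto intro: holds.And elim: holds.cases)
  then show ?thesis using g js by (auto simp: wire_iff gate_def)
qed

lemma sem_or: "gate i \<Longrightarrow> \<not> is_and (ns ! i) \<Longrightarrow> sem S i \<longleftrightarrow> (\<exists>j. (j, i) \<in> W \<and> sem S j)"
proof -
  assume g: "gate i" "\<not> is_and (ns ! i)"
  then obtain js where js: "ns ! i = Or js" by (cases "ns ! i") (auto simp: gate_def)
  have "i \<in> verts C" using g by (simp add: gate_def verts_def)
  have "sem S i \<longleftrightarrow> (\<exists>j \<in> set js. sem S j)"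
    unfolding sem_def
  proof
    assume "holds C {v. \<exists>x \<in> S. x \<in> Lits \<and> ns ! x = Lit True v} i"
    then show "\<exists>j \<in> set js. holds C {v. \<exists>x \<in> S. x \<in> Lits \<and> ns ! x = Lit True v} j"
      using js by (cases rule: holds.cases) auto
  qed (use \<open>i \<in> verts C\<close> js holds.Or in blast)
  then show ?thesis using g js by (auto simp: wire_iff gate_def)
qed

lemma wfW: "wf W"
proof (rule finite_acyclic_wf[OF _ acyclicW])
  show "finite W" by (rule finite_subset[of _ "{..<length ns} \<times> {..<length ns}"]) (auto dest: wire_verts)
qed

text \<open>The value at a vertex depends monotonically on the literals below it and on nothing
  else. This gives monotonicity and also localises a solution to the supports of single
  items.\<close>

lemma sem_restrict:
  assumes "i < length ns" "\<And>x. x \<in> Lits \<Longrightarrow> (x, i) \<in> W\<^sup>* \<Longrightarrow> x \<in> S \<Longrightarrow> x \<in> S'" "sem S i"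
  shows "sem S' i"
  using assms
proof (induction i rule: wf_induct_rule[OF wfW])
  case (1 i)
  have IH: "sem S j \<Longrightarrow> sem S' j" if "(j, i) \<in> W" for j
  proof (rule "1.IH"[OF that])
    show "j < length ns" using that wire_verts by blast
    show "x \<in> S'" if "x \<in> Lits" "(x, j) \<in> W\<^sup>*" "x \<in> S" for x
      using that \<open>(j, i) \<in> W\<close> "1.prems"(2) rtrancl_into_rtrancl by metis
  qed
  show ?case
  proof (cases "i \<in> Lits")
    case True
    then show ?thesis using "1.prems" sem_lit by auto
  next
    case False
    then have g: "gate i" using Lits_or_gate "1.prems"(1) by blast
    show ?thesis
    proof (cases "is_and (ns ! i)")
      case True then show ?thesis using "1.prems"(3) IH sem_and[OF g] by blast
    next
      case False then show ?thesis using "1.prems"(3) IH sem_or[OF g] by blast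
    qed
  qed
qed

lemma sem_mono: "i < length ns \<Longrightarrow> S \<subseteq> S' \<Longrightarrow> sem S i \<Longrightarrow> sem S' i"
  using sem_restrict by blast

text \<open>Fuel and distance to the output together exceed \<open>t\<close> throughout the
  recursion, so running out of fuel would mean a path longer than the depth bound.\<close>

lemma sat_below_sem:
  assumes "(i, out) \<in> W ^^ n" "t < d + n" "i < length ns"
  shows "sat_below d ns X i \<longleftrightarrow> sem (set X) i"
  using assms
proof (induction d arbitrary: i n)
  case 0
  then show ?case using depth_le by fastforce
next
  case (Suc d)
  have IH: "sat_below d ns X j \<longleftrightarrow> sem (set X) j" if "(j, i) \<in> W" for j
    by (rule Suc.IH[OF relpow_Suc_I2[OF that Suc.prems(1)]]) (use Suc.prems wire_verts[OF that] in auto)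
  show ?case
  proof (cases "i \<in> Lits")
    case True
    then show ?thesis using Suc.prems(3) sem_lit by (auto simp: node_at_eq Lits_def)
  next
    case False
    then have g: "gate i" using Lits_or_gate Suc.prems(3) by blast
    have pr: "j \<in> set (preds (ns ! i)) \<longleftrightarrow> (j, i) \<in> W" for j using Suc.prems(3) by (simp add: wire_iff)
    show ?thesis using g sem_and[OF g] sem_or[OF g] IH Suc.prems(3)
      by (auto simp: node_at_eq gate_def list_all_iff list_ex_iff pr)
  qed
qed

lemma below_gate_step:
  assumes "x \<in> Lits" "gate i" "(x, i) \<in> W\<^sup>*"
  shows "\<exists>j. (j, i) \<in> W \<and> (x, j) \<in> W\<^sup>*"
  using assms Lits_not_gate by (metis rtranclE)

lemma touches_below:
  assumes "(i, out) \<in> W ^^ n" "t < d + n" "i < length ns"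
  shows "touches d ns x i \<longleftrightarrow> x \<in> Lits \<and> (x, i) \<in> W\<^sup>*"
  using assms
proof (induction d arbitrary: i n)
  case 0
  then show ?case using depth_le by fastforce
next
  case (Suc d)
  have IH: "touches d ns x j \<longleftrightarrow> x \<in> Lits \<and> (x, j) \<in> W\<^sup>*" if "(j, i) \<in> W" for j
    by (rule Suc.IH[OF relpow_Suc_I2[OF that Suc.prems(1)]]) (use Suc.prems wire_verts[OF that] in auto)
  show ?case
  proof (cases "i \<in> Lits")
    case True
    then have "(x, i) \<in> W\<^sup>* \<longleftrightarrow> x = i" using Lits_not_gate wire_gate by (metis rtrancl.simps)
    then show ?thesis using True Suc.prems(3) by (auto simp: node_at_eq Lits_def)
  next
    case False
    then have g: "gate i" using Lits_or_gate Suc.prems(3) by blast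
    have pr: "j \<in> set (preds (ns ! i)) \<longleftrightarrow> (j, i) \<in> W" for j using Suc.prems(3) by (simp add: wire_iff)
    have "touches (Suc d) ns x i \<longleftrightarrow> (\<exists>j. (j, i) \<in> W \<and> x \<in> Lits \<and> (x, j) \<in> W\<^sup>*)"
      using g IH Suc.prems(3) by (auto simp: node_at_eq gate_def list_ex_iff pr)
    also have "\<dots> \<longleftrightarrow> x \<in> Lits \<and> (x, i) \<in> W\<^sup>*"
      using below_gate_step[OF _ g] by (meson rtrancl.rtrancl_into_rtrancl)
    finally show ?thesis .
  qed
qed

subsection \<open>Minors in the circuit graph\<close>

definition CV :: "nat set" where
  "CV = verts C - {out}"

definition CE :: "nat set set" where
  "CE = {{j, i} | j i. (j, i) \<in> W \<and> j \<noteq> out \<and> i \<noteq> out}"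

text \<open>The tree of gates rooted at \<open>i\<close>; literals are left out because they may lie
  below many gates. These trees are the branch sets of the minors.\<close>

definition gates_below :: "nat \<Rightarrow> nat set" where
  "gates_below i = {j. gate j \<and> (j, i) \<in> W\<^sup>*}"

lemma wire_irrefl: "(i, i) \<notin> W" using acyclicW by (meson acyclic_def r_into_trancl')

lemma no_cycle: "(i, j) \<in> W \<Longrightarrow> (j, i) \<notin> W\<^sup>*"
  using acyclicW by (meson acyclic_def rtrancl_into_trancl2)

lemma simple_circuit_graph: "simple_graph CV CE"
  unfolding simple_graph_def
proof (intro conjI ballI)
  show "finite CV" by (simp add: CV_def verts_def)
  fix e assume "e \<in> CE"
  then obtain j i where e: "e = {j, i}" "(j, i) \<in> W" "j \<noteq> out" "i \<noteq> out" by (auto simp: CE_def)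
  show "e \<subseteq> CV" using e wire_verts by (auto simp: CV_def verts_def)
  have "j \<noteq> i" using e wire_irrefl by blast
  then show "card e = 2" using e by simp
qed

text \<open>There is only one way up from a gate, so any two vertices above it lie on the same path.
  Consequently incomparable vertices have disjoint trees below them.\<close>

lemma comparable:
  assumes "gate g" "(g, i) \<in> W\<^sup>*" "(g, j) \<in> W\<^sup>*"
  shows "(i, j) \<in> W\<^sup>* \<or> (j, i) \<in> W\<^sup>*"
  using assms(2,1,3)
proof (induction rule: converse_rtrancl_induct)
  case (step g g')
  show ?case
  proof (cases "g = j")
    case True
    then show ?thesis using step.hyps by (meson converse_rtrancl_into_rtrancl)
  next
    case False
    then obtain g'' where "(g, g'') \<in> W" "(g'', j) \<in> W\<^sup>*" using step.prems(2) by (meson converse_rtranclE)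
    then show ?thesis using step.IH gate_unique_wire[OF step.prems(1) step.hyps(1)] wire_gate[OF step.hyps(1)] by auto
  qed
qed simp

lemma gates_below_disjoint:
  "(i, j) \<notin> W\<^sup>* \<Longrightarrow> (j, i) \<notin> W\<^sup>* \<Longrightarrow> gates_below i \<inter> gates_below j = {}"
  using comparable by (auto simp: gates_below_def)

lemma out_below: "(out, i) \<in> W\<^sup>* \<Longrightarrow> i = out"
  by (erule converse_rtranclE) (auto simp: out_top)

lemma wire_edge: "(j, i) \<in> W \<Longrightarrow> i \<noteq> out \<Longrightarrow> {j, i} \<in> CE"
proof -
  assume w: "(j, i) \<in> W" "i \<noteq> out"
  then have "j \<noteq> out" using out_top by blast
  then show ?thesis using w unfolding CE_def by blast
qed

lemma edge_darts: "{a, b} \<in> E \<Longrightarrow> (a, b) \<in> darts E \<and> (b, a) \<in> darts E"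
  by (simp add: darts_def insert_commute)

lemma connected_via_root:
  assumes "\<And>x. x \<in> S \<Longrightarrow> (x, r) \<in> (darts E \<inter> S \<times> S)\<^sup>*" "x \<in> S" "y \<in> S"
  shows "(x, y) \<in> (darts E \<inter> S \<times> S)\<^sup>*"
proof -
  have "sym (darts E \<inter> S \<times> S)" using sym_darts[of E] by (auto simp: sym_def)
  then have "(r, y) \<in> (darts E \<inter> S \<times> S)\<^sup>*" using assms(1)[OF assms(3)] sym_rtrancl by (meson symD)
  then show ?thesis using assms(1)[OF assms(2)] by (meson rtrancl_trans)
qed

lemma gates_below_root:
  assumes "gate x" "(x, i) \<in> W\<^sup>*" "i \<noteq> out" "gates_below i \<subseteq> S"
  shows "(x, i) \<in> (darts CE \<inter> S \<times> S)\<^sup>*"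
  using assms(2,1)
proof (induction rule: converse_rtrancl_induct)
  case (step x y)
  have "y \<noteq> out" using step.hyps out_below assms(3) by blast
  then have "(x, y) \<in> darts CE" using edge_darts[OF wire_edge[OF step.hyps(1)]] by simp
  moreover have "gate y" using step.hyps wire_gate by blast
  moreover have "x \<in> gates_below i" "y \<in> gates_below i"
    using step.hyps step.prems \<open>gate y\<close> converse_rtrancl_into_rtrancl by (auto simp: gates_below_def)
  ultimately have "(x, y) \<in> darts CE \<inter> S \<times> S" using assms(4) by blast
  then show ?case using step.IH[OF \<open>gate y\<close>] by (rule converse_rtrancl_into_rtrancl)
qed simp

text \<open>The first gate on a path from the literal to \<open>i\<close> gives the edge between the
  literal and the tree below \<open>i\<close>.\<close>

lemma lit_first_gate:
  assumes "x \<in> Lits" "gate i" "(x, i) \<in> W\<^sup>*" "i \<noteq> out"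
  shows "\<exists>g \<in> gates_below i. {g, x} \<in> CE"
proof -
  have "x \<noteq> i" using assms Lits_not_gate by blast
  then obtain g where g: "(x, g) \<in> W" "(g, i) \<in> W\<^sup>*" using assms(3) by (meson converse_rtranclE)
  have "g \<noteq> out" using g out_below assms(4) by blast
  then have "{x, g} \<in> CE" using wire_edge g by blast
  moreover have "g \<in> gates_below i" using g wire_gate by (auto simp: gates_below_def)
  ultimately show ?thesis by (metis insert_commute)
qed

lemma gates_below_CV: "i \<noteq> out \<Longrightarrow> gates_below i \<subseteq> CV"
  using out_below by (auto simp: gates_below_def gate_def verts_def CV_def)

lemma Lits_CV: "Lits \<subseteq> CV"
  using out_gate Lits_not_gate by (auto simp: Lits_def verts_def CV_def)

lemma Tops_ne_out: "i \<in> Tops \<Longrightarrow> i \<noteq> out"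
  using out_and by (auto simp: Tops_def)

lemma Tops_gate: "i \<in> Tops \<Longrightarrow> gate i" by (simp add: Tops_def)

definition antichain :: "nat set \<Rightarrow> bool" where
  "antichain F \<longleftrightarrow> (\<forall>i \<in> F. \<forall>j \<in> F. i \<noteq> j \<longrightarrow> (i, j) \<notin> W\<^sup>*)"

lemma antichain_disjoint: "antichain F \<Longrightarrow> i \<in> F \<Longrightarrow> j \<in> F \<Longrightarrow> i \<noteq> j \<Longrightarrow> gates_below i \<inter> gates_below j = {}"
  by (rule gates_below_disjoint) (auto simp: antichain_def)

lemma gates_below_self: "gate i \<Longrightarrow> i \<in> gates_below i" by (simp add: gates_below_def)

definition minor_bound :: nat where
  "minor_bound = 4 * circuit_genus C + 2"

lemma K3_circuit:
  assumes parts: "\<And>S. S \<in> \<A> \<union> \<B> \<Longrightarrow> S \<subseteq> CV \<and> S \<noteq> {}"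
    and root: "\<And>S. S \<in> \<A> \<union> \<B> \<Longrightarrow> \<exists>r. \<forall>x \<in> S. (x, r) \<in> (darts CE \<inter> S \<times> S)\<^sup>*"
    and disj: "\<And>S S'. S \<in> \<A> \<union> \<B> \<Longrightarrow> S' \<in> \<A> \<union> \<B> \<Longrightarrow> S \<noteq> S' \<Longrightarrow> S \<inter> S' = {}"
    and AB: "\<A> \<inter> \<B> = {}" "card \<B> = 3"
    and adj: "\<And>A B. A \<in> \<A> \<Longrightarrow> B \<in> \<B> \<Longrightarrow> \<exists>a \<in> A. \<exists>b \<in> B. {a, b} \<in> CE"
  shows "card \<A> \<le> minor_bound"
  unfolding minor_bound_def circuit_genus_def CV_def[symmetric] CE_def[symmetric]
proof (rule K3_minor_bound[OF simple_circuit_graph parts _ disj AB adj])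
  fix S x y assume S: "S \<in> \<A> \<union> \<B>" "x \<in> S" "y \<in> S"
  then obtain r where "\<And>x. x \<in> S \<Longrightarrow> (x, r) \<in> (darts CE \<inter> S \<times> S)\<^sup>*" using root by blast
  from connected_via_root[OF this S(2,3)] show "(x, y) \<in> (darts CE \<inter> S \<times> S)\<^sup>*" .
qed

lemma card_disjoint_image:
  assumes "\<And>i j. i \<in> I \<Longrightarrow> j \<in> I \<Longrightarrow> i \<noteq> j \<Longrightarrow> f i \<inter> f j = {}" "\<And>i. i \<in> I \<Longrightarrow> f i \<noteq> {}"
  shows "card (f ` I) = card I"
proof (rule card_image, rule inj_onI)
  fix i j assume "i \<in> I" "j \<in> I" "f i = f j"
  then show "i = j" using assms by (metis inf.idem)
qed

text \<open>The three literals, as single vertices, against the trees below the common gates form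
  the minor.\<close>

lemma three_lits_bound:
  assumes F: "F \<subseteq> Tops" "antichain F" and xyz: "x \<in> Lits" "y \<in> Lits" "z \<in> Lits" "x \<noteq> y" "x \<noteq> z" "y \<noteq> z"
  shows "card {i \<in> F. (x, i) \<in> W\<^sup>* \<and> (y, i) \<in> W\<^sup>* \<and> (z, i) \<in> W\<^sup>*} \<le> minor_bound" (is "card ?I \<le> _")
proof -
  have I: "i \<in> Tops" "gate i" "i \<noteq> out" if "i \<in> ?I" for i using that F Tops_gate Tops_ne_out by auto
  have ne: "gates_below i \<noteq> {}" if "gate i" for i using gates_below_self[OF that] by blast
  have "card (gates_below ` ?I) \<le> minor_bound"
  proof (rule K3_circuit[where \<B> = "{{x}, {y}, {z}}"])
    fix S assume S: "S \<in> gates_below ` ?I \<union> {{x}, {y}, {z}}"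
    have "gates_below i \<subseteq> CV \<and> gates_below i \<noteq> {}" if "i \<in> ?I" for i
      using gates_below_CV ne I[OF that] by blast
    moreover have "{w} \<subseteq> CV" if "w \<in> Lits" for w using Lits_CV that by blast
    ultimately show "S \<subseteq> CV \<and> S \<noteq> {}" using S xyz by auto
    show "\<exists>r. \<forall>x \<in> S. (x, r) \<in> (darts CE \<inter> S \<times> S)\<^sup>*"
    proof (cases "S \<in> gates_below ` ?I")
      case True
      then obtain i where i: "i \<in> ?I" "S = gates_below i" by blast
      then show ?thesis using gates_below_root[of _ i S] I[OF i(1)] by (auto simp: gates_below_def)
    next
      case False
      then show ?thesis using S by auto
    qed
  next
    have lg: "gates_below i \<inter> {w} = {}" if "w \<in> Lits" for i w using that Lits_not_gate by (auto simp: gates_below_def)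
    fix S S' assume S: "S \<in> gates_below ` ?I \<union> {{x}, {y}, {z}}" "S' \<in> gates_below ` ?I \<union> {{x}, {y}, {z}}" "S \<noteq> S'"
    show "S \<inter> S' = {}"
    proof (cases "S \<in> gates_below ` ?I")
      case True
      then obtain i where i: "i \<in> ?I" "S = gates_below i" by blast
      show ?thesis
      proof (cases "S' \<in> gates_below ` ?I")
        case True
        then obtain j where "j \<in> ?I" "S' = gates_below j" by blast
        then show ?thesis using antichain_disjoint[OF F(2), of i j] i S(3) by blast
      next
        case False then show ?thesis using S(2) i lg xyz by auto
      qed
    next
      case F1: False
      show ?thesis
      proof (cases "S' \<in> gates_below ` ?I")
        case True then show ?thesis using S(1) F1 lg xyz by auto
      next
        case False then show ?thesis using S F1 xyz by auto
      qed
    qed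
  next
    show "gates_below ` ?I \<inter> {{x}, {y}, {z}} = {}"
      using xyz Lits_not_gate by (auto simp: gates_below_def)
    show "card {{x}, {y}, {z}} = 3" using xyz by simp
    fix A B assume "A \<in> gates_below ` ?I" "B \<in> {{x}, {y}, {z}}"
    then obtain i w where "i \<in> ?I" "A = gates_below i" "B = {w}" "w \<in> Lits" "(w, i) \<in> W\<^sup>*" using xyz by auto
    then show "\<exists>a \<in> A. \<exists>b \<in> B. {a, b} \<in> CE" using lit_first_gate I by auto
  qed
  moreover have "card (gates_below ` ?I) = card ?I"
    by (rule card_disjoint_image) (use antichain_disjoint[OF F(2)] I ne in auto)
  ultimately show ?thesis by simp
qed

text \<open>The same minor with exchanged roles: three trees on the fixed side and the common
  literals as single vertices.\<close>

lemma three_gates_bound: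
  assumes F: "F \<subseteq> Tops" "antichain F" and ijl: "i \<in> F" "j \<in> F" "l \<in> F" "i \<noteq> j" "i \<noteq> l" "j \<noteq> l"
  shows "card {x \<in> Lits. (x, i) \<in> W\<^sup>* \<and> (x, j) \<in> W\<^sup>* \<and> (x, l) \<in> W\<^sup>*} \<le> minor_bound" (is "card ?X \<le> _")
proof -
  let ?G = "gates_below" and ?B = "gates_below ` {i, j, l}"
  have g: "gate w" "w \<noteq> out" if "w \<in> {i, j, l}" for w using that ijl F(1) Tops_gate Tops_ne_out by blast+
  have dis: "?G v \<inter> ?G w = {}" if "v \<in> {i, j, l}" "w \<in> {i, j, l}" "v \<noteq> w" for v w
    using antichain_disjoint[OF F(2), of v w] that ijl by blast
  have ne: "?G w \<noteq> {}" if "w \<in> {i, j, l}" for w using gates_below_self[OF g(1)[OF that]] by blast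
  have lg: "x \<notin> ?G w" if "x \<in> Lits" for x w using that Lits_not_gate by (auto simp: gates_below_def)
  have "card ((\<lambda>x. {x}) ` ?X) \<le> minor_bound"
  proof (rule K3_circuit[where \<B> = ?B])
    fix S assume S: "S \<in> (\<lambda>x. {x}) ` ?X \<union> ?B"
    have "?G w \<subseteq> CV \<and> ?G w \<noteq> {}" if "w \<in> {i, j, l}" for w
      using gates_below_CV[OF g(2)[OF that]] ne[OF that] by blast
    moreover have "{x} \<subseteq> CV" if "x \<in> Lits" for x using Lits_CV that by blast
    ultimately show "S \<subseteq> CV \<and> S \<noteq> {}" using S by auto
    show "\<exists>r. \<forall>x \<in> S. (x, r) \<in> (darts CE \<inter> S \<times> S)\<^sup>*"
    proof (cases "S \<in> ?B")
      case True
      then obtain w where w: "w \<in> {i, j, l}" "S = ?G w" by blast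
      then show ?thesis using gates_below_root[of _ w S] g[OF w(1)] by (auto simp: gates_below_def)
    next
      case False
      then show ?thesis using S by auto
    qed
  next
    fix S S' assume S: "S \<in> (\<lambda>x. {x}) ` ?X \<union> ?B" "S' \<in> (\<lambda>x. {x}) ` ?X \<union> ?B" "S \<noteq> S'"
    show "S \<inter> S' = {}"
    proof (cases "S \<in> ?B")
      case True
      then obtain v where v: "v \<in> {i, j, l}" "S = ?G v" by blast
      show ?thesis
      proof (cases "S' \<in> ?B")
        case True
        then obtain w where "w \<in> {i, j, l}" "S' = ?G w" by blast
        then show ?thesis using dis v S(3) by blast
      next
        case False then show ?thesis using S(2) v lg by auto
      qed
    next
      case F1: False
      show ?thesis
      proof (cases "S' \<in> ?B")
        case True then show ?thesis using S(1) F1 lg by auto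
      next
        case False then show ?thesis using S F1 by auto
      qed
    qed
  next
    show "(\<lambda>x. {x}) ` ?X \<inter> ?B = {}" using lg by blast
    have "card ?B = card {i, j, l}" by (rule card_disjoint_image) (use dis ne in auto)
    then show "card ?B = 3" using ijl by simp
    fix A B assume "A \<in> (\<lambda>x. {x}) ` ?X" "B \<in> ?B"
    then obtain x w where xw: "x \<in> Lits" "A = {x}" "w \<in> {i, j, l}" "B = ?G w" "(x, w) \<in> W\<^sup>*" by auto
    then obtain b where "b \<in> ?G w" "{b, x} \<in> CE" using lit_first_gate[of x w] g[OF xw(3)] by blast
    then show "\<exists>a \<in> A. \<exists>b \<in> B. {a, b} \<in> CE" using xw by (auto simp: insert_commute)
  qed
  then show ?thesis by (simp add: card_image)
qed

text \<open>The only way up from \<open>c\<close> leads through the parent \<open>i\<close>, and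
  reaching a child of \<open>i\<close> from there would close a cycle.\<close>

lemma siblings_incomparable:
  assumes "(c, i) \<in> W" "(c', i) \<in> W" "gate c" "c \<noteq> c'"
  shows "(c, c') \<notin> W\<^sup>*"
proof
  assume "(c, c') \<in> W\<^sup>*"
  then obtain g where "(c, g) \<in> W" "(g, c') \<in> W\<^sup>*" using assms(4) by (meson converse_rtranclE)
  then have "(i, c') \<in> W\<^sup>*" using gate_unique_wire[OF assms(3)] assms(1) by blast
  then show False using no_cycle assms(2) by blast
qed

text \<open>
  The branch sets are the gates below an item, the gate \<open>i\<close> itself, and the gates below \<open>j\<close> and
  \<open>l\<close> enlarged by the literals that they share with \<open>i\<close> only.
\<close>

lemma items_bound:
  assumes F: "F \<subseteq> Tops" "antichain F" and ijl: "i \<in> F" "j \<in> F" "l \<in> F" "i \<noteq> j" "i \<noteq> l" "j \<noteq> l"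
  defines "shared \<equiv> \<lambda>j. {x \<in> Lits. (x, i) \<in> W\<^sup>* \<and> (x, j) \<in> W\<^sup>* \<and> (\<forall>m \<in> F. (x, m) \<in> W\<^sup>* \<longrightarrow> m = i \<or> m = j)}"
  shows "card {c. (c, i) \<in> W \<and> gate c \<and> (\<exists>x \<in> shared j. (x, c) \<in> W\<^sup>*) \<and> (\<exists>x \<in> shared l. (x, c) \<in> W\<^sup>*)} \<le> minor_bound"
    (is "card ?I \<le> _")
proof -
  let ?G = "gates_below"
  have g: "gate w" "w \<noteq> out" if "w \<in> F" for w using that F(1) Tops_gate Tops_ne_out by blast+
  have lg: "x \<notin> ?G w" if "x \<in> Lits" for x w using that Lits_not_gate by (auto simp: gates_below_def)
  have shL: "shared w \<subseteq> Lits" for w by (auto simp: shared_def)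
  define Bj where "Bj w = ?G w \<union> shared w" for w
  let ?B = "{{i}, Bj j, Bj l}"
  \<comment> \<open>The root \<open>i\<close> is not in the trees of its children, so
    \<open>{i}\<close> can serve as the third branch set next to them.\<close>
  have GiI: "?G c \<subseteq> ?G i - {i}" if "c \<in> ?I" for c
    using that no_cycle by (auto simp: gates_below_def)
  have cI: "gate c" "c \<noteq> out" if "c \<in> ?I" for c using that out_top by blast+
  have d1: "?G c \<inter> ?G c' = {}" if "c \<in> ?I" "c' \<in> ?I" "c \<noteq> c'" for c c'
    using that siblings_incomparable by (intro gates_below_disjoint) auto
  have d2: "?G c \<inter> Bj w = {}" if "c \<in> ?I" "w \<in> F" "w \<noteq> i" for c w
    using GiI[OF that(1)] antichain_disjoint[OF F(2), of i w] ijl that(2,3) lg shL unfolding Bj_def by blast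
  have d3: "i \<notin> Bj w" if "w \<in> F" "w \<noteq> i" for w
    using antichain_disjoint[OF F(2), of i w] ijl that gates_below_self[of i] g[of i] lg shL unfolding Bj_def by blast
  \<comment> \<open>A literal added to the tree of \<open>j\<close> has only \<open>i\<close> and
    \<open>j\<close> above it in \<open>F\<close>, so it is not added to the tree of
    \<open>l\<close>.\<close>
  have d4: "Bj j \<inter> Bj l = {}"
    using antichain_disjoint[OF F(2) ijl(2,3,6)] lg shL ijl unfolding Bj_def shared_def by blast
  have d5: "i \<notin> ?G c" if "c \<in> ?I" for c using GiI[OF that] by blast
  have root: "(x, w) \<in> (darts CE \<inter> Bj w \<times> Bj w)\<^sup>*" if w: "w \<in> F" and x: "x \<in> Bj w" for x w
  proof (cases "x \<in> ?G w")
    case True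
    then show ?thesis using gates_below_root[of x w "Bj w"] g[OF w] by (auto simp: gates_below_def Bj_def)
  next
    case False
    then have "x \<in> Lits" "(x, w) \<in> W\<^sup>*" using x by (auto simp: Bj_def shared_def)
    then obtain h where h: "h \<in> ?G w" "{h, x} \<in> CE" using lit_first_gate g[OF w] by blast
    then have "(x, h) \<in> darts CE \<inter> Bj w \<times> Bj w" using edge_darts[OF h(2)] x by (simp add: Bj_def)
    moreover have "(h, w) \<in> (darts CE \<inter> Bj w \<times> Bj w)\<^sup>*"
      using h gates_below_root[of h w "Bj w"] g[OF w] by (auto simp: gates_below_def Bj_def)
    ultimately show ?thesis by (rule converse_rtrancl_into_rtrancl)
  qed
  have "card (?G ` ?I) \<le> minor_bound"
  proof (rule K3_circuit[where \<B> = ?B])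
    fix S assume S: "S \<in> ?G ` ?I \<union> ?B"
    then consider c where "c \<in> ?I" "S = ?G c" | "S = {i}" | w where "w \<in> {j, l}" "S = Bj w" by blast
    then show "S \<subseteq> CV \<and> S \<noteq> {}"
    proof cases
      case 1 then show ?thesis using gates_below_CV cI gates_below_self by blast
    next
      case 2 then show ?thesis using g[OF ijl(1)] by (auto simp: gate_def verts_def CV_def)
    next
      case 3
      then have "w \<in> F" using ijl by blast
      then show ?thesis using 3 g gates_below_CV[of w] gates_below_self[of w] Lits_CV shL[of w] unfolding Bj_def by blast
    qed
    from S consider c where "c \<in> ?I" "S = ?G c" | "S = {i}" | w where "w \<in> {j, l}" "S = Bj w" by blast
    then show "\<exists>r. \<forall>x \<in> S. (x, r) \<in> (darts CE \<inter> S \<times> S)\<^sup>*"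
    proof cases
      case 1 then show ?thesis using gates_below_root[of _ c S] cI[of c] by (auto simp: gates_below_def)
    next
      case 2 then show ?thesis by auto
    next
      case 3 then show ?thesis using root ijl by blast
    qed
  next
    fix S S' assume S: "S \<in> ?G ` ?I \<union> ?B" "S' \<in> ?G ` ?I \<union> ?B" "S \<noteq> S'"
    have e: "\<And>w. w \<in> {j, l} \<Longrightarrow> w \<in> F \<and> w \<noteq> i" using ijl by blast
    have sy: "R \<inter> R' = {}" if R: "R \<in> ?G ` ?I" "R' \<in> ?G ` ?I \<union> ?B" "R \<noteq> R'" for R R'
    proof -
      obtain c where c: "c \<in> ?I" "R = ?G c" using R(1) by blast
      from R(2) consider c' where "c' \<in> ?I" "R' = ?G c'" | "R' = {i}" | w where "w \<in> {j, l}" "R' = Bj w" by blast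
      then show ?thesis
      proof cases
        case 1 then show ?thesis using d1[of c c'] c R(3) by blast
      next
        case 2 then show ?thesis using d5[OF c(1)] c by blast
      next
        case 3 then show ?thesis using d2[OF c(1)] e c by blast
      qed
    qed
    show "S \<inter> S' = {}"
    proof (cases "S \<in> ?G ` ?I \<or> S' \<in> ?G ` ?I")
      case True
      then show ?thesis
      proof
        assume "S \<in> ?G ` ?I"
        from sy[OF this S(2,3)] show ?thesis .
      next
        assume "S' \<in> ?G ` ?I"
        from sy[OF this S(1) S(3)[symmetric]] show ?thesis by (simp only: Int_commute)
      qed
    next
      case False
      then have "S \<in> ?B" "S' \<in> ?B" using S by blast+
      then show ?thesis using S(3) d3[of j] d3[of l] d4 ijl by auto
    qed
  next
    show "?G ` ?I \<inter> ?B = {}"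
    proof -
      have "?G c \<noteq> {i}" "?G c \<noteq> Bj j" "?G c \<noteq> Bj l" if "c \<in> ?I" for c
        using d5[OF that] d2[OF that, of j] d2[OF that, of l] gates_below_self[OF cI(1)[OF that]] ijl by blast+
      then show ?thesis by blast
    qed
    have "Bj w \<noteq> {}" if "w \<in> F" for w using gates_below_self[OF g(1)[OF that]] unfolding Bj_def by blast
    then have "Bj j \<noteq> Bj l" "{i} \<noteq> Bj j" "{i} \<noteq> Bj l" using d3[of j] d3[of l] d4 ijl by blast+
    then show "card ?B = 3" by simp
    fix A B assume A: "A \<in> ?G ` ?I" and B: "B \<in> ?B"
    obtain c where c: "c \<in> ?I" "A = ?G c" using A by blast
    have sh: "\<exists>a \<in> A. \<exists>b \<in> Bj w. {a, b} \<in> CE" if ex: "\<exists>x \<in> shared w. (x, c) \<in> W\<^sup>*" for w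
    proof -
      obtain x where x: "x \<in> shared w" "(x, c) \<in> W\<^sup>*" using ex by blast
      then obtain h where "h \<in> ?G c" "{h, x} \<in> CE" using lit_first_gate[of x c] cI[OF c(1)] shL by blast
      then show ?thesis using x c unfolding Bj_def by blast
    qed
    have ci: "\<exists>a \<in> A. \<exists>b \<in> {i}. {a, b} \<in> CE"
      using c gates_below_self[OF cI(1)[OF c(1)]] wire_edge[of c i] g[OF ijl(1)] by blast
    from B consider "B = {i}" | w where "w \<in> {j, l}" "B = Bj w" by blast
    then show "\<exists>a \<in> A. \<exists>b \<in> B. {a, b} \<in> CE"
    proof cases
      case 1 then show ?thesis using ci by blast
    next
      case 2 then show ?thesis using sh[of w] c by auto
    qed
  qed
  moreover have "card (?G ` ?I) = card ?I"
    by (rule card_disjoint_image) (use d1 cI gates_below_self in blast)+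
  ultimately show ?thesis by simp
qed

end

section \<open>Correctness and size of the search tree\<close>

lemma distinct_triple:
  assumes "3 \<le> card A"
  obtains x y z where "x \<in> A" "y \<in> A" "z \<in> A" "x \<noteq> y" "x \<noteq> z" "y \<noteq> z"
proof -
  obtain T where "T \<subseteq> A" "card T = 3" using assms by (rule obtain_subset_with_card_n)
  then show ?thesis using that by (auto simp: card_3_iff)
qed

lemma distinct_pair:
  assumes "2 \<le> card A"
  obtains x y where "x \<in> A" "y \<in> A" "x \<noteq> y"
proof -
  obtain T where "T \<subseteq> A" "card T = 2" using assms by (rule obtain_subset_with_card_n)
  then show ?thesis using that by (auto simp: card_2_iff)
qed

lemma card_UN_bound:
  assumes "finite I" "\<And>i. i \<in> I \<Longrightarrow> card (A i) \<le> N"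
  shows "card (\<Union>i \<in> I. A i) \<le> card I * N"
proof -
  have "card (\<Union>i \<in> I. A i) \<le> (\<Sum>i \<in> I. card (A i))" using assms(1) by (rule card_UN_le)
  also have "\<dots> \<le> (\<Sum>i \<in> I. N)" using assms(2) by (intro sum_mono)
  finally show ?thesis by simp
qed

lemma length_concat_map_le:
  assumes "\<And>x. x \<in> set xs \<Longrightarrow> length (f x) \<le> N"
  shows "length (concat (map f xs)) \<le> length xs * N"
  using assms by (induction xs) (auto simp: add_mono)

lemma length_concat_map_if:
  assumes "\<And>x. x \<in> set xs \<Longrightarrow> length (f x) \<le> 1"
  shows "length (concat (map (\<lambda>x. if P x then f x else []) xs)) \<le> length (filter P xs)"
  using assms by (induction xs) (auto, fastforce)

text \<open>The fuel will be \<open>Suc t\<close>, which the simplifier would otherwise keep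
  unfolding.\<close>

declare sat_below.simps(2) [simp del] touches.simps(2) [simp del]

lemma card_filter_sum: "finite A \<Longrightarrow> card {x \<in> A. Q x} = (\<Sum>x \<in> A. if Q x then 1 else 0)"
  using sum.inter_filter[of A "\<lambda>_. 1 :: nat" Q] by simp

context mono_circuit
begin

text \<open>The budget is an upper bound, which suits branching; exact weight is recovered at the
  end by padding.\<close>

definition SAT :: "nat set \<Rightarrow> nat \<Rightarrow> nat set \<Rightarrow> bool" where
  "SAT X k F \<longleftrightarrow> (\<exists>S \<subseteq> Lits. card S \<le> k \<and> (\<forall>i \<in> F. sem (X \<union> S) i))"

definition SATs :: "state \<Rightarrow> bool" where
  "SATs s \<longleftrightarrow> SAT (set (fst (snd s))) (fst (snd (snd s))) (set (snd (snd (snd s))))"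

abbreviation "fuel \<equiv> Suc t"

lemma below_out_less: "(i, out) \<in> W\<^sup>* \<Longrightarrow> i < length ns"
  using out_vert by (erule_tac converse_rtranclE) (auto dest: wire_verts)

lemma preds_set: "i < length ns \<Longrightarrow> set (preds (node_at ns i)) = {c. (c, i) \<in> W}"
  by (auto simp: node_at_eq wire_iff)

lemma touch_iff: "(i, out) \<in> W\<^sup>* \<Longrightarrow> touches fuel ns x i \<longleftrightarrow> x \<in> Lits \<and> (x, i) \<in> W\<^sup>*"
  by (rule touches_below[OF dep_path]) (auto intro: below_out_less)

lemma sat_iff: "(i, out) \<in> W\<^sup>* \<Longrightarrow> sat_below fuel ns X i \<longleftrightarrow> sem (set X) i"
  by (rule sat_below_sem[OF dep_path]) (auto intro: below_out_less)

lemma TopsD: "i \<in> Tops \<Longrightarrow> (i, out) \<in> W\<^sup>*" "i \<in> Tops \<Longrightarrow> gate i" "i \<in> Tops \<Longrightarrow> i < length ns"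
  by (auto simp: Tops_def gate_def)

lemma deg_card:
  assumes "distinct F" "set F \<subseteq> Tops" "x \<in> Lits"
  shows "deg fuel ns F x = card {i \<in> set F. (x, i) \<in> W\<^sup>*}"
proof -
  have "deg fuel ns F x = card (set (filter (touches fuel ns x) F))"
    unfolding deg_def using assms(1) by (intro distinct_card[symmetric]) simp
  also have "set (filter (touches fuel ns x) F) = {i \<in> set F. (x, i) \<in> W\<^sup>*}"
    using assms touch_iff TopsD by auto
  finally show ?thesis .
qed

lemma avail_set: "set (avail ns X) = Lits - set X"
  by (auto simp: avail_def Lits_def node_at_eq)

lemma distinct_avail: "distinct (avail ns X)" by (simp add: avail_def)

subsection \<open>Items\<close>

definition item :: "nat \<Rightarrow> bool" where
  "item c \<longleftrightarrow> c \<in> Lits \<or> gate c \<and> is_and (ns ! c) \<and> (c, out) \<in> W\<^sup>*"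

lemma item_pred: "i \<in> Tops \<Longrightarrow> (c, i) \<in> W \<Longrightarrow> item c"
  using alternate[of c i] Lits_or_gate[of c] wire_verts[of c i] converse_rtrancl_into_rtrancl[of c i W out]
  by (auto simp: item_def Tops_def)

text \<open>The output counts as an item although it is no child of an OR-gate, so the start of the
  search needs no separate treatment.\<close>

lemma item_out: "item out" using out_gate out_and by (simp add: item_def)

lemma lits_ors_lit: "c \<in> Lits \<Longrightarrow> lits ns c = [c] \<and> ors ns c = []"
proof -
  assume c: "c \<in> Lits"
  then have "\<not> is_gate (node_at ns c)" "preds (node_at ns c) = []"
    using Lits_node[OF c] by (auto simp: node_at_eq Lits_def)
  then show ?thesis by (simp add: lits_def ors_def)
qed

lemma lits_ors_gate:
  assumes "gate c"
  shows "set (lits ns c) = {x \<in> Lits. (x, c) \<in> W}" "set (ors ns c) = {j. gate j \<and> (j, c) \<in> W}"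
proof -
  have c: "is_gate (node_at ns c)" "c < length ns" using assms by (auto simp: gate_def node_at_eq)
  note p = preds_set[OF c(2)]
  have n: "node_at ns x = ns ! x \<and> x < length ns" if "(x, c) \<in> W" for x
    using wire_verts[OF that] node_at_eq by simp
  show "set (lits ns c) = {x \<in> Lits. (x, c) \<in> W}"
    using c(1) n by (auto simp: lits_def p Lits_def)
  show "set (ors ns c) = {j. gate j \<and> (j, c) \<in> W}"
    using n by (auto simp: ors_def p gate_def)
qed

lemma item_lits: "item c \<Longrightarrow> set (lits ns c) \<subseteq> Lits"
  using lits_ors_lit lits_ors_gate by (auto simp: item_def)

lemma item_orsD:
  assumes "item c" "j \<in> set (ors ns c)"
  shows "j \<in> Tops" "gate j" "(j, c) \<in> W" "gate c" "is_and (ns ! c)" "(c, out) \<in> W\<^sup>*"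
proof -
  have c: "gate c" "is_and (ns ! c)" "(c, out) \<in> W\<^sup>*"
    using assms lits_ors_lit[of c] by (auto simp: item_def)
  then have j: "gate j" "(j, c) \<in> W" using assms lits_ors_gate[OF c(1)] by auto
  have "\<not> is_and (ns ! j)" using alternate[OF j(2) c(3) j(1)] c(2) by simp
  then show "j \<in> Tops" using j c converse_rtrancl_into_rtrancl[OF j(2) c(3)] by (simp add: Tops_def)
qed (use assms lits_ors_lit[of c] lits_ors_gate[of c] in \<open>auto simp: item_def\<close>)

lemma item_sem: "item c \<Longrightarrow> sem S c \<longleftrightarrow> set (lits ns c) \<subseteq> S \<and> (\<forall>j \<in> set (ors ns c). sem S j)"
proof (cases "c \<in> Lits")
  case True
  then show ?thesis using sem_lit lits_ors_lit by simp
next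
  case False
  assume "item c"
  then have c: "gate c" "is_and (ns ! c)" using False by (auto simp: item_def)
  have "sem S c \<longleftrightarrow> (\<forall>j. (j, c) \<in> W \<longrightarrow> sem S j)" by (rule sem_and[OF c])
  also have "\<dots> \<longleftrightarrow> set (lits ns c) \<subseteq> S \<and> (\<forall>j \<in> set (ors ns c). sem S j)"
    unfolding lits_ors_gate[OF c(1)] using sem_lit Lits_or_gate wire_verts by blast
  finally show ?thesis .
qed

lemma top_sem: "i \<in> Tops \<Longrightarrow> sem S i \<longleftrightarrow> (\<exists>c. (c, i) \<in> W \<and> sem S c)"
  using sem_or by (simp add: Tops_def)

lemma item_dep:
  assumes "i \<in> Tops" "(c, i) \<in> W" "j \<in> set (ors ns c)"
  shows "dep j = dep i + 2"
proof -
  note it = item_orsD[OF item_pred[OF assms(1,2)] assms(3)]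
  show ?thesis using dep_step[OF it(2,3,6)] dep_step[OF it(4) assms(2) TopsD(1)[OF assms(1)]] by simp
qed

text \<open>The way up from a grandchild gate is forced: first the item, then the OR-gate above
  it.\<close>

lemma above_item:
  assumes "i \<in> Tops" "(c, i) \<in> W" "j \<in> set (ors ns c)" "(j, l) \<in> W\<^sup>*"
  shows "l = j \<or> l = c \<or> (i, l) \<in> W\<^sup>*"
proof (cases "j = l")
  case False
  note it = item_orsD[OF item_pred[OF assms(1,2)] assms(3)]
  obtain g where g: "(j, g) \<in> W" "(g, l) \<in> W\<^sup>*" using assms(4) False by (meson converse_rtranclE)
  have gc: "g = c" using gate_unique_wire[OF it(2) g(1) it(3)] .
  show ?thesis
  proof (cases "c = l")
    case False
    then obtain g' where g': "(c, g') \<in> W" "(g', l) \<in> W\<^sup>*" using g gc by (meson converse_rtranclE)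
    then have "g' = i" using gate_unique_wire[OF it(4) _ assms(2)] by blast
    then show ?thesis using g' by blast
  qed simp
qed simp

lemma antichain_subset: "antichain F \<Longrightarrow> F' \<subseteq> F \<Longrightarrow> antichain F'"
  unfolding antichain_def by blast

text \<open>A path between two grandchild gates would have to pass the OR-gate over the first. It
  would then connect two gates of the antichain, or run from a gate back into one of its own
  children.\<close>

lemma antichain_items:
  assumes F: "F \<subseteq> Tops" "antichain F" and i: "i \<in> F" "(c, i) \<in> W" and j: "j \<in> F" "(c', j) \<in> W"
  shows "antichain (set (ors ns c) \<union> set (ors ns c'))"
proof -
  have key: "(u, v) \<notin> W\<^sup>*" if ab: "a \<in> F" "b \<in> F" "(p, a) \<in> W" "(r, b) \<in> W" "u \<in> set (ors ns p)" "v \<in> set (ors ns r)" "u \<noteq> v"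
    for a b p r u v
  proof
    assume uv: "(u, v) \<in> W\<^sup>*"
    have T: "a \<in> Tops" "b \<in> Tops" using ab F by auto
    note u = item_orsD[OF item_pred[OF T(1) ab(3)] ab(5)]
    note v = item_orsD[OF item_pred[OF T(2) ab(4)] ab(6)]
    have "v \<noteq> p" using u(5) v(1) by (auto simp: Tops_def)
    then have av: "(a, v) \<in> W\<^sup>*" using above_item[OF T(1) ab(3,5) uv] ab(7) by blast
    then have ar: "(a, r) \<in> W\<^sup>*" using v(3) by (meson rtrancl_into_rtrancl)
    then have "(a, b) \<in> W\<^sup>*" using ab(4) by (meson rtrancl_into_rtrancl)
    then have "a = b" using F(2) ab(1,2) by (auto simp: antichain_def)
    then show False using no_cycle[OF ab(4)] ar by blast
  qed
  show ?thesis unfolding antichain_def using key[OF i(1) i(1) i(2) i(2)] key[OF j(1) j(1) j(2) j(2)]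
      key[OF i(1) j(1) i(2) j(2)] key[OF j(1) i(1) j(2) i(2)] by blast
qed

text \<open>A path from a new gate to an old one passes through \<open>i\<close>, and a path from an
  old gate to a new one continues to \<open>i\<close>; both contradict the antichain.\<close>

lemma antichain_expand:
  assumes F: "F \<subseteq> Tops" "antichain F" and i: "i \<in> F" "(c, i) \<in> W"
  shows "antichain (F - {i} \<union> set (ors ns c))"
proof -
  have T: "i \<in> Tops" using F i by auto
  have 1: "(u, v) \<notin> W\<^sup>*" if uv: "u \<in> set (ors ns c)" "v \<in> F - {i}" "u \<noteq> v" for u v
  proof
    assume r: "(u, v) \<in> W\<^sup>*"
    note u = item_orsD[OF item_pred[OF T i(2)] uv(1)]
    have "v \<noteq> c" using u(5) uv(2) F(1) by (auto simp: Tops_def)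
    then have "(i, v) \<in> W\<^sup>*" using above_item[OF T i(2) uv(1) r] uv(3) by blast
    then show False using F(2) i(1) uv(2) by (auto simp: antichain_def)
  qed
  have 2: "(v, u) \<notin> W\<^sup>*" if uv: "u \<in> set (ors ns c)" "v \<in> F - {i}" for u v
  proof
    assume r: "(v, u) \<in> W\<^sup>*"
    note u = item_orsD[OF item_pred[OF T i(2)] uv(1)]
    have "(v, i) \<in> W\<^sup>*" using r u(3) i(2) by (meson rtrancl_into_rtrancl)
    then show False using F(2) i(1) uv(2) by (auto simp: antichain_def)
  qed
  have 3: "antichain (set (ors ns c))" using antichain_items[OF F i i] by simp
  show ?thesis using F(2) 1 2 3 unfolding antichain_def by blast
qed

subsection \<open>States\<close>

lemma length_filter_upt: "(\<And>x. P x \<Longrightarrow> x < n) \<Longrightarrow> length (filter P [0..<n]) = card {x. P x}"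
proof -
  assume "\<And>x. P x \<Longrightarrow> x < n"
  then have "set (filter P [0..<n]) = {x. P x}" by auto
  then show ?thesis by (metis distinct_card distinct_filter distinct_upt)
qed

lemma Lits_less: "x \<in> Lits \<Longrightarrow> x < length ns" by (simp add: Lits_def)

lemma mk_state_cost:
  assumes "set L \<subseteq> Lits"
  shows "length (filter (\<lambda>x. x \<in> set L \<and> x \<notin> set X) [0..<length ns]) = card (set L - set X)"
proof -
  have "{x. x \<in> set L \<and> x \<notin> set X} = set L - set X" by blast
  then show ?thesis using length_filter_upt[of "\<lambda>x. x \<in> set L \<and> x \<notin> set X" "length ns"] assms Lits_less by auto
qed

lemma mk_state_elem:
  assumes "set X \<subseteq> Lits" "set L \<subseteq> Lits" "set F \<subseteq> Tops" and s: "s \<in> set (mk_state fuel ns X k L F)"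
  obtains X' F' where "s = (False, X', k - card (set L - set X), F')" "card (set L - set X) \<le> k"
    "distinct X'" "distinct F'" "set X' = set X \<union> set L" "set F' = {i \<in> set F. \<not> sem (set X \<union> set L) i}"
proof -
  let ?X = "filter (\<lambda>x. x \<in> set X \<or> x \<in> set L) [0..<length ns]"
  have X: "set ?X = set X \<union> set L" using assms(1,2) Lits_less by auto
  let ?F = "filter (\<lambda>i. i \<in> set F \<and> \<not> sat_below fuel ns ?X i) [0..<length ns]"
  have F: "set ?F = {i \<in> set F. \<not> sem (set X \<union> set L) i}"
  proof -
    have "i \<in> set ?F \<longleftrightarrow> i \<in> set F \<and> \<not> sem (set X \<union> set L) i" for i
    proof (cases "i \<in> set F")
      case True
      then have "i \<in> Tops" using assms(3) by blast
      then have "i < length ns" "sat_below fuel ns ?X i \<longleftrightarrow> sem (set ?X) i" using TopsD sat_iff by blast+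
      then show ?thesis unfolding X using True by simp
    qed simp
    then show ?thesis by blast
  qed
  have "s = (False, ?X, k - card (set L - set X), ?F)" "card (set L - set X) \<le> k"
    using s unfolding mk_state_def mk_state_cost[OF assms(2)] by (auto split: if_splits)
  then show ?thesis using that[of ?X ?F] X F by simp
qed

text \<open>On the right, \<open>S\<close> still includes the literals of \<open>L\<close> that the
  new state has already paid for. Gates dropped as satisfied stay satisfied by monotonicity.\<close>

lemma mk_state_SAT:
  assumes "set X \<subseteq> Lits" "set L \<subseteq> Lits" "set F \<subseteq> Tops"
  shows "(\<exists>s \<in> set (mk_state fuel ns X k L F). SATs s) \<longleftrightarrow>
    (\<exists>S \<subseteq> Lits. card S \<le> k \<and> set L \<subseteq> set X \<union> S \<and> (\<forall>i \<in> set F. sem (set X \<union> S) i))"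
proof
  assume "\<exists>s \<in> set (mk_state fuel ns X k L F). SATs s"
  then obtain s where s: "s \<in> set (mk_state fuel ns X k L F)" "SATs s" by blast
  obtain X' F' where e: "s = (False, X', k - card (set L - set X), F')" "card (set L - set X) \<le> k"
    "set X' = set X \<union> set L" "set F' = {i \<in> set F. \<not> sem (set X \<union> set L) i}"
    by (rule mk_state_elem[OF assms s(1)]) (rule that)
  obtain S where S: "S \<subseteq> Lits" "card S \<le> k - card (set L - set X)" "\<And>i. i \<in> set F' \<Longrightarrow> sem (set X \<union> set L \<union> S) i"
    using s(2) unfolding SATs_def SAT_def e(1) by (auto simp: e(3))
  have "card (S \<union> (set L - set X)) \<le> k" using card_Un_le[of S "set L - set X"] S(2) e(2) by linarith
  moreover have eq: "set X \<union> (S \<union> (set L - set X)) = set X \<union> set L \<union> S" by blast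
  moreover have "sem (set X \<union> set L \<union> S) i" if "i \<in> set F" for i
  proof (cases "sem (set X \<union> set L) i")
    case True
    then show ?thesis using sem_mono[of i "set X \<union> set L"] assms(3) that TopsD by blast
  next
    case False
    then show ?thesis using S(3) that e(4) by blast
  qed
  ultimately show "\<exists>S \<subseteq> Lits. card S \<le> k \<and> set L \<subseteq> set X \<union> S \<and> (\<forall>i \<in> set F. sem (set X \<union> S) i)"
    using S(1) assms(2) by (intro exI[of _ "S \<union> (set L - set X)"]) auto
next
  assume "\<exists>S \<subseteq> Lits. card S \<le> k \<and> set L \<subseteq> set X \<union> S \<and> (\<forall>i \<in> set F. sem (set X \<union> S) i)"
  then obtain S where S: "S \<subseteq> Lits" "card S \<le> k" "set L \<subseteq> set X \<union> S" "\<And>i. i \<in> set F \<Longrightarrow> sem (set X \<union> S) i" by blast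
  have finS: "finite S" using S(1) finite_Lits finite_subset by blast
  have sub: "set L - set X \<subseteq> S" using S(3) by blast
  have le: "card (set L - set X) \<le> k" using card_mono[OF finS sub] S(2) by linarith
  then obtain s where s: "s \<in> set (mk_state fuel ns X k L F)"
    unfolding mk_state_def mk_state_cost[OF assms(2)] by simp
  obtain X' F' where e: "s = (False, X', k - card (set L - set X), F')"
    "set X' = set X \<union> set L" "set F' = {i \<in> set F. \<not> sem (set X \<union> set L) i}"
    by (rule mk_state_elem[OF assms s]) (rule that)
  have "card (S - (set L - set X)) \<le> k - card (set L - set X)"
    using card_Diff_subset[OF _ sub] S(2) by simp
  moreover have "set X' \<union> (S - (set L - set X)) = set X \<union> S" using e(2) S(3) by blast
  ultimately have "SATs s" unfolding SATs_def SAT_def e(1) using S(1,4) e(3)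
    by (intro exI[of _ "S - (set L - set X)"]) auto
  then show "\<exists>s \<in> set (mk_state fuel ns X k L F). SATs s" using s by blast
qed

text \<open>The bound that \<open>many_cand_bound\<close> yields from \<open>3 * k0 + 1\<close>
  common literals: a power of three for the choice of triples and one more from the double
  counting.\<close>

definition maxF :: "nat \<Rightarrow> nat" where
  "maxF k0 = (3 * k0 + 1) ^ 4 * minor_bound"

text \<open>\<open>e\<close> is the number of oracle levels left: every pending gate is so deep that
  \<open>e\<close> levels suffice, and for \<open>e = 0\<close> none can exist. The flag is only set
  when \<open>F\<close> is short.\<close>

definition valid :: "nat \<Rightarrow> nat \<Rightarrow> state \<Rightarrow> bool" where
  "valid e k0 s \<longleftrightarrow> (\<exists>m X k F. s = (m, X, k, F) \<and> distinct X \<and> distinct F \<and> set X \<subseteq> Lits \<and> set F \<subseteq> Tops \<and>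
     antichain (set F) \<and> (\<forall>i \<in> set F. \<not> sem (set X) i \<and> t < dep i + e) \<and> k \<le> k0 \<and> (m \<longrightarrow> length F \<le> maxF k0))"

lemma validD:
  assumes "valid e k0 (m, X, k, F)"
  shows "distinct X" "distinct F" "set X \<subseteq> Lits" "set F \<subseteq> Tops" "antichain (set F)"
    "\<And>i. i \<in> set F \<Longrightarrow> \<not> sem (set X) i" "\<And>i. i \<in> set F \<Longrightarrow> t < dep i + e" "k \<le> k0" "m \<Longrightarrow> length F \<le> maxF k0"
  using assms by (auto simp: valid_def)

lemma mk_state_valid:
  assumes "set X \<subseteq> Lits" "set L \<subseteq> Lits" "set F \<subseteq> Tops" "antichain (set F)" "\<And>i. i \<in> set F \<Longrightarrow> t < dep i + e" "k \<le> k0"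
    and s: "s \<in> set (mk_state fuel ns X k L F)"
  shows "valid e k0 s \<and> \<not> fst s"
proof -
  obtain X' F' where e: "s = (False, X', k - card (set L - set X), F')"
    "distinct X'" "distinct F'" "set X' = set X \<union> set L" "set F' = {i \<in> set F. \<not> sem (set X \<union> set L) i}"
    by (rule mk_state_elem[OF assms(1-3) s]) (rule that)
  have "antichain (set F')" using antichain_subset[OF assms(4)] e(5) by blast
  then show ?thesis unfolding valid_def using e assms by auto
qed

text \<open>A lexicographic measure packed into one number: the budget, then the flag, then the
  missing depth of the pending gates, or their number once the flag is set. The factor of the budget
  exceeds every value of the remaining part.\<close>

definition weight :: "nat \<Rightarrow> state \<Rightarrow> nat" where
  "weight k0 s = fst (snd (snd s)) * (maxF k0 * t + maxF k0 + 3) +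
     (if fst s then length (snd (snd (snd s)))
      else (maxF k0 * t + 1 - (\<Sum>i \<in> set (snd (snd (snd s))). dep i)) + maxF k0 + 1)"

lemma weight_paid:
  assumes "s = (False, X', k - n, F')" "1 \<le> n" "n \<le> k"
  shows "weight k0 s < weight k0 (m, X, k, F)"
proof -
  let ?M = "maxF k0 * t + maxF k0 + 3"
  have "weight k0 s \<le> (k - n) * ?M + (?M - 1)" unfolding assms weight_def by simp
  also have "\<dots> < (k - n) * ?M + ?M" by simp
  also have "\<dots> = (k - n + 1) * ?M" by simp
  also have "\<dots> \<le> k * ?M" using assms by (intro mult_right_mono) auto
  finally show ?thesis unfolding weight_def by simp
qed

text \<open>Take \<open>p = 3 * k + 1\<close> candidates and count incidences with the
  \<open>m\<close> gates of \<open>F\<close>: \<open>p * m \<le> k * (2 * m + p * card H)\<close>,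
  where \<open>H\<close> has the gates above at least three of them. Since
  \<open>p - 2 * k = k + 1\<close>, this leaves \<open>m \<le> p * card H\<close>. Each gate of
  \<open>H\<close> belongs to one of at most \<open>p ^ 3\<close> triples of literals, and each
  triple has few common gates.\<close>

lemma many_cand_bound:
  assumes v: "valid e k0 (False, X, k, F)" and many: "3 * k < length (cand fuel ns X k F)"
  shows "length F \<le> maxF k0"
proof -
  note V = validD[OF v]
  let ?p = "3 * k + 1" and ?m = "length F" and ?N = minor_bound
  have m: "?m = card (set F)" using V(2) by (simp add: distinct_card)
  have "distinct (cand fuel ns X k F)" by (simp add: cand_def distinct_avail)
  then have "?p \<le> card (set (cand fuel ns X k F))" using many by (simp add: distinct_card)
  then obtain P where P: "P \<subseteq> set (cand fuel ns X k F)" "card P = ?p" "finite P" by (rule obtain_subset_with_card_n)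
  have PL: "P \<subseteq> Lits" using P(1) by (auto simp: cand_def avail_set)
  have degP: "?m \<le> k * card {i \<in> set F. (x, i) \<in> W\<^sup>*}" if "x \<in> P" for x
  proof -
    have "x \<in> set (cand fuel ns X k F)" "x \<in> Lits" using that P(1) PL by blast+
    then show ?thesis using deg_card[OF V(2,4), of x] by (simp add: cand_def)
  qed
  define a where "a i = card {x \<in> P. (x, i) \<in> W\<^sup>*}" for i
  define H where "H = {i \<in> set F. 3 \<le> a i}"
  have dbl: "(\<Sum>x \<in> P. card {i \<in> set F. (x, i) \<in> W\<^sup>*}) = (\<Sum>i \<in> set F. a i)"
    unfolding a_def card_filter_sum[OF P(3)] card_filter_sum[OF finite_set] by (rule sum.swap)
  have aH: "a i \<le> 2 + (if i \<in> H then ?p else 0)" if "i \<in> set F" for i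
  proof (cases "3 \<le> a i")
    case True
    have "a i \<le> card P" unfolding a_def using P(3) by (intro card_mono) auto
    then show ?thesis using True that P(2) by (simp add: H_def)
  next
    case False then show ?thesis by simp
  qed
  have "(\<Sum>i \<in> set F. a i) \<le> (\<Sum>i \<in> set F. 2 + (if i \<in> H then ?p else 0))" using aH by (intro sum_mono)
  also have "\<dots> = 2 * ?m + ?p * card H"
    unfolding sum.distrib H_def m by (simp add: sum.If_cases Int_def conj_commute)
  finally have sum_le: "(\<Sum>i \<in> set F. a i) \<le> 2 * ?m + ?p * card H" .
  have "?p * ?m \<le> k * (2 * ?m + ?p * card H)"
  proof -
    have "?p * ?m = (\<Sum>x \<in> P. ?m)" using P(2) by simp
    also have "\<dots> \<le> (\<Sum>x \<in> P. k * card {i \<in> set F. (x, i) \<in> W\<^sup>*})" using degP by (intro sum_mono)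
    also have "\<dots> = k * (\<Sum>i \<in> set F. a i)" unfolding sum_distrib_left[symmetric] dbl ..
    also have "\<dots> \<le> k * (2 * ?m + ?p * card H)" using sum_le by (intro mult_left_mono) auto
    finally show ?thesis .
  qed
  then have "(k + 1) * ?m \<le> k * (?p * card H)" by (simp add: algebra_simps)
  also have "\<dots> \<le> (k + 1) * (?p * card H)" by (intro mult_right_mono) auto
  finally have mH: "?m \<le> ?p * card H" by (metis Suc_eq_plus1 Suc_mult_le_cancel1)
  have "H \<subseteq> (\<Union>(x, y, z) \<in> {(x, y, z). x \<in> P \<and> y \<in> P \<and> z \<in> P \<and> x \<noteq> y \<and> x \<noteq> z \<and> y \<noteq> z}.
      {i \<in> set F. (x, i) \<in> W\<^sup>* \<and> (y, i) \<in> W\<^sup>* \<and> (z, i) \<in> W\<^sup>*})" (is "_ \<subseteq> (\<Union>w \<in> ?T. ?A w)")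
  proof
    fix i assume i: "i \<in> H"
    then have "3 \<le> card {x \<in> P. (x, i) \<in> W\<^sup>*}" by (simp add: H_def a_def)
    then obtain x y z where "x \<in> {x \<in> P. (x, i) \<in> W\<^sup>*}" "y \<in> {x \<in> P. (x, i) \<in> W\<^sup>*}" "z \<in> {x \<in> P. (x, i) \<in> W\<^sup>*}"
      "x \<noteq> y" "x \<noteq> z" "y \<noteq> z" by (rule distinct_triple)
    then show "i \<in> (\<Union>w \<in> ?T. ?A w)" using i by (auto simp: H_def intro!: bexI[of _ "(x, y, z)"])
  qed
  moreover have T: "?T \<subseteq> P \<times> P \<times> P" by auto
  then have finT: "finite ?T" using P(3) finite_subset by blast
  ultimately have "card H \<le> card (\<Union>w \<in> ?T. ?A w)" by (intro card_mono) auto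
  also have "\<dots> \<le> card ?T * ?N"
  proof (rule card_UN_bound[OF finT])
    fix w assume "w \<in> ?T"
    then show "card (?A w) \<le> ?N" using three_lits_bound[OF V(4,5)] PL by auto
  qed
  also have "\<dots> \<le> ?p ^ 3 * ?N"
  proof (rule mult_right_mono)
    have "card ?T \<le> card (P \<times> P \<times> P)" using P(3) by (intro card_mono T) auto
    also have "\<dots> = card P ^ 3" by (simp add: card_cartesian_product power3_eq_cube)
    finally show "card ?T \<le> ?p ^ 3" unfolding P(2) .
  qed simp
  finally have "card H \<le> ?p ^ 3 * ?N" .
  then have "?m \<le> ?p * (?p ^ 3 * ?N)" using mH mult_le_mono2 le_trans by blast
  also have "\<dots> = ?p ^ 4 * ?N" by (simp only: power4_eq_xxxx power3_eq_cube mult.assoc)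
  also have "\<dots> \<le> maxF k0" unfolding maxF_def using V(8) by (intro mult_right_mono power_mono) auto
  finally show ?thesis .
qed

text \<open>Each such literal lies below some triple of gates of \<open>F\<close>, and each triple
  shares few literals.\<close>

lemma special_bound:
  assumes v: "valid e k0 (False, X, k, F)" and len: "length F \<le> B"
  shows "length (special fuel ns X F) \<le> B ^ 3 * minor_bound"
proof -
  note V = validD[OF v]
  have L: "length (special fuel ns X F) = card (set (special fuel ns X F))"
    by (rule distinct_card[symmetric]) (simp add: special_def distinct_avail)
  let ?T = "{(i, j, l). i \<in> set F \<and> j \<in> set F \<and> l \<in> set F \<and> i \<noteq> j \<and> i \<noteq> l \<and> j \<noteq> l}"
  let ?A = "\<lambda>(i, j, l). {x \<in> Lits. (x, i) \<in> W\<^sup>* \<and> (x, j) \<in> W\<^sup>* \<and> (x, l) \<in> W\<^sup>*}"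
  have "set (special fuel ns X F) \<subseteq> (\<Union>w \<in> ?T. ?A w)"
  proof
    fix x assume "x \<in> set (special fuel ns X F)"
    then have x: "x \<in> Lits" "3 \<le> deg fuel ns F x" by (auto simp: special_def avail_set)
    then have "3 \<le> card {i \<in> set F. (x, i) \<in> W\<^sup>*}" using deg_card[OF V(2,4)] by simp
    then obtain i j l where "i \<in> {i \<in> set F. (x, i) \<in> W\<^sup>*}" "j \<in> {i \<in> set F. (x, i) \<in> W\<^sup>*}" "l \<in> {i \<in> set F. (x, i) \<in> W\<^sup>*}"
      "i \<noteq> j" "i \<noteq> l" "j \<noteq> l" by (rule distinct_triple)
    then show "x \<in> (\<Union>w \<in> ?T. ?A w)" using x by (auto intro!: bexI[of _ "(i, j, l)"])
  qed
  moreover have T: "?T \<subseteq> set F \<times> set F \<times> set F" by auto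
  then have finT: "finite ?T" by (rule finite_subset) auto
  moreover have "finite (\<Union>w \<in> ?T. ?A w)" using finT finite_Lits by (auto intro!: finite_UN_I)
  ultimately have "card (set (special fuel ns X F)) \<le> card (\<Union>w \<in> ?T. ?A w)" by (intro card_mono) auto
  also have "\<dots> \<le> card ?T * minor_bound"
  proof (rule card_UN_bound[OF finT])
    fix w assume "w \<in> ?T"
    then show "card (?A w) \<le> minor_bound" using three_gates_bound[OF V(4,5)] by auto
  qed
  also have "\<dots> \<le> B ^ 3 * minor_bound"
  proof (rule mult_right_mono)
    have "card ?T \<le> length F ^ 3"
      using card_mono[OF _ T] V(2) by (simp add: card_cartesian_product power3_eq_cube distinct_card)
    also have "\<dots> \<le> B ^ 3" using len by (intro power_mono) auto
    finally show "card ?T \<le> B ^ 3" .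
  qed simp
  finally show ?thesis using L by simp
qed

lemma linkedD:
  assumes v: "valid e k0 (False, X, k, F)" and i: "i \<in> set F" "(c, i) \<in> W" and j: "j \<in> set F" "j \<noteq> i"
    and l: "linked fuel ns X F c j"
  shows "\<exists>x. x \<in> Lits \<and> (x, c) \<in> W\<^sup>* \<and> (x, i) \<in> W\<^sup>* \<and> (x, j) \<in> W\<^sup>* \<and> (\<forall>m \<in> set F. (x, m) \<in> W\<^sup>* \<longrightarrow> m = i \<or> m = j)"
proof -
  note V = validD[OF v]
  have co: "(c, out) \<in> W\<^sup>*" using V(4) i TopsD(1) by (meson converse_rtrancl_into_rtrancl subsetD)
  have jo: "(j, out) \<in> W\<^sup>*" using V(4) j TopsD(1) by blast
  obtain x where x: "x \<in> Lits" "deg fuel ns F x \<le> 2" "(x, c) \<in> W\<^sup>*" "(x, j) \<in> W\<^sup>*"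
    using l unfolding linked_def list_ex_iff avail_set touch_iff[OF co] touch_iff[OF jo] by blast
  have xi: "(x, i) \<in> W\<^sup>*" using x(3) i(2) by (rule rtrancl_into_rtrancl)
  have "m = i \<or> m = j" if m: "m \<in> set F" "(x, m) \<in> W\<^sup>*" for m
  proof (rule ccontr)
    assume "\<not> (m = i \<or> m = j)"
    then have "card {m, i, j} = 3" using j by simp
    moreover have "card {m, i, j} \<le> card {i \<in> set F. (x, i) \<in> W\<^sup>*}"
      using m i j x xi by (intro card_mono) auto
    ultimately show False using x(2) deg_card[OF V(2,4) x(1)] by simp
  qed
  then show ?thesis using x xi by blast
qed

text \<open>Each such item is charged to a pair of other gates it is linked to;
  \<open>items_bound\<close> limits the items of one pair.\<close>

lemma special_items_bound:
  assumes v: "valid e k0 (False, X, k, F)" and len: "length F \<le> B" and i: "i \<in> set F"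
  shows "length (filter (special_item fuel ns X F i) (preds (node_at ns i))) \<le> B ^ 2 * minor_bound"
proof -
  note V = validD[OF v]
  have iT: "i \<in> Tops" using V(4) i by blast
  let ?l = "filter (special_item fuel ns X F i) (preds (node_at ns i))"
  have "distinct (preds (node_at ns i))"
    using wf TopsD(3)[OF iT] by (simp add: node_at_eq wf_circuit_def)
  then have L: "length ?l = card (set ?l)" by (intro distinct_card[symmetric]) simp
  define sh where "sh j = {x \<in> Lits. (x, i) \<in> W\<^sup>* \<and> (x, j) \<in> W\<^sup>* \<and> (\<forall>m \<in> set F. (x, m) \<in> W\<^sup>* \<longrightarrow> m = i \<or> m = j)}" for j
  let ?T = "{(j, l). j \<in> set F \<and> l \<in> set F \<and> i \<noteq> j \<and> i \<noteq> l \<and> j \<noteq> l}"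
  let ?A = "\<lambda>(j, l). {c. (c, i) \<in> W \<and> gate c \<and> (\<exists>x \<in> sh j. (x, c) \<in> W\<^sup>*) \<and> (\<exists>x \<in> sh l. (x, c) \<in> W\<^sup>*)}"
  have "set ?l \<subseteq> (\<Union>w \<in> ?T. ?A w)"
  proof
    fix c assume "c \<in> set ?l"
    then have c: "(c, i) \<in> W" "special_item fuel ns X F i c" using preds_set[OF TopsD(3)[OF iT]] by auto
    have "2 \<le> card {j \<in> set F. j \<noteq> i \<and> linked fuel ns X F c j}"
      using c(2) distinct_card[of "filter (\<lambda>j. j \<noteq> i \<and> linked fuel ns X F c j) F"] V(2)
      unfolding special_item_def by (simp add: conj_commute)
    then obtain j l where jl: "j \<in> {j \<in> set F. j \<noteq> i \<and> linked fuel ns X F c j}"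
      "l \<in> {j \<in> set F. j \<noteq> i \<and> linked fuel ns X F c j}" "j \<noteq> l" by (rule distinct_pair)
    obtain x where x: "x \<in> sh j" "(x, c) \<in> W\<^sup>*" using linkedD[OF v i c(1), of j] jl unfolding sh_def by auto
    obtain y where y: "y \<in> sh l" "(y, c) \<in> W\<^sup>*" using linkedD[OF v i c(1), of l] jl unfolding sh_def by auto
    \<comment> \<open>If \<open>c\<close> were a literal, both shared literals would be
      \<open>c\<close> itself, which would then lie below three gates of \<open>F\<close>.\<close>
    have "gate c"
    proof (rule ccontr)
      assume ng: "\<not> gate c"
      then have top: "z = c" if "(z, c) \<in> W\<^sup>*" for z using that wire_gate by (metis rtrancl.simps)
      have "x = c" "y = c" using top x y by blast+
      then show False using x(1) y(1) jl unfolding sh_def by auto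
    qed
    then show "c \<in> (\<Union>w \<in> ?T. ?A w)" using c(1) x y jl by (auto intro!: bexI[of _ "(j, l)"])
  qed
  moreover have T: "?T \<subseteq> set F \<times> set F" by auto
  then have finT: "finite ?T" by (rule finite_subset) auto
  moreover have "finite (\<Union>w \<in> ?T. ?A w)"
    by (rule finite_subset[of _ "{..<length ns}"]) (auto dest: wire_verts)
  ultimately have "card (set ?l) \<le> card (\<Union>w \<in> ?T. ?A w)" by (intro card_mono) auto
  also have "\<dots> \<le> card ?T * minor_bound"
  proof (rule card_UN_bound[OF finT])
    fix w assume "w \<in> ?T"
    then show "card (?A w) \<le> minor_bound" using items_bound[OF V(4,5) i] unfolding sh_def by auto
  qed
  also have "\<dots> \<le> B ^ 2 * minor_bound"
  proof (rule mult_right_mono)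
    have "card ?T \<le> length F ^ 2"
      using card_mono[OF _ T] V(2) by (simp add: card_cartesian_product power2_eq_square distinct_card)
    also have "\<dots> \<le> B ^ 2" using len by (intro power_mono) auto
    finally show "card ?T \<le> B ^ 2" .
  qed simp
  finally show ?thesis using L by simp
qed

end

lemma in_concat_map: "x \<in> set xs \<Longrightarrow> y \<in> set (f x) \<Longrightarrow> y \<in> set (concat (map f xs))"
  by auto

context mono_circuit
begin

subsection \<open>Every step decreases the weight\<close>

lemma mk_state_length: "length (mk_state d ns X k L F) \<le> 1"
  by (simp add: mk_state_def)

lemma sum_dep_le: "set F \<subseteq> Tops \<Longrightarrow> distinct F \<Longrightarrow> (\<Sum>i \<in> set F. dep i) \<le> length F * t"
proof -
  assume F: "set F \<subseteq> Tops" "distinct F"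
  have "(\<Sum>i \<in> set F. dep i) \<le> (\<Sum>i \<in> set F. t)" using F dep_le TopsD(1) by (intro sum_mono) auto
  then show ?thesis using F by (simp add: distinct_card)
qed

lemma var_branch_step:
  assumes v: "valid e k0 (False, X, k, F)" and x: "x \<in> set (avail ns X)" and s: "s \<in> set (mk_state fuel ns X k [x] F)"
  shows "valid e k0 s \<and> weight k0 s < weight k0 (False, X, k, F)"
proof -
  note V = validD[OF v]
  have xL: "x \<in> Lits" "x \<notin> set X" using x by (auto simp: avail_set)
  have L: "set [x] \<subseteq> Lits" using xL by simp
  have val: "valid e k0 s" using mk_state_valid[OF V(3) L V(4,5,7,8) s] by blast
  obtain X' F' where e: "s = (False, X', k - card (set [x] - set X), F')" "card (set [x] - set X) \<le> k"
    by (rule mk_state_elem[OF V(3) L V(4) s]) (rule that)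
  have "set [x] - set X = {x}" using xL by auto
  then have "card (set [x] - set X) = 1" by simp
  then show ?thesis using val weight_paid[OF e(1) _ e(2)] by simp
qed

text \<open>Either a new literal is paid for, or all literals of the item are already set. In the
  latter case \<open>i\<close> is false because some OR-gate below the item is, and this gate
  replaces \<open>i\<close> two levels deeper.\<close>

lemma item_branch_step:
  assumes v: "valid e k0 (False, X, k, F)" and len: "length F \<le> maxF k0" and i: "i \<in> set F" "(c, i) \<in> W"
    and s: "s \<in> set (mk_state fuel ns X k (lits ns c) (filter (\<lambda>j. j \<noteq> i) F @ ors ns c))"
  shows "valid e k0 s \<and> weight k0 s < weight k0 (False, X, k, F)"
proof -
  note V = validD[OF v]
  have iT: "i \<in> Tops" using V(4) i by blast
  have ic: "item c" by (rule item_pred[OF iT i(2)])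
  let ?F = "filter (\<lambda>j. j \<noteq> i) F @ ors ns c"
  have sF: "set ?F = set F - {i} \<union> set (ors ns c)" by auto
  have FT: "set ?F \<subseteq> Tops" using V(4) item_orsD(1)[OF ic] by auto
  have an: "antichain (set ?F)" unfolding sF by (rule antichain_expand[OF V(4,5) i])
  have dp: "t < dep j + e" if "j \<in> set ?F" for j
    using that V(7) i item_dep[OF iT i(2), of j] by fastforce
  have val: "valid e k0 s" using mk_state_valid[OF V(3) item_lits[OF ic] FT an dp V(8) s] by blast
  obtain X' F' where e: "s = (False, X', k - card (set (lits ns c) - set X), F')" "card (set (lits ns c) - set X) \<le> k"
    "set X' = set X \<union> set (lits ns c)" "set F' = {i \<in> set ?F. \<not> sem (set X \<union> set (lits ns c)) i}"
    by (rule mk_state_elem[OF V(3) item_lits[OF ic] FT s]) (rule that)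
  show ?thesis
  proof (cases "card (set (lits ns c) - set X) = 0")
    case False
    then have "1 \<le> card (set (lits ns c) - set X)" by linarith
    from weight_paid[OF e(1) this e(2)] show ?thesis using val by blast
  next
    case True
    then have LX: "set (lits ns c) \<subseteq> set X" by auto
    then have XX: "set X \<union> set (lits ns c) = set X" by blast
    have "\<not> sem (set X) c" using V(6)[OF i(1)] top_sem[OF iT] i(2) by blast
    then obtain j where j: "j \<in> set (ors ns c)" "\<not> sem (set X) j" using item_sem[OF ic] LX by blast
    have jn: "j \<notin> set F - {i}"
    proof
      assume "j \<in> set F - {i}"
      moreover have "(j, i) \<in> W\<^sup>*" using item_orsD(3)[OF ic j(1)] i(2) by (meson r_into_rtrancl rtrancl_into_rtrancl)
      ultimately show False using V(5) i(1) by (auto simp: antichain_def)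
    qed
    have sub: "insert j (set F - {i}) \<subseteq> set F'" unfolding e(4) XX using j V(6) by auto
    have "(\<Sum>i \<in> set F. dep i) + 2 = dep i + 2 + (\<Sum>i \<in> set F - {i}. dep i)"
      using i(1) by (simp add: sum.remove[of _ i])
    also have "\<dots> = (\<Sum>i \<in> insert j (set F - {i}). dep i)" using jn item_dep[OF iT i(2) j(1)] by simp
    also have "\<dots> \<le> (\<Sum>i \<in> set F'. dep i)" using sub by (intro sum_mono2) auto
    finally have up: "(\<Sum>i \<in> set F. dep i) + 2 \<le> (\<Sum>i \<in> set F'. dep i)" .
    \<comment> \<open>Hence the truncated difference in the weight is positive before the step, and
      raising the depth sum lowers it strictly even if it is truncated afterwards.\<close>
    have "(\<Sum>i \<in> set F. dep i) \<le> maxF k0 * t"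
      using sum_dep_le[OF V(4,2)] mult_right_mono[OF len, of t] by linarith
    then have "maxF k0 * t + 1 - (\<Sum>i \<in> set F'. dep i) < maxF k0 * t + 1 - (\<Sum>i \<in> set F. dep i)" using up by linarith
    then have "weight k0 s < weight k0 (False, X, k, F)" unfolding e(1) True weight_def by simp
    then show ?thesis using val by blast
  qed
qed

lemma branches_cases:
  assumes "s \<in> set (branches d ns False X k F)"
  obtains (var) x where "x \<in> set (avail ns X)" "s \<in> set (mk_state d ns X k [x] F)"
  | (item) i c where "3 * k < length (cand d ns X k F)" "i \<in> set F" "c \<in> set (preds (node_at ns i))"
      "s \<in> set (mk_state d ns X k (lits ns c) (filter (\<lambda>j. j \<noteq> i) F @ ors ns c))"
  | (groups) "3 * k < length (cand d ns X k F)" "s = (True, X, k, F)"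
proof (cases "length (cand d ns X k F) \<le> 3 * k")
  case True
  then obtain x where "x \<in> set (cand d ns X k F)" "s \<in> set (mk_state d ns X k [x] F)"
    using assms by (auto simp: branches_def var_branches_def)
  then show ?thesis using var by (auto simp: cand_def)
next
  case False
  then have "s \<in> set (var_branches d ns X k F (special d ns X F)) \<or> s \<in> set (item_branches d ns X k F) \<or> s = (True, X, k, F)"
    using assms unfolding branches_def by auto
  then show ?thesis
  proof (elim disjE)
    assume "s \<in> set (var_branches d ns X k F (special d ns X F))"
    then show ?thesis using var by (auto simp: var_branches_def special_def)
  next
    assume "s \<in> set (item_branches d ns X k F)"
    then obtain i c where "i \<in> set F" "c \<in> set (preds (node_at ns i))"
      "s \<in> set (if special_item d ns X F i c
        then mk_state d ns X k (lits ns c) (filter (\<lambda>j. j \<noteq> i) F @ ors ns c) else [])"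
      by (auto simp: item_branches_def)
    then show ?thesis using item[of i c] False by (simp split: if_splits)
  next
    assume "s = (True, X, k, F)"
    then show ?thesis using groups False by simp
  qed
qed

lemma branches_step:
  assumes v: "valid e k0 (False, X, k, F)" and s: "s \<in> set (branches fuel ns False X k F)"
  shows "valid e k0 s \<and> weight k0 s < weight k0 (False, X, k, F)"
  using s
proof (cases rule: branches_cases)
  case (var x)
  then show ?thesis using var_branch_step[OF v] by blast
next
  case (item i c)
  have "(c, i) \<in> W" using item(2,3) preds_set[OF TopsD(3)] validD(4)[OF v] by blast
  then show ?thesis using item_branch_step[OF v many_cand_bound[OF v item(1)] item(2) _ item(4)] by blast
next
  case groups
  have "length F \<le> maxF k0" by (rule many_cand_bound[OF v groups(1)])
  then show ?thesis using v groups(2) by (auto simp: valid_def weight_def)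
qed

lemma groups_elem:
  assumes "y \<in> set (groups d ns True X k F)"
  obtains i j b where "i \<in> set F" "j \<in> set F" "b \<le> k"
    "y = (group_states d ns X b i j, (True, X, k - b, filter (\<lambda>l. l \<noteq> i \<and> l \<noteq> j) F))"
  using assms by (auto simp: groups_def less_Suc_eq_le simp del: upt_Suc)

lemma groups_step:
  assumes v: "valid e k0 (True, X, k, F)" and y: "y \<in> set (groups fuel ns True X k F)"
  shows "valid e k0 (snd y) \<and> weight k0 (snd y) < weight k0 (True, X, k, F)"
proof -
  note V = validD[OF v]
  obtain i j b where i: "i \<in> set F" "j \<in> set F" "b \<le> k"
    "y = (group_states fuel ns X b i j, (True, X, k - b, filter (\<lambda>l. l \<noteq> i \<and> l \<noteq> j) F))"
    by (rule groups_elem[OF y]) (rule that)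
  let ?F = "filter (\<lambda>l. l \<noteq> i \<and> l \<noteq> j) F"
  have lt: "length ?F < length F" using i(1) by (intro length_filter_less) auto
  have an: "antichain (set ?F)" by (rule antichain_subset[OF V(5)]) auto
  have "valid e k0 (snd y)" unfolding valid_def i(4) using V an lt by auto
  moreover have "weight k0 (snd y) < weight k0 (True, X, k, F)"
    unfolding weight_def i(4) using lt by (simp add: add_le_less_mono mult_right_mono del: add_mult_distrib2)
  ultimately show ?thesis by blast
qed

lemma group_states_elem:
  assumes "i \<in> Tops" "j \<in> Tops"
  shows "q \<in> set (group_states d ns X b i j) \<longleftrightarrow> (\<exists>c c'. (c, i) \<in> W \<and> (c', j) \<in> W \<and>
     q \<in> set (mk_state d ns X b (lits ns c @ lits ns c') (ors ns c @ ors ns c')))"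
  using preds_set[OF TopsD(3)[OF assms(1)]] preds_set[OF TopsD(3)[OF assms(2)]]
  by (auto simp: group_states_def)

text \<open>The gates of a query lie two levels deeper than those of \<open>F\<close>, which more
  than pays for the oracle level that is used up.\<close>

lemma group_query_valid:
  assumes v: "valid (Suc e) k0 (True, X, k, F)" and ij: "i \<in> set F" "j \<in> set F" and b: "b \<le> k"
    and q: "q \<in> set (group_states fuel ns X b i j)"
  shows "valid e k0 q \<and> \<not> fst q"
proof -
  note V = validD[OF v]
  have T: "i \<in> Tops" "j \<in> Tops" using V(4) ij by blast+
  obtain c c' where c: "(c, i) \<in> W" "(c', j) \<in> W"
    "q \<in> set (mk_state fuel ns X b (lits ns c @ lits ns c') (ors ns c @ ors ns c'))"
    using q unfolding group_states_elem[OF T] by blast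
  have it: "item c" "item c'" using item_pred T c by blast+
  have "set (lits ns c @ lits ns c') \<subseteq> Lits" using item_lits it by auto
  moreover have "set (ors ns c @ ors ns c') \<subseteq> Tops" using item_orsD(1) it by auto
  moreover have "antichain (set (ors ns c @ ors ns c'))"
    using antichain_items[OF V(4,5) ij(1) c(1) ij(2) c(2)] by simp
  moreover have "t < dep l + e" if "l \<in> set (ors ns c @ ors ns c')" for l
    using that item_dep[OF T(1) c(1), of l] item_dep[OF T(2) c(2), of l] V(7)[OF ij(1)] V(7)[OF ij(2)] by auto
  ultimately show ?thesis using mk_state_valid[OF V(3) _ _ _ _ _ c(3)] V(8) b by auto
qed

text \<open>The summands bound the candidates, the special literals and special items together, the
  switch of the flag, and the pairs of gates with a budget share.\<close>

definition max_branch :: "nat \<Rightarrow> nat" where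
  "max_branch k0 = 3 * k0 + 2 * (maxF k0 ^ 3 * minor_bound) + 1 + maxF k0 * (maxF k0 * (k0 + 1))"

lemma succs_eq:
  "succs d orc (ns, (m, X, k, F)) = branches d ns m X k F @
     map snd (filter (\<lambda>y. list_ex (\<lambda>q. orc (ns, q)) (fst y)) (groups d ns m X k F))"
  by (simp add: succs_def branches_at_def groups_at_def)

lemma succs_length:
  assumes v: "valid e k0 (m, X, k, F)"
  shows "length (succs fuel orc (ns, (m, X, k, F))) \<le> max_branch k0"
proof (cases m)
  case True
  note V = validD[OF v]
  have "length (groups fuel ns True X k F) \<le> length F * (length F * (k + 1))"
    unfolding groups_def if_True by (intro length_concat_map_le) simp
  also have "\<dots> \<le> maxF k0 * (maxF k0 * (k0 + 1))" using V(8) V(9)[OF True] by (intro mult_mono add_mono) auto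
  finally have "length (groups fuel ns True X k F) \<le> maxF k0 * (maxF k0 * (k0 + 1))" .
  moreover have "length (succs fuel orc (ns, (True, X, k, F))) \<le> length (groups fuel ns True X k F)"
    unfolding succs_eq by (simp add: branches_def)
  moreover have "(m, X, k, F) = (True, X, k, F)" using True by simp
  ultimately show ?thesis by (simp add: max_branch_def)
next
  case False
  have v': "valid e k0 (False, X, k, F)" using v False by simp
  note V = validD[OF v']
  have vb: "length (var_branches fuel ns X k F xs) \<le> length xs" for xs
  proof -
    have "length (concat (map (\<lambda>x. mk_state fuel ns X k [x] F) xs)) \<le> length xs * 1"
      by (rule length_concat_map_le) (rule mk_state_length)
    then show ?thesis by (simp add: var_branches_def)
  qed
  have "length (branches fuel ns False X k F) \<le> max_branch k0"
  proof (cases "length (cand fuel ns X k F) \<le> 3 * k")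
    case True
    then show ?thesis using vb[of "cand fuel ns X k F"] V(8) by (simp add: branches_def max_branch_def)
  next
    case many: False
    then have len: "length F \<le> maxF k0" using many_cand_bound[OF v'] by simp
    have "length (item_branches fuel ns X k F) \<le> length F * (maxF k0 ^ 2 * minor_bound)"
      unfolding item_branches_def
    proof (rule length_concat_map_le)
      fix i assume i: "i \<in> set F"
      have "length (concat (map (\<lambda>c. if special_item fuel ns X F i c
          then mk_state fuel ns X k (lits ns c) (filter (\<lambda>j. j \<noteq> i) F @ ors ns c) else []) (preds (node_at ns i))))
         \<le> length (filter (special_item fuel ns X F i) (preds (node_at ns i)))"
        by (rule length_concat_map_if) (rule mk_state_length)
      also have "\<dots> \<le> maxF k0 ^ 2 * minor_bound" by (rule special_items_bound[OF v' len i])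
      finally show "length (concat (map (\<lambda>c. if special_item fuel ns X F i c
          then mk_state fuel ns X k (lits ns c) (filter (\<lambda>j. j \<noteq> i) F @ ors ns c) else []) (preds (node_at ns i))))
         \<le> maxF k0 ^ 2 * minor_bound" .
    qed
    also have "\<dots> \<le> maxF k0 * (maxF k0 ^ 2 * minor_bound)" using len by (intro mult_right_mono) auto
    also have "\<dots> = maxF k0 ^ 3 * minor_bound" by (simp add: power2_eq_square power3_eq_cube)
    finally have "length (item_branches fuel ns X k F) \<le> maxF k0 ^ 3 * minor_bound" .
    moreover have "length (var_branches fuel ns X k F (special fuel ns X F)) \<le> maxF k0 ^ 3 * minor_bound"
      using vb[of "special fuel ns X F"] special_bound[OF v' len] by linarith
    ultimately show ?thesis using many by (simp add: branches_def max_branch_def)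
  qed
  then show ?thesis unfolding succs_eq using False by (simp add: groups_def)
qed

lemma succs_step:
  assumes v: "valid e k0 s" and s': "s' \<in> set (succs fuel orc (ns, s))"
  shows "valid e k0 s' \<and> weight k0 s' < weight k0 s"
proof -
  obtain m X k F where s: "s = (m, X, k, F)" by (metis surj_pair)
  show ?thesis
  proof (cases m)
    case True
    then obtain y where "y \<in> set (groups fuel ns True X k F)" "s' = snd y"
      using s' unfolding s succs_eq by (auto simp: branches_def)
    then show ?thesis using groups_step[of e k0 X k F y] v s True by simp
  next
    case False
    then have "s' \<in> set (branches fuel ns False X k F)" using s' unfolding s succs_eq by (simp add: groups_def)
    then show ?thesis using branches_step[of e k0 X k F s'] v s False by simp
  qed
qed

subsection \<open>Soundness\<close>

lemma sat_branch:
  assumes "valid e k0 (False, X, k, F)" "set L \<subseteq> Lits" "set G \<subseteq> Tops" "s \<in> set (mk_state fuel ns X k L G)" "SATs s"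
  shows "\<exists>S \<subseteq> Lits. card S \<le> k \<and> set L \<subseteq> set X \<union> S \<and> (\<forall>i \<in> set G. sem (set X \<union> S) i)"
  using mk_state_SAT[OF validD(3)[OF assms(1)] assms(2,3)] assms(4,5) by blast

lemma branches_sound:
  assumes v: "valid e k0 (False, X, k, F)" and s: "s \<in> set (branches fuel ns False X k F)" and sat: "SATs s"
  shows "SATs (False, X, k, F)"
  using s
proof (cases rule: branches_cases)
  case (var x)
  have "set [x] \<subseteq> Lits" using var(1) by (simp add: avail_set)
  from sat_branch[OF v this validD(4)[OF v] var(2) sat] show ?thesis by (auto simp: SATs_def SAT_def)
next
  case (item i c)
  have T: "i \<in> Tops" using validD(4)[OF v] item(2) by blast
  have ci: "(c, i) \<in> W" using item(3) preds_set[OF TopsD(3)[OF T]] by blast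
  have ic: "item c" by (rule item_pred[OF T ci])
  let ?G = "filter (\<lambda>j. j \<noteq> i) F @ ors ns c"
  have "set ?G \<subseteq> Tops" using validD(4)[OF v] item_orsD(1)[OF ic] by auto
  from sat_branch[OF v item_lits[OF ic] this item(4) sat] obtain S where
    S: "S \<subseteq> Lits" "card S \<le> k" "set (lits ns c) \<subseteq> set X \<union> S" "\<forall>j \<in> set ?G. sem (set X \<union> S) j" by blast
  have "sem (set X \<union> S) c" using item_sem[OF ic] S(3,4) by auto
  then have "sem (set X \<union> S) i" using top_sem[OF T] ci by blast
  then have "\<forall>j \<in> set F. sem (set X \<union> S) j" using S(4) by auto
  then show ?thesis using S(1,2) by (auto simp: SATs_def SAT_def)
next
  case groups
  then show ?thesis using sat by (simp add: SATs_def)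
qed

lemma group_SAT:
  assumes v: "valid (Suc e) k0 (True, X, k, F)" and ij: "i \<in> set F" "j \<in> set F"
  shows "(\<exists>q \<in> set (group_states fuel ns X b i j). SATs q) \<longleftrightarrow>
    (\<exists>c c'. (c, i) \<in> W \<and> (c', j) \<in> W \<and> (\<exists>S \<subseteq> Lits. card S \<le> b \<and> sem (set X \<union> S) c \<and> sem (set X \<union> S) c'))"
proof -
  note V = validD[OF v]
  have T: "i \<in> Tops" "j \<in> Tops" using V(4) ij by blast+
  have key: "(\<exists>q \<in> set (mk_state fuel ns X b (lits ns c @ lits ns c') (ors ns c @ ors ns c')). SATs q) \<longleftrightarrow>
      (\<exists>S \<subseteq> Lits. card S \<le> b \<and> sem (set X \<union> S) c \<and> sem (set X \<union> S) c')"
    if c: "(c, i) \<in> W" "(c', j) \<in> W" for c c'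
  proof -
    have it: "item c" "item c'" using item_pred T c by blast+
    have 1: "set (lits ns c @ lits ns c') \<subseteq> Lits" using item_lits it by auto
    have 2: "set (ors ns c @ ors ns c') \<subseteq> Tops" using item_orsD(1) it by auto
    show ?thesis unfolding mk_state_SAT[OF V(3) 1 2] item_sem[OF it(1)] item_sem[OF it(2)]
      by (rule ex_cong1) auto
  qed
  have "(\<exists>q \<in> set (group_states fuel ns X b i j). SATs q) \<longleftrightarrow> (\<exists>c c'. (c, i) \<in> W \<and> (c', j) \<in> W \<and>
      (\<exists>q \<in> set (mk_state fuel ns X b (lits ns c @ lits ns c') (ors ns c @ ors ns c')). SATs q))"
    unfolding Bex_def group_states_elem[OF T] by blast
  also have "\<dots> \<longleftrightarrow> (\<exists>c c'. (c, i) \<in> W \<and> (c', j) \<in> W \<and>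
      (\<exists>S \<subseteq> Lits. card S \<le> b \<and> sem (set X \<union> S) c \<and> sem (set X \<union> S) c'))"
    by (intro ex_cong1 conj_cong refl key)
  finally show ?thesis .
qed

text \<open>The union of the solutions for the group and for the rest satisfies all gates by
  monotonicity and has size at most \<open>b + (k - b)\<close>; overlaps only make it
  smaller.\<close>

lemma groups_sound:
  assumes v: "valid (Suc e) k0 (True, X, k, F)"
    and orc: "\<And>q. valid e k0 q \<Longrightarrow> \<not> fst q \<Longrightarrow> orc (ns, q) \<Longrightarrow> SATs q"
    and y: "y \<in> set (groups fuel ns True X k F)" and ex: "list_ex (\<lambda>q. orc (ns, q)) (fst y)" and sat: "SATs (snd y)"
  shows "SATs (True, X, k, F)"
proof -
  note V = validD[OF v]
  obtain i j b where i: "i \<in> set F" "j \<in> set F" "b \<le> k"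
    "y = (group_states fuel ns X b i j, (True, X, k - b, filter (\<lambda>l. l \<noteq> i \<and> l \<noteq> j) F))"
    by (rule groups_elem[OF y]) (rule that)
  obtain q where q: "q \<in> set (group_states fuel ns X b i j)" "orc (ns, q)" using ex unfolding list_ex_iff i(4) by auto
  then have "SATs q" using orc group_query_valid[OF v i(1,2,3) q(1)] by blast
  then obtain c c' S where c: "(c, i) \<in> W" "(c', j) \<in> W" and S: "S \<subseteq> Lits" "card S \<le> b" "sem (set X \<union> S) c" "sem (set X \<union> S) c'"
    using group_SAT[OF v i(1,2)] q(1) by blast
  obtain S' where S': "S' \<subseteq> Lits" "card S' \<le> k - b" "\<And>l. l \<in> set F \<Longrightarrow> l \<noteq> i \<Longrightarrow> l \<noteq> j \<Longrightarrow> sem (set X \<union> S') l"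
    using sat unfolding i(4) SATs_def SAT_def by auto
  have T: "i \<in> Tops" "j \<in> Tops" using V(4) i by blast+
  have ij: "sem (set X \<union> S) i" "sem (set X \<union> S) j" using top_sem T c S by blast+
  have "sem (set X \<union> (S \<union> S')) l" if l: "l \<in> set F" for l
  proof -
    have ll: "l < length ns" using V(4) l TopsD(3) by blast
    show ?thesis
    proof (cases "l = i \<or> l = j")
      case True
      then have "sem (set X \<union> S) l" using ij by blast
      then show ?thesis by (rule sem_mono[OF ll, rotated]) auto
    next
      case False
      then have "sem (set X \<union> S') l" using S' l by blast
      then show ?thesis by (rule sem_mono[OF ll, rotated]) auto
    qed
  qed
  moreover have "card (S \<union> S') \<le> k" using card_Un_le[of S S'] S S' i(3) by linarith
  ultimately show ?thesis using S S' unfolding SATs_def SAT_def by (intro exI[of _ "S \<union> S'"]) auto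
qed

lemma succs_sound:
  assumes v: "valid (Suc e) k0 s" and orc: "\<And>q. valid e k0 q \<Longrightarrow> \<not> fst q \<Longrightarrow> orc (ns, q) \<Longrightarrow> SATs q"
    and s': "s' \<in> set (succs fuel orc (ns, s))" "SATs s'"
  shows "SATs s"
proof -
  obtain m X k F where s: "s = (m, X, k, F)" by (metis surj_pair)
  show ?thesis
  proof (cases m)
    case True
    then obtain y where "y \<in> set (groups fuel ns True X k F)" "list_ex (\<lambda>q. orc (ns, q)) (fst y)" "s' = snd y"
      using s' unfolding s succs_eq by (auto simp: branches_def)
    then show ?thesis using groups_sound[of e k0 X k F orc y] orc v s s'(2) True by auto
  next
    case False
    then have "s' \<in> set (branches fuel ns False X k F)" using s' unfolding s succs_eq by (simp add: groups_def)
    then show ?thesis using branches_sound[of "Suc e" k0 X k F s'] v s s'(2) False by simp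
  qed
qed

subsection \<open>Completeness\<close>

text \<open>
  In a state with the flag set, the chosen items have supports \<open>U i\<close> that meet at most one other
  support each, so the gates split into groups of at most two with disjoint supports.
\<close>

definition splits :: "state \<Rightarrow> bool" where
  "splits s \<longleftrightarrow> (\<exists>c U. let X = set (fst (snd s)); F = set (snd (snd (snd s))) in
     (\<forall>i \<in> F. (c i, i) \<in> W \<and> U i \<subseteq> Lits \<and> sem (X \<union> U i) (c i)) \<and>
     (\<forall>i \<in> F. \<forall>j \<in> F. \<forall>l \<in> F. j \<noteq> i \<and> l \<noteq> i \<and> j \<noteq> l \<longrightarrow> U i \<inter> U j = {} \<or> U i \<inter> U l = {}) \<and>
     card (\<Union>i \<in> F. U i) \<le> fst (snd (snd s)))"

text \<open>For any \<open>i\<close>, let \<open>j\<close> be the one other gate whose support meets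
  that of \<open>i\<close>, or \<open>i\<close> itself. Applied at \<open>i\<close> and at
  \<open>j\<close>, the condition makes all other supports disjoint from these two, so the costs add
  up exactly.\<close>

lemma groups_complete:
  assumes v: "valid (Suc e) k0 (True, X, k, F)"
    and orc: "\<And>q. valid e k0 q \<Longrightarrow> \<not> fst q \<Longrightarrow> SATs q \<Longrightarrow> orc (ns, q)"
    and sp: "splits (True, X, k, F)" and ne: "F \<noteq> []"
  shows "\<exists>y \<in> set (groups fuel ns True X k F). list_ex (\<lambda>q. orc (ns, q)) (fst y) \<and> splits (snd y)"
proof -
  note V = validD[OF v]
  obtain c U where c: "\<And>i. i \<in> set F \<Longrightarrow> (c i, i) \<in> W \<and> U i \<subseteq> Lits \<and> sem (set X \<union> U i) (c i)"
    and U: "\<And>i j l. i \<in> set F \<Longrightarrow> j \<in> set F \<Longrightarrow> l \<in> set F \<Longrightarrow> j \<noteq> i \<Longrightarrow> l \<noteq> i \<Longrightarrow> j \<noteq> l \<Longrightarrow> U i \<inter> U j = {} \<or> U i \<inter> U l = {}"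
    and k: "card (\<Union>i \<in> set F. U i) \<le> k"
  proof -
    from sp[unfolded splits_def Let_def, simplified] obtain c U where
      "\<forall>i \<in> set F. (c i, i) \<in> W \<and> U i \<subseteq> Lits \<and> sem (set X \<union> U i) (c i)"
      "\<forall>i \<in> set F. \<forall>j \<in> set F. \<forall>l \<in> set F. j \<noteq> i \<and> l \<noteq> i \<and> j \<noteq> l \<longrightarrow> U i \<inter> U j = {} \<or> U i \<inter> U l = {}"
      "card (\<Union>i \<in> set F. U i) \<le> k" by auto
    then show ?thesis using that[of c U] by blast
  qed
  obtain i where i: "i \<in> set F" using ne by (meson list.set_sel(1))
  obtain j where j: "j \<in> set F" "j \<noteq> i \<Longrightarrow> U i \<inter> U j \<noteq> {}" "j = i \<Longrightarrow> (\<forall>l \<in> set F. l \<noteq> i \<longrightarrow> U i \<inter> U l = {})"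
    using i by metis
  let ?b = "card (U i \<union> U j)"
  let ?F = "filter (\<lambda>l. l \<noteq> i \<and> l \<noteq> j) F"
  have finU: "finite (U l)" if "l \<in> set F" for l using c[OF that] finite_Lits finite_subset by blast
  have disj: "(U i \<union> U j) \<inter> U l = {}" if l: "l \<in> set ?F" for l
  proof (cases "j = i")
    case True then show ?thesis using j(3) l by auto
  next
    case False
    have "U i \<inter> U l = {}" using U[of i j l] i j(1) j(2)[OF False] l False by auto
    moreover have "U j \<inter> U l = {}" using U[of j i l] i j(1) j(2)[OF False] l False by auto
    ultimately show ?thesis by blast
  qed
  have "card (\<Union>l \<in> set ?F. U l) + ?b = card ((\<Union>l \<in> set ?F. U l) \<union> (U i \<union> U j))"
  proof (rule card_Un_disjoint[symmetric])
    show "finite (\<Union>l \<in> set ?F. U l)" using finU by auto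
    show "finite (U i \<union> U j)" using finU i j by auto
    show "(\<Union>l \<in> set ?F. U l) \<inter> (U i \<union> U j) = {}" using disj by blast
  qed
  also have "\<dots> \<le> card (\<Union>i \<in> set F. U i)" using i j finU by (intro card_mono) auto
  finally have cost: "card (\<Union>l \<in> set ?F. U l) + ?b \<le> k" using k by linarith
  let ?y = "(group_states fuel ns X ?b i j, (True, X, k - ?b, ?F))"
  have y: "?y \<in> set (groups fuel ns True X k F)"
  proof -
    have "?b \<in> set [0..<Suc k]" using cost by (simp del: upt_Suc)
    then have "?y \<in> set (map (\<lambda>b. (group_states fuel ns X b i j, (True, X, k - b, ?F))) [0..<Suc k])"
      unfolding set_map by blast
    then show ?thesis
      unfolding groups_def if_True by (intro in_concat_map[OF i] in_concat_map[OF j(1)])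
  qed
  have T: "i \<in> Tops" "j \<in> Tops" using V(4) i j(1) by blast+
  have "sem (set X \<union> (U i \<union> U j)) (c l)" if "l = i \<or> l = j" for l
  proof (rule sem_mono)
    show "c l < length ns" using c[of l] that i j(1) wire_verts by blast
    show "sem (set X \<union> U l) (c l)" using c[of l] that i j(1) by blast
  qed (use that in auto)
  then have "\<exists>q \<in> set (group_states fuel ns X ?b i j). SATs q"
    unfolding group_SAT[OF v i j(1)] using c[OF i] c[OF j(1)]
    by (intro exI[of _ "c i"] exI[of _ "c j"] conjI exI[of _ "U i \<union> U j"]) auto
  then obtain q where q: "q \<in> set (group_states fuel ns X ?b i j)" "SATs q" by blast
  have "?b \<le> k" using cost by linarith
  then have "orc (ns, q)" using orc q group_query_valid[OF v i j(1) _ q(1)] by blast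
  then have "list_ex (\<lambda>q. orc (ns, q)) (fst ?y)" using q(1) by (auto simp: list_ex_iff)
  moreover have "splits (snd ?y)" unfolding splits_def Let_def
    using c U cost by (intro exI[of _ c] exI[of _ U]) auto
  ultimately show ?thesis using y by blast
qed

text \<open>A solution is followed: if it contains a branching literal or uses a special item, the
  corresponding branch keeps it. Otherwise its items interact in pairs and the flagged state
  splits.\<close>

lemma branches_complete:
  assumes v: "valid e k0 (False, X, k, F)" and sat: "SATs (False, X, k, F)" and ne: "F \<noteq> []"
  shows "\<exists>s \<in> set (branches fuel ns False X k F). if fst s then splits s else SATs s"
proof -
  note V = validD[OF v]
  obtain S0 where S0: "S0 \<subseteq> Lits" "card S0 \<le> k" "\<forall>i \<in> set F. sem (set X \<union> S0) i"
    using sat by (auto simp: SATs_def SAT_def)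
  \<comment> \<open>Without the literals of \<open>X\<close>, every element of the solution is
    available for branching.\<close>
  define S where "S = S0 - set X"
  have XS: "set X \<union> S = set X \<union> S0" by (auto simp: S_def)
  have finS0: "finite S0" using S0(1) finite_Lits finite_subset by blast
  have S: "S \<subseteq> Lits" "card S \<le> k" "\<And>i. i \<in> set F \<Longrightarrow> sem (set X \<union> S) i" "finite S" "S \<inter> set X = {}"
    using S0 card_mono[OF finS0, of S] finS0 unfolding XS by (auto simp: S_def)
  have Sav: "x \<in> set (avail ns X)" if "x \<in> S" for x using that S by (auto simp: avail_set)
  \<comment> \<open>The gate is false under \<open>X\<close> and its value depends only on the
    literals below it, so the solution must contain one of these.\<close>
  have hit: "\<exists>x \<in> S. (x, i) \<in> W\<^sup>*" if i: "i \<in> set F" for i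
  proof (rule ccontr)
    assume "\<not> ?thesis"
    then have "sem (set X) i"
      using sem_restrict[of i "set X \<union> S" "set X"] S(3)[OF i] V(4) i TopsD(3) by blast
    then show False using V(6)[OF i] by blast
  qed
  have var: "\<exists>s \<in> set (mk_state fuel ns X k [x] F). SATs s" if x: "x \<in> S" for x
  proof -
    have "set [x] \<subseteq> Lits" using x S(1) by auto
    from mk_state_SAT[OF V(3) this V(4), of k] show ?thesis using S x by auto
  qed
  have mode: "\<not> fst s" if "s \<in> set (mk_state d ns X' k' L G)" for s d X' k' L G
    using that by (auto simp: mk_state_def split: if_splits)
  show ?thesis
  proof (cases "length (cand fuel ns X k F) \<le> 3 * k")
    case True
    \<comment> \<open>Averaging: at most \<open>k\<close> literals together lie below all gates of
      \<open>F\<close>.\<close>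
    have "\<exists>x \<in> S. length F \<le> k * deg fuel ns F x"
    proof (rule ccontr)
      assume no: "\<not> ?thesis"
      let ?d = "\<lambda>x. card {i \<in> set F. (x, i) \<in> W\<^sup>*}"
      have d: "k * ?d x < length F" if "x \<in> S" for x
      proof -
        have "x \<in> Lits" using that S(1) by blast
        moreover have "k * deg fuel ns F x < length F" using no that by (simp add: not_le)
        ultimately show ?thesis using deg_card[OF V(2,4), of x] by metis
      qed
      have "set F \<subseteq> (\<Union>x \<in> S. {i \<in> set F. (x, i) \<in> W\<^sup>*})" using hit by auto
      then have "card (set F) \<le> card (\<Union>x \<in> S. {i \<in> set F. (x, i) \<in> W\<^sup>*})" using S(4) by (intro card_mono) auto
      also have "\<dots> \<le> (\<Sum>x \<in> S. ?d x)" using S(4) by (rule card_UN_le)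
      finally have le: "length F \<le> (\<Sum>x \<in> S. ?d x)" using V(2) by (simp add: distinct_card)
      have Sne: "S \<noteq> {}" using hit ne by (metis empty_iff last_in_set)
      have "k * length F \<le> (\<Sum>x \<in> S. k * ?d x)" using mult_le_mono2[OF le, of k] by (simp add: sum_distrib_left)
      also have "\<dots> < (\<Sum>x \<in> S. length F)" using d Sne S(4) by (intro sum_strict_mono) auto
      also have "\<dots> \<le> k * length F" using S(2) by simp
      finally show False by simp
    qed
    then obtain x where x: "x \<in> S" "length F \<le> k * deg fuel ns F x" by blast
    then have "x \<in> set (cand fuel ns X k F)" using Sav by (simp add: cand_def)
    moreover obtain s where "s \<in> set (mk_state fuel ns X k [x] F)" "SATs s" using var[OF x(1)] by blast
    ultimately have "s \<in> set (branches fuel ns False X k F)" "\<not> fst s"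
      using True mode unfolding branches_def var_branches_def by auto
    then show ?thesis using \<open>SATs s\<close> by auto
  next
    case many: False
    then have br: "set (branches fuel ns False X k F) = set (var_branches fuel ns X k F (special fuel ns X F)) \<union>
        set (item_branches fuel ns X k F) \<union> {(True, X, k, F)}" by (auto simp: branches_def)
    show ?thesis
    proof (cases "\<exists>x \<in> S. 3 \<le> deg fuel ns F x")
      case True
      then obtain x where x: "x \<in> S" "x \<in> set (special fuel ns X F)" using Sav by (auto simp: special_def)
      obtain s where s: "s \<in> set (mk_state fuel ns X k [x] F)" "SATs s" using var[OF x(1)] by blast
      have "s \<in> set (var_branches fuel ns X k F (special fuel ns X F))"
        using s(1) x(2) by (auto simp: var_branches_def)
      then show ?thesis using s mode[OF s(1)] unfolding br by (intro bexI[of _ s]) auto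
    next
      case low: False
      define c where "c i = (SOME c. (c, i) \<in> W \<and> sem (set X \<union> S) c)" for i
      have c: "(c i, i) \<in> W" "sem (set X \<union> S) (c i)" if "i \<in> set F" for i
      proof -
        have "\<exists>c. (c, i) \<in> W \<and> sem (set X \<union> S) c" using top_sem S(3)[OF that] V(4) that by blast
        from someI_ex[OF this] show "(c i, i) \<in> W" "sem (set X \<union> S) (c i)" unfolding c_def by blast+
      qed
      have T: "i \<in> Tops" if "i \<in> set F" for i using V(4) that by blast
      show ?thesis
      proof (cases "\<exists>i \<in> set F. special_item fuel ns X F i (c i)")
        case True
        then obtain i where i: "i \<in> set F" "special_item fuel ns X F i (c i)" by blast
        have ic: "item (c i)" using item_pred T c i by blast
        let ?G = "filter (\<lambda>j. j \<noteq> i) F @ ors ns (c i)"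
        have G: "set ?G \<subseteq> Tops" using V(4) item_orsD(1)[OF ic] by auto
        have "set (lits ns (c i)) \<subseteq> set X \<union> S" "\<forall>j \<in> set ?G. sem (set X \<union> S) j"
          using item_sem[OF ic, of "set X \<union> S"] c(2)[OF i(1)] S(3) by auto
        then have "\<exists>s \<in> set (mk_state fuel ns X k (lits ns (c i)) ?G). SATs s"
          unfolding mk_state_SAT[OF V(3) item_lits[OF ic] G] using S(1,2) by blast
        then obtain s where s: "s \<in> set (mk_state fuel ns X k (lits ns (c i)) ?G)" "SATs s" by blast
        have "c i \<in> set (preds (node_at ns i))" using c(1)[OF i(1)] preds_set[OF TopsD(3)[OF T[OF i(1)]]] by simp
        then have "s \<in> set (item_branches fuel ns X k F)"
          unfolding item_branches_def
          by (intro in_concat_map[OF i(1)] in_concat_map[of "c i"]) (use s(1) i(2) in simp_all)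
        then show ?thesis using s mode unfolding br by (intro bexI[of _ s]) auto
      next
        case plain: False
        \<comment> \<open>The support of a chosen item is the part of the solution below it.\<close>
        define U where "U i = {x \<in> S. (x, c i) \<in> W\<^sup>*}" for i
        have co: "(c i, out) \<in> W\<^sup>*" if "i \<in> set F" for i
          using c(1)[OF that] TopsD(1)[OF T[OF that]] by (rule converse_rtrancl_into_rtrancl)
        have link: "linked fuel ns X F (c i) j" if ij: "i \<in> set F" "j \<in> set F" "U i \<inter> U j \<noteq> {}" for i j
        proof -
          obtain x where x: "x \<in> S" "(x, c i) \<in> W\<^sup>*" "(x, c j) \<in> W\<^sup>*" using ij(3) by (auto simp: U_def)
          have "(x, j) \<in> W\<^sup>*" using x(3) c(1)[OF ij(2)] by (rule rtrancl_into_rtrancl)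
          moreover have "deg fuel ns F x \<le> 2" using low x(1) by fastforce
          ultimately show ?thesis unfolding linked_def list_ex_iff
            using x Sav S(1) touch_iff[OF co[OF ij(1)]] touch_iff[OF TopsD(1)[OF T[OF ij(2)]]]
            by (intro bexI[of _ x]) auto
        qed
        \<comment> \<open>A gate whose support meets that of \<open>i\<close> is linked to the item
          \<open>c i\<close>, and two such gates would make this item special.\<close>
        have two: "U i \<inter> U j = {} \<or> U i \<inter> U l = {}"
          if ijl: "i \<in> set F" "j \<in> set F" "l \<in> set F" "j \<noteq> i" "l \<noteq> i" "j \<noteq> l" for i j l
        proof (rule ccontr)
          assume "\<not> ?thesis"
          then have "{j, l} \<subseteq> set (filter (\<lambda>j. j \<noteq> i \<and> linked fuel ns X F (c i) j) F)"
            using link[OF ijl(1,2)] link[OF ijl(1,3)] ijl by auto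
          then have "card {j, l} \<le> card (set (filter (\<lambda>j. j \<noteq> i \<and> linked fuel ns X F (c i) j) F))"
            by (intro card_mono) auto
          also have "\<dots> \<le> length (filter (\<lambda>j. j \<noteq> i \<and> linked fuel ns X F (c i) j) F)" by (rule card_length)
          finally have "special_item fuel ns X F i (c i)" using ijl(6) by (simp add: special_item_def)
          then show False using plain ijl(1) by blast
        qed
        have "sem (set X \<union> U i) (c i)" if i: "i \<in> set F" for i
          using sem_restrict[of "c i" "set X \<union> S" "set X \<union> U i"] c[OF i] wire_verts by (auto simp: U_def)
        moreover have "card (\<Union>i \<in> set F. U i) \<le> k"
        proof -
          have "(\<Union>i \<in> set F. U i) \<subseteq> S" by (auto simp: U_def)
          from card_mono[OF S(4) this] show ?thesis using S(2) by linarith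
        qed
        ultimately have "splits (True, X, k, F)" unfolding splits_def Let_def
          using c(1) two S(1) by (intro exI[of _ c] exI[of _ U]) (auto simp: U_def)
        then show ?thesis unfolding br by (intro bexI[of _ "(True, X, k, F)"]) auto
      qed
    qed
  qed
qed

text \<open>Soundness carries \<open>SATs\<close> backwards along the search path. Completeness
  descends along the weight and needs the stronger invariant \<open>splits\<close> in flagged
  states, where satisfiability alone does not guarantee independent groups.\<close>

lemma solve_correct:
  assumes "valid e k0 s" "\<not> fst s"
  shows "solve fuel e (ns, s) \<longleftrightarrow> SATs s"
  using assms
proof (induction e arbitrary: s)
  case 0
  obtain m X k F where s: "s = (m, X, k, F)" by (metis surj_pair)
  \<comment> \<open>A gate left at level 0 would be deeper than the circuit.\<close>
  have "F = []"
  proof (rule ccontr)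
    assume "F \<noteq> []"
    then obtain i where "i \<in> set F" by (meson list.set_sel(1))
    then have "t < dep i" "dep i \<le> t" using validD(4,7)[OF "0.prems"(1)[unfolded s]] dep_le TopsD(1) by auto
    then show False by simp
  qed
  then show ?case unfolding s by (auto simp: no_gates_def SATs_def SAT_def intro: exI[of _ "{}"])
next
  case (Suc e)
  let ?orc = "solve fuel e"
  let ?R = "{(a, b). b \<in> set (succs fuel ?orc (ns, a))}"
  have srch: "solve fuel (Suc e) (ns, s) \<longleftrightarrow> search (succs fuel ?orc) no_gates (ns, s)" by simp
  have sound: "SATs s" if "valid (Suc e) k0 s" "(s, s') \<in> ?R\<^sup>*" "no_gates (ns, s')" for s s'
    using that(2,1)
  proof (induction rule: converse_rtrancl_induct)
    case base
    then show ?case using that(3) by (auto simp: no_gates_def SATs_def SAT_def intro!: exI[of _ "{}"])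
  next
    case (step a b)
    then have ab: "b \<in> set (succs fuel ?orc (ns, a))" by simp
    have "SATs b" using step succs_step[OF step.prems ab] by blast
    then show ?case using succs_sound[OF step.prems _ ab] Suc.IH by blast
  qed
  have complete: "search (succs fuel ?orc) no_gates (ns, s)"
    if "valid (Suc e) k0 s" "if fst s then splits s else SATs s" for s
    using that
  proof (induction "weight k0 s" arbitrary: s rule: less_induct)
    case less
    obtain m X k F where s: "s = (m, X, k, F)" by (metis surj_pair)
    show ?case
    proof (cases "F = []")
      case True
      then show ?thesis unfolding s by (subst search_unfold) (simp add: no_gates_def)
    next
      case ne: False
      have "\<exists>s' \<in> set (succs fuel ?orc (ns, s)). if fst s' then splits s' else SATs s'"
      proof (cases m)
        case True
        have v: "valid (Suc e) k0 (True, X, k, F)" "splits (True, X, k, F)" using less.prems s True by auto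
        obtain y where y: "y \<in> set (groups fuel ns True X k F)" "list_ex (\<lambda>q. ?orc (ns, q)) (fst y)" "splits (snd y)"
          using groups_complete[OF v(1) _ v(2) ne, of ?orc] Suc.IH by blast
        have "fst (snd y)" by (rule groups_elem[OF y(1)]) simp
        moreover have "snd y \<in> set (succs fuel ?orc (ns, s))" using y(1,2) True unfolding s succs_eq by auto
        ultimately show ?thesis using y(3) by (intro bexI[of _ "snd y"]) auto
      next
        case False
        have v: "valid (Suc e) k0 (False, X, k, F)" "SATs (False, X, k, F)" using less.prems s False by auto
        obtain s' where "s' \<in> set (branches fuel ns False X k F)" "if fst s' then splits s' else SATs s'"
          using branches_complete[OF v ne] by blast
        moreover have "set (branches fuel ns False X k F) \<subseteq> set (succs fuel ?orc (ns, s))"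
          unfolding s succs_eq using False by simp
        ultimately show ?thesis by blast
      qed
      then obtain s' where s': "s' \<in> set (succs fuel ?orc (ns, s))" "if fst s' then splits s' else SATs s'" by blast
      have "search (succs fuel ?orc) no_gates (ns, s')"
        using less.hyps[OF _ _ s'(2)] succs_step[OF less.prems(1) s'(1)] by blast
      then show ?thesis using s'(1) by (subst search_unfold) blast
    qed
  qed
  show ?case
  proof
    assume "solve fuel (Suc e) (ns, s)"
    then show "SATs s" unfolding srch search_def using sound[OF Suc.prems(1)] by auto
  next
    assume "SATs s"
    then show "solve fuel (Suc e) (ns, s)" unfolding srch using complete[OF Suc.prems(1)] Suc.prems(2) by simp
  qed
qed

end

section \<open>Running time\<close>

text \<open>A program sees only codes, so elements may be exchanged for annotated ones with the same
  code and the same value.\<close>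

lemma compK_transfer:
  assumes "compK D' ea' eb f'" "\<And>K x. x \<in> D K \<Longrightarrow> \<exists>x' \<in> D' K. ea x = ea' x' \<and> f x = f' x'"
  shows "compK D ea eb f"
proof -
  obtain p T where 1: "polyb T" "\<And>K x. x \<in> D' K \<Longrightarrow> computes_at p (ea' x) (eb (f' x)) (T K)"
    "\<And>K x. x \<in> D' K \<Longrightarrow> data_size (eb (f' x)) \<le> T K" by (rule compKE[OF assms(1)]) (rule that)
  show ?thesis
  proof (rule compKI[OF 1(1) 1(1)])
    fix K x assume "x \<in> D K"
    then obtain x' where x': "x' \<in> D' K" "ea x = ea' x'" "f x = f' x'" using assms(2) by blast
    show "computes_at p (ea x) (eb (f x)) (T K)" "data_size (eb (f x)) \<le> T K"
      unfolding x'(2,3) using 1(2,3)[OF x'(1)] by auto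
  qed
qed

context mono_circuit
begin

section \<open>Bounds on the search tree and on the size of its states\<close>

definition max_weight :: "nat \<Rightarrow> nat" where
  "max_weight k0 = k0 * (maxF k0 * t + maxF k0 + 3) + (maxF k0 * t + maxF k0 + 2)"

definition tree_bound :: "nat \<Rightarrow> nat" where
  "tree_bound k0 = (max_branch k0 + 1) ^ max_weight k0"

lemma weight_le:
  assumes "valid e k0 s"
  shows "weight k0 s \<le> max_weight k0"
proof -
  obtain m X k F where s: "s = (m, X, k, F)" by (metis surj_pair)
  note V = validD[OF assms[unfolded s]]
  have "k * (maxF k0 * t + maxF k0 + 3) \<le> k0 * (maxF k0 * t + maxF k0 + 3)" using V(8) by (rule mult_right_mono) simp
  moreover have "(if m then length F else (maxF k0 * t + 1 - (\<Sum>i \<in> set F. dep i)) + maxF k0 + 1) \<le> maxF k0 * t + maxF k0 + 2"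
    using V(9) by (cases m) auto
  ultimately show ?thesis unfolding s weight_def max_weight_def fst_conv snd_conv by (rule add_mono)
qed

text \<open>With at most \<open>q\<close> successors of smaller weight,
  \<open>1 + q * (q + 1) ^ w \<le> (q + 1) ^ (w + 1)\<close>. This is the potential that the tree
  search asks for.\<close>

lemma tree_step:
  assumes v: "valid e k0 s"
  shows "1 + (\<Sum>s'\<leftarrow>succs fuel orc (ns, s). (max_branch k0 + 1) ^ weight k0 s') \<le> (max_branch k0 + 1) ^ weight k0 s"
proof -
  let ?q = "max_branch k0" and ?l = "succs fuel orc (ns, s)"
  obtain m X k F where s: "s = (m, X, k, F)" by (metis surj_pair)
  have len: "length ?l \<le> ?q" using succs_length[OF v[unfolded s]] unfolding s .
  show ?thesis
  proof (cases "?l = []")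
    case False
    then obtain s' where "s' \<in> set ?l" by (meson list.set_sel(1))
    then have pos: "0 < weight k0 s" using succs_step[OF v] by fastforce
    then obtain w where w: "weight k0 s = Suc w" using gr0_implies_Suc by blast
    have "(\<Sum>s'\<leftarrow>?l. (?q + 1) ^ weight k0 s') \<le> (\<Sum>s'\<leftarrow>?l. (?q + 1) ^ w)"
    proof (rule sum_list_mono)
      fix s' assume "s' \<in> set ?l"
      then have "weight k0 s' \<le> w" using succs_step[OF v, of s'] w by fastforce
      then show "(?q + 1) ^ weight k0 s' \<le> (?q + 1) ^ w" by (intro power_increasing) auto
    qed
    also have "\<dots> = length ?l * (?q + 1) ^ w" by (simp add: sum_list_triv)
    also have "\<dots> \<le> ?q * (?q + 1) ^ w" using len by (rule mult_right_mono) simp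
    finally have "1 + (\<Sum>s'\<leftarrow>?l. (?q + 1) ^ weight k0 s') \<le> (?q + 1) ^ w + ?q * (?q + 1) ^ w"
      using one_le_power[of "?q + 1" w] by linarith
    then show ?thesis using w by simp
  qed simp
qed

text \<open>The lists of a valid state are duplicate-free lists of vertices, so states stay
  polynomial at any depth of the search.\<close>

lemma state_size:
  assumes "valid e k0 s" "data_size (enc_nodes ns) \<le> K" "k0 \<le> K"
  shows "data_size (enc_state s) \<le> 10 + 2 * K + 2 * (K * (2 * K + 2))"
proof -
  obtain m X k F where s: "s = (m, X, k, F)" by (metis surj_pair)
  note V = validD[OF assms(1)[unfolded s]]
  have K: "length ns \<le> K" using length_le_data_size[of ns enc_node] assms(2) by linarith
  have lst: "data_size (enc_nats l) \<le> 1 + K * (2 * K + 2)" if "distinct l" "set l \<subseteq> {..<length ns}" for l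
  proof -
    have "length l = card (set l)" using that(1) by (simp add: distinct_card)
    also have "\<dots> \<le> length ns" using card_mono[OF _ that(2)] by simp
    finally have "length l \<le> K" using K by simp
    moreover have "data_size (enc_nats l) \<le> 1 + length l * (1 + (2 * K + 1))"
    proof (rule data_size_enc_list_le)
      fix x assume "x \<in> set l"
      then have "x < length ns" using that(2) by auto
      then show "data_size (enc_nat x) \<le> 2 * K + 1" using K by (simp add: enc_nat_size)
    qed
    ultimately show ?thesis using mult_right_mono[of "length l" K "2 * K + 2"] by simp
  qed
  have "data_size (enc_nats X) \<le> 1 + K * (2 * K + 2)" using V(1,3) Lits_less by (intro lst) auto
  moreover have "data_size (enc_nats F) \<le> 1 + K * (2 * K + 2)" using V(2,4) TopsD(3) by (intro lst) auto
  moreover have "data_size (enc_nat k) \<le> 2 * K + 1" using V(8) assms(3) by (simp add: enc_nat_size)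
  moreover have "data_size (enc_bool m) \<le> 3" by (simp add: enc_bool_def)
  ultimately show ?thesis unfolding s by simp
qed

text \<open>Here the ambient number is also made to bound the search tree, which is what turns the
  search into a polynomial computation.\<close>

definition in_range :: "nat \<Rightarrow> nat \<Rightarrow> nat \<Rightarrow> state \<Rightarrow> bool" where
  "in_range e K k0 s \<longleftrightarrow> valid e k0 s \<and> data_size (enc_nodes ns) \<le> K \<and> k0 \<le> K \<and> tree_bound k0 \<le> K"

end

definition search_dom :: "nat \<Rightarrow> nat \<Rightarrow> nat \<Rightarrow> (node list \<times> state) set" where
  "search_dom t e K = {(nodes C, s) |C k0 s. mono_circuit t C \<and> mono_circuit.in_range t C e K k0 s}"

definition search_dom' :: "nat \<Rightarrow> nat \<Rightarrow> nat \<Rightarrow> ((circuit \<times> nat) \<times> state) set" where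
  "search_dom' t e K = {((C, k0), s) |C k0 s. mono_circuit t C \<and> mono_circuit.in_range t C e K k0 s}"

lemma search_domI: "mono_circuit t C \<Longrightarrow> mono_circuit.in_range t C e K k0 s \<Longrightarrow> (nodes C, s) \<in> search_dom t e K"
  unfolding search_dom_def by blast

lemma search_domE:
  assumes "z \<in> search_dom t e K"
  obtains C k0 s where "z = (nodes C, s)" "mono_circuit t C" "mono_circuit.in_range t C e K k0 s"
  using assms unfolding search_dom_def by blast

lemma search_dom'I: "mono_circuit t C \<Longrightarrow> mono_circuit.in_range t C e K k0 s \<Longrightarrow> ((C, k0), s) \<in> search_dom' t e K"
  unfolding search_dom'_def by blast

lemma search_dom'E:
  assumes "z \<in> search_dom' t e K"
  obtains C k0 s where "z = ((C, k0), s)" "mono_circuit t C" "mono_circuit.in_range t C e K k0 s"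
  using assms unfolding search_dom'_def by blast

lemma search_dom_id: "compK (search_dom t e) (enc_pair enc_nodes enc_state) (enc_pair enc_nodes enc_state) (\<lambda>z. z)"
proof (rule compK_id)
  show "polyb (\<lambda>K. 1 + K + (10 + 2 * K + 2 * (K * (2 * K + 2))))" by (intro polyb_intros)
  fix K z assume "z \<in> search_dom t e K"
  then obtain C k0 s where z: "z = (nodes C, s)" and C: "mono_circuit t C" "mono_circuit.in_range t C e K k0 s"
    by (rule search_domE)
  interpret mono_circuit t C by (rule C)
  have "data_size (enc_nodes (nodes C)) \<le> K" "data_size (enc_state s) \<le> 10 + 2 * K + 2 * (K * (2 * K + 2))"
    using C(2) state_size unfolding in_range_def by blast+
  then show "data_size (enc_pair enc_nodes enc_state z) \<le> 1 + K + (10 + 2 * K + 2 * (K * (2 * K + 2)))"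
    unfolding z by simp
qed

text \<open>
  The tree search runs on states paired with the circuit and the initial budget, which fix the
  bound on its size; the encoding ignores both.
\<close>

lemma compK_solve: "compK (search_dom t e) (enc_pair enc_nodes enc_state) enc_bool (solve (Suc t) e)"
proof (induction e)
  case 0
  show ?case by simp (rule compK_restrict[OF search_dom_id PT_no_gates])
next
  case (Suc e)
  let ?ec = "\<lambda>c :: circuit \<times> nat. enc_nodes (nodes (fst c))"
  let ?D = "search_dom t (Suc e)" and ?D' = "search_dom' t (Suc e)" and ?orc = "solve (Suc t) e"
  let ?succ = "\<lambda>z :: (circuit \<times> nat) \<times> state. succs (Suc t) ?orc (nodes (fst (fst z)), snd z)"
  let ?acc = "\<lambda>z :: (circuit \<times> nat) \<times> state. no_gates (nodes (fst (fst z)), snd z)"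
  have tr: "\<exists>x' \<in> ?D K. enc_pair ?ec enc_state z = enc_pair enc_nodes enc_state x' \<and> f (nodes (fst (fst z)), snd z) = f x'"
    if "z \<in> ?D' K" for K z and f :: "node list \<times> state \<Rightarrow> 'b"
    using that
  proof (rule search_dom'E)
    fix C k0 s assume z: "z = ((C, k0), s)" "mono_circuit t C" "mono_circuit.in_range t C (Suc e) K k0 s"
    show ?thesis by (rule bexI[OF _ search_domI[OF z(2,3)]]) (simp add: z(1))
  qed
  obtain T0 where T0: "polyb T0" "\<And>K z. z \<in> ?D K \<Longrightarrow> data_size (enc_pair enc_nodes enc_state z) \<le> T0 K"
    by (rule compKE[OF search_dom_id[of t "Suc e"]]) auto
  have id': "compK ?D' (enc_pair ?ec enc_state) (enc_pair ?ec enc_state) (\<lambda>z. z)"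
  proof (rule compK_id[OF T0(1)])
    fix K z assume "z \<in> ?D' K"
    from tr[OF this, of "\<lambda>_. ()"] show "data_size (enc_pair ?ec enc_state z) \<le> T0 K" using T0(2) by metis
  qed
  have su: "compK ?D (enc_pair enc_nodes enc_state) (enc_list enc_state) (succs (Suc t) ?orc)"
  proof (rule compK_succs[OF search_dom_id Suc.IH])
    fix K z y q assume z: "z \<in> ?D K" and y: "y \<in> set (groups_at (Suc t) z)" and q: "q \<in> set (fst y)"
    obtain C k0 s where z': "z = (nodes C, s)" and C: "mono_circuit t C" "mono_circuit.in_range t C (Suc e) K k0 s"
      by (rule search_domE[OF z]) (rule that)
    interpret mono_circuit t C by (rule C)
    obtain m X k F where s: "s = (m, X, k, F)" by (metis surj_pair)
    have m: m using y unfolding z' s groups_at_def groups_def by (auto split: if_splits)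
    have v: "valid (Suc e) k0 (True, X, k, F)" using C(2) m unfolding s in_range_def by simp
    have "y \<in> set (groups fuel ns True X k F)" using y m unfolding z' s groups_at_def by simp
    then obtain i j b where "i \<in> set F" "j \<in> set F" "b \<le> k"
      "y = (group_states fuel ns X b i j, (True, X, k - b, filter (\<lambda>l. l \<noteq> i \<and> l \<noteq> j) F))"
      by (rule groups_elem) (rule that)
    then have "valid e k0 q" using group_query_valid[OF v] q by auto
    then have "in_range e K k0 q" using C(2) by (simp add: in_range_def)
    from search_domI[OF C(1) this] show "(fst z, q) \<in> search_dom t e K" unfolding z' by simp
  qed
  have "compK ?D' (enc_pair ?ec enc_state) enc_bool (search ?succ ?acc)"
  proof (rule compK_search[OF id'])
    show "compK ?D' (enc_pair ?ec enc_state) (enc_list enc_state) ?succ" by (rule compK_transfer[OF su tr])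
    show "compK ?D' (enc_pair ?ec enc_state) enc_bool ?acc"
      by (rule compK_transfer[OF compK_restrict[OF search_dom_id PT_no_gates] tr])
    fix K and c :: "circuit \<times> nat" and s assume cs: "(c, s) \<in> ?D' K"
    obtain C k0 where c: "c = (C, k0)" and C: "mono_circuit t C" "mono_circuit.in_range t C (Suc e) K k0 s"
      by (rule search_dom'E[OF cs]) (auto intro: that)
    interpret mono_circuit t C by (rule C)
    have v: "valid (Suc e) k0 s" using C(2) by (simp add: in_range_def)
    { fix s' assume "s' \<in> set (?succ (c, s))"
      then have "valid (Suc e) k0 s'" using succs_step[OF v] by (simp add: c)
      then have "in_range (Suc e) K k0 s'" using C(2) by (simp add: in_range_def)
      from search_dom'I[OF C(1) this] show "(c, s') \<in> ?D' K" unfolding c . }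
    let ?t = "\<lambda>(K :: nat) (c :: circuit \<times> nat) s.
      (mono_circuit.max_branch (fst c) (snd c) + 1) ^ mono_circuit.weight t (fst c) (snd c) s"
    show "1 + (\<Sum>s'\<leftarrow>?succ (c, s). ?t K c s') \<le> ?t K c s" using tree_step[OF v] by (simp add: c)
    have "(max_branch k0 + 1) ^ weight k0 s \<le> tree_bound k0"
      unfolding tree_bound_def using weight_le[OF v] by (intro power_increasing) auto
    then show "?t K c s \<le> K" using C(2) by (simp add: c in_range_def)
  qed (rule polyb_id)
  then have "compK ?D (enc_pair enc_nodes enc_state) enc_bool (search (succs (Suc t) ?orc) no_gates)"
  proof (rule compK_transfer)
    fix K z assume "z \<in> ?D K"
    then obtain C k0 s where z: "z = (nodes C, s)" "mono_circuit t C" "mono_circuit.in_range t C (Suc e) K k0 s"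
      by (rule search_domE)
    show "\<exists>x' \<in> ?D' K. enc_pair enc_nodes enc_state z = enc_pair ?ec enc_state x' \<and>
        search (succs (Suc t) ?orc) no_gates z = search ?succ ?acc x'"
      by (rule bexI[OF _ search_dom'I[OF z(2,3)]]) (simp add: z(1) search_def)
  qed
  then show ?case by simp
qed

subsection \<open>Deciding weighted satisfiability\<close>

definition start :: "nat \<Rightarrow> circuit \<times> nat \<Rightarrow> state list" where
  "start t z = mk_state (Suc t) (nodes (fst z)) [] (snd z)
     (lits (nodes (fst z)) (out_gate (fst z))) (ors (nodes (fst z)) (out_gate (fst z)))"

text \<open>Weight exactly \<open>k\<close> needs \<open>k\<close> variables, hence the comparison.
  The pending OR-gates of the start state have depth 1, so \<open>t\<close> oracle levels
  suffice.\<close>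

definition decide :: "nat \<Rightarrow> circuit \<times> nat \<Rightarrow> bool" where
  "decide t z \<longleftrightarrow> snd z \<le> num_vars (fst z) \<and> list_ex (\<lambda>s. solve (Suc t) t (nodes (fst z), s)) (start t z)"

context mono_circuit
begin

lemma dep_out: "dep out = 0"
  unfolding dep_def by (rule Least_eq_0) simp

lemma start_valid:
  assumes "s \<in> set (start t (C, k))"
  shows "valid t k s \<and> \<not> fst s"
proof (rule mk_state_valid)
  show "s \<in> set (mk_state fuel ns [] k (lits ns out) (ors ns out))" using assms by (simp add: start_def)
  show "set (lits ns out) \<subseteq> Lits" by (rule item_lits[OF item_out])
  show "set (ors ns out) \<subseteq> Tops" using item_orsD(1)[OF item_out] by blast
  have d: "dep j = 1" if "j \<in> set (ors ns out)" for j
    using dep_step[of j out] item_orsD[OF item_out that] dep_out by simp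
  then show "t < dep j + t" if "j \<in> set (ors ns out)" for j using that by simp
  show "antichain (set (ors ns out))" unfolding antichain_def
    using siblings_incomparable item_orsD(2,3)[OF item_out] by blast
qed auto

section \<open>Translation between sets of variables and sets of literal positions\<close>

definition var_of :: "nat \<Rightarrow> nat" where
  "var_of x = (THE v. ns ! x = Lit True v)"

lemma var_of: "x \<in> Lits \<Longrightarrow> ns ! x = Lit True (var_of x)"
  using Lits_node unfolding var_of_def by fastforce

lemma var_of_bij: "bij_betw var_of Lits {..<num_vars C}"
  unfolding bij_betw_def
proof
  show "inj_on var_of Lits"
  proof (rule inj_onI)
    fix x y assume xy: "x \<in> Lits" "y \<in> Lits" "var_of x = var_of y"
    then have "ns ! x = ns ! y" using var_of by metis
    then show "x = y" using wf xy(1,2) unfolding wf_circuit_def Lits_def verts_def by auto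
  qed
  have vars: "{v. \<exists>b. Lit b v \<in> set ns} = {..<num_vars C}" using wf by (simp add: wf_circuit_def)
  show "var_of ` Lits = {..<num_vars C}" unfolding vars[symmetric]
  proof
    show "var_of ` Lits \<subseteq> {v. \<exists>b. Lit b v \<in> set ns}"
    proof
      fix v assume "v \<in> var_of ` Lits"
      then obtain x where x: "x \<in> Lits" "v = var_of x" by blast
      then have "Lit True v \<in> set ns" using var_of[OF x(1)] nth_mem[OF Lits_less[OF x(1)]] by simp
      then show "v \<in> {v. \<exists>b. Lit b v \<in> set ns}" by blast
    qed
    show "{v. \<exists>b. Lit b v \<in> set ns} \<subseteq> var_of ` Lits"
    proof
      fix v assume "v \<in> {v. \<exists>b. Lit b v \<in> set ns}"
      then obtain b x where x: "x < length ns" "ns ! x = Lit b v" by (auto simp: in_set_conv_nth)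
      then have "x \<in> Lits" by (simp add: Lits_def)
      then show "v \<in> var_of ` Lits" using var_of[of x] x by force
    qed
  qed
qed

lemma vars_of_lits:
  assumes "S \<subseteq> Lits"
  shows "{v. \<exists>x \<in> S. x \<in> Lits \<and> ns ! x = Lit True v} = var_of ` S" "card (var_of ` S) = card S"
proof -
  have "x \<in> Lits \<and> ns ! x = Lit True v \<longleftrightarrow> v = var_of x" if "x \<in> S" for x v
    using var_of[of x] that assms by auto
  then show "{v. \<exists>x \<in> S. x \<in> Lits \<and> ns ! x = Lit True v} = var_of ` S" by blast
  have "inj_on var_of S" using var_of_bij assms inj_on_subset unfolding bij_betw_def by blast
  then show "card (var_of ` S) = card S" by (rule card_image)
qed

text \<open>A lighter solution is padded with arbitrary literals up to weight \<open>k\<close>;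
  monotonicity keeps it a solution.\<close>

lemma weighted_sat_iff:
  "weighted_sat C k \<longleftrightarrow> k \<le> num_vars C \<and> (\<exists>S \<subseteq> Lits. card S \<le> k \<and> sem S out)"
proof
  assume "weighted_sat C k"
  then obtain A where A: "A \<subseteq> {..<num_vars C}" "card A = k" "holds C A out" by (auto simp: weighted_sat_def)
  let ?S = "{x \<in> Lits. var_of x \<in> A}"
  have im: "var_of ` ?S = A" using A(1) var_of_bij by (auto simp: bij_betw_def)
  have SL: "?S \<subseteq> Lits" by blast
  have "card ?S = k" using vars_of_lits(2)[OF SL] im A(2) by simp
  moreover have "sem ?S out" unfolding sem_def vars_of_lits(1)[OF SL] im by (rule A(3))
  moreover have "k \<le> num_vars C" using card_mono[OF _ A(1)] A(2) by simp
  ultimately show "k \<le> num_vars C \<and> (\<exists>S \<subseteq> Lits. card S \<le> k \<and> sem S out)"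
    using SL by (intro conjI exI[of _ ?S]) simp_all
next
  assume "k \<le> num_vars C \<and> (\<exists>S \<subseteq> Lits. card S \<le> k \<and> sem S out)"
  then obtain S where k: "k \<le> num_vars C" and S: "S \<subseteq> Lits" "card S \<le> k" "sem S out" by blast
  have "card Lits = num_vars C" using bij_betw_same_card[OF var_of_bij] by simp
  then obtain S' where S': "S \<subseteq> S'" "S' \<subseteq> Lits" "card S' = k"
    using exists_subset_between[of S k Lits] S k finite_Lits by auto
  have sem: "sem S' out" using sem_mono[OF out_vert S'(1) S(3)] .
  have "holds C (var_of ` S') out" using sem unfolding sem_def vars_of_lits(1)[OF S'(2)] .
  moreover have "card (var_of ` S') = k" using vars_of_lits(2)[OF S'(2)] S'(3) by simp
  moreover have "var_of ` S' \<subseteq> {..<num_vars C}" using S'(2) var_of_bij by (auto simp: bij_betw_def)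
  ultimately show "weighted_sat C k" unfolding weighted_sat_def by (intro exI[of _ "var_of ` S'"] conjI)
qed

lemma decide_correct: "decide t (C, k) \<longleftrightarrow> weighted_sat C k"
proof -
  have "list_ex (\<lambda>s. solve (Suc t) t (ns, s)) (start t (C, k)) \<longleftrightarrow> (\<exists>s \<in> set (start t (C, k)). SATs s)"
    using solve_correct start_valid unfolding list_ex_iff by blast
  also have "\<dots> \<longleftrightarrow> (\<exists>S \<subseteq> Lits. card S \<le> k \<and> set (lits ns out) \<subseteq> set [] \<union> S \<and> (\<forall>i \<in> set (ors ns out). sem (set [] \<union> S) i))"
    unfolding start_def fst_conv snd_conv
    by (rule mk_state_SAT) (use item_lits[OF item_out] item_orsD(1)[OF item_out] in auto)
  also have "\<dots> \<longleftrightarrow> (\<exists>S \<subseteq> Lits. card S \<le> k \<and> sem S out)" using item_sem[OF item_out] by simp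
  finally show ?thesis unfolding decide_def weighted_sat_iff by simp
qed

end

definition enc_instance :: "circuit \<times> nat \<Rightarrow> data" where
  "enc_instance z = Cell (enc_circuit (fst z)) (enc_nat (snd z))"

definition instance_dom :: "nat \<Rightarrow> nat \<Rightarrow> (circuit \<times> nat) set" where
  "instance_dom t K = {(C, k). mono_circuit t C \<and> data_size (enc_instance (C, k)) \<le> K \<and> mono_circuit.tree_bound t C k \<le> K}"

lemma PT_nodes: "PT enc_instance enc_nodes (\<lambda>z. nodes (fst z))"
  by (rule PT_expr[of _ "ERight (ERight (ELeft (EVar 0)))" _ _ 0]) (auto simp: enc_instance_def enc_circuit_def)

lemma PT_num_vars: "PT enc_instance enc_nat (\<lambda>z. num_vars (fst z))"
  by (rule PT_expr[of _ "ELeft (ELeft (EVar 0))" _ _ 0]) (auto simp: enc_instance_def enc_circuit_def)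

lemma PT_out_gate: "PT enc_instance enc_nat (\<lambda>z. out_gate (fst z))"
  by (rule PT_expr[of _ "ELeft (ERight (ELeft (EVar 0)))" _ _ 0]) (auto simp: enc_instance_def enc_circuit_def)

lemma PT_budget: "PT enc_instance enc_nat (\<lambda>z. snd z)"
  by (rule PT_expr[of _ "ERight (EVar 0)" _ _ 0]) (auto simp: enc_instance_def)

lemma PT_start: "PT enc_instance (enc_list enc_state) (start t)"
  unfolding start_def by (rule PT_mk_state PT_nodes PT_const PT_budget PT_lits PT_ors PT_out_gate)+

lemma compK_decide: "compK (instance_dom t) enc_instance enc_bool (decide t)"
proof -
  let ?D = "instance_dom t"
  have idD: "compK ?D enc_instance enc_instance (\<lambda>z. z)"
    by (rule compK_id[OF polyb_id]) (auto simp: instance_dom_def)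
  have st: "compK ?D enc_instance (enc_list enc_state) (start t)" by (rule compK_restrict[OF idD PT_start])
  obtain T where T: "polyb T" "\<And>K z. z \<in> ?D K \<Longrightarrow> data_size (enc_list enc_state (start t z)) \<le> T K"
    by (rule compKE[OF st]) auto
  define E where "E K = {(z, s). z \<in> ?D K \<and> s \<in> set (start t z)}" for K
  have idE: "compK E (enc_pair enc_instance enc_state) (enc_pair enc_instance enc_state) (\<lambda>z. z)"
  proof (rule compK_id)
    show "polyb (\<lambda>K. 1 + K + T K)" by (intro polyb_intros T)
    fix K w assume "w \<in> E K"
    then obtain z s where w: "w = (z, s)" "z \<in> ?D K" "s \<in> set (start t z)" by (auto simp: E_def)
    have "data_size (enc_instance z) \<le> K" using w(2) by (auto simp: instance_dom_def)
    then show "data_size (enc_pair enc_instance enc_state w) \<le> 1 + K + T K"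
      using T(2)[OF w(2)] data_size_elem[OF w(3), of enc_state] unfolding w(1) data_size_enc_pair[of enc_instance] by simp
  qed
  have pr: "compK E (enc_pair enc_instance enc_state) (enc_pair enc_nodes enc_state) (\<lambda>w. (nodes (fst (fst w)), snd w))"
    by (rule compK_restrict[OF idE]) (intro PT_pair PT_comp[OF PT_fst[OF PT_id] PT_nodes] PT_snd[OF PT_id])
  have so: "compK E (enc_pair enc_instance enc_state) enc_bool (\<lambda>w. solve (Suc t) t (nodes (fst (fst w)), snd w))"
  proof (rule compK_comp[OF pr compK_solve[of t t]])
    fix K w assume "w \<in> E K"
    then obtain C k s where w: "w = ((C, k), s)" "s \<in> set (start t (C, k))" and C: "mono_circuit t C"
      "data_size (enc_instance (C, k)) \<le> K" "mono_circuit.tree_bound t C k \<le> K"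
      by (auto simp: E_def instance_dom_def)
    interpret mono_circuit t C by (rule C)
    have "in_range t K k s" unfolding in_range_def
      using start_valid[OF w(2)] C(2,3) by (auto simp: enc_instance_def enc_circuit_def enc_nat_size)
    from search_domI[OF C(1) this] show "(nodes (fst (fst w)), snd w) \<in> search_dom t t K" unfolding w(1) by simp
  qed
  have "compK ?D enc_instance (enc_list enc_bool) (\<lambda>z. map (\<lambda>s. solve (Suc t) t (nodes (fst z), s)) (start t z))"
    by (rule compK_map[OF idD st, where f = "\<lambda>z s. solve (Suc t) t (nodes (fst z), s)", OF so]) (auto simp: E_def)
  from compK_PT[OF this PT_any[OF PT_id]]
  have a: "compK ?D enc_instance enc_bool (\<lambda>z. list_ex (\<lambda>s. solve (Suc t) t (nodes (fst z), s)) (start t z))"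
    by (rule compK_cong) (auto simp: list_ex_iff image_iff)
  have b: "compK ?D enc_instance enc_bool (\<lambda>z. snd z \<le> num_vars (fst z))"
    by (rule compK_restrict[OF idD PT_le[OF PT_budget PT_num_vars]])
  have "compK ?D enc_instance enc_bool (\<lambda>z. if snd z \<le> num_vars (fst z)
      then list_ex (\<lambda>s. solve (Suc t) t (nodes (fst z), s)) (start t z) else False)"
    by (rule compK_if[OF b a compK_restrict[OF idD PT_const]])
  then show ?thesis by (rule compK_cong) (auto simp: decide_def)
qed

subsection \<open>The parameter dependence\<close>

lemma computes_runs:
  assumes "computes_at p x y T"
  shows "\<exists>n \<le> T. runs p x n y"
proof -
  have "((\<lambda>_. Atom)(0 := x)) 0 = x" by simp
  then obtain n s' where "exec p ((\<lambda>_. Atom)(0 := x)) n s'" "n \<le> T" "s' 0 = y"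
    using assms unfolding computes_at_def by blast
  then show ?thesis unfolding runs_def by blast
qed

text \<open>The ambient number bounds the value of the function, so an exponential function counts
  as polynomial, and two of them can be composed.\<close>

lemma compK_exp2: "compK (\<lambda>K. {n. 2 ^ n \<le> K}) enc_nat enc_nat (\<lambda>n. 2 ^ n)"
proof -
  let ?D = "\<lambda>K :: nat. {n :: nat. 2 ^ n \<le> K}" and ?st = "\<lambda>(_ :: nat) (acc :: nat) (_ :: unit). 2 * acc"
  have n: "n \<le> K" if "2 ^ n \<le> K" for n K :: nat using less_exp[of n] that by linarith
  have idD: "compK ?D enc_nat enc_nat (\<lambda>n. n)"
  proof (rule compK_id)
    show "polyb (\<lambda>K. 2 * K + 1)" by (intro polyb_intros)
  qed (use n in \<open>auto simp: enc_nat_size\<close>)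
  have f: "foldl (?st n) 1 us = 2 ^ length us" for n us by (induction us rule: rev_induct) auto
  define E where "E K = {z :: (nat \<times> nat) \<times> unit. fst (fst z) \<le> K \<and> snd (fst z) \<le> K}" for K
  let ?e = "enc_pair (enc_pair enc_nat enc_nat) (\<lambda>_ :: unit. Atom)"
  have "compK E ?e ?e (\<lambda>z. z)"
  proof (rule compK_id)
    show "polyb (\<lambda>K. 4 * K + 10)" by (intro polyb_intros)
  qed (auto simp: E_def data_size_enc_pair enc_nat_size)
  then have st: "compK E ?e enc_nat (\<lambda>z. ?st (fst (fst z)) (snd (fst z)) (snd z))"
    by (rule compK_restrict) (rule PT_mult PT_const PT_snd PT_fst PT_id)+
  have "compK ?D enc_nat enc_nat (\<lambda>n. foldl (?st n) 1 (replicate n ()))"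
  proof (rule compK_foldl[OF idD _ _ st])
    show "compK ?D enc_nat (enc_list (\<lambda>_. Atom)) (\<lambda>n. replicate n ())"
      by (rule compK_restrict[OF idD PT_replicate[OF PT_id]])
    show "compK ?D enc_nat enc_nat (\<lambda>_. 1)" by (rule compK_restrict[OF idD PT_const])
    fix K m ys y zs assume m: "m \<in> ?D K" and r: "replicate m () = ys @ y # zs"
    have "length ys \<le> m" using arg_cong[OF r, of length] by simp
    then have "2 ^ length ys \<le> (2 :: nat) ^ m" by (intro power_increasing) auto
    also have "\<dots> \<le> K" using m by simp
    finally show "((m, foldl (?st m) 1 ys), y) \<in> E K" unfolding f E_def using m n[of m K] by (simp del: power_increasing_iff)
  qed
  then show ?thesis unfolding f by simp
qed

text \<open>The parameter dependence is \<open>2\<close> to a polynomial in \<open>k\<close>.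
  Bounding the polynomial by a power of 2 gives a function that is easy to program.\<close>

definition dbl_exp :: "nat \<Rightarrow> nat \<Rightarrow> nat" where
  "dbl_exp c k = 2 ^ (2 ^ (c * Suc k))"

lemma computable_dbl_exp:
  assumes "1 \<le> c"
  shows "computable (dbl_exp c)"
proof -
  let ?D = "\<lambda>K. {k. dbl_exp c k \<le> K}" and ?D1 = "\<lambda>K. {n. 2 ^ n \<le> K}"
  have e: "n \<le> 2 ^ n" for n :: nat using less_exp[of n] by simp
  have "k \<le> c * Suc k" for k using assms by (induction k) auto
  then have k: "k \<le> dbl_exp c k" for k unfolding dbl_exp_def using e le_trans by blast
  have idD: "compK ?D enc_nat enc_nat (\<lambda>n. n)"
  proof (rule compK_id)
    show "polyb (\<lambda>K. 2 * K + 1)" by (intro polyb_intros)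
    show "data_size (enc_nat x) \<le> 2 * K + 1" if "x \<in> ?D K" for K x
      using that k[of x] by (auto simp: enc_nat_size)
  qed
  have 1: "compK ?D enc_nat enc_nat (\<lambda>k. c * Suc k)"
    by (rule compK_restrict[OF idD]) (rule PT_mult PT_const PT_Suc PT_id)+
  have 2: "compK ?D enc_nat enc_nat (\<lambda>k. 2 ^ (c * Suc k))"
  proof (rule compK_comp[OF 1 compK_exp2])
    show "c * Suc x \<in> ?D1 K" if "x \<in> ?D K" for K x
      using that e[of "2 ^ (c * Suc x)"] unfolding dbl_exp_def mem_Collect_eq by (rule order_trans[rotated])
  qed
  have "compK ?D enc_nat enc_nat (\<lambda>k. 2 ^ (2 ^ (c * Suc k)))"
    by (rule compK_comp[OF 2 compK_exp2]) (auto simp: dbl_exp_def)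
  then have "compK ?D enc_nat enc_nat (dbl_exp c)" by (simp add: dbl_exp_def[abs_def])
  then obtain p T where "\<And>K k. k \<in> ?D K \<Longrightarrow> computes_at p (enc_nat k) (enc_nat (dbl_exp c k)) (T K)"
    by (rule compKE) auto
  then have "computes_at p (enc_nat k) (enc_nat (dbl_exp c k)) (T (dbl_exp c k))" for k by simp
  then show ?thesis unfolding computable_def using computes_runs by blast
qed

text \<open>With \<open>x = y div A\<close>, this follows from \<open>y \<le> A * (x + 1)\<close>
  and \<open>x + 1 \<le> 2 ^ x\<close>, raised to the power \<open>A\<close>.\<close>

lemma power_le_exp: "1 \<le> A \<Longrightarrow> y ^ A \<le> A ^ A * 2 ^ y" for A y :: nat
proof -
  assume A: "1 \<le> A"
  let ?x = "y div A"
  have "y mod A < A" using A by simp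
  then have "y \<le> A * (?x + 1)" using mult_div_mod_eq[of A y] unfolding add_mult_distrib2 by linarith
  then have "y ^ A \<le> (A * (?x + 1)) ^ A" by (rule power_mono) simp
  also have "\<dots> = A ^ A * (?x + 1) ^ A" by (rule power_mult_distrib)
  also have "(?x + 1) ^ A \<le> (2 ^ ?x) ^ A" by (rule power_mono) (use less_exp[of ?x] in linarith, simp)
  also have "((2 :: nat) ^ ?x) ^ A \<le> 2 ^ y" unfolding power_mult[symmetric] by (intro power_increasing) auto
  finally show ?thesis by simp
qed

text \<open>Bounding \<open>y ^ A\<close> first avoids the logarithm of \<open>y\<close> in the
  exponent. The mixed term \<open>2 * A ^ 2 * y\<close> is then separated into
  \<open>A ^ 4 + y ^ 2\<close>, which keeps parameter and genus apart.\<close>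

lemma self_power_le:
  assumes "1 \<le> (A :: nat)"
  shows "(A * y) ^ (A * y) \<le> 2 ^ (A ^ 4 + 2 * y ^ 2)"
proof -
  have "(y ^ A) ^ y \<le> (A ^ A * 2 ^ y) ^ y" by (rule power_mono[OF power_le_exp[OF assms]]) simp
  then have "(A * y) ^ (A * y) \<le> A ^ (A * y) * (A ^ A * 2 ^ y) ^ y"
    by (simp add: power_mult_distrib power_mult)
  also have "\<dots> = A ^ (2 * A * y) * 2 ^ (y ^ 2)"
    by (simp add: power_mult_distrib power_mult[symmetric] power_add[symmetric] power2_eq_square mult_2[symmetric] mult.assoc)
  also have "\<dots> \<le> (2 ^ A) ^ (2 * A * y) * 2 ^ (y ^ 2)"
    using less_exp[of A] by (intro mult_right_mono power_mono) auto
  also have "\<dots> = 2 ^ (2 * A ^ 2 * y + y ^ 2)"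
    by (simp add: power_mult[symmetric] power_add[symmetric] power2_eq_square mult.assoc mult.left_commute)
  also have "\<dots> \<le> 2 ^ (A ^ 4 + 2 * y ^ 2)"
  proof (rule power_increasing)
    have "0 \<le> (int (A ^ 2) - int y) ^ 2" by simp
    then have "int (2 * A ^ 2 * y) \<le> int (A ^ 4 + y ^ 2)" by (simp add: power2_diff)
    then have "2 * A ^ 2 * y \<le> A ^ 4 + y ^ 2" by (simp only: of_nat_le_iff)
    then show "2 * A ^ 2 * y + y ^ 2 \<le> A ^ 4 + 2 * y ^ 2" by simp
  qed simp
  finally show ?thesis .
qed

text \<open>Times the genus plus one, this bounds \<open>max_weight\<close>: \<open>maxF\<close>
  contributes a fourth power and a factor 4 from \<open>minor_bound\<close>, the budget a fifth
  factor, and \<open>t + 4\<close> is \<open>(t + 1) + 3\<close> from the weight.\<close>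

definition branch_base :: "nat \<Rightarrow> nat \<Rightarrow> nat" where
  "branch_base t k = 4 * (t + 4) * (3 * k + 3) ^ 5"

text \<open>One number \<open>z\<close> bounds the weight, and \<open>z ^ 5\<close> bounds the
  branching, so the tree has size at most \<open>(z ^ z) ^ 5\<close>.\<close>

lemma (in mono_circuit) tree_bound_le:
  "tree_bound k \<le> 2 ^ (5 * (branch_base t k ^ 4 + 2 * (circuit_genus C + 1) ^ 2))"
proof -
  let ?y = "circuit_genus C + 1" and ?P = "3 * k + 3" and ?F = "maxF k" and ?N = minor_bound
  define A where "A = branch_base t k"
  define z where "z = A * ?y"
  have A: "A = 4 * (t + 4) * ?P ^ 5" by (simp add: A_def branch_base_def)
  have P1: "1 \<le> ?P ^ n" for n by (rule one_le_power) simp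
  have N: "?N \<le> 4 * ?y" by (simp add: minor_bound_def)
  have F: "?F \<le> ?P ^ 4 * (4 * ?y)" unfolding maxF_def by (intro mult_mono power_mono N) auto
  have "max_weight k \<le> (k + 1) * (?F * (t + 1) + 3)" by (simp add: max_weight_def algebra_simps)
  also have "\<dots> \<le> ?P * (?P ^ 4 * (4 * ?y) * (t + 1) + ?P ^ 4 * (4 * ?y) * 3)"
  proof (intro mult_mono add_mono F)
    show "(3 :: nat) \<le> ?P ^ 4 * (4 * ?y) * 3" using P1[of 4] mult_le_mono[OF P1[of 4], of 1 "4 * ?y"] by simp
  qed auto
  also have "\<dots> = z"
  proof -
    have "p * (p ^ 4 * (4 * y) * (t + 1) + p ^ 4 * (4 * y) * 3) = 4 * (t + 4) * p ^ 5 * y" for p y :: nat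
      by algebra
    then show ?thesis unfolding z_def A .
  qed
  finally have w: "max_weight k \<le> z" .
  have zP: "4 * ?y * ?P ^ 5 \<le> z"
  proof -
    have "4 * y * q \<le> 4 * (t + 4) * q * y" for q y :: nat by (simp add: algebra_simps)
    then show ?thesis unfolding z_def A .
  qed
  have yP: "4 * ?y * ?P ^ m \<le> z" if "m \<le> 5" for m
  proof -
    have "?P ^ m \<le> ?P ^ 5" using that by (intro power_increasing) auto
    then have "4 * ?y * ?P ^ m \<le> 4 * ?y * ?P ^ 5" by (rule mult_le_mono2)
    then show ?thesis using zP by linarith
  qed
  have Fz: "?F \<le> z" using F yP[of 4] by (simp add: mult.commute)
  have Nz: "?N \<le> z" using N yP[of 0] by simp
  have "p \<le> 4 * (y + 1) * p" for p y :: nat by simp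
  then have Pz: "?P \<le> z" using yP[of 1] unfolding power_one_right by (rule order_trans) simp
  have z4: "4 \<le> z" using yP[of 0] by simp
  have "max_branch k + 1 \<le> z + 2 * (z ^ 3 * z) + z * (z * z)"
  proof -
    have "?F ^ 3 * ?N \<le> z ^ 3 * z" by (intro mult_mono power_mono Fz Nz) auto
    moreover have "?F * (?F * (k + 1)) \<le> z * (z * z)" using Pz by (intro mult_mono Fz) auto
    moreover have "3 * k + 2 \<le> z" using Pz by simp
    ultimately show ?thesis unfolding max_branch_def by linarith
  qed
  also have "\<dots> \<le> z ^ 4 + 2 * z ^ 4 + z ^ 4"
  proof -
    have "z * 1 \<le> z * z ^ 3" using z4 by (intro mult_le_mono2) simp
    moreover have "z ^ 3 * 1 \<le> z ^ 3 * z" using z4 by (intro mult_le_mono2) simp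
    moreover have "z * z ^ 3 = z ^ 4" "z ^ 3 * z = z ^ 4" "z * (z * z) = z ^ 3" by algebra+
    ultimately show ?thesis by linarith
  qed
  also have "\<dots> = 4 * z ^ 4" by simp
  also have "\<dots> \<le> z * z ^ 4" using z4 by (rule mult_right_mono) simp
  finally have b: "max_branch k + 1 \<le> z ^ 5" by (simp add: numeral_eq_Suc)
  have "tree_bound k \<le> (z ^ 5) ^ max_weight k" unfolding tree_bound_def using b by (rule power_mono) simp
  also have "\<dots> \<le> (z ^ 5) ^ z" using w z4 by (intro power_increasing) auto
  also have "\<dots> = (z ^ z) ^ 5" by (simp add: power_mult[symmetric] mult.commute)
  also have "\<dots> \<le> (2 ^ (A ^ 4 + 2 * ?y ^ 2)) ^ 5"
    unfolding z_def by (intro power_mono self_power_le) (auto simp: A)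
  finally show ?thesis by (simp add: power_mult[symmetric] A_def mult.commute)
qed

text \<open>From \<open>h \<le> b + c * sqrt (ln M)\<close> follows
  \<open>(h + 1) ^ 2 \<le> 2 * (b + 1) ^ 2 + 2 * c ^ 2 * ln M\<close>: a constant plus a multiple of
  \<open>ln M\<close>, so exponentiation gives a power of \<open>M\<close>.\<close>

lemma genus_power_bound:
  fixes g :: "nat \<Rightarrow> real"
  assumes "g \<in> O(\<lambda>n. sqrt (ln (real n)))"
  shows "\<exists>E D. \<forall>n M h. real h \<le> g n \<longrightarrow> n \<le> M \<longrightarrow> 1 \<le> M \<longrightarrow> 2 ^ ((h + 1) ^ 2) \<le> E * M ^ D"
proof -
  obtain c where c: "c > 0" "eventually (\<lambda>n. norm (g n) \<le> c * norm (sqrt (ln (real n)))) at_top"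
    using landau_o.bigE[OF assms] by blast
  then obtain n0 where n0: "\<And>n. n \<ge> n0 \<Longrightarrow> \<bar>g n\<bar> \<le> c * \<bar>sqrt (ln (real n))\<bar>"
    by (auto simp: eventually_at_top_linorder)
  \<comment> \<open>Covers the finitely many \<open>n\<close> below the threshold of the asymptotic
    bound.\<close>
  define b where "b = (\<Sum>n<n0. \<bar>g n\<bar>)"
  have b0: "b \<ge> 0" by (simp add: b_def sum_nonneg)
  have gb: "g n \<le> b + c * sqrt (ln (real M))" if "n \<le> M" "1 \<le> M" for n M
  proof -
    have r0: "sqrt (ln (real M)) \<ge> 0" using that by simp
    show ?thesis
    proof (cases "n < n0")
      case True
      then have "\<bar>g n\<bar> \<le> b" unfolding b_def by (intro member_le_sum) auto
      then show ?thesis using r0 c(1) by (smt (verit) mult_nonneg_nonneg)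
    next
      case False
      have "\<bar>sqrt (ln (real n))\<bar> \<le> sqrt (ln (real M))"
      proof (cases "n = 0")
        case True then show ?thesis using r0 by simp
      next
        case False
        then have "ln (real n) \<le> ln (real M)" "0 \<le> ln (real n)" using that by auto
        then show ?thesis by simp
      qed
      then have "c * \<bar>sqrt (ln (real n))\<bar> \<le> c * sqrt (ln (real M))" using c(1) by (intro mult_left_mono) auto
      then show ?thesis using n0[of n] False b0 by linarith
    qed
  qed
  define E where "E = nat \<lceil>exp (2 * (b + 1) ^ 2)\<rceil>"
  define D where "D = nat \<lceil>2 * c ^ 2\<rceil>"
  have "2 ^ ((h + 1) ^ 2) \<le> E * M ^ D" if h: "real h \<le> g n" "n \<le> M" "1 \<le> M" for n M h
  proof -
    let ?L = "ln (real M)"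
    have L: "?L \<ge> 0" using h(3) by simp
    have "real (h + 1) \<le> (b + 1) + c * sqrt ?L" using gb[OF h(2,3)] h(1) by simp
    then have "real (h + 1) ^ 2 \<le> ((b + 1) + c * sqrt ?L) ^ 2" by (intro power_mono) auto
    also have "\<dots> \<le> 2 * (b + 1) ^ 2 + 2 * (c * sqrt ?L) ^ 2"
      using sum_squares_bound[of "b + 1" "c * sqrt ?L"] by (simp add: power2_sum)
    also have "(c * sqrt ?L) ^ 2 = c ^ 2 * ?L" using L by (simp add: power_mult_distrib)
    finally have sq: "real ((h + 1) ^ 2) \<le> 2 * (b + 1) ^ 2 + 2 * c ^ 2 * ?L" by simp
    have "real (2 ^ ((h + 1) ^ 2)) = exp (real ((h + 1) ^ 2) * ln 2)" unfolding exp_of_nat_mult by simp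
    also have "\<dots> \<le> exp (real ((h + 1) ^ 2))"
      using ln_le_minus_one[of 2] mult_left_mono[of "ln 2" 1 "real ((h + 1) ^ 2)"] by simp
    also have "\<dots> \<le> exp (2 * (b + 1) ^ 2 + 2 * c ^ 2 * ?L)" using sq by simp
    also have "\<dots> = exp (2 * (b + 1) ^ 2) * exp (2 * c ^ 2 * ?L)" by (rule exp_add)
    also have "\<dots> \<le> real E * real (M ^ D)"
    proof (rule mult_mono)
      show "exp (2 * (b + 1) ^ 2) \<le> real E" unfolding E_def by (rule real_nat_ceiling_ge)
      have "exp (2 * c ^ 2 * ?L) \<le> exp (real D * ?L)"
        using L by (intro exp_le_cancel_iff[THEN iffD2] mult_right_mono) (auto simp: D_def intro: real_nat_ceiling_ge)
      also have "\<dots> = real (M ^ D)" using h(3) by (simp add: exp_of_nat_mult)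
      finally show "exp (2 * c ^ 2 * ?L) \<le> real (M ^ D)" .
    qed auto
    finally have "real (2 ^ ((h + 1) ^ 2)) \<le> real (E * M ^ D)" by simp
    then show ?thesis by (simp only: of_nat_le_iff)
  qed
  then show ?thesis by blast
qed

text \<open>The twentieth power of \<open>3 * k + 3\<close> comes from the fourth power of
  \<open>branch_base\<close>; it is absorbed by \<open>2 ^ (40 * Suc k)\<close>.\<close>

lemma exponent_bound:
  "\<exists>c \<ge> 1. \<forall>k. a * (2 * k + 6 + 5 * branch_base t k ^ 4 + 10 * E) \<le> 2 ^ (c * Suc k)"
proof -
  define d where "d = a * (6 + 5 * (4 * (t + 4)) ^ 4 + 10 * E)"
  have "a * (2 * k + 6 + 5 * branch_base t k ^ 4 + 10 * E) \<le> 2 ^ ((d + 40) * Suc k)" for k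
  proof -
    let ?P = "3 * k + 3"
    have w1: "?P \<le> ?P ^ 20" using self_le_power[of ?P 20] by simp
    have "2 * k + 6 \<le> 6 * ?P ^ 20" using w1 by linarith
    moreover have "branch_base t k ^ 4 = (4 * (t + 4)) ^ 4 * ?P ^ 20"
      by (simp add: branch_base_def power_mult_distrib power_mult[symmetric])
    moreover have "10 * E * 1 \<le> 10 * E * ?P ^ 20" by (intro mult_le_mono2 one_le_power) simp
    ultimately have "2 * k + 6 + 5 * branch_base t k ^ 4 + 10 * E \<le> (6 + 5 * (4 * (t + 4)) ^ 4 + 10 * E) * ?P ^ 20"
      unfolding add_mult_distrib by linarith
    then have "a * (2 * k + 6 + 5 * branch_base t k ^ 4 + 10 * E) \<le> d * ?P ^ 20"
      unfolding d_def mult.assoc by (rule mult_le_mono2)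
    also have "\<dots> \<le> 2 ^ d * (2 ^ (2 * Suc k)) ^ 20"
    proof (intro mult_mono power_mono)
      show "d \<le> 2 ^ d" using less_exp[of d] by simp
      show "?P \<le> 2 ^ (2 * Suc k)" by (induction k) auto
    qed auto
    also have "\<dots> = 2 ^ (d + 40 * Suc k)" by (simp only: power_mult[symmetric] power_add[symmetric]) simp
    also have "\<dots> \<le> 2 ^ ((d + 40) * Suc k)" by (intro power_increasing) auto
    finally show ?thesis .
  qed
  then show ?thesis by (intro exI[of _ "d + 40"]) auto
qed

lemma num_vars_le_size: "num_vars C \<le> data_size (enc_circuit C)"
  by (simp add: enc_circuit_def enc_nat_size)

theorem theorem10:
  fixes t :: nat and g :: "nat \<Rightarrow> real"
  assumes "t > 2"
    and "g \<in> O(\<lambda>n. sqrt (ln (real n)))"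
  shows "fpt enc_circuit
    {(C, k) \<in> wsat_mono_instances t. real (circuit_genus C) \<le> g (num_vars C)}
    (wsat_mono t)"
proof -
  obtain p T where p: "polyb T" "\<And>K z. z \<in> instance_dom t K \<Longrightarrow> computes_at p (enc_instance z) (enc_bool (decide t z)) (T K)"
    by (rule compKE[OF compK_decide[of t]]) auto
  obtain a where a: "\<And>K. T K \<le> (K + 2) ^ a" using p(1) unfolding polyb_def by blast
  obtain E0 D where ED: "\<And>n M h. real h \<le> g n \<Longrightarrow> n \<le> M \<Longrightarrow> 1 \<le> M \<Longrightarrow> 2 ^ ((h + 1) ^ 2) \<le> E0 * M ^ D"
    using genus_power_bound[OF assms(2)] by blast
  \<comment> \<open>Makes the constant positive, so that the product \<open>Q\<close> below is at
    least the input size.\<close>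
  define E where "E = E0 + 1"
  obtain c where c: "c \<ge> 1" "\<And>k. a * (2 * k + 6 + 5 * branch_base t k ^ 4 + 10 * E) \<le> 2 ^ (c * Suc k)"
    using exponent_bound by blast
  show ?thesis unfolding fpt_def
  proof (intro exI conjI ballI)
    show "computable (dbl_exp c)" by (rule computable_dbl_exp[OF c(1)])
    fix z assume "z \<in> {(C, k) \<in> wsat_mono_instances t. real (circuit_genus C) \<le> g (num_vars C)}"
    then obtain C k where z: "z = (C, k)" and inst: "pi_circuit t C" "monotone_circuit C"
      and gen: "real (circuit_genus C) \<le> g (num_vars C)" by (auto simp: wsat_mono_instances_def)
    interpret mono_circuit t C by unfold_locales (rule inst)+
    let ?M = "data_size (enc_circuit C)" and ?B = "2 ^ (5 * branch_base t k ^ 4) :: nat"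
    have M: "1 \<le> ?M" using data_size_pos[of "enc_circuit C"] by linarith
    define Q where "Q = ?B * E ^ 10 * ?M ^ (10 * D + 1)"
    have y: "2 ^ ((circuit_genus C + 1) ^ 2) \<le> E * ?M ^ D"
      using ED[OF gen num_vars_le_size M] by (simp add: E_def)
    have "tree_bound k \<le> ?B * (2 ^ ((circuit_genus C + 1) ^ 2)) ^ 10"
      using tree_bound_le[of k] by (simp add: power_add[symmetric] power_mult[symmetric] add_mult_distrib2 mult.commute)
    also have "\<dots> \<le> ?B * (E * ?M ^ D) ^ 10" using y by (intro mult_le_mono2 power_mono) auto
    also have "\<dots> = ?B * E ^ 10 * ?M ^ (10 * D)"
      by (simp add: power_mult_distrib power_mult[symmetric] mult.commute)
    also have "\<dots> \<le> Q" unfolding Q_def using M by (intro mult_le_mono2 power_increasing) auto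
    finally have tb: "tree_bound k \<le> Q" .
    have BE: "1 \<le> ?B * E ^ 10" by (simp add: E_def)
    have MQ: "?M \<le> Q"
    proof -
      have "?M \<le> ?M ^ (10 * D + 1)" using M by (intro self_le_power) auto
      then have "1 * ?M \<le> ?B * E ^ 10 * ?M ^ (10 * D + 1)" using BE by (intro mult_le_mono)
      then show ?thesis by (simp add: Q_def)
    qed
    have Q1: "1 \<le> Q" using MQ M by linarith
    \<comment> \<open>The ambient number covers the search tree and the size of the encoded pair of
      circuit and parameter.\<close>
    define K where "K = Q + (1 + ?M + (2 * k + 1))"
    have "(C, k) \<in> instance_dom t K"
      unfolding instance_dom_def enc_instance_def K_def using tb mono_circuit_axioms by (simp add: enc_nat_size)
    from computes_runs[OF p(2)[OF this]] obtain n where n: "n \<le> T K" "runs p (enc_instance (C, k)) n (enc_bool (decide t (C, k)))"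
      by blast
    have K2: "K + 2 \<le> (2 * k + 6) * Q"
    proof -
      have "(2 * k + 4) * 1 \<le> (2 * k + 4) * Q" using Q1 by (rule mult_le_mono2)
      then show ?thesis unfolding K_def using MQ by (simp add: add_mult_distrib)
    qed
    have "T K \<le> ((2 * k + 6) * Q) ^ a" using a[of K] power_mono[OF K2, of a] by linarith
    also have "\<dots> = ((2 * k + 6) * (?B * E ^ 10)) ^ a * (?M ^ (10 * D + 1)) ^ a"
      unfolding Q_def by (simp only: power_mult_distrib mult.assoc)
    also have "\<dots> \<le> dbl_exp c k * (?M ^ (10 * D + 1)) ^ a"
    proof (rule mult_right_mono)
      have "2 * k + 6 \<le> 2 ^ (2 * k + 6)" "E \<le> 2 ^ E" using less_exp[of "2 * k + 6"] less_exp[of E] by linarith+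
      then have "((2 * k + 6) * (?B * E ^ 10)) ^ a \<le> (2 ^ (2 * k + 6) * (?B * (2 ^ E) ^ 10)) ^ a"
        by (intro power_mono mult_mono order_refl) auto
      also have "\<dots> = 2 ^ (a * (2 * k + 6 + 5 * branch_base t k ^ 4 + 10 * E))"
        by (simp add: power_add[symmetric] power_mult[symmetric] mult.commute)
      also have "\<dots> \<le> 2 ^ (2 ^ (c * Suc k))" using c(2) by (rule power_increasing) simp
      finally show "((2 * k + 6) * (?B * E ^ 10)) ^ a \<le> dbl_exp c k" by (simp add: dbl_exp_def)
    qed simp
    finally have time: "n \<le> dbl_exp c k * ?M ^ ((10 * D + 1) * a)" using n(1) by (simp only: power_mult)
    have "enc_bool (decide t (C, k)) \<noteq> Atom \<longleftrightarrow> (C, k) \<in> wsat_mono t"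
      using decide_correct[of k] inst by (simp add: enc_bool_def wsat_mono_def wsat_mono_instances_def)
    then show "case z of (x, k) \<Rightarrow> \<exists>T y. runs p (Cell (enc_circuit x) (enc_nat k)) T y \<and>
        T \<le> dbl_exp c k * data_size (enc_circuit x) ^ ((10 * D + 1) * a) \<and> (y \<noteq> Atom \<longleftrightarrow> (x, k) \<in> wsat_mono t)"
      using n(2) time unfolding z enc_instance_def by auto
  qed
qed

end
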